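(* Let $T>0$, let the Hamiltonians $H_\alpha$ satisfy (H), let $F$ satisfy (F), and let $u_0:J\to\mathbb R$ be Lipschitz continuous. There exist real numbers $\underline p_\alpha,\overline p_\alpha,\underline p^0_\alpha$, $\alpha=1,\dots,N$, depending only on $u_0$, the Hamiltonians $H_\alpha$ and $F$, such that the following holds: if $\varepsilon=(\Delta t,\Delta x)$ satisfies the CFL condition (CFLr) with these numbers, then the numerical solution $u^\varepsilon$ of the scheme (S) converges, as $|\varepsilon|\to0$, locally uniformly to the unique relaxed viscosity solution $u$ of (P$_F$)-(IC): for every compact set $\mathcal K\subset[0,T)\times J$, $$\limsup_{|\varepsilon|\to0}\ \sup_{(t,x)\in\mathcal K\cap\mathcal G_\varepsilon}|u^\varepsilon(t,x)-u(t,x)|=0 .$$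
   Context: Junction: Let $N\ge1$. The junction $J=\bigcup_{\alpha=1}^N J_\alpha$ consists of $N$ copies $J_\alpha$ of $[0,+\infty)$ glued at the origin $0$ ($J_\alpha\cap J_\beta=\{0\}$ for $\alpha\ne\beta$); a point $x\in J_\alpha$ is identified with its coordinate $x\ge0$. The distance on $J$ is $d(x,y)=|x-y|$ if $x,y$ lie on the same branch and $d(x,y)=|x|+|y|$ otherwise. For a function $u$ on $(0,T)\times J$, $\partial_\alpha u$ denotes the spatial derivative along $J_\alpha$ (one-sided at $0$); $u_x=\partial_\alpha u$ at $x\in J_\alpha\setminus\{0\}$ and $u_x=(\partial_1u,\dots,\partial_Nu)$ at $x=0$. Hamiltonians (H): $H_\alpha:\mathbb R\to\mathbb R$, $\alpha=1,\dots,N$, are Lipschitz continuous, coercive ($H_\alpha(p)\to+\infty$ as $|p|\to\infty$) and quasi-convex ($\{H_\alpha\le\lambda\}$ is convex for every $\lambda\in\mathbb R$). Hence there is $p_0^\alpha$ with $H_\alpha$ non-increasing on $(-\infty,p_0^\alpha]$ and non-decreasing on $[p_0^\alpha,\infty)$; set $H_\alpha^-(p)=H_\alpha(\min(p,p_0^\alpha))$, $H_\alpha^+(p)=H_\alpha(\max(p,p_0^\alpha))$. Junction function (F): $F:\mathbb R^N\to\mathbb R$ is piecewise $C^1$, for each $\alpha$ the map $p_\alpha\mapsto F(p_1,\dots,p_N)$ is strictly decreasing, and $F(p)\to+\infty$ as $(p_1)_-+\dots+(p_N)_-\to+\infty$, where $r_-=\max(-r,0)$. Write $(-\nabla\cdot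 F)(p)=-\sum_{\beta=1}^N\partial_{p_\beta}F(p)$. Continuous problem (P$_F$)-(IC): $u_t+H_\alpha(u_x)=0$ in $(0,T)\times(J_\alpha\setminus\{0\})$ for each $\alpha$; $u_t+F(\partial_1u,\dots,\partial_Nu)=0$ on $(0,T)\times\{0\}$; $u(0,x)=u_0(x)$ for $x\in J$. Relaxed viscosity solutions: test functions are $\varphi\in C(( 0,T)\times J)$ whose restriction to each $(0,T)\times J_\alpha$ is $C^1$. $u^*$, $u_*$ denote upper/lower semicontinuous envelopes. $u$ is a relaxed sub-solution (resp. super-solution) of (P$_F$) if whenever $u^*\le\varphi$ (resp. $u_*\ge\varphi$) near $(t_0,x_0)$, $t_0>0$, with equality at $(t_0,x_0)$: if $x_0\in J_\alpha\setminus\{0\}$ then $\varphi_t+H_\alpha(\varphi_x)\le0$ (resp. $\ge0$) at $(t_0,x_0)$; if $x_0=0$ then either $\varphi_t+F(\varphi_x)\le0$ (resp. $\ge0$) or $\varphi_t+H_\alpha(\partial_\alpha\varphi)\le0$ (resp. $\ge0$) for some $\alpha$, at $(t_0,0)$. It is a relaxed solution of (P$_F$)-(IC) if it is both, and additionally $u^*(0,\cdot)\le u_0\le u_*(0,\cdot)$ on $J$. Scheme (S): for $\Delta t,\Delta x>0$ let $\varepsilon=(\Delta t,\Delta x)$, let $x_i^\alpha\in J_\alpha$ be the point of coordinate $i\Delta x$ ($i\in\mathbb N$), and $\mathcal G_\varepsilon=\{n\Delta t:n\in\mathbb N\}\times\{x_i^\alpha\}$. Unknowns $U_i^{\alpha,n}$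 with $U_0^{\alpha,n}=U_0^n$ for all $\alpha$. Discrete gradients $p_{i,+}^{\alpha,n}=(U_{i+1}^{\alpha,n}-U_i^{\alpha,n})/\Delta x$, $p_{i,-}^{\alpha,n}=(U_i^{\alpha,n}-U_{i-1}^{\alpha,n})/\Delta x$. For $n\ge0$: $\frac{U_i^{\alpha,n+1}-U_i^{\alpha,n}}{\Delta t}+\max\{H_\alpha^+(p_{i,-}^{\alpha,n}),H_\alpha^-(p_{i,+}^{\alpha,n})\}=0$ for $i\ge1$, $\alpha=1,\dots,N$; $\frac{U_0^{n+1}-U_0^n}{\Delta t}+F(p_{0,+}^{1,n},\dots,p_{0,+}^{N,n})=0$; initial data $U_i^{\alpha,0}=u_0(x_i^\alpha)$. The numerical solution is $u^\varepsilon(n\Delta t,x_i^\alpha)=U_i^{\alpha,n}$. CFL condition (CFLr) with numbers $\underline p_\alpha,\overline p_\alpha,\underline p^0_\alpha$: $\frac{\Delta x}{\Delta t}\ge\max\Big\{\max_\alpha\sup_{p\in[\underline p_\alpha,\overline p_\alpha]}|H_\alpha'(p)|,\ \sup_{p\in\prod_\alpha[\underline p^0_\alpha,\overline p_\alpha]}(-\nabla\cdot F)(p)\Big\}$ (derivatives exist a.e.; suprema are understood as essential suprema).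
   Formalization: Relaxed viscosity solutions are required to be locally bounded on [0,T)×J; without this, uniqueness fails, since a function equal to the solution for t<T/2 and unbounded above and below near every later point also satisfies the definition. *)

theory Defs
  imports "HOL-Analysis.Analysis" "HOL-Probability.Essential_Supremum"
begin

text \<open>A point of the junction J with branches indexed by the finite type 'n is a pair
  (alpha, x) with x >= 0; all pairs (alpha, 0) represent the junction point 0
  (they are at distance 0 from each other).\<close>

definition jpts :: "('n \<times> real) set" where
  "jpts = {p. 0 \<le> snd p}"

definition jd :: "'n \<times> real \<Rightarrow> 'n \<times> real \<Rightarrow> real" where
  "jd p q = (if fst p = fst q then \<bar>snd p - snd q\<bar> else snd p + snd q)"

definition tjd :: "real \<times> ('n \<times> real) \<Rightarrow> real \<times> ('n \<times> real) \<Rightarrow> real" where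
  "tjd z w = \<bar>fst z - fst w\<bar> + jd (snd z) (snd w)"

definition jcompact :: "real \<Rightarrow> (real \<times> ('n \<times> real)) set \<Rightarrow> bool" where
  "jcompact T K \<longleftrightarrow> K \<subseteq> {z. 0 \<le> fst z \<and> fst z < T \<and> snd z \<in> jpts} \<and>
     (\<forall>f::nat \<Rightarrow> real \<times> ('n \<times> real). (\<forall>n. f n \<in> K) \<longrightarrow>
        (\<exists>l\<in>K. \<exists>r. strict_mono r \<and> (\<lambda>n. tjd (f (r n)) l) \<longlonglongrightarrow> 0))"

definition quasi_convex :: "(real \<Rightarrow> real) \<Rightarrow> bool" where
  "quasi_convex h \<longleftrightarrow> (\<forall>c. convex {p. h p \<le> c})"

definition coercive :: "(real \<Rightarrow> real) \<Rightarrow> bool" where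
  "coercive h \<longleftrightarrow> filterlim h at_top at_infinity"

definition hyp_H :: "('n \<Rightarrow> real \<Rightarrow> real) \<Rightarrow> bool" where
  "hyp_H H \<longleftrightarrow> (\<forall>\<alpha>. (\<exists>L. L-lipschitz_on UNIV (H \<alpha>)) \<and> coercive (H \<alpha>) \<and> quasi_convex (H \<alpha>))"

definition hp0 :: "(real \<Rightarrow> real) \<Rightarrow> real" where
  "hp0 h = (SOME p. antimono_on {..p} h \<and> mono_on {p..} h)"

definition Hminus :: "(real \<Rightarrow> real) \<Rightarrow> real \<Rightarrow> real" where
  "Hminus h p = h (min p (hp0 h))"

definition Hplus :: "(real \<Rightarrow> real) \<Rightarrow> real \<Rightarrow> real" where
  "Hplus h p = h (max p (hp0 h))"

definition vupd :: "real^'n \<Rightarrow> 'n \<Rightarrow> real \<Rightarrow> real^'n" where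
  "vupd p \<beta> s = (\<chi> \<gamma>. if \<gamma> = \<beta> then s else p $ \<gamma>)"

definition C1_on_UNIV :: "(real^'n \<Rightarrow> real) \<Rightarrow> bool" where
  "C1_on_UNIV G \<longleftrightarrow> (\<exists>D. (\<forall>p. (G has_derivative D p) (at p)) \<and>
                           (\<forall>v. continuous_on UNIV (\<lambda>p. D p v)))"

definition piecewise_C1 :: "(real^'n \<Rightarrow> real) \<Rightarrow> bool" where
  "piecewise_C1 F \<longleftrightarrow> (\<exists>k (A :: nat \<Rightarrow> (real^'n) set) (G :: nat \<Rightarrow> real^'n \<Rightarrow> real).
      (\<forall>j<k. closed (A j) \<and> C1_on_UNIV (G j) \<and> (\<forall>p\<in>A j. F p = G j p)) \<and>
      (\<Union>j<k. A j) = UNIV)"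

definition hyp_F :: "(real^'n \<Rightarrow> real) \<Rightarrow> bool" where
  "hyp_F F \<longleftrightarrow> piecewise_C1 F \<and>
     (\<forall>p \<beta> s t. s < t \<longrightarrow> F (vupd p \<beta> t) < F (vupd p \<beta> s)) \<and>
     (\<forall>M. \<exists>R. \<forall>p. (\<Sum>\<beta>\<in>UNIV. max (- p $ \<beta>) 0) \<ge> R \<longrightarrow> F p \<ge> M)"

definition mdivF :: "(real^'n \<Rightarrow> real) \<Rightarrow> real^'n \<Rightarrow> real" where
  "mdivF F p = - (\<Sum>\<beta>\<in>UNIV. frechet_derivative F (at p) (axis \<beta> 1))"

definition CFLr :: "('n \<Rightarrow> real \<Rightarrow> real) \<Rightarrow> (real^'n \<Rightarrow> real) \<Rightarrow>
    ('n \<Rightarrow> real) \<Rightarrow> ('n \<Rightarrow> real) \<Rightarrow> ('n \<Rightarrow> real) \<Rightarrow> real \<Rightarrow> real \<Rightarrow> bool" where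
  "CFLr H F plo phi p0lo dt dx \<longleftrightarrow>
     (\<forall>\<alpha>. esssup (restrict_space lebesgue {plo \<alpha>..phi \<alpha>}) (\<lambda>p. ereal \<bar>deriv (H \<alpha>) p\<bar>)
            \<le> ereal (dx / dt)) \<and>
     esssup (restrict_space lebesgue {p. \<forall>\<beta>. p0lo \<beta> \<le> p $ \<beta> \<and> p $ \<beta> \<le> phi \<beta>})
            (\<lambda>p. ereal (mdivF F p)) \<le> ereal (dx / dt)"

fun scheme :: "('n \<Rightarrow> real \<Rightarrow> real) \<Rightarrow> (real^'n \<Rightarrow> real) \<Rightarrow> ('n \<times> real \<Rightarrow> real) \<Rightarrow>
    real \<Rightarrow> real \<Rightarrow> nat \<Rightarrow> 'n \<Rightarrow> nat \<Rightarrow> real" where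
  "scheme H F u0 dt dx 0 = (\<lambda>\<alpha> i. u0 (\<alpha>, real i * dx))"
| "scheme H F u0 dt dx (Suc n) =
     (let V = scheme H F u0 dt dx n in
       (\<lambda>\<alpha> i. if i = 0 then V \<alpha> 0 - dt * F (\<chi> \<beta>. (V \<beta> 1 - V \<beta> 0) / dx)
              else V \<alpha> i - dt * max (Hplus (H \<alpha>) ((V \<alpha> i - V \<alpha> (i - 1)) / dx))
                                     (Hminus (H \<alpha>) ((V \<alpha> (i + 1) - V \<alpha> i) / dx))))"

definition nbhd :: "real \<Rightarrow> real \<Rightarrow> 'n \<times> real \<Rightarrow> real \<Rightarrow> (real \<times> ('n \<times> real)) set" where
  "nbhd T t p r = {z. 0 \<le> fst z \<and> fst z < T \<and> snd z \<in> jpts \<and> tjd z (t, p) < r}"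

definition ustar :: "real \<Rightarrow> (real \<Rightarrow> 'n \<times> real \<Rightarrow> real) \<Rightarrow> real \<Rightarrow> 'n \<times> real \<Rightarrow> ereal" where
  "ustar T u t p = (INF r\<in>{0<..}. SUP z\<in>nbhd T t p r. ereal (u (fst z) (snd z)))"

definition lstar :: "real \<Rightarrow> (real \<Rightarrow> 'n \<times> real \<Rightarrow> real) \<Rightarrow> real \<Rightarrow> 'n \<times> real \<Rightarrow> ereal" where
  "lstar T u t p = (SUP r\<in>{0<..}. INF z\<in>nbhd T t p r. ereal (u (fst z) (snd z)))"

text \<open>Test functions: given by their branch pieces g alpha (t,x), x >= 0, each C1 on
  (0,T) x R (a C1 extension across x = 0, equivalently one-sided C1 at x = 0),
  agreeing at the junction point.\<close>
definition testfun :: "real \<Rightarrow> ('n \<Rightarrow> real \<times> real \<Rightarrow> real) \<Rightarrow> bool" where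
  "testfun T g \<longleftrightarrow>
     (\<forall>\<alpha>. \<exists>D. (\<forall>z. 0 < fst z \<and> fst z < T \<longrightarrow> (g \<alpha> has_derivative D z) (at z)) \<and>
              (\<forall>v. continuous_on {z. 0 < fst z \<and> fst z < T} (\<lambda>z. D z v))) \<and>
     (\<forall>\<alpha> \<beta> t. 0 < t \<and> t < T \<longrightarrow> g \<alpha> (t, 0) = g \<beta> (t, 0))"

definition phi_of :: "('n \<Rightarrow> real \<times> real \<Rightarrow> real) \<Rightarrow> real \<Rightarrow> 'n \<times> real \<Rightarrow> real" where
  "phi_of g t p = g (fst p) (t, snd p)"

definition dt_g :: "('n \<Rightarrow> real \<times> real \<Rightarrow> real) \<Rightarrow> 'n \<Rightarrow> real \<Rightarrow> real \<Rightarrow> real" where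
  "dt_g g \<alpha> t x = frechet_derivative (g \<alpha>) (at (t, x)) (1, 0)"

definition dx_g :: "('n \<Rightarrow> real \<times> real \<Rightarrow> real) \<Rightarrow> 'n \<Rightarrow> real \<Rightarrow> real \<Rightarrow> real" where
  "dx_g g \<alpha> t x = frechet_derivative (g \<alpha>) (at (t, x)) (0, 1)"

definition junction_fun :: "real \<Rightarrow> (real \<Rightarrow> 'n \<times> real \<Rightarrow> real) \<Rightarrow> bool" where
  "junction_fun T u \<longleftrightarrow> (\<forall>t a b. 0 \<le> t \<and> t < T \<longrightarrow> u t (a, 0) = u t (b, 0))"

definition loc_bounded :: "real \<Rightarrow> (real \<Rightarrow> 'n \<times> real \<Rightarrow> real) \<Rightarrow> bool" where
  "loc_bounded T u \<longleftrightarrow> (\<forall>t p. 0 \<le> t \<and> t < T \<and> p \<in> jpts \<longrightarrow>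
      (\<exists>r>0. \<exists>C. \<forall>z\<in>nbhd T t p r. \<bar>u (fst z) (snd z)\<bar> \<le> C))"

definition relaxed_sub :: "real \<Rightarrow> ('n \<Rightarrow> real \<Rightarrow> real) \<Rightarrow> (real^'n \<Rightarrow> real) \<Rightarrow>
    (real \<Rightarrow> 'n \<times> real \<Rightarrow> real) \<Rightarrow> bool" where
  "relaxed_sub T H F u \<longleftrightarrow> (\<forall>g t0 x0. testfun T g \<and> 0 < t0 \<and> t0 < T \<and> x0 \<in> jpts \<and>
      (\<exists>r>0. \<forall>z\<in>nbhd T t0 x0 r. 0 < fst z \<longrightarrow> ustar T u (fst z) (snd z) \<le> ereal (phi_of g (fst z) (snd z))) \<and>
      ustar T u t0 x0 = ereal (phi_of g t0 x0) \<longrightarrow>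
      (if 0 < snd x0 then
         dt_g g (fst x0) t0 (snd x0) + H (fst x0) (dx_g g (fst x0) t0 (snd x0)) \<le> 0
       else
         dt_g g (fst x0) t0 0 + F (\<chi> \<beta>. dx_g g \<beta> t0 0) \<le> 0 \<or>
         (\<exists>\<alpha>. dt_g g \<alpha> t0 0 + H \<alpha> (dx_g g \<alpha> t0 0) \<le> 0)))"

definition relaxed_super :: "real \<Rightarrow> ('n \<Rightarrow> real \<Rightarrow> real) \<Rightarrow> (real^'n \<Rightarrow> real) \<Rightarrow>
    (real \<Rightarrow> 'n \<times> real \<Rightarrow> real) \<Rightarrow> bool" where
  "relaxed_super T H F u \<longleftrightarrow> (\<forall>g t0 x0. testfun T g \<and> 0 < t0 \<and> t0 < T \<and> x0 \<in> jpts \<and>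
      (\<exists>r>0. \<forall>z\<in>nbhd T t0 x0 r. 0 < fst z \<longrightarrow> lstar T u (fst z) (snd z) \<ge> ereal (phi_of g (fst z) (snd z))) \<and>
      lstar T u t0 x0 = ereal (phi_of g t0 x0) \<longrightarrow>
      (if 0 < snd x0 then
         dt_g g (fst x0) t0 (snd x0) + H (fst x0) (dx_g g (fst x0) t0 (snd x0)) \<ge> 0
       else
         dt_g g (fst x0) t0 0 + F (\<chi> \<beta>. dx_g g \<beta> t0 0) \<ge> 0 \<or>
         (\<exists>\<alpha>. dt_g g \<alpha> t0 0 + H \<alpha> (dx_g g \<alpha> t0 0) \<ge> 0)))"

definition relaxed_solution :: "real \<Rightarrow> ('n \<Rightarrow> real \<Rightarrow> real) \<Rightarrow> (real^'n \<Rightarrow> real) \<Rightarrow>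
    ('n \<times> real \<Rightarrow> real) \<Rightarrow> (real \<Rightarrow> 'n \<times> real \<Rightarrow> real) \<Rightarrow> bool" where
  "relaxed_solution T H F u0 u \<longleftrightarrow> junction_fun T u \<and> loc_bounded T u \<and>
     relaxed_sub T H F u \<and> relaxed_super T H F u \<and>
     (\<forall>p\<in>jpts. ustar T u 0 p \<le> ereal (u0 p) \<and> ereal (u0 p) \<le> lstar T u 0 p)"

definition jlipschitz :: "('n \<times> real \<Rightarrow> real) \<Rightarrow> bool" where
  "jlipschitz u0 \<longleftrightarrow> (\<exists>L. \<forall>p\<in>jpts. \<forall>q\<in>jpts. \<bar>u0 p - u0 q\<bar> \<le> L * jd p q)"

end

(* The numerical Hamiltonians are truncated outside large slopes, which makes the scheme monotone on all
   grid functions under the CFL condition; hence time increments stay bounded by their initial bound K,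
   this bounds all discrete gradients, and so the truncation is never active. The interpolated numerical
   solutions are therefore equi-Lipschitz up to the mesh size, and every cluster point (Tychonoff) is a
   Lipschitz relaxed solution by monotonicity. Convergence of the whole family is uniqueness.

   Uniqueness is a comparison principle in the spirit of Lions and Souganidis: after doubling the time
   variable only, the problem at a maximum point is one-dimensional in space. At the junction one compares
   the critical slopes of the two functions on each branch and picks, between them, a slope at which the
   Hamiltonian lies strictly between the two bounds; testing both functions with these slopes gives
   contradictory inequalities for F.

   The essential suprema in the CFL condition control difference quotients because Lipschitz functions of
   one variable are differentiable almost everywhere (proved with the Vitali covering theorem), and because
   the interiors of the closed pieces of the piecewise C1 function F are dense. *)
theory Submission
  imports Defs
begin

section \<open>Lipschitz functions of one real variable\<close>

text \<open>The slope bounds need monotonicity, while the CFL condition yields monotonicity only for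
  slopes in a bounded box; truncation breaks this circle. \<open>F\<close> decreases in every slope,
  so a bound on \<open>F\<close> controls the junction slopes from below only. Their upper bound
  comes from the Hamiltonian at the first interior node, and this is why the box for
  \<open>F\<close> combines a separate lower number \<open>p0lo\<close> with the upper number
  \<open>phi\<close> of the Hamiltonians. Where clamping from above makes the junction function too
  large, the Hamiltonian alternative in the relaxed junction condition rescues the supersolution
  property. In the comparison principle one of the two functions has to be Lipschitz in space, since
  otherwise no finite test slopes need exist at the junction. Uniqueness among discontinuous
  solutions is therefore proved against a limit of the scheme, which is Lipschitz. Such a limit must
  be available beforehand, so one family of meshes with an admissible ratio has to be exhibited
  independently of the given one.\<close>

lemma emeasure_image_ge_of_steep_intervals:
  fixes g :: "real \<Rightarrow> real"
  assumes mono: "strict_mono g" and cont: "continuous_on UNIV g"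
    and E: "E \<in> sets lebesgue" and gE: "g ` E \<in> sets lebesgue" and "0 < s"
    and steep: "\<And>x d. x \<in> E \<Longrightarrow> 0 < d \<Longrightarrow>
      \<exists>y z. y \<le> x \<and> x \<le> z \<and> y < z \<and> z - y < d \<and> s * (z - y) \<le> g z - g y"
  shows "ennreal s * emeasure lebesgue E \<le> emeasure lebesgue (g ` E)"
proof (rule ennreal_le_epsilon)
  fix e :: real assume fin: "emeasure lebesgue (g ` E) < top" and "0 < e"
  obtain T where T: "open T" "g ` E \<subseteq> T" "T - g ` E \<in> lmeasurable" "emeasure lebesgue (T - g ` E) < ennreal e"
    using sets_lebesgue_outer_open[OF gE \<open>0 < e\<close>] by blast
  have Tle: "emeasure lebesgue T \<le> emeasure lebesgue (g ` E) + ennreal e"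
  proof -
    have "emeasure lebesgue T \<le> emeasure lebesgue (g ` E) + emeasure lebesgue (T - g ` E)"
      using emeasure_Un_Int[of "g ` E" lebesgue "T - g ` E"] gE T
      by (smt (verit, ccfv_SIG) Un_Diff_cancel emeasure_subadditive fmeasurableD sup.absorb2)
    then show ?thesis using T(4) by (meson add_left_mono dual_order.trans less_imp_le)
  qed
  define G where "G = g -` T"
  have "open G" using cont T(1) by (simp add: G_def open_vimage)
  define K where "K = {(y, z). y < z \<and> {y..z} \<subseteq> G \<and> s * (z - y) \<le> g z - g y}"
  define a where "a = (\<lambda>(y, z). (y + z) / (2::real))"
  define r where "r = (\<lambda>(y, z). (z - y) / (2::real))"
  have cb: "cball (a i) (r i) = {fst i..snd i}" for i
    by (cases i) (auto simp: a_def r_def cball_eq_atLeastAtMost field_simps)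
  have K1: "0 < r i" if "i \<in> K" for i using that by (auto simp: K_def r_def)
  have K2: "\<exists>i. i \<in> K \<and> x \<in> cball (a i) (r i) \<and> r i < d" if xE: "x \<in> E" and d0: "0 < d" for x d
  proof -
    have "x \<in> G" using xE T by (auto simp: G_def)
    then obtain d' where d': "d' > 0" "ball x d' \<subseteq> G" using \<open>open G\<close> openE by blast
    obtain y z where yz: "y \<le> x" "x \<le> z" "y < z" "z - y < min d d'" "s * (z - y) \<le> g z - g y"
      using steep[OF xE, of "min d d'"] d0 d'(1) by auto
    have "{y..z} \<subseteq> ball x d'" using yz by (auto simp: dist_real_def)
    then have "(y, z) \<in> K" using yz d' by (auto simp: K_def)
    moreover have "x \<in> cball (a (y, z)) (r (y, z))" unfolding cb using yz by simp
    moreover have "r (y, z) < d" using yz by (simp add: r_def)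
    ultimately show ?thesis by blast
  qed
  obtain C where C: "countable C" "C \<subseteq> K"
    "pairwise (\<lambda>i j. disjnt (cball (a i) (r i)) (cball (a j) (r j))) C"
    "negligible (E - (\<Union>i\<in>C. cball (a i) (r i)))"
    by (rule Vitali_covering_theorem_cballs[of K r E a, OF K1 K2]) blast+
  let ?I = "\<lambda>i. {fst i..snd i}"
  have dj: "disjoint_family_on ?I C"
    using C(3) by (auto simp: disjoint_family_on_def pairwise_def disjnt_def cb)
  have "emeasure lebesgue E \<le> emeasure lebesgue (\<Union>i\<in>C. ?I i)"
  proof -
    have m: "(\<Union>i\<in>C. ?I i) \<in> sets lebesgue" using C(1) by (intro sets.countable_UN'') auto
    have "E \<subseteq> (\<Union>i\<in>C. ?I i) \<union> (E - (\<Union>i\<in>C. ?I i))" by blast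
    then have "emeasure lebesgue E \<le> emeasure lebesgue ((\<Union>i\<in>C. ?I i) \<union> (E - (\<Union>i\<in>C. ?I i)))"
      using m E by (intro emeasure_mono) auto
    also have "\<dots> = emeasure lebesgue (\<Union>i\<in>C. ?I i)"
      using C(4) m by (intro emeasure_Un_null_set) (auto simp: cb negligible_iff_null_sets)
    finally show ?thesis .
  qed
  then have "ennreal s * emeasure lebesgue E \<le> ennreal s * emeasure lebesgue (\<Union>i\<in>C. ?I i)"
    by (rule mult_left_mono) simp
  also have "\<dots> = ennreal s * (\<integral>\<^sup>+i. emeasure lebesgue (?I i) \<partial>count_space C)"
    using C(1) dj by (subst emeasure_UN_countable) auto
  also have "\<dots> = (\<integral>\<^sup>+i. ennreal s * emeasure lebesgue (?I i) \<partial>count_space C)"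
    by (simp add: nn_integral_cmult)
  also have "\<dots> \<le> (\<integral>\<^sup>+i. emeasure lebesgue {g (fst i)..g (snd i)} \<partial>count_space C)"
  proof (rule nn_integral_mono)
    fix i assume "i \<in> space (count_space C)"
    then have "i \<in> K" using C by auto
    then have i: "fst i < snd i" "s * (snd i - fst i) \<le> g (snd i) - g (fst i)" by (auto simp: K_def)
    then have "g (fst i) \<le> g (snd i)" using mono by (simp add: strict_mono_less_eq)
    then show "ennreal s * emeasure lebesgue (?I i) \<le> emeasure lebesgue {g (fst i)..g (snd i)}"
      using i \<open>0 < s\<close> by (simp add: ennreal_mult[symmetric] ennreal_leI)
  qed
  also have "\<dots> = emeasure lebesgue (\<Union>i\<in>C. {g (fst i)..g (snd i)})"
  proof (rule emeasure_UN_countable[symmetric])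
    show "disjoint_family_on (\<lambda>i. {g (fst i)..g (snd i)}) C"
    proof (unfold disjoint_family_on_def, intro ballI impI)
      fix i j assume ij: "i \<in> C" "j \<in> C" "i \<noteq> j"
      then have "fst i < snd i" "fst j < snd j" using C(2) by (auto simp: K_def)
      moreover have "?I i \<inter> ?I j = {}" using dj ij by (auto simp: disjoint_family_on_def)
      ultimately have "snd i < fst j \<or> snd j < fst i"
        by (metis Int_atLeastAtMost atLeastatMost_empty_iff2 max_def min_def not_le order_less_imp_le)
      then have "g (snd i) < g (fst j) \<or> g (snd j) < g (fst i)"
        using mono by (auto simp: strict_mono_less)
      then show "{g (fst i)..g (snd i)} \<inter> {g (fst j)..g (snd j)} = {}" by auto
    qed
  qed (use C in auto)
  also have "\<dots> \<le> emeasure lebesgue T"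
  proof (rule emeasure_mono)
    show "(\<Union>i\<in>C. {g (fst i)..g (snd i)}) \<subseteq> T"
    proof clarify
      fix w y z assume c: "(y, z) \<in> C" and w: "w \<in> {g (fst (y,z))..g (snd (y,z))}"
      then have yz: "y < z" "{y..z} \<subseteq> G" using C(2) by (auto simp: K_def)
      obtain x where "y \<le> x" "x \<le> z" "g x = w"
        using IVT'[of g y w z] w yz cont by (auto intro: continuous_on_subset)
      then show "w \<in> T" using yz by (auto simp: G_def)
    qed
  qed (use T in auto)
  finally show "ennreal s * emeasure lebesgue E \<le> emeasure lebesgue (g ` E) + ennreal e"
    using Tle by (rule order_trans)
qed

text \<open>A function with Lipschitz constant \<open>L\<close> becomes such a \<open>g\<close>,
  with \<open>M = 2 * L + 1\<close>, once \<open>(L + 1) * p\<close> is added. Slopes of at least 1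
  make \<open>g\<close> a homeomorphism with 1-Lipschitz inverse, so Borel sets have Borel images
  and the covering estimate applies to \<open>g\<close> as well as to \<open>ginv\<close>.\<close>

locale increasing_bilipschitz =
  fixes g :: "real \<Rightarrow> real" and M :: real
  assumes lower: "\<And>x y. x \<le> y \<Longrightarrow> y - x \<le> g y - g x"
    and upper: "\<And>x y. x \<le> y \<Longrightarrow> g y - g x \<le> M * (y - x)"
begin

lemma strict_mono_g: "strict_mono g"
proof (unfold strict_mono_def, intro allI impI)
  fix x y :: real assume "x < y" then show "g x < g y" using lower[of x y] by linarith
qed

lemma M_ge_1: "1 \<le> M"
  using lower[of 0 1] upper[of 0 1] by simp

lemma lip_g: "\<bar>g x - g y\<bar> \<le> M * \<bar>x - y\<bar>"
  using lower[of x y] lower[of y x] upper[of x y] upper[of y x] by (cases "x \<le> y") auto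

lemma cont_g: "continuous_on UNIV g"
proof -
  have "M-lipschitz_on UNIV g"
    using lip_g M_ge_1 by (intro lipschitz_onI) (auto simp: dist_real_def)
  then show ?thesis by (rule lipschitz_on_continuous_on)
qed

lemma surj_g: "surj g"
proof (unfold surj_def, intro allI)
  fix w
  define R where "R = \<bar>w - g 0\<bar>"
  have "g (- R) \<le> w" "w \<le> g R" using lower[of "-R" 0] lower[of 0 R] by (auto simp: R_def)
  then have "\<exists>x\<ge>- R. x \<le> R \<and> g x = w"
    using continuous_on_subset[OF cont_g] by (intro IVT') (auto simp: R_def)
  then show "\<exists>x. w = g x" by auto
qed

definition ginv :: "real \<Rightarrow> real" where "ginv = inv g"

lemma g_ginv [simp]: "g (ginv w) = w" by (simp add: ginv_def surj_f_inv_f surj_g)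
lemma ginv_g [simp]: "ginv (g x) = x" by (simp add: ginv_def strict_mono_g strict_mono_imp_inj_on inv_f_f)

lemma strict_mono_ginv: "strict_mono ginv"
  by (metis g_ginv strict_mono_def strict_mono_g strict_mono_less)

lemma cont_ginv: "continuous_on UNIV ginv"
proof -
  have "1-lipschitz_on UNIV ginv"
  proof (intro lipschitz_onI)
    fix x y show "dist (ginv x) (ginv y) \<le> 1 * dist x y"
      using lower[of "ginv x" "ginv y"] lower[of "ginv y" "ginv x"] by (auto simp: dist_real_def abs_if)
  qed auto
  then show ?thesis by (rule lipschitz_on_continuous_on)
qed

lemma image_eq_vimage: "g ` E = ginv -` E"
  by (metis (no_types, opaque_lifting) bij_betw_def bij_betw_inv_into bij_vimage_eq_inv_image ginv_def inv_inv_eq strict_mono_g strict_mono_imp_inj_on surj_g)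

lemma image_borel: "E \<in> sets borel \<Longrightarrow> g ` E \<in> sets borel"
  unfolding image_eq_vimage
  using borel_measurable_continuous_onI[OF cont_ginv] by (simp add: measurable_def)

lemma image_negligible: "negligible N \<Longrightarrow> negligible (g ` N)"
  by (rule negligible_locally_Lipschitz_image[of N g]) (use lip_g in \<open>auto intro!: exI[of _ UNIV]\<close>)

lemma emeasure_image_ge:
  assumes "E \<in> sets borel" "0 < s"
    and "\<And>x d. x \<in> E \<Longrightarrow> 0 < d \<Longrightarrow>
      \<exists>y z. y \<le> x \<and> x \<le> z \<and> y < z \<and> z - y < d \<and> s * (z - y) \<le> g z - g y"
  shows "ennreal s * emeasure lebesgue E \<le> emeasure lebesgue (g ` E)"
proof (rule emeasure_image_ge_of_steep_intervals[OF strict_mono_g cont_g _ _ assms(2,3)])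
  show "E \<in> sets lebesgue" "g ` E \<in> sets lebesgue" using assms(1) image_borel by auto
qed

text \<open>An interval on which \<open>g\<close> has mean slope at most \<open>r\<close> is mapped
  to one on which \<open>ginv\<close> has mean slope at least \<open>1 / r\<close>, so the lower
  estimate for \<open>ginv\<close> is the upper estimate for \<open>g\<close>. Choosing lengths
  below \<open>d / M\<close> makes the image intervals shorter than \<open>d\<close>.\<close>

lemma emeasure_image_le:
  assumes E: "E \<in> sets lebesgue" and gE: "g ` E \<in> sets lebesgue" and "0 < r"
    and flat: "\<And>x d. x \<in> E \<Longrightarrow> 0 < d \<Longrightarrow>
      \<exists>y z. y \<le> x \<and> x \<le> z \<and> y < z \<and> z - y < d \<and> g z - g y \<le> r * (z - y)"
  shows "emeasure lebesgue (g ` E) \<le> ennreal r * emeasure lebesgue E"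
proof -
  have img: "ginv ` g ` E = E" by (auto simp: image_image)
  have "ennreal (1 / r) * emeasure lebesgue (g ` E) \<le> emeasure lebesgue (ginv ` g ` E)"
  proof (rule emeasure_image_ge_of_steep_intervals[OF strict_mono_ginv cont_ginv])
    fix w d assume w: "w \<in> g ` E" and d: "(0::real) < d"
    obtain x where x: "x \<in> E" "w = g x" using w by auto
    obtain y z where yz: "y \<le> x" "x \<le> z" "y < z" "z - y < d / M" "g z - g y \<le> r * (z - y)"
      using flat[OF x(1), of "d / M"] d M_ge_1 by auto
    have "g z - g y \<le> M * (z - y)" using upper yz by simp
    also have "\<dots> < d" using yz(4) M_ge_1 by (simp add: field_simps)
    finally show "\<exists>y z. y \<le> w \<and> w \<le> z \<and> y < z \<and> z - y < d \<and> 1 / r * (z - y) \<le> ginv z - ginv y"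
      using yz x strict_mono_g \<open>0 < r\<close>
      by (intro exI[of _ "g y"] exI[of _ "g z"])
         (auto simp: strict_mono_less_eq strict_mono_less field_simps)
  qed (use assms img in auto)
  then have "ennreal r * (ennreal (1 / r) * emeasure lebesgue (g ` E)) \<le> ennreal r * emeasure lebesgue E"
    unfolding img by (rule mult_left_mono) simp
  moreover have "ennreal r * (ennreal (1 / r) * emeasure lebesgue (g ` E)) = emeasure lebesgue (g ` E)"
    using \<open>0 < r\<close> by (simp add: mult.assoc[symmetric] ennreal_mult[symmetric])
  ultimately show ?thesis by simp
qed

text \<open>Written as a countable intersection of open sets in order to be Borel. Up to the value
  \<open>s\<close> itself, it is a superlevel set of the upper derivative taken over intervals that
  straddle the point; \<open>flat_at\<close> is the counterpart for the lower derivative.\<close>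

definition steep_at :: "real \<Rightarrow> real set" where
  "steep_at s = (\<Inter>n. \<Union>{ {y<..<z} |y z. y < z \<and> z - y < 1 / real (Suc n) \<and> s * (z - y) < g z - g y})"

definition flat_at :: "real \<Rightarrow> real set" where
  "flat_at r = (\<Inter>n. \<Union>{ {y<..<z} |y z. y < z \<and> z - y < 1 / real (Suc n) \<and> g z - g y < r * (z - y)})"

lemma borel_steep_flat: "steep_at s \<in> sets borel" "flat_at r \<in> sets borel"
  unfolding steep_at_def flat_at_def
  by (intro sets.countable_INT'' borel_open open_Union; auto)+

text \<open>On a bounded piece \<open>E\<close> the two covering estimates give
  \<open>s * |E| \<le> |g(E)| \<le> r * |E|\<close>; since \<open>r < s\<close> and
  \<open>|E|\<close> is finite, \<open>|E| = 0\<close>.\<close>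

lemma steep_flat_null:
  assumes rs: "0 < r" "r < s"
  shows "negligible (steep_at s \<inter> flat_at r)"
proof -
  have "negligible (steep_at s \<inter> flat_at r \<inter> {-real k..real k})" for k
  proof -
    let ?E = "steep_at s \<inter> flat_at r \<inter> {-real k..real k}"
    have E: "?E \<in> sets borel" using borel_steep_flat by auto
    have 1: "ennreal s * emeasure lebesgue ?E \<le> emeasure lebesgue (g ` ?E)"
    proof (rule emeasure_image_ge[OF E])
      fix x d assume "x \<in> ?E" and "(0::real) < d"
      then obtain n where n: "1 / real (Suc n) < d" using nat_approx_posE by blast
      have "x \<in> \<Union>{ {y<..<z} |y z. y < z \<and> z - y < 1 / real (Suc n) \<and> s * (z - y) < g z - g y}"
        using \<open>x \<in> ?E\<close> unfolding steep_at_def by blast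
      then obtain y z where "y < x" "x < z" "z - y < 1 / real (Suc n)" "s * (z - y) < g z - g y" by auto
      then show "\<exists>y z. y \<le> x \<and> x \<le> z \<and> y < z \<and> z - y < d \<and> s * (z - y) \<le> g z - g y"
        using n by (intro exI[of _ y] exI[of _ z]) linarith
    qed (use rs in auto)
    have 2: "emeasure lebesgue (g ` ?E) \<le> ennreal r * emeasure lebesgue ?E"
    proof (rule emeasure_image_le)
      fix x d assume "x \<in> ?E" and "(0::real) < d"
      then obtain n where n: "1 / real (Suc n) < d" using nat_approx_posE by blast
      have "x \<in> \<Union>{ {y<..<z} |y z. y < z \<and> z - y < 1 / real (Suc n) \<and> g z - g y < r * (z - y)}"
        using \<open>x \<in> ?E\<close> unfolding flat_at_def by blast
      then obtain y z where "y < x" "x < z" "z - y < 1 / real (Suc n)" "g z - g y < r * (z - y)" by auto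
      then show "\<exists>y z. y \<le> x \<and> x \<le> z \<and> y < z \<and> z - y < d \<and> g z - g y \<le> r * (z - y)"
        using n by (intro exI[of _ y] exI[of _ z]) linarith
    qed (use rs E image_borel[OF E] in auto)
    have fin: "emeasure lebesgue ?E < top"
    proof -
      have "emeasure lebesgue ?E \<le> emeasure lebesgue {-real k..real k}"
        by (rule emeasure_mono) auto
      also have "\<dots> < top" by simp
      finally show ?thesis .
    qed
    then obtain m where m: "emeasure lebesgue ?E = ennreal m" "0 \<le> m"
      by (cases "emeasure lebesgue ?E") auto
    have "ennreal (s * m) \<le> ennreal (r * m)"
      using order_trans[OF 1 2] m rs by (simp add: ennreal_mult)
    then have "s * m \<le> r * m" using m rs by (simp add: ennreal_le_iff)
    then have "m = 0" using m rs by (simp add: mult_le_cancel_right)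
    then show ?thesis using m E by (simp add: negligible_iff_null_sets null_sets_def)
  qed
  then have "negligible (\<Union>k. steep_at s \<inter> flat_at r \<inter> {-real k..real k})"
    by (intro negligible_countable_Union) auto
  moreover have "steep_at s \<inter> flat_at r \<subseteq> (\<Union>k. steep_at s \<inter> flat_at r \<inter> {-real k..real k})"
  proof
    fix x assume x: "x \<in> steep_at s \<inter> flat_at r"
    obtain k where "\<bar>x\<bar> \<le> real k" using real_arch_simple by blast
    then show "x \<in> (\<Union>k. steep_at s \<inter> flat_at r \<inter> {-real k..real k})" using x by (auto intro!: exI[of _ k])
  qed
  ultimately show ?thesis by (rule negligible_subset)
qed

lemma not_steepD:
  assumes "x \<notin> steep_at s"
  obtains d where "d > 0" "\<And>y z. y < x \<Longrightarrow> x < z \<Longrightarrow> z - y < d \<Longrightarrow> g z - g y \<le> s * (z - y)"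
proof -
  obtain n where n: "x \<notin> \<Union>{ {y<..<z} |y z. y < z \<and> z - y < 1 / real (Suc n) \<and> s * (z - y) < g z - g y}"
    using assms unfolding steep_at_def by blast
  show thesis
  proof (rule that[of "1 / real (Suc n)"])
    fix y z assume yz: "y < x" "x < z" "z - y < 1 / real (Suc n)"
    show "g z - g y \<le> s * (z - y)"
    proof (rule ccontr)
      assume neg: "\<not> ?thesis"
      have "{y<..<z} \<in> { {y<..<z} |y z. y < z \<and> z - y < 1 / real (Suc n) \<and> s * (z - y) < g z - g y}"
        by (rule CollectI, rule exI[of _ y], rule exI[of _ z]) (use neg yz in auto)
      moreover have "x \<in> {y<..<z}" using yz by simp
      ultimately show False using n by blast
    qed
  qed simp
qed

lemma not_flatD:
  assumes "x \<notin> flat_at r"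
  obtains d where "d > 0" "\<And>y z. y < x \<Longrightarrow> x < z \<Longrightarrow> z - y < d \<Longrightarrow> r * (z - y) \<le> g z - g y"
proof -
  obtain n where n: "x \<notin> \<Union>{ {y<..<z} |y z. y < z \<and> z - y < 1 / real (Suc n) \<and> g z - g y < r * (z - y)}"
    using assms unfolding flat_at_def by blast
  show thesis
  proof (rule that[of "1 / real (Suc n)"])
    fix y z assume yz: "y < x" "x < z" "z - y < 1 / real (Suc n)"
    show "r * (z - y) \<le> g z - g y"
    proof (rule ccontr)
      assume neg: "\<not> ?thesis"
      have "{y<..<z} \<in> { {y<..<z} |y z. y < z \<and> z - y < 1 / real (Suc n) \<and> g z - g y < r * (z - y)}"
        by (rule CollectI, rule exI[of _ y], rule exI[of _ z]) (use neg yz in auto)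
      moreover have "x \<in> {y<..<z}" using yz by simp
      ultimately show False using n by blast
    qed
  qed simp
qed

text \<open>\<open>D\<close> is the infimum of all bounds on the mean slopes over short straddling
  intervals. A rational \<open>s < D\<close> is no such bound, so the point is steep for
  \<open>s\<close> and hence not flat for a positive rational \<open>r < s\<close>; with
  \<open>r\<close> close to \<open>D\<close> this is the matching lower bound.\<close>

lemma differentiable_off_steep_flat:
  assumes x: "\<And>r s. r \<in> \<rat> \<Longrightarrow> s \<in> \<rat> \<Longrightarrow> 0 < r \<Longrightarrow> r < s \<Longrightarrow> x \<notin> steep_at s \<inter> flat_at r"
  shows "\<exists>D. (g has_real_derivative D) (at x)"
proof -
  define A where "A = {s. \<exists>d>0. \<forall>y z. y < x \<longrightarrow> x < z \<longrightarrow> z - y < d \<longrightarrow> g z - g y \<le> s * (z - y)}"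
  have MA: "M \<in> A" unfolding A_def using upper by (auto intro!: exI[of _ 1])
  have A1: "1 \<le> s" if s: "s \<in> A" for s
  proof -
    obtain d where d: "d > 0" "\<And>y z. y < x \<Longrightarrow> x < z \<Longrightarrow> z - y < d \<Longrightarrow> g z - g y \<le> s * (z - y)"
      using s unfolding A_def by blast
    have "g (x + d/3) - g (x - d/3) \<le> s * (2 * d/3)" using d(2)[of "x - d/3" "x + d/3"] d(1) by (simp add: field_simps)
    moreover have "2*d/3 \<le> g (x + d/3) - g (x - d/3)" using lower[of "x - d/3" "x + d/3"] d(1) by simp
    ultimately have "1 * (2*d/3) \<le> s * (2 * d/3)" by simp
    then show "1 \<le> s" using d(1) by (subst (asm) mult_le_cancel_right) auto
  qed
  have bd: "bdd_below A" using A1 by (rule bdd_belowI)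
  define D where "D = Inf A"
  have D1: "1 \<le> D" unfolding D_def using A1 MA by (intro cInf_greatest) auto
  have key: "\<exists>d>0. \<forall>y z. y < x \<longrightarrow> x < z \<longrightarrow> z - y < d \<longrightarrow> \<bar>(g z - g y) - D * (z - y)\<bar> \<le> e * (z - y)"
    if e: "0 < e" "e < 1" for e
  proof -
    obtain s0 where s0: "s0 \<in> A" "s0 < D + e"
      using cInf_lessD[of A "D + e"] MA e by (auto simp: D_def)
    obtain d1 where d1: "d1 > 0" "\<And>y z. y < x \<Longrightarrow> x < z \<Longrightarrow> z - y < d1 \<Longrightarrow> g z - g y \<le> s0 * (z - y)"
      using s0 unfolding A_def by blast
    obtain r where r: "r \<in> \<rat>" "D - e < r" "r < D - e/2" using Rats_dense_in_real[of "D - e" "D - e/2"] e by auto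
    obtain s where s: "s \<in> \<rat>" "r < s" "s < D" using Rats_dense_in_real[of r D] r e by auto
    have "s \<notin> A" using s cInf_lower[OF _ bd, of s] by (auto simp: D_def)
    then have "x \<in> steep_at s"
      by (rule contrapos_np) (erule not_steepD, auto simp: A_def)
    then have "x \<notin> flat_at r" using x[OF r(1) s(1)] s r D1 e by auto
    then obtain d2 where d2: "d2 > 0" "\<And>y z. y < x \<Longrightarrow> x < z \<Longrightarrow> z - y < d2 \<Longrightarrow> r * (z - y) \<le> g z - g y"
      using not_flatD by blast
    show ?thesis
    proof (intro exI[of _ "min d1 d2"] conjI allI impI)
      fix y z assume yz: "y < x" "x < z" "z - y < min d1 d2"
      have "g z - g y \<le> s0 * (z - y)" using d1 yz by auto
      also have "\<dots> \<le> (D + e) * (z - y)" using s0 yz by (intro mult_right_mono) auto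
      finally have 1: "g z - g y \<le> (D + e) * (z - y)" .
      have "(D - e) * (z - y) \<le> r * (z - y)" using r yz by (intro mult_right_mono) auto
      also have "\<dots> \<le> g z - g y" using d2 yz by auto
      finally show "\<bar>(g z - g y) - D * (z - y)\<bar> \<le> e * (z - y)" using 1 by (auto simp: algebra_simps abs_le_iff)
    qed (use d1 d2 in auto)
  qed
  \<comment> \<open>Letting the end point on the far side of \<open>x\<close> tend to
    \<open>x\<close> turns straddling intervals into intervals with one end at
    \<open>x\<close>.\<close>
  have key2: "\<exists>d>0. \<forall>y. \<bar>y - x\<bar> < d \<longrightarrow> \<bar>(g y - g x) - D * (y - x)\<bar> \<le> e * \<bar>y - x\<bar>" if e: "0 < e" "e < 1" for e
  proof -
    obtain d where d: "d > 0" "\<And>y z. y < x \<Longrightarrow> x < z \<Longrightarrow> z - y < d \<Longrightarrow> \<bar>(g z - g y) - D * (z - y)\<bar> \<le> e * (z - y)"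
      using key[OF e] by blast
    have g0: "((\<lambda>w. g w) \<longlongrightarrow> g x) (at x within S)" for S
      using cont_g by (metis UNIV_I continuous_on_def tendsto_within_subset subset_UNIV)
    show ?thesis
    proof (intro exI[of _ d] conjI allI impI)
      fix y assume y: "\<bar>y - x\<bar> < d"
      consider "y = x" | "x < y" | "y < x" by linarith
      then show "\<bar>(g y - g x) - D * (y - x)\<bar> \<le> e * \<bar>y - x\<bar>"
      proof cases
        case 2
        have "((\<lambda>w. e * (y - w) - \<bar>(g y - g w) - D * (y - w)\<bar>) \<longlongrightarrow> e * (y - x) - \<bar>(g y - g x) - D * (y - x)\<bar>) (at_left x)"
          by (intro tendsto_intros g0)
        moreover have "\<forall>\<^sub>F w in at_left x. 0 \<le> e * (y - w) - \<bar>(g y - g w) - D * (y - w)\<bar>"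
          using eventually_at_left_real[of "y - d" x] y 2
          by (auto elim!: eventually_mono intro!: d)
        ultimately have "0 \<le> e * (y - x) - \<bar>(g y - g x) - D * (y - x)\<bar>"
          by (rule tendsto_lowerbound) simp
        then show ?thesis using 2 by simp
      next
        case 3
        have "((\<lambda>w. e * (w - y) - \<bar>(g w - g y) - D * (w - y)\<bar>) \<longlongrightarrow> e * (x - y) - \<bar>(g x - g y) - D * (x - y)\<bar>) (at_right x)"
          by (intro tendsto_intros g0)
        moreover have "\<forall>\<^sub>F w in at_right x. 0 \<le> e * (w - y) - \<bar>(g w - g y) - D * (w - y)\<bar>"
          using eventually_at_right_real[of x "y + d"] y 3
          by (auto elim!: eventually_mono intro!: d)
        ultimately have "0 \<le> e * (x - y) - \<bar>(g x - g y) - D * (x - y)\<bar>"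
          by (rule tendsto_lowerbound) simp
        then show ?thesis using 3 by (simp add: abs_if algebra_simps split: if_splits)
      qed simp
    qed (use d in auto)
  qed
  have "(g has_derivative (\<lambda>h. D * h)) (at x)"
    unfolding has_derivative_within_alt
  proof (intro conjI allI impI)
    show "bounded_linear (\<lambda>h. D * h)" by (rule bounded_linear_mult_right)
    fix e :: real assume "0 < e"
    have "0 < min e (1/2)" "min e (1/2) < 1" using \<open>0 < e\<close> by (auto simp: min_def)
    then obtain d where d: "d > 0" "\<And>y. \<bar>y - x\<bar> < d \<Longrightarrow> \<bar>(g y - g x) - D * (y - x)\<bar> \<le> min e (1/2) * \<bar>y - x\<bar>"
      using key2 by blast
    have "min e (1/2) * \<bar>y - x\<bar> \<le> e * \<bar>y - x\<bar>" for y by (intro mult_right_mono) auto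
    then show "\<exists>d>0. \<forall>y\<in>UNIV. norm (y - x) < d \<longrightarrow> norm (g y - g x - D * (y - x)) \<le> e * norm (y - x)"
      using d by (intro exI[of _ d]) (auto intro: order_trans)
  qed
  then show ?thesis unfolding has_field_derivative_def by blast
qed

lemma ae_differentiable: "negligible {x. \<nexists>D. (g has_real_derivative D) (at x)}"
proof -
  have "negligible (\<Union>(r,s)\<in>{(r,s). r \<in> \<rat> \<and> s \<in> \<rat> \<and> 0 < r \<and> r < s}. steep_at s \<inter> flat_at r)"
  proof (rule negligible_countable_Union)
    have "countable {(r,s::real). r \<in> \<rat> \<and> s \<in> \<rat> \<and> 0 < r \<and> r < s}"
      by (rule countable_subset[of _ "\<rat> \<times> \<rat>"]) (auto intro: countable_rat)
    then show "countable ((\<lambda>(r,s). steep_at s \<inter> flat_at r) ` {(r,s). r \<in> \<rat> \<and> s \<in> \<rat> \<and> 0 < r \<and> r < s})"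
      by (rule countable_image)
  qed (use steep_flat_null in auto)
  then show ?thesis
    by (rule negligible_subset) (use differentiable_off_steep_flat in blast)
qed

text \<open>The increment is the length of \<open>{g a..g b}\<close>, at most the measure of the
  image of \<open>{a..b}\<close>. The null set \<open>N\<close> contributes nothing because
  \<open>g\<close> is Lipschitz, and off \<open>N\<close> the derivative bound makes
  \<open>g\<close> flat at rate \<open>c + e\<close>.\<close>

lemma increment_le_of_ae_derivative_le:
  assumes ab: "a \<le> b" and c: "0 < c"
    and N: "negligible N" and der: "\<And>x. x \<in> {a..b} - N \<Longrightarrow> \<exists>D\<le>c. (g has_real_derivative D) (at x)"
  shows "g b - g a \<le> c * (b - a)"
proof (rule field_le_epsilon)
  fix e' :: real assume "0 < e'"
  define e where "e = e' / (b - a + 1)"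
  have e: "0 < e" "e * (b - a) \<le> e'" using \<open>0 < e'\<close> ab by (auto simp: e_def field_simps)
  let ?E = "{a..b} - N"
  have Em: "?E \<in> sets lebesgue" using N by (auto simp: negligible_iff_null_sets)
  have gE: "g ` {a..b} \<in> sets lebesgue" "g ` ?E \<in> sets lebesgue"
  proof -
    have gab: "g ` {a..b} \<in> sets borel" by (rule image_borel) auto
    then show "g ` {a..b} \<in> sets lebesgue" by simp
    have "g ` ?E = g ` {a..b} - g ` N"
      by (simp add: image_set_diff strict_mono_g strict_mono_imp_inj_on)
    then show "g ` ?E \<in> sets lebesgue"
      using gab image_negligible[OF N] negligible_imp_sets by (metis sets.Diff sets_completionI_sets sets_lborel)
  qed
  have "emeasure lebesgue (g ` {a..b}) \<le> emeasure lebesgue (g ` ?E \<union> g ` N)"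
    using gE image_negligible[OF N] by (intro emeasure_mono) (auto simp: negligible_iff_null_sets)
  also have "\<dots> = emeasure lebesgue (g ` ?E)"
    using gE image_negligible[OF N] by (intro emeasure_Un_null_set) (auto simp: negligible_iff_null_sets)
  also have "\<dots> \<le> ennreal (c + e) * emeasure lebesgue ?E"
  proof (rule emeasure_image_le[OF Em gE(2)])
    fix x d assume x: "x \<in> ?E" and d: "(0::real) < d"
    obtain D where D: "D \<le> c" "(g has_real_derivative D) (at x)" using der[OF x] by auto
    then obtain d' where d': "d' > 0" "\<And>y. norm (y - x) < d' \<Longrightarrow> norm (g y - g x - D * (y - x)) \<le> e * norm (y - x)"
      using e unfolding has_field_derivative_def has_derivative_within_alt by (metis UNIV_I)
    define z where "z = x + min d d' / 2"
    have z: "z > x" "z - x < d" "z - x < d'" using d d' by (auto simp: z_def min_def)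
    have "g z - g x - D * (z - x) \<le> e * (z - x)" using d'(2)[of z] z by auto
    moreover have "D * (z - x) \<le> c * (z - x)" using D z by (intro mult_right_mono) auto
    ultimately have "g z - g x \<le> (c + e) * (z - x)" by (simp add: algebra_simps)
    then show "\<exists>y z. y \<le> x \<and> x \<le> z \<and> y < z \<and> z - y < d \<and> g z - g y \<le> (c + e) * (z - y)"
      using z by (intro exI[of _ x] exI[of _ z]) auto
  qed (use c e in auto)
  also have "\<dots> \<le> ennreal (c + e) * emeasure lebesgue {a..b}"
    using Em by (intro mult_left_mono emeasure_mono) auto
  also have "\<dots> = ennreal ((c + e) * (b - a))" using ab c e by (simp add: ennreal_mult)
  finally have le: "emeasure lebesgue (g ` {a..b}) \<le> ennreal ((c + e) * (b - a))" .
  have "{g a..g b} \<subseteq> g ` {a..b}"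
  proof
    fix w assume "w \<in> {g a..g b}"
    then obtain x where "a \<le> x" "x \<le> b" "g x = w"
      using IVT'[of g a w b] ab continuous_on_subset[OF cont_g] by auto
    then show "w \<in> g ` {a..b}" by auto
  qed
  then have "emeasure lebesgue {g a..g b} \<le> emeasure lebesgue (g ` {a..b})"
    using gE by (intro emeasure_mono)
  moreover have "g a \<le> g b" using lower[OF ab] ab by simp
  ultimately have "ennreal (g b - g a) \<le> ennreal ((c + e) * (b - a))" using le by simp
  then have "g b - g a \<le> (c + e) * (b - a)" using ab c e by (subst (asm) ennreal_le_iff) auto
  then show "g b - g a \<le> c * (b - a) + e'" using e by (simp add: algebra_simps)
qed

end

section \<open>From essential suprema of derivatives to increments\<close>

lemma increment_le_of_esssup_deriv:
  fixes f :: "real \<Rightarrow> real"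
  assumes lip: "L-lipschitz_on UNIV f" and xy: "a \<le> x" "x \<le> y" "y \<le> b" and c: "0 < c"
    and ess: "esssup (restrict_space lebesgue {a..b}) (\<lambda>p. ereal \<bar>deriv f p\<bar>) \<le> ereal c"
  shows "\<bar>f y - f x\<bar> \<le> c * (y - x)"
proof -
  have L: "0 \<le> L" using lip by (rule lipschitz_on_nonneg)
  have lip': "\<bar>f v - f u\<bar> \<le> L * \<bar>v - u\<bar>" for u v
    using lipschitz_onD[OF lip, of v u] by (auto simp: dist_real_def)
  have "AE p in restrict_space lebesgue {a..b}. ereal \<bar>deriv f p\<bar> \<le> ereal c"
    using esssup_AE[of "\<lambda>p. ereal \<bar>deriv f p\<bar>" "restrict_space lebesgue {a..b}"]
    by (rule eventually_mono) (use ess in \<open>blast intro: order_trans\<close>)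
  then have "AE p in lebesgue. p \<in> {a..b} \<longrightarrow> \<bar>deriv f p\<bar> \<le> c"
    by (subst (asm) AE_restrict_space_iff) auto
  then obtain N1 where N1: "negligible N1" "\<And>p. p \<in> {a..b} \<Longrightarrow> p \<notin> N1 \<Longrightarrow> \<bar>deriv f p\<bar> \<le> c"
    by (auto elim!: AE_E3 simp: negligible_iff_null_sets) 
  have main: "\<sigma> * f y - \<sigma> * f x \<le> c * (y - x)" if \<sigma>: "\<sigma> = 1 \<or> \<sigma> = -1" for \<sigma> :: real
  proof -
    \<comment> \<open>The sign \<sigma> yields the upper and the lower bound on the increment of
      \<open>f\<close> by the same argument.\<close>
    define g where "g = (\<lambda>p. \<sigma> * f p + (L + 1) * p)"
    interpret increasing_bilipschitz g "2 * L + 1"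
    proof
      fix u v :: real assume "u \<le> v"
      then show "v - u \<le> g v - g u" "g v - g u \<le> (2 * L + 1) * (v - u)"
        using lip'[of v u] \<sigma> by (auto simp: g_def abs_le_iff algebra_simps)
    qed
    \<comment> \<open>Where \<open>f\<close> is not differentiable, \<open>deriv f\<close> is an
      unspecified value that says nothing about slopes; those points form a null set and are
      excluded as well.\<close>
    define N where "N = N1 \<union> {p. \<nexists>D. (g has_real_derivative D) (at p)}"
    have "g y - g x \<le> (c + L + 1) * (y - x)"
    proof (rule increment_le_of_ae_derivative_le[where N = N])
      show "negligible N" unfolding N_def using N1(1) ae_differentiable by (rule negligible_Un)
      fix p assume p: "p \<in> {x..y} - N"
      then obtain D where D: "(g has_real_derivative D) (at p)" by (auto simp: N_def)
      have "((\<lambda>p. \<sigma> * (g p - (L + 1) * p)) has_real_derivative \<sigma> * (D - (L + 1))) (at p)"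
        by (auto intro!: derivative_eq_intros D)
      moreover have "(\<lambda>p. \<sigma> * (g p - (L + 1) * p)) = f" using \<sigma> by (auto simp: g_def)
      ultimately have "deriv f p = \<sigma> * (D - (L + 1))" by (simp add: DERIV_imp_deriv)
      moreover have "\<bar>deriv f p\<bar> \<le> c" using p xy N1 by (auto simp: N_def)
      ultimately have "D \<le> c + L + 1" using \<sigma> by auto
      then show "\<exists>D\<le>c + L + 1. (g has_real_derivative D) (at p)" using D by blast
    qed (use xy c L in auto)
    then show ?thesis by (simp add: g_def algebra_simps)
  qed
  show ?thesis using main[of 1] main[of "-1"] by (simp add: abs_le_iff)
qed

section \<open>Diagonal increments of piecewise C1 functions\<close>

text \<open>Either the open set lies in the last piece, hence in its interior, or removing this
  closed piece leaves a nonempty open set covered by the remaining ones.\<close>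

lemma open_meets_interior_of_finite_closed_cover:
  fixes A :: "nat \<Rightarrow> 'a::topological_space set"
  assumes "\<And>j. j < k \<Longrightarrow> closed (A j)" "open O'" "O' \<noteq> {}" "O' \<subseteq> (\<Union>j<k. A j)"
  shows "\<exists>j<k. interior (A j) \<inter> O' \<noteq> {}"
  using assms
proof (induction k arbitrary: O')
  case (Suc k)
  show ?case
  proof (cases "O' \<subseteq> A k")
    case True
    then have "O' \<subseteq> interior (A k)" using Suc.prems by (simp add: interior_maximal)
    then show ?thesis using Suc.prems by blast
  next
    case False
    have "\<exists>j<k. interior (A j) \<inter> (O' - A k) \<noteq> {}"
    proof (rule Suc.IH)
      show "O' - A k \<subseteq> (\<Union>j<k. A j)" using Suc.prems(4) by (fastforce simp: lessThan_Suc)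
    qed (use Suc.prems False in \<open>auto intro: open_Diff\<close>)
    then show ?thesis by (metis Int_iff Diff_iff less_SucI all_not_in_conv)
  qed
qed simp

text \<open>Raising the junction value lowers all junction gradients by the same amount, so only
  increments of \<open>F\<close> along this diagonal decide whether the junction update is monotone.
  \<open>mdivF\<close> is the corresponding directional derivative.\<close>

abbreviation cvec :: "real \<Rightarrow> real^'n" where "cvec h \<equiv> (\<chi> i. h)"

text \<open>A segment may change pieces infinitely often, so its increment is not a finite sum over
  pieces. Instead, with slack \<open>e\<close>, let \<open>s\<close> be the last parameter at which
  \<open>f s \<le> f 0\<close>. If \<open>s < h\<close>, infinitely many points approaching
  \<open>q s\<close> from beyond lie in one piece; closedness puts \<open>q s\<close> into it, and
  the difference quotients of \<open>G j\<close> there tend to a derivative of at least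
  \<open>c + e\<close>, against the bound \<open>c\<close>.\<close>

lemma diagonal_increment_le:
  fixes F :: "real^'n \<Rightarrow> real" and A :: "nat \<Rightarrow> (real^'n) set"
  assumes closed: "\<And>j. j < k \<Longrightarrow> closed (A j)"
    and cover: "B \<subseteq> (\<Union>j<k. A j)" and eq: "\<And>j p. j < k \<Longrightarrow> p \<in> A j \<Longrightarrow> F p = G j p"
    and der: "\<And>j p. j < k \<Longrightarrow> (G j has_derivative D j p) (at p)"
    and D: "\<And>j p. j < k \<Longrightarrow> p \<in> A j \<Longrightarrow> D j p (cvec (-1)) \<le> c"
    and contF: "continuous_on UNIV F" and h: "0 \<le> h"
    and seg: "\<And>s. 0 \<le> s \<Longrightarrow> s \<le> h \<Longrightarrow> p - cvec s \<in> B"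
  shows "F (p - cvec h) - F p \<le> c * h"
proof (rule field_le_epsilon)
  fix e' :: real assume "0 < e'"
  define e where "e = e' / (h + 1)"
  have e: "0 < e" "e * h \<le> e'" using \<open>0 < e'\<close> h by (auto simp: e_def field_simps)
  define q where "q = (\<lambda>s::real. p - cvec s)"
  have cv: "cvec s = s *\<^sub>R cvec 1" for s by (simp add: vec_eq_iff)
  have q_eq: "q = (\<lambda>s. p - s *\<^sub>R cvec 1)" unfolding q_def by (subst cv) simp
  have qd: "(q has_derivative (\<lambda>u. u *\<^sub>R cvec (-1))) (at s)" for s
  proof -
    have "((\<lambda>s. p - s *\<^sub>R cvec 1) has_derivative (\<lambda>u. 0 - u *\<^sub>R cvec 1)) (at s)"
      by (intro derivative_intros)
    moreover have "(\<lambda>u. 0 - u *\<^sub>R cvec 1) = (\<lambda>u. u *\<^sub>R (cvec (-1) :: real^'n))" by (auto simp: vec_eq_iff)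
    ultimately show ?thesis unfolding q_eq by simp
  qed
  have qc: "continuous_on UNIV q" unfolding q_eq by (intro continuous_intros)
  define f where "f = (\<lambda>s. F (q s) - (c + e) * s)"
  have fc: "continuous_on S f" for S
    unfolding f_def by (intro continuous_intros continuous_on_compose2[OF contF] continuous_on_subset[OF qc]) auto
  define S where "S = {s \<in> {0..h}. f s \<le> f 0}"
  have "S = {0..h} \<inter> {s. f s \<le> f 0}" by (auto simp: S_def)
  then have Scl: "closed S"
    using fc by (simp add: closed_Int closed_Collect_le)
  have "0 \<in> S" using h by (auto simp: S_def)
  have bdd: "bdd_above S" by (auto simp: S_def intro!: bdd_aboveI[of _ h])
  define s where "s = Sup S"
  have sS: "s \<in> S" unfolding s_def using Scl \<open>0 \<in> S\<close> bdd by (intro closed_contains_Sup) auto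
  have "s = h"
  proof (rule ccontr)
    assume "s \<noteq> h"
    then have sh: "0 \<le> s" "s < h" using sS by (auto simp: S_def)
    have gt: "f t > f s" if "s < t" "t \<le> h" for t
    proof -
      have "t \<notin> S" using that bdd cSup_upper[of t S] by (auto simp: s_def)
      then show ?thesis using that sS sh by (auto simp: S_def)
    qed
    define T where "T = (\<lambda>n. s + (h - s) / real (Suc n))"
    have T: "s < T n" "T n \<le> h" for n
    proof -
      show "s < T n" using sh by (auto simp: T_def)
      have "(h - s) / real (Suc n) \<le> (h - s) / 1" using sh by (intro divide_left_mono) auto
      then show "T n \<le> h" by (simp add: T_def)
    qed
    have Tl: "T \<longlonglongrightarrow> s" unfolding T_def
      using tendsto_add[OF tendsto_const[of s] LIMSEQ_Suc[OF lim_const_over_n[of "h - s"]]] by simp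
    have "\<forall>n. \<exists>j<k. q (T n) \<in> A j"
    proof
      fix n have "q (T n) \<in> B" unfolding q_def using T[of n] sh by (intro seg) auto
      then show "\<exists>j<k. q (T n) \<in> A j" using cover by auto
    qed
    then obtain J where J: "\<And>n. J n < k" "\<And>n. q (T n) \<in> A (J n)" by metis
    have "finite (range J)" using J(1) by (intro finite_subset[of "range J" "{..<k}"]) auto
    then obtain j where j: "infinite {n. J n = j}"
      using pigeonhole_infinite[of UNIV J] by auto
    then have "j < k" using J(1) by (metis (mono_tags, lifting) Collect_empty_eq finite.emptyI)
    obtain r :: "nat \<Rightarrow> nat" where r: "strict_mono r" "\<And>n. J (r n) = j"
      using infinite_enumerate[OF j] by auto
    have Tr: "(\<lambda>n. T (r n)) \<longlonglongrightarrow> s" using LIMSEQ_subseq_LIMSEQ[OF Tl r(1)] by (simp add: o_def)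
    have qT: "(\<lambda>n. q (T (r n))) \<longlonglongrightarrow> q s"
      using continuous_on_tendsto_compose[OF qc Tr] by auto
    have qsA: "q s \<in> A j"
      by (rule closed_sequentially[OF closed[OF \<open>j < k\<close>] _ qT]) (use J(2) r(2) in metis)
    have gd: "((\<lambda>t. G j (q t)) has_derivative (\<lambda>u. D j (q s) (u *\<^sub>R cvec (-1)))) (at s)"
      by (rule has_derivative_compose[OF qd der[OF \<open>j < k\<close>]])
    have lin: "D j (q s) (u *\<^sub>R v) = u *\<^sub>R D j (q s) v" for u v
      using der[OF \<open>j < k\<close>, of "q s"] by (simp add: has_derivative_linear linear_cmul)
    have gd': "((\<lambda>t. G j (q t)) has_real_derivative D j (q s) (cvec (-1))) (at s)"
      unfolding has_field_derivative_def
      by (rule has_derivative_eq_rhs[OF gd]) (auto simp: lin fun_eq_iff)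
    have "(\<lambda>n. (G j (q (T (r n))) - G j (q s)) / (T (r n) - s)) \<longlonglongrightarrow> D j (q s) (cvec (-1))"
    proof -
      have "((\<lambda>t. (G j (q t) - G j (q s)) / (t - s)) \<longlongrightarrow> D j (q s) (cvec (-1))) (at s)"
        using gd' by (simp add: has_field_derivative_iff)
      moreover have "filterlim (\<lambda>n. T (r n)) (at s) sequentially"
        unfolding filterlim_at using Tr T(1) by (auto intro!: always_eventually simp: less_imp_neq[THEN not_sym])
      ultimately show ?thesis by (rule filterlim_compose)
    qed
    moreover have "\<forall>\<^sub>F n in sequentially. c + e \<le> (G j (q (T (r n))) - G j (q s)) / (T (r n) - s)"
    proof (rule always_eventually, rule allI)
      fix n
      have "f (T (r n)) > f s" using gt T by auto
      then have "F (q (T (r n))) - F (q s) > (c + e) * (T (r n) - s)" by (simp add: f_def algebra_simps)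
      moreover have "F (q (T (r n))) = G j (q (T (r n)))" "F (q s) = G j (q s)"
        using eq[OF \<open>j < k\<close>] J(2)[of "r n"] r(2)[of n] qsA by auto
      ultimately show "c + e \<le> (G j (q (T (r n))) - G j (q s)) / (T (r n) - s)"
        using T[of "r n"] by (simp add: pos_le_divide_eq)
    qed
    ultimately have "c + e \<le> D j (q s) (cvec (-1))" by (rule tendsto_lowerbound) simp
    moreover have "D j (q s) (cvec (-1)) \<le> c" using D \<open>j < k\<close> qsA by blast
    ultimately show False using e by simp
  qed
  then have "f h \<le> f 0" using sS by (auto simp: S_def)
  moreover have "q 0 = p" by (simp add: q_def vec_eq_iff)
  ultimately show "F (p - cvec h) - F p \<le> c * h + e'"
    using e by (simp add: f_def algebra_simps) (simp add: q_def)
qed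

lemma piecewise_C1_pieces:
  fixes F :: "real^'n::finite \<Rightarrow> real"
  assumes "piecewise_C1 F"
  shows "\<exists>(k :: nat) A G D. (\<forall>j<k. closed (A j)) \<and> (\<Union>j<k. A j) = UNIV \<and> (\<forall>j<k. \<forall>p\<in>A j. F p = G j p) \<and>
    (\<forall>j<k. \<forall>p. (G j has_derivative D j p) (at p)) \<and> (\<forall>j<k. \<forall>v. continuous_on UNIV (\<lambda>p. D j p v))"
proof -
  obtain k A G where 1: "\<forall>j<k::nat. closed (A j) \<and> C1_on_UNIV (G j) \<and> (\<forall>p\<in>A j. F p = G j p)"
     "(\<Union>j<k. A j) = UNIV"
    using assms unfolding piecewise_C1_def by blast
  then have "\<forall>j. \<exists>D. j < k \<longrightarrow> (\<forall>p. (G j has_derivative D p) (at p)) \<and> (\<forall>v. continuous_on UNIV (\<lambda>p. D p v))"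
    unfolding C1_on_UNIV_def by meson
  from choice[OF this] obtain D where
    "\<forall>j. j < k \<longrightarrow> (\<forall>p. (G j has_derivative D j p) (at p)) \<and> (\<forall>v. continuous_on UNIV (\<lambda>p. D j p v))" ..
  then show ?thesis using 1 by (intro exI[of _ k] exI[of _ A] exI[of _ G] exI[of _ D]) simp
qed

lemma piecewise_C1_continuous:
  fixes F :: "real^'n::finite \<Rightarrow> real"
  assumes "piecewise_C1 F"
  shows "continuous_on UNIV F"
proof -
  from piecewise_C1_pieces[OF assms] obtain k A G D where A': "\<forall>j<k::nat. closed (A j)" "(\<Union>j<k. A j) = UNIV"
    "\<forall>j<k. \<forall>p\<in>A j. F p = G j p" "\<forall>j<k. \<forall>p. (G j has_derivative D j p) (at p)"
    by (elim exE conjE)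
  note A = A'(1)[rule_format] A'(2) A'(3-4)[rule_format]
  have "continuous_on (\<Union>j<k. A j) F"
  proof (rule continuous_on_closed_Union)
    fix j assume j: "j \<in> {..<k}"
    have "continuous_on (A j) (G j)"
      using A(4) j by (intro has_derivative_continuous_on[where f' = "D j"]) (rule has_derivative_at_withinI, simp)
    then show "continuous_on (A j) F" using A(3) j by (subst continuous_on_cong[of _ _ F "G j"]) auto
  qed (use A in auto)
  then show ?thesis using A(2) by simp
qed

abbreviation vbox :: "('n \<Rightarrow> real) \<Rightarrow> ('n \<Rightarrow> real) \<Rightarrow> (real^'n) set" where
  "vbox lo hi \<equiv> {p. \<forall>\<beta>. lo \<beta> \<le> p $ \<beta> \<and> p $ \<beta> \<le> hi \<beta>}"

lemma vbox_eq_cbox: "vbox lo hi = cbox (\<chi> i. lo i) (\<chi> i. hi i)"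
  by (auto simp: mem_box_cart)

lemma diagonal_segment_in_vbox:
  assumes "p \<in> vbox lo hi" "p - cvec h \<in> vbox lo hi" "0 \<le> s" "s \<le> h"
  shows "p - cvec s \<in> vbox lo hi"
  using assms by (auto simp: algebra_simps) (smt (verit, best))+

text \<open>Provides an admissible mesh ratio for the junction. It is stated for all larger
  \<open>c\<close> so that it can be combined with the Lipschitz constant of the
  Hamiltonians.\<close>

lemma diagonal_lipschitz_on_vbox:
  fixes F :: "real^'n::finite \<Rightarrow> real"
  assumes F: "piecewise_C1 F"
  shows "\<exists>c0. \<forall>c\<ge>c0. \<forall>p h. 0 \<le> h \<longrightarrow> p \<in> vbox lo hi \<longrightarrow> p - cvec h \<in> vbox lo hi \<longrightarrow>
    F (p - cvec h) - F p \<le> c * h"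
proof -
  from piecewise_C1_pieces[OF F] obtain k A G D where A': "\<forall>j<k::nat. closed (A j)" "(\<Union>j<k. A j) = UNIV"
    "\<forall>j<k. \<forall>p\<in>A j. F p = G j p" "\<forall>j<k. \<forall>p. (G j has_derivative D j p) (at p)"
    "\<forall>j<k. \<forall>v. continuous_on UNIV (\<lambda>p. D j p v)"
    by (elim exE conjE)
  note A = A'(1)[rule_format] A'(2) A'(3-5)[rule_format]
  have cpt: "compact (vbox lo hi)" unfolding vbox_eq_cbox by (rule compact_cbox)
  have ex: "\<forall>j. \<exists>c. j < k \<longrightarrow> (\<forall>p\<in>vbox lo hi. D j p (cvec (-1)) \<le> c)"
  proof
    fix j
    show "\<exists>c. j < k \<longrightarrow> (\<forall>p\<in>vbox lo hi. D j p (cvec (-1)) \<le> c)"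
    proof (cases "j < k")
      case True
      have "compact ((\<lambda>p. D j p (cvec (-1))) ` vbox lo hi)"
        using continuous_on_subset[OF A(5)[OF True]] cpt by (intro compact_continuous_image) auto
      then have "bdd_above ((\<lambda>p. D j p (cvec (-1))) ` vbox lo hi)"
        by (simp add: bounded_imp_bdd_above compact_imp_bounded)
      then show ?thesis by (auto simp: bdd_above_def)
    qed auto
  qed
  obtain C where C: "\<And>j p. j < k \<Longrightarrow> p \<in> vbox lo hi \<Longrightarrow> D j p (cvec (-1)) \<le> C j"
    using choice[OF ex] by blast
  define c0 where "c0 = (\<Sum>j<k. \<bar>C j\<bar>)"
  have c0: "C j \<le> c0" if "j < k" for j
    using member_le_sum[of j "{..<k}" "\<lambda>j. \<bar>C j\<bar>"] that by (auto simp: c0_def)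
  show ?thesis
  proof (intro exI[of _ c0] allI impI)
    fix c h and p :: "real^'n" assume c: "c0 \<le> c" and h: "0 \<le> h" "p \<in> vbox lo hi" "p - cvec h \<in> vbox lo hi"
    show "F (p - cvec h) - F p \<le> c * h"
    proof (rule diagonal_increment_le[where A = "\<lambda>j. A j \<inter> vbox lo hi" and k = k and B = "vbox lo hi" and G = G and D = D])
      show "closed (A j \<inter> vbox lo hi)" if "j < k" for j
        using A(1)[OF that] unfolding vbox_eq_cbox by auto
      show "vbox lo hi \<subseteq> (\<Union>j<k. A j \<inter> vbox lo hi)" using A(2) by blast
      show "D j p (cvec (-1)) \<le> c" if "j < k" "p \<in> A j \<inter> vbox lo hi" for j p
        using C[of j p] c0[of j] c that by auto
      show "p - cvec s \<in> vbox lo hi" if "0 \<le> s" "s \<le> h" for s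
        using diagonal_segment_in_vbox[OF h(2,3) that] .
    qed (use A piecewise_C1_continuous[OF F] h in auto)
  qed
qed

text \<open>A piece may be a null set, about which an essential supremum says nothing. Each piece is
  therefore replaced by the closure of the part \<open>O' j\<close> of its interior inside the open
  box. On \<open>O' j\<close> the function \<open>F\<close> has the derivative of
  \<open>G j\<close>, an almost everywhere bound on a continuous function holds everywhere on an
  open set, and these closures still cover the closed box.\<close>

lemma diagonal_increment_le_of_esssup:
  fixes F :: "real^'n::finite \<Rightarrow> real"
  assumes F: "piecewise_C1 F" and lohi: "\<And>\<beta>. lo \<beta> < hi \<beta>"
    and ess: "esssup (restrict_space lebesgue (vbox lo hi)) (\<lambda>p. ereal (mdivF F p)) \<le> ereal c"
    and h: "0 \<le> h" "p \<in> vbox lo hi" "p - cvec h \<in> vbox lo hi"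
  shows "F (p - cvec h) - F p \<le> c * h"
proof -
  from piecewise_C1_pieces[OF F] obtain k A G D where A': "\<forall>j<k::nat. closed (A j)" "(\<Union>j<k. A j) = UNIV"
    "\<forall>j<k. \<forall>p\<in>A j. F p = G j p" "\<forall>j<k. \<forall>p. (G j has_derivative D j p) (at p)"
    "\<forall>j<k. \<forall>v. continuous_on UNIV (\<lambda>p. D j p v)"
    by (elim exE conjE)
  note A = A'(1)[rule_format] A'(2) A'(3-5)[rule_format]
  let ?a = "\<chi> i. lo i" and ?b = "\<chi> i. hi i"
  have "AE p in restrict_space lebesgue (vbox lo hi). ereal (mdivF F p) \<le> ereal c"
    using esssup_AE[of "\<lambda>p. ereal (mdivF F p)" "restrict_space lebesgue (vbox lo hi)"]
    by (rule eventually_mono) (use ess in \<open>blast intro: order_trans\<close>)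
  then have "AE p in lebesgue. p \<in> vbox lo hi \<longrightarrow> mdivF F p \<le> c"
    unfolding vbox_eq_cbox by (subst (asm) AE_restrict_space_iff) auto
  then obtain N where N: "negligible N" "\<And>p. p \<in> vbox lo hi \<Longrightarrow> p \<notin> N \<Longrightarrow> mdivF F p \<le> c"
    by (auto elim!: AE_E3 simp: negligible_iff_null_sets)
  define O' where "O' = (\<lambda>j. interior (A j) \<inter> box ?a ?b)"
  have mdiv: "mdivF F p = D j p (cvec (-1))" if j: "j < k" and p: "p \<in> interior (A j)" for j p
  proof -
    have "(F has_derivative D j p) (at p)"
    proof (rule has_derivative_transform_within_open[OF A(4)[OF j] open_interior p])
      fix x assume "x \<in> interior (A j)"
      then have "x \<in> A j" using interior_subset by blast
      then show "G j x = F x" using A(3)[OF j] by simp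
    qed
    then have "frechet_derivative F (at p) = D j p" by (simp add: frechet_derivative_at[symmetric])
    moreover have lin: "linear (D j p)" using A(4)[OF j] has_derivative_linear by blast
    moreover have "(cvec (-1) :: real^'n) = - (\<Sum>\<beta>\<in>UNIV. axis \<beta> 1)"
      by (simp add: vec_eq_iff axis_def sum.delta)
    ultimately show ?thesis by (simp add: mdivF_def linear_sum linear_neg)
  qed
  have on_O: "D j p (cvec (-1)) \<le> c" if j: "j < k" and p: "p \<in> O' j" for j p
  proof (rule ccontr)
    assume gt: "\<not> D j p (cvec (-1)) \<le> c"
    define W where "W = O' j \<inter> {p. c < D j p (cvec (-1))}"
    have "open W" unfolding W_def O'_def
      using A(5)[OF j] by (intro open_Int open_interior open_box open_Collect_less continuous_intros)
    moreover have "W \<noteq> {}" using gt p by (auto simp: W_def)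
    moreover have "W \<subseteq> N"
    proof
      fix p' assume p': "p' \<in> W"
      then have "p' \<in> vbox lo hi" unfolding vbox_eq_cbox W_def O'_def using box_subset_cbox by blast
      then show "p' \<in> N" using N(2)[of p'] mdiv[OF j, of p'] p' by (auto simp: W_def O'_def)
    qed
    ultimately show False using N(1) negligible_subset open_not_negligible by blast
  qed
  have "(\<chi> i. (lo i + hi i) / 2) \<in> box ?a ?b" using lohi by (simp add: mem_box_cart)
  then have "box ?a ?b \<noteq> {}" by blast
  then have cl: "cbox ?a ?b = closure (box ?a ?b)" by (simp add: closure_box)
  show ?thesis
  proof (rule diagonal_increment_le[where A = "\<lambda>j. closure (O' j)" and k = k and B = "vbox lo hi" and G = G and D = D])
    show "vbox lo hi \<subseteq> (\<Union>j<k. closure (O' j))"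
    proof
      fix p assume "p \<in> vbox lo hi"
      then have p: "p \<in> closure (box ?a ?b)" unfolding vbox_eq_cbox cl .
      have "p \<in> closure (\<Union>j<k. O' j)"
        unfolding closure_iff_nhds_not_empty
      proof (intro allI impI)
        fix X S assume X: "(S::(real^'n) set) \<subseteq> X" "open S" "p \<in> S"
        then have "S \<inter> box ?a ?b \<noteq> {}" using p by (metis closure_iff_nhds_not_empty Int_commute order_refl)
        then have "\<exists>j<k. interior (A j) \<inter> (S \<inter> box ?a ?b) \<noteq> {}"
          using A X by (intro open_meets_interior_of_finite_closed_cover) auto
        then show "(\<Union>j<k. O' j) \<inter> X \<noteq> {}" using X by (auto simp: O'_def)
      qed
      moreover have "closure (\<Union>j<k. O' j) \<subseteq> (\<Union>j<k. closure (O' j))"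
        using closure_subset by (intro closure_minimal closed_UN) blast+
      ultimately show "p \<in> (\<Union>j<k. closure (O' j))" by blast
    qed
    fix j p assume j: "j < k" and p: "p \<in> closure (O' j)"
    have "closure (O' j) \<subseteq> A j" unfolding O'_def using A(1)[OF j] interior_subset by (intro closure_minimal) auto
    then show "F p = G j p" using A(3) j p by auto
    have "closed {p. D j p (cvec (-1)) \<le> c}"
      using A(5)[OF j] by (intro closed_Collect_le continuous_intros)
    then have "closure (O' j) \<subseteq> {p. D j p (cvec (-1)) \<le> c}" using on_O[OF j] by (intro closure_minimal) auto
    then show "D j p (cvec (-1)) \<le> c" using p by auto
  next
    show "p - cvec s \<in> vbox lo hi" if "0 \<le> s" "s \<le> h" for s
      using diagonal_segment_in_vbox[OF h(2,3) that] .
  qed (use A piecewise_C1_continuous[OF F] h in auto)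
qed

section \<open>Semicontinuity and critical slopes\<close>

definition usc_on :: "'a::metric_space set \<Rightarrow> ('a \<Rightarrow> real) \<Rightarrow> bool" where
  "usc_on S f \<longleftrightarrow> (\<forall>z\<in>S. \<forall>e>0. \<exists>d>0. \<forall>y\<in>S. dist y z < d \<longrightarrow> f y < f z + e)"

lemma usc_onD: "usc_on S f \<Longrightarrow> z \<in> S \<Longrightarrow> 0 < e \<Longrightarrow> \<exists>d>0. \<forall>y\<in>S. dist y z < d \<longrightarrow> f y < f z + e"
  by (simp add: usc_on_def)

lemma usc_on_continuous: "continuous_on S f \<Longrightarrow> usc_on S f"
  unfolding usc_on_def continuous_on_iff
  by (clarify, drule (1) bspec, drule spec, drule (1) mp) (auto simp: dist_real_def abs_less_iff algebra_simps)

lemma usc_on_add: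
  assumes "usc_on S f" "usc_on S g"
  shows "usc_on S (\<lambda>x. f x + g x)"
  unfolding usc_on_def
proof (intro ballI allI impI)
  fix z e assume z: "z \<in> S" and e: "0 < (e::real)"
  obtain d1 where d1: "d1 > 0" "\<forall>y\<in>S. dist y z < d1 \<longrightarrow> f y < f z + e/2" using usc_onD[OF assms(1) z, of "e/2"] e by auto
  obtain d2 where d2: "d2 > 0" "\<forall>y\<in>S. dist y z < d2 \<longrightarrow> g y < g z + e/2" using usc_onD[OF assms(2) z, of "e/2"] e by auto
  show "\<exists>d>0. \<forall>y\<in>S. dist y z < d \<longrightarrow> f y + g y < f z + g z + e"
    using d1 d2 by (intro exI[of _ "min d1 d2"]) (auto, smt (verit) field_sum_of_halves)
qed

lemma usc_on_compose:
  assumes f: "usc_on S f" and g: "continuous_on T g" and sub: "g ` T \<subseteq> S"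
  shows "usc_on T (\<lambda>x. f (g x))"
  unfolding usc_on_def
proof (intro ballI allI impI)
  fix z e assume z: "z \<in> T" and e: "0 < (e::real)"
  obtain d1 where d1: "d1 > 0" "\<forall>y\<in>S. dist y (g z) < d1 \<longrightarrow> f y < f (g z) + e"
    using usc_onD[OF f _ e, of "g z"] z sub by auto
  obtain d2 where "d2 > 0" "\<forall>y\<in>T. dist y z < d2 \<longrightarrow> dist (g y) (g z) < d1"
    using g z d1(1) unfolding continuous_on_iff by blast
  then show "\<exists>d>0. \<forall>y\<in>T. dist y z < d \<longrightarrow> f (g y) < f (g z) + e"
    using d1 sub by (intro exI[of _ d2]) blast
qed

lemma usc_on_limit_ge:
  assumes f: "usc_on S f" and x: "\<And>n. x n \<in> S" "x \<longlonglongrightarrow> l" "l \<in> S" and c: "\<And>n::nat. c \<le> f (x n)"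
  shows "c \<le> f l"
proof (rule field_le_epsilon)
  fix e :: real assume "0 < e"
  then obtain d where d: "d > 0" "\<forall>y\<in>S. dist y l < d \<longrightarrow> f y < f l + e" using usc_onD[OF f x(3)] by blast
  obtain n where "dist (x n) l < d" using x(2) d(1) by (metis LIMSEQ_def order_refl)
  then show "c \<le> f l + e" using d x(1) c[of n] by (smt (verit, best))
qed

lemma usc_on_attains_sup:
  assumes S: "compact S" "S \<noteq> {}" and f: "usc_on S f"
  shows "\<exists>z\<in>S. \<forall>y\<in>S. f y \<le> f z"
proof (rule ccontr)
  assume "\<not> ?thesis"
  then have ex: "\<forall>z\<in>S. \<exists>y\<in>S. f z < f y" by (auto simp: not_le)
  then obtain g where g: "\<And>z. z \<in> S \<Longrightarrow> g z \<in> S" "\<And>z. z \<in> S \<Longrightarrow> f z < f (g z)" by metis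
  have "\<forall>z\<in>S. \<exists>d>0. \<forall>y\<in>S. dist y z < d \<longrightarrow> f y < f (g z)"
  proof
    fix z assume z: "z \<in> S"
    show "\<exists>d>0. \<forall>y\<in>S. dist y z < d \<longrightarrow> f y < f (g z)"
      using usc_onD[OF f z, of "f (g z) - f z"] g(2)[OF z] by auto
  qed
  then obtain d where d: "\<And>z. z \<in> S \<Longrightarrow> d z > 0" "\<And>z y. z \<in> S \<Longrightarrow> y \<in> S \<Longrightarrow> dist y z < d z \<Longrightarrow> f y < f (g z)"
    by metis
  have "S \<subseteq> (\<Union>z\<in>S. ball z (d z))" using d(1) by auto
  then obtain C where C: "C \<subseteq> S" "finite C" "S \<subseteq> (\<Union>z\<in>C. ball z (d z))"
    using compactE_image[OF S(1), of S "\<lambda>z. ball z (d z)"] by (metis open_ball)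
  then have "C \<noteq> {}" using S(2) by auto
  have "Max ((\<lambda>z. f (g z)) ` C) \<in> (\<lambda>z. f (g z)) ` C" using C \<open>C \<noteq> {}\<close> by (intro Max_in) auto
  then obtain z where "z \<in> C" "Max ((\<lambda>z. f (g z)) ` C) = f (g z)" by auto
  moreover from this have "f (g z') \<le> f (g z)" if "z' \<in> C" for z'
    using Max_ge[of "(\<lambda>z. f (g z)) ` C" "f (g z')"] C that by auto
  ultimately obtain z where z: "z \<in> C" "\<And>z'. z' \<in> C \<Longrightarrow> f (g z') \<le> f (g z)" by blast
  have "g z \<in> S" using C g(1) z(1) by blast
  then have "g z \<in> (\<Union>z\<in>C. ball z (d z))" using C(3) by blast
  then obtain z' where z': "z' \<in> C" "dist (g z) z' < d z'" by (auto simp: dist_commute)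
  then have "f (g z) < f (g z')" using d(2) C g(1) z(1) by blast
  then show False using z(2)[OF z'(1)] by simp
qed

section \<open>Critical one-sided slopes of one-dimensional subsolutions\<close>

definition touch1 :: "(real \<Rightarrow> real) \<Rightarrow> real \<Rightarrow> real \<Rightarrow> real \<Rightarrow> bool" where
  "touch1 U x p C \<longleftrightarrow> (\<exists>d>0. \<forall>y. \<bar>y - x\<bar> < d \<longrightarrow> U y \<le> U x + p * (y - x) + C * (y - x)\<^sup>2)"

text \<open>Viscosity subsolutions of \<open>H (U') \<le> B\<close> near \<open>x0\<close>, tested with quadratic functions. Points where \<open>U\<close> is far
  below \<open>U x0\<close> are excluded, because there the maximum over time defining \<open>U\<close> may be attained at an end point.\<close>
definition sub1_near :: "(real \<Rightarrow> real) \<Rightarrow> (real \<Rightarrow> real) \<Rightarrow> real \<Rightarrow> real \<Rightarrow> bool" where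
  "sub1_near H U x0 B \<longleftrightarrow> (\<exists>\<delta>>0. \<exists>\<kappa>>0. \<forall>x p C. \<bar>x - x0\<bar> < \<delta> \<and> 0 < x \<and> U x0 - \<kappa> < U x \<and> touch1 U x p C \<longrightarrow> H p \<le> B)"

text \<open>An upward closed set of slopes. Its infimum, the critical slope, is the upper right Dini
  derivative of \<open>U\<close> at 0.\<close>

definition upslopes :: "(real \<Rightarrow> real) \<Rightarrow> real set" where
  "upslopes U = {p. \<exists>\<delta>>0. \<forall>x. 0 \<le> x \<and> x < \<delta> \<longrightarrow> U x \<le> U 0 + p * x}"

text \<open>The Hamiltonian satisfied by \<open>- u\<close>: a supersolution \<open>u\<close> for
  \<open>h\<close> corresponds to a subsolution \<open>- u\<close> for
  \<open>dual h\<close>.\<close>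

definition dual :: "(real \<Rightarrow> real) \<Rightarrow> real \<Rightarrow> real" where "dual h p = - h (- p)"

lemma upslopes_mono: "p \<in> upslopes U \<Longrightarrow> p \<le> q \<Longrightarrow> q \<in> upslopes U"
  unfolding upslopes_def
  by clarsimp (smt (verit, best) mult_right_mono)

lemma not_upslopesD:
  assumes "p \<notin> upslopes U" "0 < \<delta>"
  shows "\<exists>x. 0 < x \<and> x < \<delta> \<and> U 0 + p * x < U x"
proof -
  obtain x where x: "0 \<le> x" "x < \<delta>" "\<not> U x \<le> U 0 + p * x"
    using assms unfolding upslopes_def by blast
  then have "x \<noteq> 0" by auto
  then show ?thesis using x by (intro exI[of _ x]) auto
qed

text \<open>Arbitrarily close to 0 the graph of \<open>U\<close> has points above and points below
  the line of slope \<open>p\<close>. Between two points below it that enclose one above it,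
  \<open>U y - p * y\<close> has an interior maximum, where \<open>U\<close> is touched with slope
  exactly \<open>p\<close>.\<close>

lemma sub1_intermediate_slope:
  assumes sub: "sub1_near H U 0 B" and usc: "usc_on {0..} U"
    and above: "p \<notin> upslopes U" and below: "\<And>\<delta>. 0 < \<delta> \<Longrightarrow> \<exists>x. 0 < x \<and> x < \<delta> \<and> U x < U 0 + p * x"
  shows "H p \<le> B"
proof -
  obtain \<delta>0 \<kappa> where s: "\<delta>0 > 0" "\<kappa> > 0"
    "\<And>x p C. \<bar>x - 0\<bar> < \<delta>0 \<Longrightarrow> 0 < x \<Longrightarrow> U 0 - \<kappa> < U x \<Longrightarrow> touch1 U x p C \<Longrightarrow> H p \<le> B"
    using sub unfolding sub1_near_def by blast
  \<comment> \<open>The second bound ensures \<open>p * x > - \<kappa>\<close>, so that a point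
    above the line meets the value condition in \<open>sub1_near\<close>.\<close>
  define \<delta> where "\<delta> = min \<delta>0 (\<kappa> / (\<bar>p\<bar> + 1))"
  have \<delta>: "\<delta> > 0" "\<delta> \<le> \<delta>0" using s by (auto simp: \<delta>_def)
  have pk: "- \<kappa> < p * x" if "0 < x" "x < \<delta>" for x
  proof -
    have "x < \<kappa> / (\<bar>p\<bar> + 1)" using that by (simp add: \<delta>_def)
    then have "(\<bar>p\<bar> + 1) * x < \<kappa>" by (simp add: pos_less_divide_eq mult.commute)
    moreover have "- (\<bar>p\<bar> * x) \<le> p * x" using that by (metis abs_ge_minus_self abs_mult abs_of_pos minus_le_iff)
    ultimately show ?thesis using that by (simp add: algebra_simps)
  qed
  obtain y2 where y2: "0 < y2" "y2 < \<delta>" "U y2 < U 0 + p * y2" using below[OF \<delta>(1)] by blast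
  obtain x where x: "0 < x" "x < y2" "U 0 + p * x < U x" using not_upslopesD[OF above y2(1)] by blast
  obtain y1 where y1: "0 < y1" "y1 < x" "U y1 < U 0 + p * y1" using below[OF x(1)] by blast
  have "usc_on {y1..y2} (\<lambda>y. U y + (- p * y))"
    by (intro usc_on_add usc_on_compose[OF usc continuous_on_id] usc_on_continuous continuous_intros) (use y1 in auto)
  then obtain z where z: "z \<in> {y1..y2}" "\<And>y. y \<in> {y1..y2} \<Longrightarrow> U y + (- p * y) \<le> U z + (- p * z)"
    using usc_on_attains_sup[of "{y1..y2}" "\<lambda>y. U y + (- p * y)"] x y1 y2 by auto
  have gt: "U 0 < U z - p * z" using z(2)[of x] x y1 y2 by auto
  then have "z \<noteq> y1" "z \<noteq> y2" using y1 y2 by auto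
  then have zi: "y1 < z" "z < y2" using z by auto
  have "touch1 U z p 0"
    unfolding touch1_def
  proof (intro exI[of _ "min (z - y1) (y2 - z)"] conjI allI impI)
    fix y assume "\<bar>y - z\<bar> < min (z - y1) (y2 - z)"
    then have "y \<in> {y1..y2}" by auto
    then show "U y \<le> U z + p * (y - z) + 0 * (y - z)\<^sup>2" using z(2)[of y] by (simp add: algebra_simps)
  qed (use zi in auto)
  then show ?thesis using s(3)[of z p 0] zi y1 y2 \<delta> gt pk[of z] by auto
qed

text \<open>\<open>U\<close> is tested with a parabola that starts at 0 with slope
  \<open>pbar - 2 * e\<close>. It lies below \<open>U\<close> somewhere near 0, because
  \<open>pbar - e\<close> is not an upslope, and above \<open>U\<close> at \<delta>, because
  \<open>pbar + e\<close> is one. So the difference has an interior maximum, and the slope there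
  lies between \<open>pbar - 2 * e\<close> and \<open>pbar + 6 * e\<close>, hence the choice
  \<open>e = e0 / 7\<close>.\<close>

lemma sub1_critical_slope:
  assumes sub: "sub1_near H U 0 B" and usc: "usc_on {0..} U" and H: "continuous_on UNIV H"
    and up: "\<And>p. pbar < p \<Longrightarrow> p \<in> upslopes U" and dn: "\<And>p. p < pbar \<Longrightarrow> p \<notin> upslopes U"
  shows "H pbar \<le> B"
proof (rule ccontr)
  assume "\<not> H pbar \<le> B"
  obtain e0 where e0: "e0 > 0" "\<And>p. \<bar>p - pbar\<bar> < e0 \<Longrightarrow> \<bar>H p - H pbar\<bar> < H pbar - B"
    using H \<open>\<not> H pbar \<le> B\<close> unfolding continuous_on_iff dist_real_def by (metis UNIV_I diff_gt_0_iff_gt not_le)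
  obtain \<delta>0 \<kappa> where s: "\<delta>0 > 0" "\<kappa> > 0"
    "\<And>x p C. \<bar>x - 0\<bar> < \<delta>0 \<Longrightarrow> 0 < x \<Longrightarrow> U 0 - \<kappa> < U x \<Longrightarrow> touch1 U x p C \<Longrightarrow> H p \<le> B"
    using sub unfolding sub1_near_def by blast
  define e where "e = e0 / 7"
  have e: "e > 0" using e0 by (simp add: e_def)
  obtain \<delta>1 where \<delta>1: "\<delta>1 > 0" "\<And>x. 0 \<le> x \<Longrightarrow> x < \<delta>1 \<Longrightarrow> U x \<le> U 0 + (pbar + e) * x"
    using up[of "pbar + e"] e unfolding upslopes_def by auto
  define m0 where "m0 = min (min \<delta>0 \<delta>1) (\<kappa> / (\<bar>pbar - 2 * e\<bar> + 1))"
  have m0: "m0 > 0" "m0 \<le> \<delta>0" "m0 \<le> \<delta>1" "m0 \<le> \<kappa> / (\<bar>pbar - 2 * e\<bar> + 1)" using s \<delta>1 by (auto simp: m0_def)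
  define \<delta> where "\<delta> = m0 / 2"
  have "\<delta> < m0" using m0 by (simp add: \<delta>_def)
  then have \<delta>: "\<delta> > 0" "\<delta> < \<delta>0" "\<delta> < \<delta>1" "\<delta> < \<kappa> / (\<bar>pbar - 2 * e\<bar> + 1)"
    using m0 by (linarith | simp add: \<delta>_def)+
  have pk: "- \<kappa> < (pbar - 2 * e) * x" if "0 < x" "x < \<delta>" for x
  proof -
    have "x < \<kappa> / (\<bar>pbar - 2 * e\<bar> + 1)" using that \<delta>(4) by simp
    then have "(\<bar>pbar - 2 * e\<bar> + 1) * x < \<kappa>" by (simp add: pos_less_divide_eq mult.commute)
    moreover have "- (\<bar>pbar - 2 * e\<bar> * x) \<le> (pbar - 2 * e) * x" using that by (metis abs_ge_minus_self abs_mult abs_of_pos minus_le_iff)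
    ultimately show ?thesis using that by (simp add: algebra_simps)
  qed
  \<comment> \<open>Makes the chord of the parabola from 0 to \<delta> have slope
    \<open>pbar + 2 * e\<close>, beyond the upslope \<open>pbar + e\<close>.\<close>
  define K where "K = 4 * e / \<delta>"
  have K: "K > 0" using e \<delta> by (simp add: K_def)
  have "pbar - e \<notin> upslopes U" using dn e by simp
  then obtain xe where xe: "0 < xe" "xe < \<delta> / 4" "U 0 + (pbar - e) * xe < U xe"
    using not_upslopesD[of "pbar - e" U "\<delta>/4"] \<delta> by auto
  define f where "f = (\<lambda>x. U x + (- U 0 - (pbar - 2 * e) * x - K * x\<^sup>2))"
  have "usc_on {0..\<delta>} f" unfolding f_def
    by (intro usc_on_add usc_on_compose[OF usc continuous_on_id] usc_on_continuous continuous_intros) auto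
  then obtain z where z: "z \<in> {0..\<delta>}" "\<And>y. y \<in> {0..\<delta>} \<Longrightarrow> f y \<le> f z"
    using usc_on_attains_sup[of "{0..\<delta>}" f] \<delta> by auto
  have "K * xe < e" using xe e \<delta> by (simp add: K_def field_simps)
  then have "K * xe * xe < e * xe" using xe by simp
  moreover have "f xe = (U xe - (U 0 + (pbar - e) * xe)) + (e * xe - K * xe * xe)"
    by (simp add: f_def power2_eq_square algebra_simps)
  ultimately have "0 < f xe" using xe(3) by linarith
  then have fz: "0 < f z" using z(2)[of xe] xe \<delta> by auto
  have "f \<delta> \<le> (pbar + e) * \<delta> - (pbar - 2 * e) * \<delta> - K * \<delta>\<^sup>2"
    using \<delta>1(2)[of \<delta>] \<delta> by (simp add: f_def)
  also have "\<dots> < 0" using \<delta> e by (simp add: K_def power2_eq_square field_simps)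
  finally have "z \<noteq> \<delta>" using fz by auto
  moreover have "z \<noteq> 0" using fz by (auto simp: f_def)
  ultimately have zi: "0 < z" "z < \<delta>" using z by auto
  define p where "p = pbar - 2 * e + 2 * K * z"
  have "touch1 U z p K"
    unfolding touch1_def
  proof (intro exI[of _ "min z (\<delta> - z)"] conjI allI impI)
    fix y assume "\<bar>y - z\<bar> < min z (\<delta> - z)"
    then have "y \<in> {0..\<delta>}" by auto
    then have "f y \<le> f z" by (rule z(2))
    then show "U y \<le> U z + p * (y - z) + K * (y - z)\<^sup>2"
      unfolding f_def p_def by (simp add: algebra_simps power2_eq_square)
  qed (use zi in auto)
  moreover have "U 0 - \<kappa> < U z"
  proof -
    have "0 \<le> K * z\<^sup>2" using K by simp
    then show ?thesis using fz pk[OF zi] by (simp add: f_def)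
  qed
  ultimately have "H p \<le> B" using s(3)[of z p K] zi \<delta> by auto
  moreover have "\<bar>p - pbar\<bar> < e0"
  proof -
    have "K * z < 4 * e" using zi e \<delta> by (simp add: K_def field_simps)
    moreover have "0 < K * z" using K zi by simp
    moreover have "p - pbar = 2 * (K * z) - 2 * e" by (simp add: p_def)
    ultimately show ?thesis using e by (simp add: e_def abs_less_iff)
  qed
  ultimately show False using e0(2)[of p] \<open>\<not> H pbar \<le> B\<close> by auto
qed

lemma coerciveD: "coercive h \<Longrightarrow> \<exists>R>0. \<forall>p. R \<le> \<bar>p\<bar> \<longrightarrow> M \<le> h p"
proof -
  assume "coercive h"
  then obtain b where "\<forall>x. b \<le> norm x \<longrightarrow> M \<le> h x"
    unfolding coercive_def filterlim_at_top eventually_at_infinity by blast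
  then show ?thesis by (intro exI[of _ "max b 1"]) auto
qed

lemma upslopes_Inf:
  assumes "upslopes U \<noteq> {}" "upslopes U \<noteq> UNIV"
  obtains pbar where "\<And>p. pbar < p \<Longrightarrow> p \<in> upslopes U" "\<And>p. p < pbar \<Longrightarrow> p \<notin> upslopes U"
proof -
  obtain b where b: "b \<notin> upslopes U" using assms(2) by auto
  then have lb: "b \<le> p" if "p \<in> upslopes U" for p using upslopes_mono[OF that] by (meson linear)
  then have bdd: "bdd_below (upslopes U)" by (rule bdd_belowI)
  show thesis
  proof (rule that[of "Inf (upslopes U)"])
    fix p assume "Inf (upslopes U) < p"
    then obtain q where "q \<in> upslopes U" "q < p" using cInf_lessD[OF assms(1)] by blast
    then show "p \<in> upslopes U" using upslopes_mono by (meson less_imp_le)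
  next
    fix p assume "p < Inf (upslopes U)"
    then show "p \<notin> upslopes U" using cInf_lower[OF _ bdd] by (meson not_le)
  qed
qed

text \<open>\<open>H\<close> is at most \<open>B1\<close> at the critical slope of \<open>U\<close>
  and at least \<open>B2\<close> at minus the critical slope of \<open>M\<close>. The maximum of
  \<open>U + M\<close> at 0 puts these two slopes in order, so \<open>H\<close> takes the mean of
  \<open>B1\<close> and \<open>B2\<close> strictly between them, where \<open>p\<close> is an
  upslope of \<open>U\<close> and \<open>- p\<close> one of \<open>M\<close>. If \<open>M\<close>
  has no finite critical slope, coercivity of \<open>H\<close> supplies the large value.\<close>

lemma common_slope:
  assumes subU: "sub1_near H U 0 B1" and subM: "sub1_near (dual H) M 0 (- B2)" and B: "B1 < B2"
    and uscU: "usc_on {0..} U" and uscM: "usc_on {0..} M"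
    and H: "continuous_on UNIV H" "coercive H"
    and max0: "0 < r" "\<And>x. 0 \<le> x \<Longrightarrow> x < r \<Longrightarrow> U x + M x \<le> U 0 + M 0"
    and neU: "upslopes U \<noteq> {}" and neM: "upslopes M \<noteq> {}" and nuU: "upslopes U \<noteq> UNIV"
  shows "\<exists>p. p \<in> upslopes U \<and> - p \<in> upslopes M \<and> B1 < H p \<and> H p < B2"
proof -
  obtain pbar where pbar: "\<And>p. pbar < p \<Longrightarrow> p \<in> upslopes U" "\<And>p. p < pbar \<Longrightarrow> p \<notin> upslopes U"
    using upslopes_Inf[OF neU nuU] by blast
  have Hp: "H pbar \<le> B1" by (rule sub1_critical_slope[OF subU uscU H(1) pbar])
  define mid where "mid = (B1 + B2) / 2"
  have mid: "B1 < mid" "mid < B2" using B by (auto simp: mid_def)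
  show ?thesis
  proof (cases "upslopes M = UNIV")
    case True
    obtain R where R: "R > 0" "\<And>p. R \<le> \<bar>p\<bar> \<Longrightarrow> mid \<le> H p" using coerciveD[OF H(2)] by blast
    have "\<exists>p\<ge>pbar. p \<le> max pbar R \<and> H p = mid"
      using Hp mid R H(1) by (intro IVT') (auto intro: continuous_on_subset simp: max_def)
    then obtain p where p: "pbar \<le> p" "H p = mid" by auto
    then have "p \<noteq> pbar" using Hp mid by auto
    then show ?thesis using p pbar(1)[of p] True mid by auto
  next
    case False
    obtain pv where pv: "\<And>p. pv < p \<Longrightarrow> p \<in> upslopes M" "\<And>p. p < pv \<Longrightarrow> p \<notin> upslopes M"
      using upslopes_Inf[OF neM False] by blast
    have "continuous_on UNIV (dual H)"
      unfolding dual_def[abs_def] by (intro continuous_intros continuous_on_compose2[OF H(1)]) auto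
    then have "dual H pv \<le> - B2" by (rule sub1_critical_slope[OF subM uscM _ pv])
    then have Hq: "B2 \<le> H (- pv)" by (simp add: dual_def)
    \<comment> \<open>Otherwise some \<open>p\<close> just above \<open>- pv\<close> satisfies
      \<open>B1 < H p\<close> without being an upslope of \<open>U\<close>. By
      \<open>sub1_intermediate_slope\<close>, \<open>U\<close> then stays above the line of slope
      \<open>p\<close>, and the maximum of \<open>U + M\<close> makes \<open>- p\<close> an upslope
      of \<open>M\<close> below the infimum \<open>pv\<close>.\<close>
    have le: "pbar \<le> - pv"
    proof (rule ccontr)
      assume "\<not> pbar \<le> - pv"
      obtain e where e: "e > 0" "\<And>p. \<bar>p - (- pv)\<bar> < e \<Longrightarrow> \<bar>H p - H (- pv)\<bar> < B2 - B1"
        using H(1) B unfolding continuous_on_iff dist_real_def by (metis UNIV_I diff_gt_0_iff_gt)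
      define p where "p = - pv + min (e / 2) ((pbar + pv) / 2)"
      have p: "- pv < p" "p < pbar" "\<bar>p - (- pv)\<bar> < e"
        using e(1) \<open>\<not> pbar \<le> - pv\<close> by (auto simp: p_def min_def)
      have "B1 < H p" using e(2)[OF p(3)] Hq by auto
      then obtain \<delta> where \<delta>: "\<delta> > 0" "\<And>x. 0 < x \<Longrightarrow> x < \<delta> \<Longrightarrow> U 0 + p * x \<le> U x"
        using sub1_intermediate_slope[OF subU uscU pbar(2)[OF p(2)]] by (metis not_le)
      have "- p \<in> upslopes M" unfolding upslopes_def
      proof (intro CollectI exI[of _ "min \<delta> r"] conjI allI impI)
        fix x assume "0 \<le> x \<and> x < min \<delta> r"
        then show "M x \<le> M 0 + - p * x" using \<delta>(2)[of x] max0(2)[of x] by (cases "x = 0") auto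
      qed (use \<delta> max0 in auto)
      then show False using pv(2)[of "- p"] p by auto
    qed
    have "\<exists>p\<ge>pbar. p \<le> - pv \<and> H p = mid"
      using Hp mid Hq le H(1) by (intro IVT') (auto intro: continuous_on_subset)
    then obtain p where p: "pbar \<le> p" "p \<le> - pv" "H p = mid" by auto
    have "p \<noteq> pbar" "p \<noteq> - pv" using p Hp Hq mid by auto
    then show ?thesis using p pbar(1)[of p] pv(1)[of "- p"] mid by (intro exI[of _ p]) auto
  qed
qed

text \<open>Away from the junction the space variable is doubled in the classical way. The term
  \<open>(fst z - x0)\<^sup>2\<close> makes the maximum strict, so that a subsequence of the doubled
  maximum points converges to \<open>(x0, x0)\<close>.\<close>

lemma interior_max_contradiction:
  assumes subU: "sub1_near H U x0 B1" and subM: "sub1_near (dual H) M x0 (- B2)" and B: "B1 < B2"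
    and uscU: "usc_on {0..} U" and uscM: "usc_on {0..} M"
    and H: "\<And>p q. \<bar>H p - H q\<bar> \<le> L * \<bar>p - q\<bar>" and L: "0 < L"
    and x0: "0 < r" "r < x0" and mx: "\<And>x. \<bar>x - x0\<bar> \<le> r \<Longrightarrow> U x + M x \<le> U x0 + M x0"
  shows False
proof -
  define a b where "a = x0 - r" and "b = x0 + r"
  have ab: "0 < a" "a < x0" "x0 < b" using x0 by (auto simp: a_def b_def)
  let ?Q = "{a..b} \<times> {a..b}"
  define \<Phi> where "\<Phi> = (\<lambda>n::nat. \<lambda>z::real\<times>real. (U (fst z) + M (snd z)) + (- (real n * (fst z - snd z)\<^sup>2) - (fst z - x0)\<^sup>2))"
  have uscUM: "usc_on ?Q (\<lambda>z. U (fst z) + M (snd z))"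
    using ab by (intro usc_on_add usc_on_compose[OF uscU continuous_on_fst[OF continuous_on_id]] usc_on_compose[OF uscM continuous_on_snd[OF continuous_on_id]]) auto
  have usc: "usc_on ?Q (\<Phi> n)" for n unfolding \<Phi>_def
    by (intro usc_on_add[OF uscUM] usc_on_continuous continuous_intros)
  have cQ: "compact ?Q" by (intro compact_Times) auto
  have neQ: "?Q \<noteq> {}" using ab by auto
  have "\<forall>n. \<exists>z\<in>?Q. \<forall>y\<in>?Q. \<Phi> n y \<le> \<Phi> n z" using usc_on_attains_sup[OF cQ neQ usc] by blast
  then obtain Z where Z: "\<And>n. Z n \<in> ?Q" "\<And>n y. y \<in> ?Q \<Longrightarrow> \<Phi> n y \<le> \<Phi> n (Z n)" by metis
  obtain zB where zB: "\<And>z. z \<in> ?Q \<Longrightarrow> U (fst z) + M (snd z) \<le> U (fst zB) + M (snd zB)"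
    using usc_on_attains_sup[OF cQ neQ uscUM] by blast
  define m where "m = U x0 + M x0"
  have Zm: "m \<le> \<Phi> n (Z n)" for n using Z(2)[of "(x0, x0)" n] ab by (simp add: \<Phi>_def m_def)
  define Bd where "Bd = U (fst zB) + M (snd zB) - m"
  have pen: "real n * (fst (Z n) - snd (Z n))\<^sup>2 \<le> Bd" for n
  proof -
    have "0 \<le> (fst (Z n) - x0)\<^sup>2" by simp
    then show ?thesis using Zm[of n] zB[OF Z(1)[of n]] unfolding \<Phi>_def Bd_def by linarith
  qed
  obtain l s where l: "l \<in> ?Q" "strict_mono s" "(Z \<circ> s) \<longlonglongrightarrow> l"
    using cQ Z(1) unfolding compact_def by blast
  have lf: "(\<lambda>k. fst (Z (s k))) \<longlonglongrightarrow> fst l" "(\<lambda>k. snd (Z (s k))) \<longlonglongrightarrow> snd l"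
    using tendsto_fst[OF l(3)] tendsto_snd[OF l(3)] by (auto simp: o_def)
  have "fst l = snd l"
  proof -
    have "(\<lambda>k. (fst (Z (s k)) - snd (Z (s k)))\<^sup>2) \<longlonglongrightarrow> (fst l - snd l)\<^sup>2"
      by (intro tendsto_intros lf)
    moreover have "(\<lambda>k. (fst (Z (s k)) - snd (Z (s k)))\<^sup>2) \<longlonglongrightarrow> 0"
    proof (rule tendsto_sandwich[OF _ _ tendsto_const])
      show "(\<lambda>k. Bd / real (s k)) \<longlonglongrightarrow> 0"
        using LIMSEQ_subseq_LIMSEQ[OF lim_const_over_n l(2)] by (simp add: o_def)
      show "\<forall>\<^sub>F k in sequentially. (fst (Z (s k)) - snd (Z (s k)))\<^sup>2 \<le> Bd / real (s k)"
      proof (rule eventually_sequentiallyI[of 1])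
        fix k :: nat assume "1 \<le> k"
        then have "0 < s k" using seq_suble[OF l(2), of k] by simp
        then show "(fst (Z (s k)) - snd (Z (s k)))\<^sup>2 \<le> Bd / real (s k)"
          using pen[of "s k"] by (simp add: pos_le_divide_eq mult.commute)
      qed
    qed simp
    ultimately have "(fst l - snd l)\<^sup>2 = 0" by (rule LIMSEQ_unique)
    then show ?thesis by simp
  qed
  have "m \<le> U (fst l) + M (snd l) + (- (fst l - x0)\<^sup>2)"
  proof (rule usc_on_limit_ge[where S = ?Q and f = "\<lambda>z. U (fst z) + M (snd z) + (- (fst z - x0)\<^sup>2)" and x = "Z \<circ> s" and l = l])
    show "usc_on ?Q (\<lambda>z. U (fst z) + M (snd z) + (- (fst z - x0)\<^sup>2))"
      by (intro usc_on_add[OF uscUM] usc_on_continuous continuous_intros)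
    fix k
    have "0 \<le> real (s k) * (fst (Z (s k)) - snd (Z (s k)))\<^sup>2" by simp
    then show "m \<le> U (fst ((Z \<circ> s) k)) + M (snd ((Z \<circ> s) k)) + (- (fst ((Z \<circ> s) k) - x0)\<^sup>2)"
      using Zm[of "s k"] unfolding \<Phi>_def comp_def by linarith
  qed (use l Z in auto)
  moreover have "U (snd l) + M (snd l) \<le> m"
    unfolding m_def using l(1) by (intro mx) (auto simp: mem_Times_iff a_def b_def)
  ultimately have "(snd l - x0)\<^sup>2 \<le> 0" unfolding \<open>fst l = snd l\<close> by linarith
  then have lx: "fst l = x0" "snd l = x0" using \<open>fst l = snd l\<close> by auto
  obtain \<delta>1 \<kappa>1 where s1: "\<delta>1 > 0" "\<kappa>1 > 0"
    "\<And>x p C. \<bar>x - x0\<bar> < \<delta>1 \<Longrightarrow> 0 < x \<Longrightarrow> U x0 - \<kappa>1 < U x \<Longrightarrow> touch1 U x p C \<Longrightarrow> H p \<le> B1"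
    using subU unfolding sub1_near_def by blast
  obtain \<delta>2 \<kappa>2 where s2: "\<delta>2 > 0" "\<kappa>2 > 0"
    "\<And>x p C. \<bar>x - x0\<bar> < \<delta>2 \<Longrightarrow> 0 < x \<Longrightarrow> M x0 - \<kappa>2 < M x \<Longrightarrow> touch1 M x p C \<Longrightarrow> dual H p \<le> - B2"
    using subM unfolding sub1_near_def by blast
  have x0S: "x0 \<in> {0..}" using x0 by auto
  \<comment> \<open>Since \<open>m \<le> U x + M y\<close>, an upper bound on one summand is a lower
    bound on the other. The value condition for \<open>M\<close> thus follows from semicontinuity of
    \<open>U\<close>, and conversely, which explains the exchanged constants.\<close>
  obtain d1 where d1: "d1 > 0" "\<And>y. y \<ge> 0 \<Longrightarrow> \<bar>y - x0\<bar> < d1 \<Longrightarrow> U y < U x0 + \<kappa>2"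
    using usc_onD[OF uscU x0S s2(2)] by (auto simp: dist_real_def)
  obtain d2 where d2: "d2 > 0" "\<And>y. y \<ge> 0 \<Longrightarrow> \<bar>y - x0\<bar> < d2 \<Longrightarrow> M y < M x0 + \<kappa>1"
    using usc_onD[OF uscM x0S s1(2)] by (auto simp: dist_real_def)
  \<comment> \<open>The two test slopes differ by \<open>2 * (x - x0)\<close>; the last term keeps
    the resulting change of \<open>H\<close> below \<open>(B2 - B1) / 2\<close>.\<close>
  define \<rho> where "\<rho> = min (min (min \<delta>1 \<delta>2) (min d1 d2)) (min r ((B2 - B1) / (4 * L)))"
  have \<rho>: "\<rho> > 0" using s1 s2 d1 d2 x0 B L by (simp add: \<rho>_def)
  have "\<forall>\<^sub>F k in sequentially. \<bar>fst (Z (s k)) - x0\<bar> < \<rho> \<and> \<bar>snd (Z (s k)) - x0\<bar> < \<rho>"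
    using tendstoD[OF lf(1) \<rho>] tendstoD[OF lf(2) \<rho>] by eventually_elim (simp add: dist_real_def lx)
  then obtain k where k: "\<bar>fst (Z (s k)) - x0\<bar> < \<rho>" "\<bar>snd (Z (s k)) - x0\<bar> < \<rho>"
    by (auto simp: eventually_sequentially)
  define n where "n = s k"
  define x y where "x = fst (Z n)" and "y = snd (Z n)"
  have xy: "\<bar>x - x0\<bar> < \<rho>" "\<bar>y - x0\<bar> < \<rho>" using k by (auto simp: x_def y_def n_def)
  have xyr: "\<bar>x - x0\<bar> < r" "\<bar>y - x0\<bar> < r" using xy by (auto simp: \<rho>_def)
  have xypos: "0 < x" "0 < y" using xyr x0 by auto
  have mx2: "U x' + M y' - real n * (x' - y')\<^sup>2 - (x' - x0)\<^sup>2 \<le> U x + M y - real n * (x - y)\<^sup>2 - (x - x0)\<^sup>2"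
    if "\<bar>x' - x0\<bar> \<le> r" "\<bar>y' - x0\<bar> \<le> r" for x' y'
  proof -
    have "(x', y') \<in> ?Q" using that by (auto simp: a_def b_def)
    then show ?thesis using Z(2)[of "(x', y')" n] unfolding \<Phi>_def x_def y_def fst_conv snd_conv by linarith
  qed
  have mle: "m \<le> U x + M y"
  proof -
    have "0 \<le> real n * (x - y)\<^sup>2" "0 \<le> (x - x0)\<^sup>2" by simp_all
    then show ?thesis using Zm[of n] unfolding \<Phi>_def x_def y_def by linarith
  qed
  define P where "P = 2 * real n * (x - y)"
  have "touch1 U x (P + 2 * (x - x0)) (real n + 1)"
    unfolding touch1_def
  proof (intro exI[of _ "r - \<bar>x - x0\<bar>"] conjI allI impI)
    fix x' assume "\<bar>x' - x\<bar> < r - \<bar>x - x0\<bar>"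
    then have "\<bar>x' - x0\<bar> \<le> r" by auto
    then have "U x' + M y - real n * (x' - y)\<^sup>2 - (x' - x0)\<^sup>2 \<le> U x + M y - real n * (x - y)\<^sup>2 - (x - x0)\<^sup>2"
      using xyr by (intro mx2) auto
    then show "U x' \<le> U x + (P + 2 * (x - x0)) * (x' - x) + (real n + 1) * (x' - x)\<^sup>2"
      unfolding P_def by (simp add: power2_eq_square algebra_simps)
  qed (use xyr in auto)
  then have 1: "H (P + 2 * (x - x0)) \<le> B1"
    using s1(3)[of x] xy xypos mle d2(2)[of y] by (auto simp: \<rho>_def m_def)
  have "touch1 M y (- P) (real n)"
    unfolding touch1_def
  proof (intro exI[of _ "r - \<bar>y - x0\<bar>"] conjI allI impI)
    fix y' assume "\<bar>y' - y\<bar> < r - \<bar>y - x0\<bar>"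
    then have "\<bar>y' - x0\<bar> \<le> r" by auto
    then have "U x + M y' - real n * (x - y')\<^sup>2 - (x - x0)\<^sup>2 \<le> U x + M y - real n * (x - y)\<^sup>2 - (x - x0)\<^sup>2"
      using xyr by (intro mx2) auto
    then show "M y' \<le> M y + - P * (y' - y) + real n * (y' - y)\<^sup>2"
      unfolding P_def by (simp add: power2_eq_square algebra_simps)
  qed (use xyr in auto)
  then have "dual H (- P) \<le> - B2"
    using s2(3)[of y] xy xypos mle d1(2)[of x] by (auto simp: \<rho>_def m_def)
  then have 2: "B2 \<le> H P" by (simp add: dual_def)
  have "\<bar>H (P + 2 * (x - x0)) - H P\<bar> \<le> L * \<bar>2 * (x - x0)\<bar>" using H[of "P + 2 * (x - x0)" P] by simp
  also have "\<dots> < L * (2 * ((B2 - B1) / (4 * L)))"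
  proof (rule mult_strict_left_mono[OF _ L])
    have "\<bar>x - x0\<bar> < (B2 - B1) / (4 * L)" using xy(1) by (simp add: \<rho>_def)
    then show "\<bar>2 * (x - x0)\<bar> < 2 * ((B2 - B1) / (4 * L))"
      unfolding abs_mult abs_numeral by (rule mult_strict_left_mono) simp
  qed
  also have "\<dots> = (B2 - B1) / 2" using L by simp
  finally show False using 1 2 B by auto
qed

section \<open>Reduction to one space dimension\<close>

text \<open>Only quadratic polynomials serve as test functions. This asks less than testing with all
  C1 functions and is enough for the comparison argument.\<close>

definition isub :: "real \<Rightarrow> (real \<Rightarrow> real) \<Rightarrow> (real \<Rightarrow> real \<Rightarrow> real) \<Rightarrow> bool" where
  "isub T H w \<longleftrightarrow> (\<forall>t0 x0 a p C. 0 < t0 \<and> t0 < T \<and> 0 < x0 \<and>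
     (\<exists>d>0. \<forall>t x. \<bar>t - t0\<bar> < d \<and> \<bar>x - x0\<bar> < d \<longrightarrow>
        w t x \<le> w t0 x0 + a * (t - t0) + p * (x - x0) + C * ((t - t0)\<^sup>2 + (x - x0)\<^sup>2)) \<longrightarrow> a + H p \<le> 0)"

definition jsub :: "real \<Rightarrow> ('n::finite \<Rightarrow> real \<Rightarrow> real) \<Rightarrow> (real^'n \<Rightarrow> real) \<Rightarrow> ('n \<Rightarrow> real \<Rightarrow> real \<Rightarrow> real) \<Rightarrow> bool" where
  "jsub T H F w \<longleftrightarrow> (\<forall>t0 a p C. 0 < t0 \<and> t0 < T \<and>
     (\<forall>\<alpha>. \<exists>d>0. \<forall>t x. \<bar>t - t0\<bar> < d \<and> 0 \<le> x \<and> x < d \<longrightarrow>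
        w \<alpha> t x \<le> w \<alpha> t0 0 + a * (t - t0) + p $ \<alpha> * x + C * ((t - t0)\<^sup>2 + x\<^sup>2)) \<longrightarrow>
     a + F p \<le> 0 \<or> (\<exists>\<alpha>. a + H \<alpha> (p $ \<alpha>) \<le> 0))"

abbreviation strip :: "real \<Rightarrow> (real \<times> real) set" where "strip T \<equiv> {0..<T} \<times> {0..}"

definition tmax :: "(real \<Rightarrow> real \<Rightarrow> real) \<Rightarrow> real \<Rightarrow> real \<Rightarrow> real \<Rightarrow> real \<Rightarrow> real \<Rightarrow> real" where
  "tmax w tb \<rho> a k x = Sup ((\<lambda>t. w t x + (- a * (t - tb) - 2 * k * (t - tb)\<^sup>2)) ` {tb-\<rho>..tb+\<rho>})"

text \<open>Maximizing over a time window removes the time variable. Of the penalty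
  \<open>2 * k * (t - tb)\<^sup>2\<close>, half is kept in reserve by \<open>strict_max\<close>, so
  that at \<open>xb\<close> the time \<open>tb\<close> is the strict maximizer and the ends of the
  window are worse by a fixed amount.\<close>

locale time_reduction =
  fixes T :: real and w :: "real \<Rightarrow> real \<Rightarrow> real" and tb \<rho> a k xb :: real
  assumes usc: "usc_on (strip T) (\<lambda>(t, x). w t x)"
    and tb: "0 < tb - \<rho>" "tb + \<rho> < T" and pos: "0 < \<rho>" "0 < k" "0 \<le> xb"
    and strict_max: "\<And>t. \<bar>t - tb\<bar> \<le> \<rho> \<Longrightarrow>
      w t xb + (- a * (t - tb) - 2 * k * (t - tb)\<^sup>2) \<le> w tb xb - k * (t - tb)\<^sup>2"
begin

abbreviation "I \<equiv> {tb-\<rho>..tb+\<rho>}"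
abbreviation "U \<equiv> tmax w tb \<rho> a k"

definition wt :: "real \<Rightarrow> real \<Rightarrow> real" where "wt t x = w t x + (- a * (t - tb) - 2 * k * (t - tb)\<^sup>2)"

lemma usc_wt: "usc_on (strip T) (\<lambda>z. wt (fst z) (snd z))"
proof -
  have "usc_on (strip T) (\<lambda>z. w (fst z) (snd z))" using usc by (simp add: case_prod_unfold)
  then show ?thesis unfolding wt_def by (intro usc_on_add usc_on_continuous[of _ "\<lambda>z. _ z - _ z"] continuous_intros)
qed

lemma attained: "0 \<le> x \<Longrightarrow> \<exists>t\<in>I. U x = wt t x \<and> (\<forall>t'\<in>I. wt t' x \<le> wt t x)"
proof -
  assume x: "0 \<le> x"
  have "usc_on I (\<lambda>t. wt (fst (t, x)) (snd (t, x)))"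
    by (rule usc_on_compose[OF usc_wt]) (use x tb in \<open>auto intro!: continuous_intros\<close>)
  then have "\<exists>z\<in>I. \<forall>y\<in>I. wt y x \<le> wt z x"
    using usc_on_attains_sup[of I "\<lambda>t. wt t x"] pos by auto
  then obtain t where t: "t \<in> I" "\<And>t'. t' \<in> I \<Longrightarrow> wt t' x \<le> wt t x" by blast
  then have "U x = wt t x"
    unfolding tmax_def wt_def[symmetric] by (intro cSup_eq_maximum) auto
  then show ?thesis using t by blast
qed

lemma upper: "0 \<le> x \<Longrightarrow> t \<in> I \<Longrightarrow> wt t x \<le> U x"
  using attained by fastforce

lemma at_xb: "U xb = w tb xb"
proof -
  obtain t where t: "t \<in> I" "U xb = wt t xb" using attained pos by blast
  have "0 \<le> k * (t - tb)\<^sup>2" using pos by simp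
  moreover have "\<bar>t - tb\<bar> \<le> \<rho>" using t by auto
  ultimately have "U xb \<le> w tb xb" using strict_max[of t] t(2) by (simp add: wt_def)
  moreover have "w tb xb \<le> U xb" using upper[of xb tb] pos by (simp add: wt_def)
  ultimately show ?thesis by simp
qed

lemma usc_U: "usc_on {0..} U"
  unfolding usc_on_def
proof (intro ballI allI impI, rule ccontr)
  fix x e assume x: "x \<in> {0..}" and e: "0 < (e::real)"
    and c: "\<nexists>d. 0 < d \<and> (\<forall>y\<in>{0..}. dist y x < d \<longrightarrow> U y < U x + e)"
  have "\<forall>n. \<exists>y\<ge>0. dist y x < 1 / real (Suc n) \<and> U x + e \<le> U y"
  proof
    fix n :: nat
    have "0 < 1 / real (Suc n)" by simp
    then show "\<exists>y\<ge>0. dist y x < 1 / real (Suc n) \<and> U x + e \<le> U y" using c by (force simp: not_less)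
  qed
  then obtain y where y: "\<And>n. y n \<ge> 0" "\<And>n. dist (y n) x < 1 / real (Suc n)" "\<And>n. U x + e \<le> U (y n)" by metis
  have yl: "y \<longlonglongrightarrow> x"
  proof (rule metric_LIMSEQ_I)
    fix e :: real assume "0 < e"
    then obtain N where N: "1 / real (Suc N) < e" using nat_approx_posE by blast
    have "dist (y n) x < e" if "N \<le> n" for n
    proof -
      have "1 / real (Suc n) \<le> 1 / real (Suc N)" using that by (intro divide_left_mono) auto
      then show ?thesis using y(2)[of n] N by linarith
    qed
    then show "\<exists>N. \<forall>n\<ge>N. dist (y n) x < e" by blast
  qed
  have "\<forall>n. \<exists>t\<in>I. U (y n) = wt t (y n)" using attained y(1) by blast
  then obtain t where t: "\<And>n. t n \<in> I" "\<And>n. U (y n) = wt (t n) (y n)" by metis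
  obtain l s where l: "l \<in> I" "strict_mono s" "(t \<circ> s) \<longlonglongrightarrow> l"
    using compact_Icc[of "tb - \<rho>" "tb + \<rho>"] t(1) unfolding compact_def by blast
  have "U x + e \<le> wt (fst (l, x)) (snd (l, x))"
  proof (rule usc_on_limit_ge[OF usc_wt, where x = "\<lambda>n. (t (s n), y (s n))" and l = "(l, x)"])
    show "(\<lambda>n. (t (s n), y (s n))) \<longlonglongrightarrow> (l, x)"
      using l(3) LIMSEQ_subseq_LIMSEQ[OF yl l(2)] by (intro tendsto_Pair) (auto simp: o_def)
    show "(t (s n), y (s n)) \<in> strip T" for n using t(1)[of "s n"] y(1) tb by auto
    show "U x + e \<le> wt (fst (t (s n), y (s n))) (snd (t (s n), y (s n)))" for n
      using y(3)[of "s n"] t(2)[of "s n"] by simp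
  qed (use l x tb in auto)
  then show False using upper[of x l] l x e by simp
qed

text \<open>At an interior maximizing time \<open>t\<close> the test function has time slope
  \<open>a + 4 * k * (t - tb)\<close>, which differs from \<open>a\<close> by at most
  \<open>4 * k * \<rho>\<close>. At \<open>xb\<close> both ends of the window lie at least
  \<open>k * \<rho>\<^sup>2\<close> below \<open>U xb\<close>. By semicontinuity they stay below
  \<open>U xb - k * \<rho>\<^sup>2 / 2\<close> nearby, so no end can be maximal where
  \<open>U\<close> exceeds this value; this is the constant of \<open>sub1_near\<close>.\<close>

lemma sub1:
  assumes sub: "isub T H w"
  shows "sub1_near H U xb (- a + 4 * k * \<rho>)"
proof -
  have end_lt: "\<exists>d>0. \<forall>x\<ge>0. \<bar>x - xb\<bar> < d \<longrightarrow> wt t x < U xb - k * \<rho>\<^sup>2 / 2" if t: "t = tb - \<rho> \<or> t = tb + \<rho>" for t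
  proof -
    have "\<bar>t - tb\<bar> = \<rho>" using t pos by auto
    then have "wt t xb \<le> U xb - k * \<rho>\<^sup>2" using strict_max[of t] at_xb by (auto simp: wt_def)
    moreover have k: "0 < k * \<rho>\<^sup>2" using pos by simp
    moreover have "(t, xb) \<in> strip T" using t tb pos by auto
    ultimately obtain d where d: "d > 0" "\<And>z. z \<in> strip T \<Longrightarrow> dist z (t, xb) < d \<Longrightarrow> wt (fst z) (snd z) < wt t xb + k * \<rho>\<^sup>2 / 2"
      using usc_onD[OF usc_wt, of "(t, xb)" "k * \<rho>\<^sup>2 / 2"] by auto
    show ?thesis
    proof (intro exI[of _ d] conjI allI impI)
      fix x assume x: "0 \<le> x" "\<bar>x - xb\<bar> < d"
      have "wt t x < wt t xb + k * \<rho>\<^sup>2 / 2"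
        using d(2)[of "(t, x)"] x t tb pos by (auto simp: dist_prod_def dist_real_def)
      then show "wt t x < U xb - k * \<rho>\<^sup>2 / 2" using \<open>wt t xb \<le> U xb - k * \<rho>\<^sup>2\<close> by simp
    qed (use d in auto)
  qed
  obtain d1 where d1: "d1 > 0" "\<And>x. x\<ge>0 \<Longrightarrow> \<bar>x - xb\<bar> < d1 \<Longrightarrow> wt (tb - \<rho>) x < U xb - k * \<rho>\<^sup>2 / 2"
    using end_lt[of "tb - \<rho>"] by blast
  obtain d2 where d2: "d2 > 0" "\<And>x. x\<ge>0 \<Longrightarrow> \<bar>x - xb\<bar> < d2 \<Longrightarrow> wt (tb + \<rho>) x < U xb - k * \<rho>\<^sup>2 / 2"
    using end_lt[of "tb + \<rho>"] by blast
  show ?thesis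
    unfolding sub1_near_def
  proof (rule exI[of _ "min d1 d2"], rule conjI, use d1 d2 in simp, rule exI[of _ "k * \<rho>\<^sup>2 / 2"], intro conjI allI impI)
    show "0 < k * \<rho>\<^sup>2 / 2" using pos by auto
    fix x p C
    assume A: "\<bar>x - xb\<bar> < min d1 d2 \<and> 0 < x \<and> U xb - k * \<rho>\<^sup>2 / 2 < U x \<and> touch1 U x p C"
    then have x: "\<bar>x - xb\<bar> < d1" "\<bar>x - xb\<bar> < d2" "0 < x" "U xb - k * \<rho>\<^sup>2 / 2 < U x" by auto
    obtain d where d: "d > 0" "\<And>y. \<bar>y - x\<bar> < d \<Longrightarrow> U y \<le> U x + p * (y - x) + C * (y - x)\<^sup>2"
      using A unfolding touch1_def by blast
    obtain t where t: "t \<in> I" "U x = wt t x" using attained[of x] x by auto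
    have "t \<noteq> tb - \<rho>" "t \<noteq> tb + \<rho>" using d1(2)[of x] d2(2)[of x] x t by auto
    then have ti: "tb - \<rho> < t" "t < tb + \<rho>" using t by auto
    define a' where "a' = a + 4 * k * (t - tb)"
    define C' where "C' = max (2 * k) C"
    define dd where "dd = min (min d x) (min (t - (tb - \<rho>)) (tb + \<rho> - t))"
    have "a' + H p \<le> 0"
    proof (rule sub[unfolded isub_def, rule_format], intro conjI)
      show "\<exists>d>0. \<forall>s y. \<bar>s - t\<bar> < d \<and> \<bar>y - x\<bar> < d \<longrightarrow>
        w s y \<le> w t x + a' * (s - t) + p * (y - x) + C' * ((s - t)\<^sup>2 + (y - x)\<^sup>2)"
      proof (intro exI[of _ dd] conjI allI impI)
        show "0 < dd" using d ti x by (simp add: dd_def)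
        fix s y assume sy: "\<bar>s - t\<bar> < dd \<and> \<bar>y - x\<bar> < dd"
        then have "0 \<le> y" "s \<in> I" "\<bar>y - x\<bar> < d" by (auto simp: dd_def)
        then have "wt s y \<le> U x + p * (y - x) + C * (y - x)\<^sup>2" using upper[of y s] d(2)[of y] by simp
        moreover have "C * (y - x)\<^sup>2 \<le> C' * (y - x)\<^sup>2" by (rule mult_right_mono) (auto simp: C'_def)
        moreover have "2 * k * (s - t)\<^sup>2 \<le> C' * (s - t)\<^sup>2" by (rule mult_right_mono) (auto simp: C'_def)
        moreover have "w s y = wt s y + a * (s - tb) + 2 * k * (s - tb)\<^sup>2" by (simp add: wt_def)
        moreover have "U x = w t x - a * (t - tb) - 2 * k * (t - tb)\<^sup>2" using t by (simp add: wt_def)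
        moreover have "a * (s - tb) + 2 * k * (s - tb)\<^sup>2 - a * (t - tb) - 2 * k * (t - tb)\<^sup>2 = a' * (s - t) + 2 * k * (s - t)\<^sup>2"
          by (simp add: a'_def power2_eq_square algebra_simps)
        moreover have "C' * ((s - t)\<^sup>2 + (y - x)\<^sup>2) = C' * (s - t)\<^sup>2 + C' * (y - x)\<^sup>2" by (rule distrib_left)
        ultimately show "w s y \<le> w t x + a' * (s - t) + p * (y - x) + C' * ((s - t)\<^sup>2 + (y - x)\<^sup>2)"
          by linarith
      qed
    qed (use ti tb x in auto)
    moreover have "k * (tb - t) \<le> k * \<rho>" using pos ti by (intro mult_left_mono) auto
    ultimately show "H p \<le> - a + 4 * k * \<rho>" by (simp add: a'_def algebra_simps)
  qed
qed

lemma tmax_diff_le: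
  assumes xy: "0 \<le> x" "0 \<le> y" and le: "\<And>t. 0 \<le> t \<Longrightarrow> t < T \<Longrightarrow> w t x \<le> w t y + c"
  shows "U x \<le> U y + c"
proof -
  obtain t where t: "t \<in> I" "U x = wt t x" using attained xy by blast
  have "wt t x \<le> wt t y + c" using le[of t] t tb by (auto simp: wt_def)
  then show ?thesis using t upper[of y t] xy by simp
qed

text \<open>Leads back from one to two variables: any choice of one upslope per branch is an
  admissible gradient for testing \<open>jsub\<close>.\<close>

lemma junction_touch:
  assumes xb: "xb = 0" and p: "p \<in> upslopes U"
  shows "\<exists>d>0. \<forall>t x. \<bar>t - tb\<bar> < d \<and> 0 \<le> x \<and> x < d \<longrightarrow>
    w t x \<le> w tb 0 + a * (t - tb) + p * x + (2 * k) * ((t - tb)\<^sup>2 + x\<^sup>2)"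
proof -
  obtain \<delta> where \<delta>: "\<delta> > 0" "\<And>x. 0 \<le> x \<Longrightarrow> x < \<delta> \<Longrightarrow> U x \<le> U 0 + p * x"
    using p unfolding upslopes_def by blast
  show ?thesis
  proof (intro exI[of _ "min \<rho> \<delta>"] conjI allI impI)
    fix t x assume tx: "\<bar>t - tb\<bar> < min \<rho> \<delta> \<and> 0 \<le> x \<and> x < min \<rho> \<delta>"
    then have "t \<in> I" by auto
    then have "wt t x \<le> w tb 0 + p * x" using upper[of x t] \<delta>(2)[of x] tx at_xb xb by auto
    moreover have "0 \<le> 2 * k * x\<^sup>2" using pos by simp
    moreover have "(2 * k) * ((t - tb)\<^sup>2 + x\<^sup>2) = 2 * k * (t - tb)\<^sup>2 + 2 * k * x\<^sup>2" by (rule distrib_left)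
    ultimately show "w t x \<le> w tb 0 + a * (t - tb) + p * x + (2 * k) * ((t - tb)\<^sup>2 + x\<^sup>2)"
      unfolding wt_def by linarith
  qed (use \<delta> pos in auto)
qed

end

text \<open>The function \<open>m\<close> stands for the negative of a supersolution, so that both functions are upper
  semicontinuous subsolutions and the comparison principle reads \<open>w + m \<le> 0\<close>.\<close>
locale junction_pair =
  fixes T L :: real and H :: "'n::finite \<Rightarrow> real \<Rightarrow> real" and F :: "real^'n \<Rightarrow> real"
    and w m :: "'n \<Rightarrow> real \<Rightarrow> real \<Rightarrow> real"
  assumes usc_w: "\<And>\<alpha>. usc_on (strip T) (\<lambda>(t, x). w \<alpha> t x)"
    and usc_m: "\<And>\<alpha>. usc_on (strip T) (\<lambda>(t, x). m \<alpha> t x)"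
    and w0: "\<And>\<alpha> \<beta> t. 0 \<le> t \<Longrightarrow> t < T \<Longrightarrow> w \<alpha> t 0 = w \<beta> t 0"
    and m0: "\<And>\<alpha> \<beta> t. 0 \<le> t \<Longrightarrow> t < T \<Longrightarrow> m \<alpha> t 0 = m \<beta> t 0"
    and H_lip: "\<And>\<alpha> p q. \<bar>H \<alpha> p - H \<alpha> q\<bar> \<le> L * \<bar>p - q\<bar>" and L: "0 < L"
    and H_coercive: "\<And>\<alpha>. coercive (H \<alpha>)"
    and F_coercive: "\<And>M. \<exists>R. \<forall>p. (\<Sum>\<beta>\<in>UNIV. max (- p $ \<beta>) 0) \<ge> R \<longrightarrow> F p \<ge> M"
    and m_isub: "\<And>\<alpha>. isub T (dual (H \<alpha>)) (m \<alpha>)"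
    and m_jsub: "jsub T (\<lambda>\<alpha>. dual (H \<alpha>)) (\<lambda>p. - F (- p)) m"
begin

lemma H_cont: "continuous_on UNIV (H \<alpha>)"
proof -
  have "L-lipschitz_on UNIV (H \<alpha>)" using H_lip L by (intro lipschitz_onI) (auto simp: dist_real_def)
  then show ?thesis by (rule lipschitz_on_continuous_on)
qed

lemma local_contradiction:
  assumes w_isub: "\<And>\<alpha>. isub T (\<lambda>p. H \<alpha> p + \<eta>) (w \<alpha>)"
    and w_jsub: "jsub T (\<lambda>\<alpha> p. H \<alpha> p + \<eta>) (\<lambda>p. F p + \<eta>) w"
    and \<eta>: "0 < \<eta>" and k: "0 < k"
    and pt: "0 < tb" "tb < T" "0 < sb" "sb < T" "0 \<le> xb" and r: "0 < r"
    and mx: "\<And>\<alpha> t s x. \<bar>t - tb\<bar> < r \<Longrightarrow> \<bar>s - sb\<bar> < r \<Longrightarrow> 0 \<le> x \<Longrightarrow> \<bar>x - xb\<bar> < r \<Longrightarrow> \<alpha> = \<alpha>0 \<or> xb = 0 \<Longrightarrow>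
      w \<alpha> t x + m \<alpha> s x - k * (t - s)\<^sup>2 \<le> w \<alpha> tb xb + m \<alpha> sb xb - k * (tb - sb)\<^sup>2"
    and lip: "(\<forall>\<alpha> t x. 0 \<le> t \<longrightarrow> t < T \<longrightarrow> 0 \<le> x \<longrightarrow> x < r0 \<longrightarrow> \<bar>w \<alpha> t x - w \<alpha> t 0\<bar> \<le> C * x) \<or>
              (\<forall>\<alpha> t x. 0 \<le> t \<longrightarrow> t < T \<longrightarrow> 0 \<le> x \<longrightarrow> x < r0 \<longrightarrow> \<bar>m \<alpha> t x - m \<alpha> t 0\<bar> \<le> C * x)"
    and r0: "0 < r0"
  shows False
proof -
  define a where "a = 2 * k * (tb - sb)"
  \<comment> \<open>The time reductions are used with \<open>2 * k\<close>, so each costs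
    \<open>8 * k * \<rho>\<close>. The bound \<open>\<eta> / (32 * k)\<close> keeps the total below
    \<eta>, which gives \<open>B1 < B2\<close>.\<close>
  define \<rho> where "\<rho> = min (min (r / 2) (\<eta> / (32 * k))) (min (min tb sb) (min (T - tb) (T - sb)) / 2)"
  have \<rho>: "0 < \<rho>" "\<rho> < r" "\<rho> < tb" "\<rho> < sb" "\<rho> < T - tb" "\<rho> < T - sb" "\<rho> \<le> \<eta> / (32 * k)"
    using r \<eta> k pt by (auto simp: \<rho>_def min_def)
  have k\<rho>: "16 * k * \<rho> < \<eta>" using \<rho>(7) k \<eta> by (simp add: field_simps)
  define P where "P \<alpha> \<longleftrightarrow> \<alpha> = \<alpha>0 \<or> xb = 0" for \<alpha>
  let ?U = "\<lambda>\<alpha>. tmax (w \<alpha>) tb \<rho> a (2 * k)" and ?M = "\<lambda>\<alpha>. tmax (m \<alpha>) sb \<rho> (- a) (2 * k)"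
  have TU: "time_reduction T (w \<alpha>) tb \<rho> a (2 * k) xb" if "P \<alpha>" for \<alpha>
  proof
    fix t assume t: "\<bar>t - tb\<bar> \<le> \<rho>"
    have "w \<alpha> t xb + m \<alpha> sb xb - k * (t - sb)\<^sup>2 \<le> w \<alpha> tb xb + m \<alpha> sb xb - k * (tb - sb)\<^sup>2"
      using t that r \<rho> pt by (intro mx) (auto simp: P_def)
    moreover have "k * (t - sb)\<^sup>2 - k * (tb - sb)\<^sup>2 = a * (t - tb) + k * (t - tb)\<^sup>2"
      by (simp add: a_def power2_eq_square algebra_simps)
    moreover have "0 \<le> k * (t - tb)\<^sup>2" using k by simp
    ultimately show "w \<alpha> t xb + (- a * (t - tb) - 2 * (2 * k) * (t - tb)\<^sup>2) \<le> w \<alpha> tb xb - 2 * k * (t - tb)\<^sup>2"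
      by simp
  qed (use usc_w \<rho> pt k in auto)
  have TM: "time_reduction T (m \<alpha>) sb \<rho> (- a) (2 * k) xb" if "P \<alpha>" for \<alpha>
  proof
    fix s assume s: "\<bar>s - sb\<bar> \<le> \<rho>"
    have "w \<alpha> tb xb + m \<alpha> s xb - k * (tb - s)\<^sup>2 \<le> w \<alpha> tb xb + m \<alpha> sb xb - k * (tb - sb)\<^sup>2"
      using s that r \<rho> pt by (intro mx) (auto simp: P_def)
    moreover have "k * (tb - s)\<^sup>2 - k * (tb - sb)\<^sup>2 = - a * (s - sb) + k * (s - sb)\<^sup>2"
      by (simp add: a_def power2_eq_square algebra_simps)
    moreover have "0 \<le> k * (s - sb)\<^sup>2" using k by simp
    ultimately show "m \<alpha> s xb + (- (- a) * (s - sb) - 2 * (2 * k) * (s - sb)\<^sup>2) \<le> m \<alpha> sb xb - 2 * k * (s - sb)\<^sup>2"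
      by simp
  qed (use usc_m \<rho> pt k in auto)
  have mxUM: "?U \<alpha> x + ?M \<alpha> x \<le> ?U \<alpha> xb + ?M \<alpha> xb" if P\<alpha>: "P \<alpha>" and x: "0 \<le> x" "\<bar>x - xb\<bar> < r" for \<alpha> x
  proof -
    interpret U: time_reduction T "w \<alpha>" tb \<rho> a "2 * k" xb by (rule TU[OF P\<alpha>])
    interpret M: time_reduction T "m \<alpha>" sb \<rho> "- a" "2 * k" xb by (rule TM[OF P\<alpha>])
    obtain t where t: "t \<in> U.I" "?U \<alpha> x = U.wt t x" using U.attained[OF x(1)] by blast
    obtain s where s: "s \<in> M.I" "?M \<alpha> x = M.wt s x" using M.attained[OF x(1)] by blast
    have "w \<alpha> t x + m \<alpha> s x - k * (t - s)\<^sup>2 \<le> w \<alpha> tb xb + m \<alpha> sb xb - k * (tb - sb)\<^sup>2"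
      using t s P\<alpha> x \<rho> by (intro mx) (auto simp: P_def)
    \<comment> \<open>Completing the square bounds the coupled penalty by separate terms in
      \<open>t\<close> and in \<open>s\<close>, so the two time maxima can be taken independently of
      each other.\<close>
    moreover have "k * (t - s)\<^sup>2 - k * (tb - sb)\<^sup>2 + k * ((t - tb) + (s - sb))\<^sup>2
        = a * (t - tb) - a * (s - sb) + 2 * k * (t - tb)\<^sup>2 + 2 * k * (s - sb)\<^sup>2"
      by (simp add: a_def power2_eq_square algebra_simps)
    moreover have "0 \<le> k * ((t - tb) + (s - sb))\<^sup>2" "0 \<le> k * (t - tb)\<^sup>2" "0 \<le> k * (s - sb)\<^sup>2" using k by simp_all
    ultimately show ?thesis unfolding t(2) s(2) U.at_xb M.at_xb U.wt_def M.wt_def by simp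
  qed
  define B1 B2 where "B1 = - a + 8 * k * \<rho> - \<eta>" and "B2 = - a - 8 * k * \<rho>"
  have B: "B1 < B2" using k\<rho> unfolding B1_def B2_def by linarith
  have sU: "sub1_near (H \<alpha>) (?U \<alpha>) xb B1" if "P \<alpha>" for \<alpha>
  proof -
    have "sub1_near (\<lambda>p. H \<alpha> p + \<eta>) (?U \<alpha>) xb (- a + 4 * (2 * k) * \<rho>)"
      using time_reduction.sub1[OF TU[OF that] w_isub] by simp
    moreover have "H \<alpha> p \<le> B1" if "H \<alpha> p + \<eta> \<le> - a + 4 * (2 * k) * \<rho>" for p using that by (simp add: B1_def)
    ultimately show ?thesis unfolding sub1_near_def by meson
  qed
  have sM: "sub1_near (dual (H \<alpha>)) (?M \<alpha>) xb (- B2)" if "P \<alpha>" for \<alpha>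
    using time_reduction.sub1[OF TM[OF that] m_isub] by (simp add: B2_def add.commute)
  note uU = time_reduction.usc_U[OF TU] and uM = time_reduction.usc_U[OF TM]
  show False
  proof (cases "xb = 0")
    case False
    have P0: "P \<alpha>0" by (simp add: P_def)
    define r' where "r' = min (r / 2) (xb / 2)"
    show False
    proof (rule interior_max_contradiction[OF sU[OF P0] sM[OF P0] B uU[OF P0] uM[OF P0] H_lip L])
      show "0 < r'" "r' < xb" using r pt False by (auto simp: r'_def min_def)
      fix x assume "\<bar>x - xb\<bar> \<le> r'"
      moreover have "r' \<le> r / 2" "r' \<le> xb / 2" by (auto simp: r'_def)
      ultimately have "0 \<le> x" "\<bar>x - xb\<bar> < r" using r pt by linarith+
      then show "?U \<alpha>0 x + ?M \<alpha>0 x \<le> ?U \<alpha>0 xb + ?M \<alpha>0 xb" by (rule mxUM[OF P0])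
    qed
  next
    case True
    have PA: "P \<alpha>" for \<alpha> using True by (simp add: P_def)
    define r1 where "r1 = min r r0"
    have r1: "0 < r1" using r r0 by (simp add: r1_def)
    have mx0: "?U \<alpha> x + ?M \<alpha> x \<le> ?U \<alpha> 0 + ?M \<alpha> 0" if "0 \<le> x" "x < r1" for \<alpha> x
      using mxUM[OF PA that(1)] that True by (simp add: r1_def)
    \<comment> \<open>Lipschitz continuity of one of the functions suffices: since the sum is
      maximal at 0, a bound on the decrease of one function is a bound on the increase of the
      other.\<close>
    have slopes: "C \<in> upslopes (?U \<alpha>) \<and> C \<in> upslopes (?M \<alpha>)" for \<alpha>
    proof -
      have "?U \<alpha> x \<le> ?U \<alpha> 0 + C * x \<and> ?M \<alpha> x \<le> ?M \<alpha> 0 + C * x" if x: "0 \<le> x" "x < r1" for x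
        using lip
      proof
        assume l: "\<forall>\<alpha> t x. 0 \<le> t \<longrightarrow> t < T \<longrightarrow> 0 \<le> x \<longrightarrow> x < r0 \<longrightarrow> \<bar>w \<alpha> t x - w \<alpha> t 0\<bar> \<le> C * x"
        have "?U \<alpha> x \<le> ?U \<alpha> 0 + C * x" "?U \<alpha> 0 \<le> ?U \<alpha> x + C * x"
          using l[rule_format, of _ x \<alpha>] x
          by (intro time_reduction.tmax_diff_le[OF TU[OF PA]]; force simp: r1_def abs_le_iff)+
        then show ?thesis using mx0[OF x, of \<alpha>] by simp
      next
        assume l: "\<forall>\<alpha> t x. 0 \<le> t \<longrightarrow> t < T \<longrightarrow> 0 \<le> x \<longrightarrow> x < r0 \<longrightarrow> \<bar>m \<alpha> t x - m \<alpha> t 0\<bar> \<le> C * x"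
        have "?M \<alpha> x \<le> ?M \<alpha> 0 + C * x" "?M \<alpha> 0 \<le> ?M \<alpha> x + C * x"
          using l[rule_format, of _ x \<alpha>] x
          by (intro time_reduction.tmax_diff_le[OF TM[OF PA]]; force simp: r1_def abs_le_iff)+
        then show ?thesis using mx0[OF x, of \<alpha>] by simp
      qed
      then show ?thesis unfolding upslopes_def using r1 by blast
    qed
    have jU: "a + (F p + \<eta>) \<le> 0 \<or> (\<exists>\<alpha>. a + (H \<alpha> (p $ \<alpha>) + \<eta>) \<le> 0)" if "\<And>\<alpha>. p $ \<alpha> \<in> upslopes (?U \<alpha>)" for p :: "real^'n"
      using w_jsub[unfolded jsub_def, rule_format, of tb a p "2 * (2 * k)"] pt
        time_reduction.junction_touch[OF TU[OF PA] True that] by blast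
    have jM: "- a + (- F (- p)) \<le> 0 \<or> (\<exists>\<alpha>. - a + dual (H \<alpha>) (p $ \<alpha>) \<le> 0)" if "\<And>\<alpha>. p $ \<alpha> \<in> upslopes (?M \<alpha>)" for p :: "real^'n"
      using m_jsub[unfolded jsub_def, rule_format, of sb "- a" p "2 * (2 * k)"] pt
        time_reduction.junction_touch[OF TM[OF PA] True that] by blast
    \<comment> \<open>If all slopes were admissible on one branch, a very negative slope there and
      large slopes elsewhere would make \<open>F\<close> and every Hamiltonian at least
      \<open>- a\<close>, contradicting the subsolution condition with its gain \<eta>.\<close>
    have nU: "upslopes (?U \<alpha>1) \<noteq> UNIV" for \<alpha>1
    proof
      assume un: "upslopes (?U \<alpha>1) = UNIV"
      have "\<forall>\<alpha>. \<exists>R>0. \<forall>p. R \<le> \<bar>p\<bar> \<longrightarrow> - a \<le> H \<alpha> p" using coerciveD[OF H_coercive] by blast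
      then obtain R where R: "\<And>\<alpha>. R \<alpha> > 0" "\<And>\<alpha> p. R \<alpha> \<le> \<bar>p\<bar> \<Longrightarrow> - a \<le> H \<alpha> p" by metis
      obtain RF where RF: "\<And>p. (\<Sum>\<beta>\<in>UNIV. max (- p $ \<beta>) 0) \<ge> RF \<Longrightarrow> F p \<ge> - a"
        using F_coercive by blast
      define p :: "real^'n" where "p = (\<chi> \<alpha>. if \<alpha> = \<alpha>1 then - max (R \<alpha>) \<bar>RF\<bar> else max (R \<alpha>) C)"
      have "p $ \<alpha> \<in> upslopes (?U \<alpha>)" for \<alpha>
        using un slopes[of \<alpha>] upslopes_mono[of C "?U \<alpha>" "max (R \<alpha>) C"] by (auto simp: p_def)
      moreover have "- a \<le> H \<alpha> (p $ \<alpha>)" for \<alpha> using R(1)[of \<alpha>] by (intro R(2)) (auto simp: p_def)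
      moreover have "- a \<le> F p"
      proof (rule RF)
        have "RF \<le> max (- p $ \<alpha>1) 0" by (auto simp: p_def)
        also have "\<dots> \<le> (\<Sum>\<beta>\<in>UNIV. max (- p $ \<beta>) 0)" by (rule member_le_sum) auto
        finally show "RF \<le> (\<Sum>\<beta>\<in>UNIV. max (- p $ \<beta>) 0)" .
      qed
      ultimately show False using jU[of p] \<eta> by (smt (verit))
    qed
    have "\<forall>\<alpha>. \<exists>p. p \<in> upslopes (?U \<alpha>) \<and> - p \<in> upslopes (?M \<alpha>) \<and> B1 < H \<alpha> p \<and> H \<alpha> p < B2"
    proof
      fix \<alpha>
      show "\<exists>p. p \<in> upslopes (?U \<alpha>) \<and> - p \<in> upslopes (?M \<alpha>) \<and> B1 < H \<alpha> p \<and> H \<alpha> p < B2"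
        using slopes[of \<alpha>] sU[OF PA, of \<alpha>] sM[OF PA, of \<alpha>] unfolding True
        by (intro common_slope[OF _ _ B uU[OF PA] uM[OF PA] H_cont H_coercive r1 mx0 _ _ nU]) auto
    qed
    then obtain q where q: "\<And>\<alpha>. q \<alpha> \<in> upslopes (?U \<alpha>)" "\<And>\<alpha>. - q \<alpha> \<in> upslopes (?M \<alpha>)"
      "\<And>\<alpha>. B1 < H \<alpha> (q \<alpha>)" "\<And>\<alpha>. H \<alpha> (q \<alpha>) < B2" by metis
    define p :: "real^'n" where "p = (\<chi> \<alpha>. q \<alpha>)"
    have k\<rho>0: "0 < k * \<rho>" using k \<rho> by simp
    \<comment> \<open>The bounds \<open>B1 < H \<alpha> (q \<alpha>) < B2\<close> exclude the
      Hamiltonian alternatives in both junction conditions. What remains are two opposite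
      inequalities for \<open>F\<close> at the same vector \<open>p\<close>.\<close>
    have "\<not> a + (H \<alpha> (p $ \<alpha>) + \<eta>) \<le> 0" for \<alpha> using q(3)[of \<alpha>] k\<rho>0 by (simp add: B1_def p_def)
    then have "a + (F p + \<eta>) \<le> 0" using jU[of p] q(1) by (auto simp: p_def)
    moreover have "\<not> - a + dual (H \<alpha>) ((- p) $ \<alpha>) \<le> 0" for \<alpha> using q(4)[of \<alpha>] k\<rho>0 by (simp add: B2_def p_def dual_def)
    then have "- a + (- F (- (- p))) \<le> 0" using jM[of "- p"] q(2) by (auto simp: p_def)
    ultimately show False using \<eta> by simp
  qed
qed

end

section \<open>Comparison principle on the junction\<close>

text \<open>The square makes the penalty C1, with a second-order remainder of at most
  \<open>(z - z0)\<^sup>2\<close>, so that penalized functions can still be tested with quadratic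
  polynomials.\<close>

definition possq :: "real \<Rightarrow> real" where "possq z = (max 0 z)\<^sup>2"

lemma possq_simps [simp]: "0 \<le> possq z" "z \<le> 0 \<Longrightarrow> possq z = 0"
  by (auto simp: possq_def)

lemma possq_mono: "y \<le> z \<Longrightarrow> possq y \<le> possq z"
  unfolding possq_def by (rule power_mono) auto

lemma possq_expand: "possq z \<le> possq z0 + 2 * max 0 z0 * (z - z0) + (z - z0)\<^sup>2"
proof -
  have *: "possq z0 + 2 * max 0 z0 * (z - z0) + (z - z0)\<^sup>2 = (max 0 z0 + (z - z0))\<^sup>2"
    by (simp add: possq_def power2_eq_square algebra_simps)
  have "(max 0 z)\<^sup>2 \<le> (max 0 z0 + (z - z0))\<^sup>2"
  proof (cases "z \<le> 0")
    case False
    then show ?thesis by (intro power_mono) auto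
  qed auto
  then show ?thesis unfolding * unfolding possq_def .
qed

lemma continuous_possq [continuous_intros]: "continuous_on S f \<Longrightarrow> continuous_on S (\<lambda>x. possq (f x))"
  unfolding possq_def by (intro continuous_intros)

text \<open>The three terms make the subsolution strict, confine the maximum to a bounded region,
  and keep it away from the final time.\<close>

definition penalized :: "real \<Rightarrow> real \<Rightarrow> real \<Rightarrow> real \<Rightarrow> real \<Rightarrow> (real \<Rightarrow> real \<Rightarrow> real) \<Rightarrow> real \<Rightarrow> real \<Rightarrow> real" where
  "penalized \<eta> K L R T1 w t x = w t x + (- (\<eta> * t) - K * possq (x + L * t - R) - K * possq (t - T1))"

text \<open>The penalization moves along the cone \<open>x + L t = R\<close>: its time derivative compensates the change of
  \<open>H\<close> caused by its space derivative, since \<open>L\<close> is a Lipschitz constant of \<open>H\<close>.\<close>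
lemma isub_penalized:
  assumes sub: "isub T H w" and H: "\<And>p q. \<bar>H p - H q\<bar> \<le> L * \<bar>p - q\<bar>" and pos: "0 \<le> K" "0 \<le> L"
  shows "isub T (\<lambda>p. H p + \<eta>) (penalized \<eta> K L R T1 w)"
  unfolding isub_def
proof (intro allI impI, elim conjE exE)
  fix t0 x0 a p C d
  assume t0: "0 < t0" "t0 < T" "0 < x0" and d: "0 < (d::real)"
    and touch: "\<forall>t x. \<bar>t - t0\<bar> < d \<and> \<bar>x - x0\<bar> < d \<longrightarrow> penalized \<eta> K L R T1 w t x
      \<le> penalized \<eta> K L R T1 w t0 x0 + a * (t - t0) + p * (x - x0) + C * ((t - t0)\<^sup>2 + (x - x0)\<^sup>2)"
  define Z Y where "Z = max 0 (x0 + L * t0 - R)" and "Y = max 0 (t0 - T1)"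
  have ZY: "0 \<le> Z" "0 \<le> Y" by (auto simp: Z_def Y_def)
  define C' where "C' = C + K * (2 + 2 * L\<^sup>2) + K"
  define a' where "a' = a + \<eta> + 2 * K * Z * L + 2 * K * Y"
  have "a' + H (p + 2 * K * Z) \<le> 0"
  proof (rule sub[unfolded isub_def, rule_format], intro conjI)
    show "\<exists>d>0. \<forall>t x. \<bar>t - t0\<bar> < d \<and> \<bar>x - x0\<bar> < d \<longrightarrow>
      w t x \<le> w t0 x0 + a' * (t - t0) + (p + 2 * K * Z) * (x - x0) + C' * ((t - t0)\<^sup>2 + (x - x0)\<^sup>2)"
    proof (intro exI[of _ d] conjI allI impI d)
      fix t x assume "\<bar>t - t0\<bar> < d \<and> \<bar>x - x0\<bar> < d"
      then have 1: "penalized \<eta> K L R T1 w t x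
        \<le> penalized \<eta> K L R T1 w t0 x0 + a * (t - t0) + p * (x - x0) + C * ((t - t0)\<^sup>2 + (x - x0)\<^sup>2)"
        using touch by blast
      have "possq (x + L * t - R) \<le> possq (x0 + L * t0 - R) + 2 * Z * ((x - x0) + L * (t - t0)) + ((x - x0) + L * (t - t0))\<^sup>2"
        using possq_expand[of "x + L * t - R" "x0 + L * t0 - R"] by (simp add: Z_def algebra_simps)
      also have "((x - x0) + L * (t - t0))\<^sup>2 \<le> 2 * (x - x0)\<^sup>2 + 2 * L\<^sup>2 * (t - t0)\<^sup>2"
        using zero_le_power2[of "(x - x0) - L * (t - t0)"] by (simp add: power2_eq_square algebra_simps)
      also have "\<dots> \<le> (2 + 2 * L\<^sup>2) * ((t - t0)\<^sup>2 + (x - x0)\<^sup>2)" by (simp add: algebra_simps)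
      finally have "K * possq (x + L * t - R) \<le> K * (possq (x0 + L * t0 - R) + 2 * Z * ((x - x0) + L * (t - t0)) + (2 + 2 * L\<^sup>2) * ((t - t0)\<^sup>2 + (x - x0)\<^sup>2))"
        using pos by (intro mult_left_mono) auto
      then have 2: "K * possq (x + L * t - R) \<le> K * possq (x0 + L * t0 - R) + 2 * K * Z * (x - x0) + 2 * K * Z * L * (t - t0) + K * (2 + 2 * L\<^sup>2) * ((t - t0)\<^sup>2 + (x - x0)\<^sup>2)"
        by (simp add: algebra_simps)
      have "possq (t - T1) \<le> possq (t0 - T1) + 2 * Y * (t - t0) + (t - t0)\<^sup>2"
        using possq_expand[of "t - T1" "t0 - T1"] by (simp add: Y_def)
      also have "\<dots> \<le> possq (t0 - T1) + 2 * Y * (t - t0) + ((t - t0)\<^sup>2 + (x - x0)\<^sup>2)" by simp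
      finally have "K * possq (t - T1) \<le> K * (possq (t0 - T1) + 2 * Y * (t - t0) + ((t - t0)\<^sup>2 + (x - x0)\<^sup>2))"
        using pos by (intro mult_left_mono) auto
      then have 3: "K * possq (t - T1) \<le> K * possq (t0 - T1) + 2 * K * Y * (t - t0) + K * ((t - t0)\<^sup>2 + (x - x0)\<^sup>2)"
        by (simp add: algebra_simps)
      have "C' * ((t - t0)\<^sup>2 + (x - x0)\<^sup>2) = C * ((t - t0)\<^sup>2 + (x - x0)\<^sup>2) + K * (2 + 2 * L\<^sup>2) * ((t - t0)\<^sup>2 + (x - x0)\<^sup>2) + K * ((t - t0)\<^sup>2 + (x - x0)\<^sup>2)"
        unfolding C'_def by (simp only: distrib_right)
      moreover have "a' * (t - t0) = a * (t - t0) + \<eta> * t - \<eta> * t0 + 2 * K * Z * L * (t - t0) + 2 * K * Y * (t - t0)"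
        by (simp add: a'_def algebra_simps)
      moreover have "(p + 2 * K * Z) * (x - x0) = p * (x - x0) + 2 * K * Z * (x - x0)" by (rule distrib_right)
      ultimately show "w t x \<le> w t0 x0 + a' * (t - t0) + (p + 2 * K * Z) * (x - x0) + C' * ((t - t0)\<^sup>2 + (x - x0)\<^sup>2)"
        using 1 2 3 unfolding penalized_def by linarith
    qed
  qed (use t0 in auto)
  moreover have "H p \<le> H (p + 2 * K * Z) + L * (2 * K * Z)"
    using H[of p "p + 2 * K * Z"] pos ZY by (simp add: abs_le_iff)
  moreover have "0 \<le> 2 * K * Y" using pos ZY by simp
  moreover have "L * (2 * K * Z) = 2 * K * Z * L" by simp
  ultimately show "a + (H p + \<eta>) \<le> 0" unfolding a'_def by linarith
qed

text \<open>The bound on \<open>R\<close> keeps the cone away from the junction: the space penalty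
  vanishes for \<open>x < 1\<close>, the slopes entering \<open>F\<close> are unchanged, and thus no
  Lipschitz bound on \<open>F\<close> is called for.\<close>

lemma jsub_penalized:
  assumes sub: "jsub T H F w" and pos: "0 \<le> K" "0 \<le> L" and R: "L * T + 1 \<le> R"
  shows "jsub T (\<lambda>\<alpha> p. H \<alpha> p + \<eta>) (\<lambda>p. F p + \<eta>) (\<lambda>\<alpha>. penalized \<eta> K L R T1 (w \<alpha>))"
  unfolding jsub_def
proof (intro allI impI, elim conjE)
  fix t0 a C and p :: "real^'a"
  assume t0: "0 < t0" "t0 < T"
    and touch: "\<forall>\<alpha>. \<exists>d>0. \<forall>t x. \<bar>t - t0\<bar> < d \<and> 0 \<le> x \<and> x < d \<longrightarrow> penalized \<eta> K L R T1 (w \<alpha>) t x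
      \<le> penalized \<eta> K L R T1 (w \<alpha>) t0 0 + a * (t - t0) + p $ \<alpha> * x + C * ((t - t0)\<^sup>2 + x\<^sup>2)"
  define Y where "Y = max 0 (t0 - T1)"
  have Y: "0 \<le> Y" by (auto simp: Y_def)
  define a' where "a' = a + \<eta> + 2 * K * Y"
  have z: "possq (x + L * t - R) = 0" if "x < 1" "t < T" for t x
  proof -
    have "L * t \<le> L * T" using that pos by (intro mult_left_mono) auto
    then show ?thesis using that R by simp
  qed
  have "a' + F p \<le> 0 \<or> (\<exists>\<alpha>. a' + H \<alpha> (p $ \<alpha>) \<le> 0)"
  proof (rule sub[unfolded jsub_def, rule_format], intro conjI allI)
    fix \<alpha>
    obtain d where d: "d > 0" "\<And>t x. \<bar>t - t0\<bar> < d \<and> 0 \<le> x \<and> x < d \<Longrightarrow> penalized \<eta> K L R T1 (w \<alpha>) t x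
      \<le> penalized \<eta> K L R T1 (w \<alpha>) t0 0 + a * (t - t0) + p $ \<alpha> * x + C * ((t - t0)\<^sup>2 + x\<^sup>2)"
      using touch by meson
    show "\<exists>d>0. \<forall>t x. \<bar>t - t0\<bar> < d \<and> 0 \<le> x \<and> x < d \<longrightarrow>
      w \<alpha> t x \<le> w \<alpha> t0 0 + a' * (t - t0) + p $ \<alpha> * x + (C + K) * ((t - t0)\<^sup>2 + x\<^sup>2)"
    proof (intro exI[of _ "min d (min 1 (T - t0))"] conjI allI impI)
      fix t x assume tx: "\<bar>t - t0\<bar> < min d (min 1 (T - t0)) \<and> 0 \<le> x \<and> x < min d (min 1 (T - t0))"
      then have 1: "penalized \<eta> K L R T1 (w \<alpha>) t x
        \<le> penalized \<eta> K L R T1 (w \<alpha>) t0 0 + a * (t - t0) + p $ \<alpha> * x + C * ((t - t0)\<^sup>2 + x\<^sup>2)"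
        by (intro d) auto
      have zz: "possq (x + L * t - R) = 0" "possq (0 + L * t0 - R) = 0" using tx t0 by (auto intro!: z simp del: add_0_left)
      have "possq (t - T1) \<le> possq (t0 - T1) + 2 * Y * (t - t0) + (t - t0)\<^sup>2"
        using possq_expand[of "t - T1" "t0 - T1"] by (simp add: Y_def)
      also have "\<dots> \<le> possq (t0 - T1) + 2 * Y * (t - t0) + ((t - t0)\<^sup>2 + x\<^sup>2)" by simp
      finally have "K * possq (t - T1) \<le> K * (possq (t0 - T1) + 2 * Y * (t - t0) + ((t - t0)\<^sup>2 + x\<^sup>2))"
        using pos by (intro mult_left_mono) auto
      then have 3: "K * possq (t - T1) \<le> K * possq (t0 - T1) + 2 * K * Y * (t - t0) + K * ((t - t0)\<^sup>2 + x\<^sup>2)"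
        by (simp add: algebra_simps)
      have "(C + K) * ((t - t0)\<^sup>2 + x\<^sup>2) = C * ((t - t0)\<^sup>2 + x\<^sup>2) + K * ((t - t0)\<^sup>2 + x\<^sup>2)" by (rule distrib_right)
      moreover have "a' * (t - t0) = a * (t - t0) + \<eta> * t - \<eta> * t0 + 2 * K * Y * (t - t0)"
        by (simp add: a'_def algebra_simps)
      ultimately show "w \<alpha> t x \<le> w \<alpha> t0 0 + a' * (t - t0) + p $ \<alpha> * x + (C + K) * ((t - t0)\<^sup>2 + x\<^sup>2)"
        using 1 3 unfolding penalized_def zz by linarith
    qed (use d t0 in auto)
  qed (use t0 in auto)
  moreover have "0 \<le> 2 * K * Y" using pos Y by simp
  ultimately show "a + (F p + \<eta>) \<le> 0 \<or> (\<exists>\<alpha>. a + (H \<alpha> (p $ \<alpha>) + \<eta>) \<le> 0)"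
    unfolding a'_def by (smt (verit))
qed

context junction_pair begin

text \<open>The doubled maximum evaluates the two functions at different times, so the initial
  inequality must persist for unequal small times. A violating sequence would, by compactness in
  space and upper semicontinuity, violate it at time 0.\<close>

lemma initial_layer:
  assumes init: "\<And>\<alpha> x. 0 \<le> x \<Longrightarrow> w \<alpha> 0 x + m \<alpha> 0 x \<le> 0" and T: "0 < T" and \<sigma>: "0 < \<sigma>"
  shows "\<exists>\<rho>>0. \<forall>\<alpha> t s x. 0 \<le> t \<longrightarrow> t < \<rho> \<longrightarrow> 0 \<le> s \<longrightarrow> s < \<rho> \<longrightarrow> 0 \<le> x \<longrightarrow> x \<le> X \<longrightarrow> w \<alpha> t x + m \<alpha> s x < \<sigma>"
proof -
  let ?D = "({0..<T} \<times> {0..<T}) \<times> {0..}"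
  have one: "\<exists>\<rho>>0. \<forall>t s x. 0 \<le> t \<longrightarrow> t < \<rho> \<longrightarrow> 0 \<le> s \<longrightarrow> s < \<rho> \<longrightarrow> 0 \<le> x \<longrightarrow> x \<le> X \<longrightarrow> w \<alpha> t x + m \<alpha> s x < \<sigma>" for \<alpha>
  proof (rule ccontr)
    assume c: "\<not> ?thesis"
    have "\<forall>n. \<exists>z. 0 \<le> fst (fst z) \<and> fst (fst z) < min T (1 / real (Suc n)) \<and> 0 \<le> snd (fst z) \<and> snd (fst z) < min T (1 / real (Suc n))
      \<and> 0 \<le> snd z \<and> snd z \<le> X \<and> \<sigma> \<le> w \<alpha> (fst (fst z)) (snd z) + m \<alpha> (snd (fst z)) (snd z)"
    proof
      fix n :: nat
      have "0 < min T (1 / real (Suc n))" using T by simp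
      then obtain t s x where "0 \<le> t" "t < min T (1 / real (Suc n))" "0 \<le> s" "s < min T (1 / real (Suc n))" "0 \<le> x" "x \<le> X"
        "\<sigma> \<le> w \<alpha> t x + m \<alpha> s x" using c by (meson not_le)
      then show "\<exists>z. 0 \<le> fst (fst z) \<and> fst (fst z) < min T (1 / real (Suc n)) \<and> 0 \<le> snd (fst z) \<and> snd (fst z) < min T (1 / real (Suc n))
      \<and> 0 \<le> snd z \<and> snd z \<le> X \<and> \<sigma> \<le> w \<alpha> (fst (fst z)) (snd z) + m \<alpha> (snd (fst z)) (snd z)"
        by (intro exI[of _ "((t, s), x)"]) auto
    qed
    from choice[OF this] obtain z where z: "\<And>n. 0 \<le> fst (fst (z n))" "\<And>n. fst (fst (z n)) < min T (1 / real (Suc n))"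
      "\<And>n. 0 \<le> snd (fst (z n))" "\<And>n. snd (fst (z n)) < min T (1 / real (Suc n))" "\<And>n. snd (z n) \<in> {0..X}"
      "\<And>n. \<sigma> \<le> w \<alpha> (fst (fst (z n))) (snd (z n)) + m \<alpha> (snd (fst (z n))) (snd (z n))"
      by auto
    obtain l r where l: "l \<in> {0..X}" "strict_mono r" "((\<lambda>n. snd (z n)) \<circ> r) \<longlonglongrightarrow> l"
      using compact_Icc[of 0 X] z(5) unfolding compact_def by metis
    have inv: "(\<lambda>n. 1 / real (Suc n)) \<longlonglongrightarrow> 0"
      using LIMSEQ_Suc[OF lim_const_over_n[of 1]] by simp
    have "(\<lambda>n. fst (fst (z n))) \<longlonglongrightarrow> 0" "(\<lambda>n. snd (fst (z n))) \<longlonglongrightarrow> 0"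
      using z by (auto intro!: tendsto_sandwich[OF _ _ tendsto_const inv] always_eventually simp: less_imp_le)
    then have l0: "(\<lambda>n. fst (fst (z (r n)))) \<longlonglongrightarrow> 0" "(\<lambda>n. snd (fst (z (r n)))) \<longlonglongrightarrow> 0"
      using LIMSEQ_subseq_LIMSEQ[OF _ l(2)] by (fastforce simp: o_def)+
    let ?f = "\<lambda>z. w \<alpha> (fst (fst z)) (snd z) + m \<alpha> (snd (fst z)) (snd z)"
    have "usc_on ?D (\<lambda>z. (\<lambda>(t, x). w \<alpha> t x) (fst (fst z), snd z) + (\<lambda>(t, x). m \<alpha> t x) (snd (fst z), snd z))"
      by (intro usc_on_add usc_on_compose[OF usc_w] usc_on_compose[OF usc_m] continuous_intros) auto
    then have "usc_on ?D ?f" by simp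
    then have "\<sigma> \<le> ?f ((0, 0), l)"
    proof (rule usc_on_limit_ge[where x = "z \<circ> r"])
      have "(\<lambda>n. ((fst (fst (z (r n))), snd (fst (z (r n)))), snd (z (r n)))) \<longlonglongrightarrow> ((0, 0), l)"
        using l(3) by (intro tendsto_Pair l0) (simp add: o_def)
      then show "(z \<circ> r) \<longlonglongrightarrow> ((0, 0), l)" by (simp add: o_def)
    qed (use z l T in \<open>auto simp: mem_Times_iff\<close>)
    then show False using init[of l \<alpha>] l \<sigma> by simp
  qed
  then obtain \<rho> where \<rho>: "\<And>\<alpha>. \<rho> \<alpha> > 0" "\<And>\<alpha> t s x. 0 \<le> t \<Longrightarrow> t < \<rho> \<alpha> \<Longrightarrow> 0 \<le> s \<Longrightarrow> s < \<rho> \<alpha> \<Longrightarrow> 0 \<le> x \<Longrightarrow> x \<le> X \<Longrightarrow> w \<alpha> t x + m \<alpha> s x < \<sigma>"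
    by metis
  show ?thesis
  proof (intro exI[of _ "Min (range \<rho>)"] conjI allI impI)
    show "0 < Min (range \<rho>)" using \<rho>(1) by (subst Min_gr_iff) auto
    fix \<alpha> t s x assume *: "0 \<le> t" "t < Min (range \<rho>)" "0 \<le> s" "s < Min (range \<rho>)" "0 \<le> x" "x \<le> X"
    have "Min (range \<rho>) \<le> \<rho> \<alpha>" by (rule Min_le) auto
    then show "w \<alpha> t x + m \<alpha> s x < \<sigma>" using * by (intro \<rho>(2)) auto
  qed
qed

lemma bounded_above_on_rectangle:
  assumes v: "\<And>\<alpha>. usc_on (strip T) (\<lambda>(t, x). v \<alpha> t x)" and "T2 < T" "0 \<le> T2" "0 \<le> X"
  shows "\<exists>B\<ge>0. \<forall>\<alpha>::'n. \<forall>t x. 0 \<le> t \<longrightarrow> t \<le> T2 \<longrightarrow> 0 \<le> x \<longrightarrow> x \<le> X \<longrightarrow> v \<alpha> t x \<le> B"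
proof -
  have "\<exists>B. \<forall>t x. 0 \<le> t \<longrightarrow> t \<le> T2 \<longrightarrow> 0 \<le> x \<longrightarrow> x \<le> X \<longrightarrow> v \<alpha> t x \<le> B" for \<alpha>
  proof -
    have "usc_on ({0..T2} \<times> {0..X}) (\<lambda>z. (\<lambda>(t, x). v \<alpha> t x) z)"
      using assms by (intro usc_on_compose[OF v continuous_on_id]) auto
    then obtain z where "\<forall>y\<in>{0..T2} \<times> {0..X}. (\<lambda>(t, x). v \<alpha> t x) y \<le> (\<lambda>(t, x). v \<alpha> t x) z"
      using usc_on_attains_sup[of "{0..T2} \<times> {0..X}" "\<lambda>z. (\<lambda>(t, x). v \<alpha> t x) z"] assms by (auto intro: compact_Times)
    then show ?thesis by (intro exI[of _ "(\<lambda>(t, x). v \<alpha> t x) z"]) auto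
  qed
  then obtain B where B: "\<And>\<alpha> t x. 0 \<le> t \<Longrightarrow> t \<le> T2 \<Longrightarrow> 0 \<le> x \<Longrightarrow> x \<le> X \<Longrightarrow> v \<alpha> t x \<le> B \<alpha>" by metis
  show ?thesis
  proof (intro exI[of _ "\<Sum>\<alpha>\<in>UNIV. \<bar>B \<alpha>\<bar>"] conjI allI impI)
    fix \<alpha> t x assume "0 \<le> t" "t \<le> T2" "0 \<le> x" "x \<le> X"
    then have "v \<alpha> t x \<le> \<bar>B \<alpha>\<bar>" using B[of t x \<alpha>] by simp
    also have "\<dots> \<le> (\<Sum>\<alpha>\<in>UNIV. \<bar>B \<alpha>\<bar>)" by (rule member_le_sum) auto
    finally show "v \<alpha> t x \<le> (\<Sum>\<alpha>\<in>UNIV. \<bar>B \<alpha>\<bar>)" .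
  qed (simp add: sum_nonneg)
qed

theorem comparison:
  assumes w_isub: "\<And>\<alpha>. isub T (H \<alpha>) (w \<alpha>)" and w_jsub: "jsub T H F w"
    and init: "\<And>\<alpha> x. 0 \<le> x \<Longrightarrow> w \<alpha> 0 x + m \<alpha> 0 x \<le> 0"
    and lip: "(\<forall>\<alpha> t x. 0 \<le> t \<longrightarrow> t < T \<longrightarrow> 0 \<le> x \<longrightarrow> \<bar>w \<alpha> t x - w \<alpha> t 0\<bar> \<le> C * x) \<or>
              (\<forall>\<alpha> t x. 0 \<le> t \<longrightarrow> t < T \<longrightarrow> 0 \<le> x \<longrightarrow> \<bar>m \<alpha> t x - m \<alpha> t 0\<bar> \<le> C * x)"
    and t1: "0 \<le> t1" "t1 < T" and x1: "0 \<le> x1"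
  shows "w \<alpha>1 t1 x1 + m \<alpha>1 t1 x1 \<le> 0"
proof (rule ccontr)
  assume neg: "\<not> ?thesis"
  define \<sigma> where "\<sigma> = (w \<alpha>1 t1 x1 + m \<alpha>1 t1 x1) / 2"
  have \<sigma>: "0 < \<sigma>" using neg by (simp add: \<sigma>_def)
  have "0 < T" using t1 by simp
  define T2 T' where "T2 = (t1 + T) / 2" and "T' = (t1 + T2) / 2"
  have T2: "t1 < T'" "T' < T2" "T2 < T" using t1 by (auto simp: T2_def T'_def)
  define R where "R = L * T + 1 + x1"
  have R: "0 \<le> R + 1" using x1 L t1 by (simp add: R_def)
  have T20: "0 \<le> T2" using T2 t1 by simp
  obtain Bw where Bw: "Bw \<ge> 0" "\<And>\<alpha> t x. 0 \<le> t \<Longrightarrow> t \<le> T2 \<Longrightarrow> 0 \<le> x \<Longrightarrow> x \<le> R + 1 \<Longrightarrow> w \<alpha> t x \<le> Bw"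
    using bounded_above_on_rectangle[of w T2 "R + 1", OF usc_w T2(3) T20 R] by auto
  obtain Bm where Bm: "Bm \<ge> 0" "\<And>\<alpha> t x. 0 \<le> t \<Longrightarrow> t \<le> T2 \<Longrightarrow> 0 \<le> x \<Longrightarrow> x \<le> R + 1 \<Longrightarrow> m \<alpha> t x \<le> Bm"
    using bounded_above_on_rectangle[of m T2 "R + 1", OF usc_m T2(3) T20 R] by auto
  define B where "B = Bw + Bm + 1"
  have B: "0 < B" using Bw Bm by (simp add: B_def)
  \<comment> \<open>\<open>B\<close> exceeds \<open>w + m\<close> on the whole region. A penalty of
    at least \<open>B\<close> therefore excludes a positive maximum; \<open>K\<close> makes the
    penalties this large at \<open>x = R + 1\<close> and at time \<open>T'\<close>.\<close>
  define K where "K = B + B / (T' - t1)\<^sup>2"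
  have K: "0 < K" "B \<le> K" "B \<le> K * (T' - t1)\<^sup>2"
  proof -
    have "0 < (T' - t1)\<^sup>2" using T2 by simp
    then show "0 < K" "B \<le> K" "B \<le> K * (T' - t1)\<^sup>2" using B by (auto simp: K_def field_simps add_pos_nonneg)
  qed
  \<comment> \<open>The linear term costs at most \<sigma> at time \<open>t1\<close>, which is half
    of the supposed positive value there.\<close>
  define \<eta> where "\<eta> = \<sigma> / (t1 + 1)"
  have \<eta>: "0 < \<eta>" "\<eta> * t1 \<le> \<sigma>" using \<sigma> t1 by (auto simp: \<eta>_def field_simps)
  let ?w = "\<lambda>\<alpha>. penalized \<eta> K L R t1 (w \<alpha>)"
  interpret P: junction_pair T L H F ?w m
  proof
    fix \<alpha>
    have "usc_on (strip T) (\<lambda>z. (\<lambda>(t, x). w \<alpha> t x) z + (- (\<eta> * fst z) - K * possq (snd z + L * fst z - R) - K * possq (fst z - t1)))"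
      by (intro usc_on_add usc_w usc_on_continuous continuous_intros)
    then show "usc_on (strip T) (\<lambda>(t, x). ?w \<alpha> t x)" by (simp add: penalized_def case_prod_unfold)
  next
    fix \<alpha> \<beta> t assume "0 \<le> t" "t < T"
    then show "?w \<alpha> t 0 = ?w \<beta> t 0" using w0 by (simp add: penalized_def)
  qed (use usc_m m0 H_lip L H_coercive F_coercive m_isub m_jsub in auto)
  obtain \<rho> where \<rho>: "\<rho> > 0" "\<And>\<alpha> t s x. 0 \<le> t \<Longrightarrow> t < \<rho> \<Longrightarrow> 0 \<le> s \<Longrightarrow> s < \<rho> \<Longrightarrow> 0 \<le> x \<Longrightarrow> x \<le> R + 1 \<Longrightarrow> w \<alpha> t x + m \<alpha> s x < \<sigma>"
    using initial_layer[OF init \<open>0 < T\<close> \<sigma>, of "R + 1"] by blast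
  \<comment> \<open>With \<open>k = B / c\<^sup>2\<close> the two times differ by less than
    \<open>c\<close>. If one of them were 0, both would lie in the initial layer; moreover
    \<open>tb < T'\<close> then gives \<open>sb < T2\<close>.\<close>
  define c where "c = min \<rho> (T2 - T')"
  have c: "0 < c" using \<rho> T2 by (simp add: c_def)
  define k where "k = B / c\<^sup>2"
  have k: "0 < k" "k * c\<^sup>2 = B" using B c by (auto simp: k_def)
  define D where "D = ({0..T2} \<times> {0..T2}) \<times> {0..R + 1}"
  have cD: "compact D" unfolding D_def by (intro compact_Times) auto
  have neD: "((t1, t1), x1) \<in> D" using t1 T2 x1 L \<open>0 < T\<close> by (auto simp: D_def R_def)
  define \<Phi> where "\<Phi> = (\<lambda>\<alpha> z. ?w \<alpha> (fst (fst z)) (snd z) + m \<alpha> (snd (fst z)) (snd z) + (- k * (fst (fst z) - snd (fst z))\<^sup>2))"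
  have uscD: "usc_on D (\<Phi> \<alpha>)" for \<alpha>
  proof -
    have "usc_on D (\<lambda>z. (\<lambda>(t, x). ?w \<alpha> t x) (fst (fst z), snd z) + (\<lambda>(t, x). m \<alpha> t x) (snd (fst z), snd z) + (- k * (fst (fst z) - snd (fst z))\<^sup>2))"
      using T2 by (intro usc_on_add usc_on_compose[OF P.usc_w] usc_on_compose[OF usc_m] usc_on_continuous continuous_intros) (auto simp: D_def)
    then show ?thesis by (simp add: \<Phi>_def)
  qed
  have "\<forall>\<alpha>. \<exists>z\<in>D. \<forall>y\<in>D. \<Phi> \<alpha> y \<le> \<Phi> \<alpha> z" using usc_on_attains_sup[OF cD _ uscD] neD by blast
  then obtain Z where Z: "\<And>\<alpha>. Z \<alpha> \<in> D" "\<And>\<alpha> y. y \<in> D \<Longrightarrow> \<Phi> \<alpha> y \<le> \<Phi> \<alpha> (Z \<alpha>)" by metis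
  have "Max (range (\<lambda>\<alpha>. \<Phi> \<alpha> (Z \<alpha>))) \<in> range (\<lambda>\<alpha>. \<Phi> \<alpha> (Z \<alpha>))" by (rule Max_in) auto
  then obtain \<alpha>0 where \<alpha>0: "Max (range (\<lambda>\<alpha>. \<Phi> \<alpha> (Z \<alpha>))) = \<Phi> \<alpha>0 (Z \<alpha>0)" by (rule rangeE)
  obtain tb sb xb where z: "Z \<alpha>0 = ((tb, sb), xb)" by (metis prod.collapse)
  have mx: "\<Phi> \<alpha> y \<le> \<Phi> \<alpha>0 ((tb, sb), xb)" if "y \<in> D" for \<alpha> y
  proof -
    have "\<Phi> \<alpha> y \<le> \<Phi> \<alpha> (Z \<alpha>)" using Z that by blast
    also have "\<dots> \<le> \<Phi> \<alpha>0 (Z \<alpha>0)" unfolding \<alpha>0[symmetric] by (rule Max_ge) auto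
    finally show ?thesis using z by simp
  qed
  have zD: "0 \<le> tb" "tb \<le> T2" "0 \<le> sb" "sb \<le> T2" "0 \<le> xb" "xb \<le> R + 1" using Z(1)[of \<alpha>0] z by (auto simp: D_def)
  have "L * t1 \<le> L * T" using L t1 by (intro mult_left_mono) auto
  then have "?w \<alpha>1 t1 x1 = w \<alpha>1 t1 x1 - \<eta> * t1" by (simp add: penalized_def R_def)
  then have "\<sigma> \<le> \<Phi> \<alpha>1 ((t1, t1), x1)" using \<eta> by (simp add: \<Phi>_def \<sigma>_def)
  also have "\<dots> \<le> \<Phi> \<alpha>0 ((tb, sb), xb)" by (rule mx[OF neD])
  finally have \<sigma>le: "\<sigma> \<le> ?w \<alpha>0 tb xb + m \<alpha>0 sb xb - k * (tb - sb)\<^sup>2" by (simp add: \<Phi>_def)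
  have nn: "0 \<le> k * (tb - sb)\<^sup>2" "0 \<le> K * possq (xb + L * tb - R)" "0 \<le> K * possq (tb - t1)" "0 \<le> \<eta> * tb"
    using k K \<eta> zD by auto
  have ub: "w \<alpha>0 tb xb + m \<alpha>0 sb xb < B" using Bw(2)[of tb xb \<alpha>0] Bm(2)[of sb xb \<alpha>0] zD by (simp add: B_def)
  have tT: "tb < T'"
  proof (rule ccontr)
    assume "\<not> tb < T'"
    then have "possq (T' - t1) \<le> possq (tb - t1)" by (intro possq_mono) auto
    moreover have "possq (T' - t1) = (T' - t1)\<^sup>2" using T2 by (simp add: possq_def)
    ultimately have "K * (T' - t1)\<^sup>2 \<le> K * possq (tb - t1)" using K by (intro mult_left_mono) auto
    then show False using \<sigma>le ub K nn \<sigma> unfolding penalized_def by linarith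
  qed
  have xR: "xb < R + 1"
  proof (rule ccontr)
    assume "\<not> xb < R + 1"
    moreover have "0 \<le> L * tb" using L zD by simp
    ultimately have "possq 1 \<le> possq (xb + L * tb - R)" by (intro possq_mono) auto
    then have "K * 1 \<le> K * possq (xb + L * tb - R)" using K by (intro mult_left_mono) (auto simp: possq_def)
    then show False using \<sigma>le ub K nn \<sigma> unfolding penalized_def by linarith
  qed
  have ts: "\<bar>tb - sb\<bar> < c"
  proof (rule ccontr)
    assume "\<not> \<bar>tb - sb\<bar> < c"
    then have "c\<^sup>2 \<le> (tb - sb)\<^sup>2" using c by (simp add: abs_le_square_iff[symmetric])
    then have "k * c\<^sup>2 \<le> k * (tb - sb)\<^sup>2" using k by (intro mult_left_mono) auto
    then show False using \<sigma>le ub k nn \<sigma> unfolding penalized_def by linarith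
  qed
  have sT: "sb < T2" using ts tT unfolding c_def min_less_iff_conj abs_less_iff by linarith
  have tpos: "0 < tb \<and> 0 < sb"
  proof (rule ccontr)
    assume "\<not> (0 < tb \<and> 0 < sb)"
    then have "w \<alpha>0 tb xb + m \<alpha>0 sb xb < \<sigma>" using ts zD by (intro \<rho>(2)) (auto simp: c_def)
    then show False using \<sigma>le nn unfolding penalized_def by linarith
  qed
  define r where "r = min (min (min tb sb) (min (T2 - tb) (T2 - sb))) (R + 1 - xb)"
  have r: "0 < r" using tpos tT T2 sT xR by (auto simp: r_def)
  show False
  proof (rule P.local_contradiction[where \<eta> = \<eta> and k = k and tb = tb and sb = sb and xb = xb and r = r and ?\<alpha>0.0 = \<alpha>0 and ?r0.0 = 1 and C = C])
    show "isub T (\<lambda>p. H \<alpha> p + \<eta>) (?w \<alpha>)" for \<alpha>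
      using K L by (intro isub_penalized w_isub H_lip) auto
    show "jsub T (\<lambda>\<alpha> p. H \<alpha> p + \<eta>) (\<lambda>p. F p + \<eta>) ?w"
      using K L x1 by (intro jsub_penalized w_jsub) (auto simp: R_def)
    fix \<alpha> t s x assume a: "\<bar>t - tb\<bar> < r" "\<bar>s - sb\<bar> < r" "0 \<le> x" "\<bar>x - xb\<bar> < r" "\<alpha> = \<alpha>0 \<or> xb = 0"
    have "r \<le> tb" "r \<le> sb" "r \<le> T2 - tb" "r \<le> T2 - sb" "r \<le> R + 1 - xb" by (simp_all add: r_def)
    then have "0 \<le> t" "t \<le> T2" "0 \<le> s" "s \<le> T2" "x \<le> R + 1" using a(1,2,4) unfolding abs_less_iff by linarith+
    then have "((t, s), x) \<in> D" using a(3) by (simp add: D_def)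
    then have "\<Phi> \<alpha> ((t, s), x) \<le> \<Phi> \<alpha>0 ((tb, sb), xb)" by (rule mx)
    also have "\<dots> = \<Phi> \<alpha> ((tb, sb), xb)"
      using a(5) P.w0[of tb \<alpha> \<alpha>0] m0[of sb \<alpha> \<alpha>0] zD T2 by (auto simp: \<Phi>_def)
    finally show "?w \<alpha> t x + m \<alpha> s x - k * (t - s)\<^sup>2 \<le> ?w \<alpha> tb xb + m \<alpha> sb xb - k * (tb - sb)\<^sup>2"
      by (simp add: \<Phi>_def)
  next
    have flat: "?w \<alpha> t x - ?w \<alpha> t 0 = w \<alpha> t x - w \<alpha> t 0" if "0 \<le> t" "t < T" "0 \<le> x" "x < 1" for \<alpha> t x
    proof -
      have "L * t \<le> L * T" using L that by (intro mult_left_mono) auto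
      then show ?thesis using that x1 by (simp add: penalized_def R_def)
    qed
    show "(\<forall>\<alpha> t x. 0 \<le> t \<longrightarrow> t < T \<longrightarrow> 0 \<le> x \<longrightarrow> x < 1 \<longrightarrow> \<bar>?w \<alpha> t x - ?w \<alpha> t 0\<bar> \<le> C * x) \<or>
          (\<forall>\<alpha> t x. 0 \<le> t \<longrightarrow> t < T \<longrightarrow> 0 \<le> x \<longrightarrow> x < 1 \<longrightarrow> \<bar>m \<alpha> t x - m \<alpha> t 0\<bar> \<le> C * x)"
      using lip by (simp add: flat) blast
  qed (use \<eta> k tpos tT sT T2 zD r in auto)
qed

end

section \<open>Monotone schemes and truncation\<close>

text \<open>Kept generic in the numerical Hamiltonian and the junction function, so as to cover the
  given scheme, its truncation and the negated truncated scheme.\<close>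

definition upd :: "('n::finite \<Rightarrow> real \<Rightarrow> real \<Rightarrow> real) \<Rightarrow> (real^'n \<Rightarrow> real) \<Rightarrow> real \<Rightarrow> real \<Rightarrow> ('n \<Rightarrow> nat \<Rightarrow> real) \<Rightarrow> 'n \<Rightarrow> nat \<Rightarrow> real" where
  "upd G Fn dt dx V = (\<lambda>\<alpha> i. if i = 0 then V \<alpha> 0 - dt * Fn (\<chi> \<beta>. (V \<beta> 1 - V \<beta> 0) / dx)
     else V \<alpha> i - dt * G \<alpha> ((V \<alpha> i - V \<alpha> (i - 1)) / dx) ((V \<alpha> (i + 1) - V \<alpha> i) / dx))"

definition godunov :: "('n \<Rightarrow> real \<Rightarrow> real) \<Rightarrow> 'n \<Rightarrow> real \<Rightarrow> real \<Rightarrow> real" where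
  "godunov H \<alpha> a b = max (Hplus (H \<alpha>) a) (Hminus (H \<alpha>) b)"

lemma scheme_Suc: "scheme H F u0 dt dx (Suc n) = upd (godunov H) F dt dx (scheme H F u0 dt dx n)"
  unfolding scheme.simps upd_def godunov_def Let_def by (rule refl)

text \<open>Raising the centre value by \<open>h * dx\<close> raises the left slope and lowers the
  right slope by \<open>h\<close>, and lowers all slopes at the junction. The third and the last
  condition bound the resulting growth by \<open>c * h\<close>, which the update absorbs when
  \<open>c * dt \<le> dx\<close>. Increments are used instead of derivatives because the functions
  need not be differentiable.\<close>

definition mono_scheme :: "('n::finite \<Rightarrow> real \<Rightarrow> real \<Rightarrow> real) \<Rightarrow> (real^'n \<Rightarrow> real) \<Rightarrow> real \<Rightarrow> bool" where
  "mono_scheme G Fn c \<longleftrightarrow>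
     (\<forall>\<alpha> a a' b. a \<le> a' \<longrightarrow> G \<alpha> a b \<le> G \<alpha> a' b) \<and>
     (\<forall>\<alpha> a b b'. b \<le> b' \<longrightarrow> G \<alpha> a b' \<le> G \<alpha> a b) \<and>
     (\<forall>\<alpha> a b h. 0 \<le> h \<longrightarrow> G \<alpha> (a + h) (b - h) \<le> G \<alpha> a b + c * h) \<and>
     (\<forall>p q. (\<forall>\<beta>. p $ \<beta> \<le> q $ \<beta>) \<longrightarrow> Fn q \<le> Fn p) \<and>
     (\<forall>p h. 0 \<le> h \<longrightarrow> Fn (p - cvec h) \<le> Fn p + c * h)"

lemma mono_schemeD:
  assumes "mono_scheme G Fn c"
  shows "a \<le> a' \<Longrightarrow> G \<alpha> a b \<le> G \<alpha> a' b" "b \<le> b' \<Longrightarrow> G \<alpha> a b' \<le> G \<alpha> a b"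
    "0 \<le> h \<Longrightarrow> G \<alpha> (a + h) (b - h) \<le> G \<alpha> a b + c * h"
    "(\<And>\<beta>. p $ \<beta> \<le> q $ \<beta>) \<Longrightarrow> Fn q \<le> Fn p" "0 \<le> h \<Longrightarrow> Fn (p - cvec h) \<le> Fn p + c * h"
  using assms unfolding mono_scheme_def by blast+

lemma mono_scheme_dual:
  fixes Fn :: "real^'n::finite \<Rightarrow> real"
  assumes "mono_scheme G Fn c"
  shows "mono_scheme (\<lambda>\<alpha> a b. - G \<alpha> (- a) (- b)) (\<lambda>p. - Fn (- p)) c"
  unfolding mono_scheme_def
proof (intro conjI allI impI)
  fix \<alpha> and a b h :: real assume "0 \<le> h"
  then show "- G \<alpha> (- (a + h)) (- (b - h)) \<le> - G \<alpha> (- a) (- b) + c * h"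
    using mono_schemeD(3)[OF assms, of h \<alpha> "- (a + h)" "- (b - h)"] by simp
next
  fix p :: "real^'n" and h assume "(0::real) \<le> h"
  moreover have "- (p - cvec h) - cvec h = - p" by simp
  ultimately show "- Fn (- (p - cvec h)) \<le> - Fn (- p) + c * h"
    using mono_schemeD(5)[OF assms, of h "- (p - cvec h)"] by simp
qed (use mono_schemeD[OF assms] in auto)

lemma interior_step_mono:
  assumes m: "mono_scheme G Fn c" and dt: "0 < dt" "0 < dx" "c * dt \<le> dx"
    and le: "A \<le> A'" "B \<le> B'" "C \<le> C'"
  shows "B - dt * G \<alpha> ((B - A) / dx) ((C - B) / dx) \<le> B' - dt * G \<alpha> ((B' - A') / dx) ((C' - B') / dx)"
proof -
  define h where "h = (B' - B) / dx"
  have h: "0 \<le> h" "h * dx = B' - B" using le dt by (auto simp: h_def)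
  have "G \<alpha> ((B' - A') / dx) ((C' - B') / dx) \<le> G \<alpha> ((B' - A) / dx) ((C' - B') / dx)"
    using le dt by (intro mono_schemeD(1)[OF m] divide_right_mono) auto
  also have "\<dots> \<le> G \<alpha> ((B' - A) / dx) ((C - B') / dx)"
    using le dt by (intro mono_schemeD(2)[OF m] divide_right_mono) auto
  also have "\<dots> = G \<alpha> ((B - A) / dx + h) ((C - B) / dx - h)"
    by (simp add: h_def diff_divide_distrib)
  also have "\<dots> \<le> G \<alpha> ((B - A) / dx) ((C - B) / dx) + c * h" by (rule mono_schemeD(3)[OF m h(1)])
  finally have "dt * G \<alpha> ((B' - A') / dx) ((C' - B') / dx) \<le> dt * (G \<alpha> ((B - A) / dx) ((C - B) / dx) + c * h)"
    using dt by (intro mult_left_mono) auto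
  moreover have "c * dt * h \<le> dx * h" using dt h by (intro mult_right_mono) auto
  ultimately show ?thesis using h by (simp add: algebra_simps)
qed

lemma junction_step_mono:
  assumes m: "mono_scheme G Fn c" and dt: "0 < dt" "0 < dx" "c * dt \<le> dx"
    and le: "B \<le> B'" "\<And>\<beta>. C \<beta> \<le> C' \<beta>"
  shows "B - dt * Fn (\<chi> \<beta>. (C \<beta> - B) / dx) \<le> B' - dt * Fn (\<chi> \<beta>. (C' \<beta> - B') / dx)"
proof -
  define h where "h = (B' - B) / dx"
  have h: "0 \<le> h" "h * dx = B' - B" using le dt by (auto simp: h_def)
  have "Fn (\<chi> \<beta>. (C' \<beta> - B') / dx) \<le> Fn (\<chi> \<beta>. (C \<beta> - B') / dx)"
    using le dt by (intro mono_schemeD(4)[OF m]) (auto intro!: divide_right_mono)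
  also have "(\<chi> \<beta>. (C \<beta> - B') / dx) = (\<chi> \<beta>. (C \<beta> - B) / dx) - cvec h"
    by (simp add: vec_eq_iff h_def diff_divide_distrib)
  also have "Fn \<dots> \<le> Fn (\<chi> \<beta>. (C \<beta> - B) / dx) + c * h" by (rule mono_schemeD(5)[OF m h(1)])
  finally have "dt * Fn (\<chi> \<beta>. (C' \<beta> - B') / dx) \<le> dt * (Fn (\<chi> \<beta>. (C \<beta> - B) / dx) + c * h)"
    using dt by (intro mult_left_mono) auto
  moreover have "c * dt * h \<le> dx * h" using dt h by (intro mult_right_mono) auto
  ultimately show ?thesis using h by (simp add: algebra_simps)
qed

definition junction_grid :: "('n \<Rightarrow> nat \<Rightarrow> real) \<Rightarrow> bool" where
  "junction_grid V \<longleftrightarrow> (\<forall>\<alpha> \<beta>. V \<alpha> 0 = V \<beta> 0)"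

lemma junction_grid_upd: "junction_grid V \<Longrightarrow> junction_grid (upd G Fn dt dx V)"
  unfolding junction_grid_def upd_def by simp

lemma upd_mono:
  assumes m: "mono_scheme G Fn c" "0 < dt" "0 < dx" "c * dt \<le> dx"
    and V: "junction_grid V" and W: "junction_grid W" and le: "\<And>\<alpha> i. V \<alpha> i \<le> W \<alpha> i"
  shows "upd G Fn dt dx V \<alpha> i \<le> upd G Fn dt dx W \<alpha> i"
proof (cases "i = 0")
  case True
  have V0: "(\<chi> \<beta>. (V \<beta> 1 - V \<beta> 0) / dx) = (\<chi> \<beta>. (V \<beta> 1 - V \<alpha> 0) / dx)"
    using V unfolding junction_grid_def by (metis (no_types, lifting))
  have W0: "(\<chi> \<beta>. (W \<beta> 1 - W \<beta> 0) / dx) = (\<chi> \<beta>. (W \<beta> 1 - W \<alpha> 0) / dx)"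
    using W unfolding junction_grid_def by (metis (no_types, lifting))
  show ?thesis using True unfolding upd_def V0 W0 by (simp add: junction_step_mono[OF m le le])
next
  case False
  then show ?thesis unfolding upd_def by (simp add: interior_step_mono[OF m le le le])
qed

lemma upd_add_const: "upd G Fn dt dx (\<lambda>\<alpha> i. V \<alpha> i + k) = (\<lambda>\<alpha> i. upd G Fn dt dx V \<alpha> i + k)"
  unfolding upd_def by (intro ext) auto

text \<open>A monotone update that commutes with adding constants is nonexpansive in the supremum
  norm: consecutive time levels ordered up to the constant \<open>k\<close> remain so.\<close>

lemma time_increments_iterate:
  assumes m: "mono_scheme G Fn c" "0 < dt" "0 < dx" "c * dt \<le> dx" and V: "junction_grid V"
    and init: "\<And>\<alpha> i. \<bar>upd G Fn dt dx V \<alpha> i - V \<alpha> i\<bar> \<le> k"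
  shows "\<bar>(upd G Fn dt dx ^^ Suc n) V \<alpha> i - (upd G Fn dt dx ^^ n) V \<alpha> i\<bar> \<le> k"
proof (induction n arbitrary: \<alpha> i)
  case 0
  then show ?case using init by simp
next
  case (Suc n)
  let ?U = "upd G Fn dt dx"
  have jg: "junction_grid ((?U ^^ n) V)" for n
    by (induction n) (auto simp: V junction_grid_upd)
  have jk: "junction_grid (\<lambda>\<alpha> i. W \<alpha> i + k)" if "junction_grid W" for W :: "'a \<Rightarrow> nat \<Rightarrow> real" and k
    using that by (simp add: junction_grid_def)
  have "?U ((?U ^^ Suc n) V) \<alpha> i \<le> ?U (\<lambda>\<alpha> i. (?U ^^ n) V \<alpha> i + k) \<alpha> i"
    using Suc.IH jg jk by (intro upd_mono[OF m]) (auto simp: abs_le_iff algebra_simps simp del: funpow.simps)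
  moreover have "?U ((?U ^^ n) V) \<alpha> i \<le> ?U (\<lambda>\<alpha> i. (?U ^^ Suc n) V \<alpha> i + k) \<alpha> i"
    using Suc.IH jg jk by (intro upd_mono[OF m]) (auto simp: abs_le_iff algebra_simps simp del: funpow.simps)
  ultimately show ?case unfolding upd_add_const by (simp add: abs_le_iff)
qed

section \<open>Truncation of the Hamiltonians and of the junction function\<close>

definition quasi_min :: "(real \<Rightarrow> real) \<Rightarrow> bool" where
  "quasi_min h \<longleftrightarrow> antimono_on {..hp0 h} h \<and> mono_on {hp0 h..} h"

lemma Hplus_mono: "quasi_min h \<Longrightarrow> a \<le> b \<Longrightarrow> Hplus h a \<le> Hplus h b"
  unfolding quasi_min_def Hplus_def by (auto intro!: mono_onD[of "{hp0 h..}" h])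

lemma Hminus_antimono: "quasi_min h \<Longrightarrow> a \<le> b \<Longrightarrow> Hminus h b \<le> Hminus h a"
  unfolding quasi_min_def Hminus_def by (auto intro!: monotone_onD[of "{..hp0 h}" "(\<le>)" "(\<ge>)" h])

lemma max_Hplus_Hminus: "quasi_min h \<Longrightarrow> max (Hplus h p) (Hminus h p) = h p"
proof (cases "p \<le> hp0 h")
  case True
  assume q: "quasi_min h"
  then have "h (hp0 h) \<le> h p"
    using True unfolding quasi_min_def by (auto intro!: monotone_onD[of "{..hp0 h}" "(\<le>)" "(\<ge>)" h])
  then show ?thesis using True by (simp add: Hplus_def Hminus_def)
next
  case False
  assume q: "quasi_min h"
  then have "h (hp0 h) \<le> h p"
    using False unfolding quasi_min_def by (auto intro!: mono_onD[of "{hp0 h..}" h])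
  then show ?thesis using False by (simp add: Hplus_def Hminus_def)
qed

lemma clamp_increments:
  fixes a b h l u :: real
  assumes "0 \<le> h"
  shows "max (min (a + h) u) l - max (min a u) l \<le> h" "min (max b u) l - min (max (b - h) u) l \<le> h"
  using assms by (auto simp: max_def min_def)

text \<open>\<open>K\<close> bounds the numerical Hamiltonians and \<open>F\<close> at slopes up to
  the Lipschitz constant \<open>L0\<close> of the initial data, hence the first time increment
  divided by \<open>dt\<close>. The truncation levels lie outside these slopes, at points where
  \<open>H\<close> or \<open>F\<close> already exceeds \<open>K\<close>.\<close>

locale truncation =
  fixes H :: "'n::finite \<Rightarrow> real \<Rightarrow> real" and F :: "real^'n \<Rightarrow> real"
    and L0 K :: real and plo phi p0lo :: "'n \<Rightarrow> real"
  assumes qm: "\<And>\<alpha>. quasi_min (H \<alpha>)" and L0: "0 \<le> L0"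
    and F_antimono: "\<And>p q. (\<And>\<beta>. p $ \<beta> \<le> q $ \<beta>) \<Longrightarrow> F q \<le> F p"
    and G_bound: "\<And>\<alpha> a b. \<bar>a\<bar> \<le> L0 \<Longrightarrow> \<bar>b\<bar> \<le> L0 \<Longrightarrow> \<bar>godunov H \<alpha> a b\<bar> \<le> K"
    and F_bound: "\<And>p. (\<And>\<beta>. \<bar>p $ \<beta>\<bar> \<le> L0) \<Longrightarrow> \<bar>F p\<bar> \<le> K"
    and plo: "\<And>\<alpha>. plo \<alpha> < - L0" "\<And>\<alpha>. plo \<alpha> \<le> hp0 (H \<alpha>)" "\<And>\<alpha>. K < H \<alpha> (plo \<alpha>)"
    and phi: "\<And>\<alpha>. L0 < phi \<alpha>" "\<And>\<alpha>. hp0 (H \<alpha>) \<le> phi \<alpha>" "\<And>\<alpha>. K < H \<alpha> (phi \<alpha>)"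
    and p0lo: "\<And>\<alpha>. p0lo \<alpha> < - L0" "\<And>p \<beta>. p $ \<beta> \<le> p0lo \<beta> \<Longrightarrow> K < F p"
begin

text \<open>One-sided clamps suffice: \<open>Hplus\<close> is constant to the left of
  \<open>hp0\<close> and \<open>Hminus\<close> to the right of it, so \<open>H \<alpha>\<close> is
  evaluated only between \<open>plo \<alpha>\<close> and \<open>phi \<alpha>\<close>.\<close>

definition Gt :: "'n \<Rightarrow> real \<Rightarrow> real \<Rightarrow> real" where
  "Gt \<alpha> a b = max (Hplus (H \<alpha>) (min a (phi \<alpha>))) (Hminus (H \<alpha>) (max b (plo \<alpha>)))"

definition clamp0 :: "real^'n \<Rightarrow> real^'n" where
  "clamp0 p = (\<chi> \<beta>. max (p0lo \<beta>) (min (p $ \<beta>) (phi \<beta>)))"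

definition Ft :: "real^'n \<Rightarrow> real" where "Ft p = F (clamp0 p)"

text \<open>The form in which the CFL condition is used. The box begins at
  \<open>p0lo \<beta> - 1\<close> because clamped vectors are shifted down by up to 1 in
  \<open>Ft_step\<close>; for the same reason the numbers given to the theorem are
  \<open>p0lo \<beta> - 1\<close>.\<close>

definition cfl :: "real \<Rightarrow> bool" where
  "cfl c \<longleftrightarrow> 0 < c \<and> (\<forall>\<alpha> p q. plo \<alpha> \<le> p \<and> p \<le> q \<and> q \<le> phi \<alpha> \<longrightarrow> \<bar>H \<alpha> q - H \<alpha> p\<bar> \<le> c * (q - p)) \<and>
     (\<forall>p h. 0 \<le> h \<longrightarrow> p \<in> vbox (\<lambda>\<beta>. p0lo \<beta> - 1) phi \<longrightarrow> p - cvec h \<in> vbox (\<lambda>\<beta>. p0lo \<beta> - 1) phi \<longrightarrow>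
        F (p - cvec h) - F p \<le> c * h)"

lemma p0lo_less_phi: "p0lo \<beta> < phi \<beta>"
  using p0lo(1)[of \<beta>] phi(1)[of \<beta>] L0 by simp

text \<open>Clamping the shifted vector gives a vector that lies above the shifted clamped one, and
  \<open>F\<close> is decreasing; so it suffices to shift after clamping, inside the enlarged
  box.\<close>

lemma Ft_step:
  assumes c: "cfl c" and h: "0 \<le> h" "h \<le> 1"
  shows "Ft (p - cvec h) \<le> Ft p + c * h"
proof -
  have "Ft (p - cvec h) \<le> F (clamp0 p - cvec h)"
    unfolding Ft_def using h by (intro F_antimono) (auto simp: clamp0_def max_def min_def)
  moreover have "F (clamp0 p - cvec h) - F (clamp0 p) \<le> c * h"
  proof -
    have 1: "p0lo \<beta> \<le> clamp0 p $ \<beta>" "clamp0 p $ \<beta> \<le> phi \<beta>" for \<beta>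
      using p0lo_less_phi[of \<beta>] by (auto simp: clamp0_def)
    have "p0lo \<beta> - 1 \<le> clamp0 p $ \<beta> \<and> clamp0 p $ \<beta> \<le> phi \<beta>" for \<beta> using 1[of \<beta>] by linarith
    then have "clamp0 p \<in> vbox (\<lambda>\<beta>. p0lo \<beta> - 1) phi" by simp
    moreover have "p0lo \<beta> - 1 \<le> clamp0 p $ \<beta> - h \<and> clamp0 p $ \<beta> - h \<le> phi \<beta>" for \<beta> using 1[of \<beta>] h by linarith
    then have "clamp0 p - cvec h \<in> vbox (\<lambda>\<beta>. p0lo \<beta> - 1) phi" by simp
    ultimately show ?thesis using c h unfolding cfl_def by blast
  qed
  ultimately show ?thesis by (simp add: Ft_def)
qed

text \<open>The enlarged box has room for shifts of length at most 1 only, so a longer shift is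
  composed of such steps, with a new clamping after each.\<close>

lemma Ft_diagonal:
  assumes c: "cfl c" and h: "0 \<le> h"
  shows "Ft (p - cvec h) \<le> Ft p + c * h"
proof -
  have "h \<le> real n \<longrightarrow> 0 \<le> h \<longrightarrow> Ft (p - cvec h) \<le> Ft p + c * h" for n h p
  proof (induction n arbitrary: h p)
    case 0
    then show ?case using Ft_step[OF c, of h p] by auto
  next
    case (Suc n)
    show ?case
    proof (cases "h \<le> 1")
      case True
      then show ?thesis using Ft_step[OF c] by blast
    next
      case False
      show ?thesis
      proof (intro impI)
        assume "h \<le> real (Suc n)" "0 \<le> h"
        then have "Ft ((p - cvec 1) - cvec (h - 1)) \<le> Ft (p - cvec 1) + c * (h - 1)"
          using Suc.IH False by auto
        moreover have "(p - cvec 1) - cvec (h - 1) = p - cvec h" by (simp add: vec_eq_iff)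
        moreover have "Ft (p - cvec 1) \<le> Ft p + c * 1" by (rule Ft_step[OF c]) auto
        ultimately show "Ft (p - cvec h) \<le> Ft p + c * h" by (simp add: algebra_simps)
      qed
    qed
  qed
  moreover obtain n where "h \<le> real n" using real_arch_simple by blast
  ultimately show ?thesis using h by blast
qed

lemma mono_scheme_trunc:
  assumes c: "cfl c"
  shows "mono_scheme Gt Ft c"
  unfolding mono_scheme_def
proof (intro conjI allI impI)
  fix \<alpha> and a a' b :: real assume "a \<le> a'"
  then have "Hplus (H \<alpha>) (min a (phi \<alpha>)) \<le> Hplus (H \<alpha>) (min a' (phi \<alpha>))" by (intro Hplus_mono qm) auto
  then show "Gt \<alpha> a b \<le> Gt \<alpha> a' b" unfolding Gt_def by (intro max.mono) auto
next
  fix \<alpha> and a b b' :: real assume "b \<le> b'"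
  then have "Hminus (H \<alpha>) (max b' (plo \<alpha>)) \<le> Hminus (H \<alpha>) (max b (plo \<alpha>))" by (intro Hminus_antimono qm) auto
  then show "Gt \<alpha> a b' \<le> Gt \<alpha> a b" unfolding Gt_def by (intro max.mono) auto
next
  fix \<alpha> and a b h :: real assume h: "0 \<le> h"
  have cpos: "0 < c" and Hc: "\<And>p q. plo \<alpha> \<le> p \<Longrightarrow> p \<le> q \<Longrightarrow> q \<le> phi \<alpha> \<Longrightarrow> \<bar>H \<alpha> q - H \<alpha> p\<bar> \<le> c * (q - p)"
    using c unfolding cfl_def by blast+
  have p0: "plo \<alpha> \<le> hp0 (H \<alpha>)" "hp0 (H \<alpha>) \<le> phi \<alpha>" using plo phi by auto
  have Hd: "\<bar>H \<alpha> q - H \<alpha> p\<bar> \<le> c * h" if "plo \<alpha> \<le> p" "p \<le> q" "q \<le> phi \<alpha>" "q - p \<le> h" for p q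
    using Hc[OF that(1-3)] mult_left_mono[OF that(4), of c] cpos by linarith
  have "\<bar>Hplus (H \<alpha>) (min (a + h) (phi \<alpha>)) - Hplus (H \<alpha>) (min a (phi \<alpha>))\<bar> \<le> c * h"
    unfolding Hplus_def
  proof (rule Hd)
    show "max (min a (phi \<alpha>)) (hp0 (H \<alpha>)) \<le> max (min (a + h) (phi \<alpha>)) (hp0 (H \<alpha>))" using h by (intro max.mono min.mono) auto
    show "max (min (a + h) (phi \<alpha>)) (hp0 (H \<alpha>)) - max (min a (phi \<alpha>)) (hp0 (H \<alpha>)) \<le> h" by (rule clamp_increments(1)[OF h])
    show "plo \<alpha> \<le> max (min a (phi \<alpha>)) (hp0 (H \<alpha>))" using p0 by (intro max.coboundedI2)
    show "max (min (a + h) (phi \<alpha>)) (hp0 (H \<alpha>)) \<le> phi \<alpha>" using p0 by (intro max.boundedI) auto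
  qed
  moreover have "\<bar>Hminus (H \<alpha>) (max b (plo \<alpha>)) - Hminus (H \<alpha>) (max (b - h) (plo \<alpha>))\<bar> \<le> c * h"
    unfolding Hminus_def
  proof (rule Hd)
    show "min (max (b - h) (plo \<alpha>)) (hp0 (H \<alpha>)) \<le> min (max b (plo \<alpha>)) (hp0 (H \<alpha>))" using h by (intro max.mono min.mono) auto
    show "min (max b (plo \<alpha>)) (hp0 (H \<alpha>)) - min (max (b - h) (plo \<alpha>)) (hp0 (H \<alpha>)) \<le> h" by (rule clamp_increments(2)[OF h])
    show "plo \<alpha> \<le> min (max (b - h) (plo \<alpha>)) (hp0 (H \<alpha>))" using p0 by (intro min.boundedI) auto
    show "min (max b (plo \<alpha>)) (hp0 (H \<alpha>)) \<le> phi \<alpha>" using p0 by (intro min.coboundedI2)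
  qed
  ultimately have "Hplus (H \<alpha>) (min (a + h) (phi \<alpha>)) \<le> Hplus (H \<alpha>) (min a (phi \<alpha>)) + c * h"
    "Hminus (H \<alpha>) (max (b - h) (plo \<alpha>)) \<le> Hminus (H \<alpha>) (max b (plo \<alpha>)) + c * h"
    unfolding abs_le_iff by argo+
  then show "Gt \<alpha> (a + h) (b - h) \<le> Gt \<alpha> a b + c * h" unfolding Gt_def max_add_distrib_left by (rule max.mono)
next
  fix p q :: "real^'n" assume "\<forall>\<beta>. p $ \<beta> \<le> q $ \<beta>"
  then show "Ft q \<le> Ft p" unfolding Ft_def
    unfolding clamp0_def by (intro F_antimono) (auto simp del: max.bounded_iff intro!: max.mono min.mono)
next
  fix p h assume "(0::real) \<le> h"
  then show "Ft (p - cvec h) \<le> Ft p + c * h" by (rule Ft_diagonal[OF c])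
qed

text \<open>An active clamp would evaluate \<open>H \<alpha>\<close> at \<open>phi \<alpha>\<close>
  or \<open>plo \<alpha>\<close>, where it exceeds \<open>K\<close>. The bound by \<open>K\<close>
  thus limits the slopes and switches the truncation off at once.\<close>

lemma Gt_le_KD:
  assumes "Gt \<alpha> a b \<le> K"
  shows "a < phi \<alpha>" "plo \<alpha> < b" "Gt \<alpha> a b = godunov H \<alpha> a b"
proof -
  show a: "a < phi \<alpha>"
  proof (rule ccontr)
    assume "\<not> ?thesis"
    then have "Hplus (H \<alpha>) (min a (phi \<alpha>)) = H \<alpha> (phi \<alpha>)" using phi(2)[of \<alpha>] by (simp add: Hplus_def)
    then show False using assms phi(3)[of \<alpha>] by (simp add: Gt_def)
  qed
  show b: "plo \<alpha> < b"
  proof (rule ccontr)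
    assume "\<not> ?thesis"
    then have "Hminus (H \<alpha>) (max b (plo \<alpha>)) = H \<alpha> (plo \<alpha>)" using plo(2)[of \<alpha>] by (simp add: Hminus_def)
    then show False using assms plo(3)[of \<alpha>] by (simp add: Gt_def)
  qed
  show "Gt \<alpha> a b = godunov H \<alpha> a b" using a b by (simp add: Gt_def godunov_def)
qed

lemma Gt_eq_godunov: "a \<le> phi \<alpha> \<Longrightarrow> plo \<alpha> \<le> b \<Longrightarrow> Gt \<alpha> a b = godunov H \<alpha> a b"
  by (simp add: Gt_def godunov_def)

text \<open>Since \<open>F\<close> decreases in every slope, only lower bounds on the junction
  slopes can be gained here.\<close>

lemma Ft_le_KD:
  assumes "Ft p \<le> K"
  shows "p0lo \<beta> < p $ \<beta>"
proof (rule ccontr)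
  assume "\<not> ?thesis"
  then have "clamp0 p $ \<beta> \<le> p0lo \<beta>" by (simp add: clamp0_def)
  then have "K < F (clamp0 p)" by (rule p0lo(2))
  then show False using assms by (simp add: Ft_def)
qed

lemma Ft_eq: "(\<And>\<beta>. p0lo \<beta> \<le> p $ \<beta> \<and> p $ \<beta> \<le> phi \<beta>) \<Longrightarrow> Ft p = F p"
  unfolding Ft_def by (rule arg_cong[of _ _ F]) (simp add: clamp0_def vec_eq_iff)

definition P :: real where "P = (\<Sum>\<alpha>\<in>UNIV. \<bar>plo \<alpha>\<bar> + \<bar>phi \<alpha>\<bar> + \<bar>p0lo \<alpha>\<bar>)"

lemma P_bounds: "\<bar>plo \<alpha>\<bar> \<le> P" "\<bar>phi \<alpha>\<bar> \<le> P" "\<bar>p0lo \<alpha>\<bar> \<le> P"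
proof -
  have "\<bar>plo \<alpha>\<bar> + \<bar>phi \<alpha>\<bar> + \<bar>p0lo \<alpha>\<bar> \<le> P" unfolding P_def by (rule member_le_sum) auto
  then show "\<bar>plo \<alpha>\<bar> \<le> P" "\<bar>phi \<alpha>\<bar> \<le> P" "\<bar>p0lo \<alpha>\<bar> \<le> P" by auto
qed

lemma K_nonneg: "0 \<le> K"
  using F_bound[of 0] L0 by fastforce

lemma P_nonneg: "0 \<le> P" unfolding P_def by (intro sum_nonneg) auto

context
  fixes u0 :: "'n \<times> real \<Rightarrow> real" and dt dx :: real
  assumes u0: "\<And>p q. p \<in> jpts \<Longrightarrow> q \<in> jpts \<Longrightarrow> \<bar>u0 p - u0 q\<bar> \<le> L0 * jd p q"
    and dt: "0 < dt" "0 < dx" and cfl: "cfl (dx / dt)"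
begin

abbreviation "V \<equiv> scheme H F u0 dt dx"
abbreviation "St \<equiv> upd Gt Ft dt dx"

lemma junction_u0: "junction_grid (V 0)"
  unfolding junction_grid_def
proof (intro allI)
  fix \<alpha> \<beta>
  have "\<bar>u0 (\<alpha>, 0) - u0 (\<beta>, 0)\<bar> \<le> L0 * jd (\<alpha>, 0) (\<beta>, 0)" by (rule u0) (auto simp: jpts_def)
  also have "jd (\<alpha>, 0) (\<beta>, 0) = 0" by (simp add: jd_def)
  finally show "V 0 \<alpha> 0 = V 0 \<beta> 0" by simp
qed

lemma u0_slope: "\<bar>(V 0 \<alpha> (Suc i) - V 0 \<alpha> i) / dx\<bar> \<le> L0"
proof -
  have "\<bar>u0 (\<alpha>, real (Suc i) * dx) - u0 (\<alpha>, real i * dx)\<bar> \<le> L0 * jd (\<alpha>, real (Suc i) * dx) (\<alpha>, real i * dx)"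
    using dt by (intro u0) (auto simp: jpts_def)
  also have "jd (\<alpha>, real (Suc i) * dx) (\<alpha>, real i * dx) = dx" using dt by (simp add: jd_def algebra_simps)
  finally show ?thesis using dt by (simp add: pos_divide_le_eq abs_divide)
qed

lemma cfl_dt: "dx / dt * dt \<le> dx" using dt by simp

lemma initial_increment: "\<bar>St (V 0) \<alpha> i - V 0 \<alpha> i\<bar> \<le> K * dt"
proof (cases "i = 0")
  case True
  let ?p = "\<chi> \<beta>. (V 0 \<beta> 1 - V 0 \<beta> 0) / dx"
  have p: "\<bar>?p $ \<beta>\<bar> \<le> L0" for \<beta> using u0_slope[of \<beta> 0] by simp
  have "p0lo \<beta> \<le> ?p $ \<beta> \<and> ?p $ \<beta> \<le> phi \<beta>" for \<beta> using p[of \<beta>] p0lo(1)[of \<beta>] phi(1)[of \<beta>] by linarith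
  then have "Ft ?p = F ?p" by (rule Ft_eq)
  then have "\<bar>Ft ?p\<bar> \<le> K" using F_bound[of ?p] p by metis
  then have "dt * \<bar>Ft ?p\<bar> \<le> dt * K" using dt by (intro mult_left_mono) auto
  then show ?thesis using True dt by (simp add: upd_def abs_mult mult.commute)
next
  case False
  then obtain j where j: "i = Suc j" using not0_implies_Suc by blast
  let ?a = "(V 0 \<alpha> i - V 0 \<alpha> (i - 1)) / dx" and ?b = "(V 0 \<alpha> (i + 1) - V 0 \<alpha> i) / dx"
  have ab: "\<bar>?a\<bar> \<le> L0" "\<bar>?b\<bar> \<le> L0" using u0_slope[of \<alpha> j] u0_slope[of \<alpha> i] unfolding j by simp_all
  have "Gt \<alpha> ?a ?b = godunov H \<alpha> ?a ?b"
    using ab plo(1)[of \<alpha>] phi(1)[of \<alpha>] by (intro Gt_eq_godunov) linarith+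
  then have "\<bar>Gt \<alpha> ?a ?b\<bar> \<le> K" using G_bound[OF ab] by simp
  then have "dt * \<bar>Gt \<alpha> ?a ?b\<bar> \<le> dt * K" using dt by (intro mult_left_mono) auto
  moreover have "St (V 0) \<alpha> i - V 0 \<alpha> i = - (dt * Gt \<alpha> ?a ?b)" using False by (simp add: upd_def)
  ultimately show ?thesis using dt by (simp add: abs_mult mult.commute)
qed

lemma trunc_increments: "\<bar>(St ^^ Suc n) (V 0) \<alpha> i - (St ^^ n) (V 0) \<alpha> i\<bar> \<le> K * dt"
  by (rule time_increments_iterate[OF mono_scheme_trunc[OF cfl] dt cfl_dt junction_u0 initial_increment])

text \<open>The numerical Hamiltonian is minus the time increment divided by \<open>dt\<close>, so
  the lower bound on the increments is an upper bound on it.\<close>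

lemma trunc_G_F_le:
  fixes n
  defines "W \<equiv> (St ^^ n) (V 0)"
  shows "0 < i \<Longrightarrow> Gt \<alpha> ((W \<alpha> i - W \<alpha> (i - 1)) / dx) ((W \<alpha> (i + 1) - W \<alpha> i) / dx) \<le> K"
    "Ft (\<chi> \<beta>. (W \<beta> 1 - W \<beta> 0) / dx) \<le> K"
proof -
  have inc: "\<bar>St W \<alpha> i - W \<alpha> i\<bar> \<le> K * dt" for \<alpha> i using trunc_increments[of n \<alpha> i] by (simp add: W_def)
  show "Gt \<alpha> ((W \<alpha> i - W \<alpha> (i - 1)) / dx) ((W \<alpha> (i + 1) - W \<alpha> i) / dx) \<le> K" (is "?g \<le> K") if "0 < i"
  proof -
    have "St W \<alpha> i - W \<alpha> i = - (dt * ?g)" using that by (simp add: upd_def)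
    then have "dt * ?g \<le> dt * K" using inc[of \<alpha> i] by (simp add: abs_le_iff mult.commute)
    then show ?thesis using dt by simp
  qed
  show "Ft (\<chi> \<beta>. (W \<beta> 1 - W \<beta> 0) / dx) \<le> K" (is "?f \<le> K")
  proof -
    fix \<alpha> :: 'n
    have "St W \<alpha> 0 - W \<alpha> 0 = - (dt * ?f)" by (simp add: upd_def)
    then have "dt * ?f \<le> dt * K" using inc[of \<alpha> 0] by (simp add: abs_le_iff mult.commute)
    then show ?thesis using dt by simp
  qed
qed

lemma scheme_eq_trunc: "V n = (St ^^ n) (V 0)"
proof (induction n)
  case (Suc n)
  let ?W = "(St ^^ n) (V 0)"
  have "upd (godunov H) F dt dx ?W \<alpha> i = St ?W \<alpha> i" for \<alpha> i
  proof (cases "i = 0")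
    case True
    let ?p = "\<chi> \<beta>. (?W \<beta> 1 - ?W \<beta> 0) / dx"
    have "p0lo \<beta> < ?p $ \<beta>" for \<beta> by (rule Ft_le_KD[OF trunc_G_F_le(2)])
    \<comment> \<open>The slope leaving the junction on a branch is also the left slope at the node
      \<open>i = 1\<close>, where the interior update bounds it from above.\<close>
    moreover have "?p $ \<beta> < phi \<beta>" for \<beta> using Gt_le_KD(1)[OF trunc_G_F_le(1)[of 1 \<beta> n]] by simp
    ultimately have "Ft ?p = F ?p" by (intro Ft_eq) (auto simp: less_imp_le)
    then show ?thesis using True by (simp add: upd_def)
  next
    case False
    then show ?thesis using Gt_le_KD(3)[OF trunc_G_F_le(1)[of i \<alpha> n]] by (simp add: upd_def)
  qed
  then show ?case unfolding scheme_Suc Suc.IH by (simp add: fun_eq_iff)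
qed simp

lemma scheme_Suc_trunc: "V (Suc n) = St (V n)"
  using scheme_eq_trunc[of "Suc n"] scheme_eq_trunc[of n] by simp

lemma junction_scheme: "V n \<alpha> 0 = V n \<beta> 0"
proof -
  have "junction_grid ((St ^^ n) (V 0))" by (induction n) (auto simp: junction_u0 junction_grid_upd simp del: scheme.simps)
  then have "junction_grid (V n)" by (simp only: scheme_eq_trunc[of n])
  then show ?thesis by (simp only: junction_grid_def)
qed

lemma scheme_time_step: "\<bar>V (Suc n) \<alpha> i - V n \<alpha> i\<bar> \<le> K * dt"
  using trunc_increments[of n \<alpha> i] scheme_eq_trunc[of "Suc n"] scheme_eq_trunc[of n] by metis

text \<open>The upper bound comes from the update at the right end of the edge, where the quotient
  is the left slope. The lower bound comes from the update at the left end, which is the junction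
  when \<open>i = 0\<close>.\<close>

lemma scheme_space_step: "\<bar>V n \<alpha> (Suc i) - V n \<alpha> i\<bar> \<le> P * dx"
proof -
  let ?q = "(V n \<alpha> (Suc i) - V n \<alpha> i) / dx"
  have "?q < phi \<alpha>"
    using Gt_le_KD(1)[OF trunc_G_F_le(1)[of "Suc i" \<alpha> n]] by (simp add: scheme_eq_trunc[of n])
  moreover have "min (plo \<alpha>) (p0lo \<alpha>) < ?q"
  proof (cases "i = 0")
    case True
    then show ?thesis using Ft_le_KD[OF trunc_G_F_le(2), of \<alpha> n] by (simp add: scheme_eq_trunc[of n])
  next
    case False
    then show ?thesis using Gt_le_KD(2)[OF trunc_G_F_le(1)[of i \<alpha> n]] by (simp add: scheme_eq_trunc[of n])
  qed
  ultimately have "\<bar>?q\<bar> \<le> P" using P_bounds[of \<alpha>] by linarith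
  then show ?thesis using dt by (simp add: abs_divide pos_divide_le_eq)
qed

lemma scheme_time_lipschitz: "\<bar>V n \<alpha> i - V n' \<alpha> i\<bar> \<le> K * (\<bar>real n - real n'\<bar> * dt)"
proof -
  have *: "\<bar>V (n + k) \<alpha> i - V n \<alpha> i\<bar> \<le> K * (real k * dt)" for n k
  proof (induction k)
    case (Suc k)
    then show ?case using scheme_time_step[of "n + k" \<alpha> i] by (simp add: algebra_simps)
  qed simp
  show ?thesis
  proof (cases "n \<le> n'")
    case True
    then show ?thesis using *[of n "n' - n"] by (simp add: abs_minus_commute of_nat_diff)
  next
    case False
    then show ?thesis using *[of n' "n - n'"] by (simp add: of_nat_diff)
  qed
qed

lemma scheme_space_lipschitz: "\<bar>V n \<alpha> i - V n \<alpha> i'\<bar> \<le> P * (\<bar>real i - real i'\<bar> * dx)"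
proof -
  have *: "\<bar>V n \<alpha> (i + k) - V n \<alpha> i\<bar> \<le> P * (real k * dx)" for i k
  proof (induction k)
    case (Suc k)
    then show ?case using scheme_space_step[of n \<alpha> "i + k"] by (simp add: algebra_simps)
  qed simp
  show ?thesis
  proof (cases "i \<le> i'")
    case True
    then show ?thesis using *[of i "i' - i"] by (simp add: abs_minus_commute of_nat_diff)
  next
    case False
    then show ?thesis using *[of i' "i - i'"] by (simp add: of_nat_diff)
  qed
qed

end

end

section \<open>Limits of monotone schemes\<close>

lemma isCont_real2D:
  fixes f :: "real \<times> real \<Rightarrow> real"
  assumes "isCont f (t0, x0)" "0 < e"
  shows "\<exists>d>0. \<forall>t x. \<bar>t - t0\<bar> < d \<longrightarrow> \<bar>x - x0\<bar> < d \<longrightarrow> \<bar>f (t, x) - f (t0, x0)\<bar> < e"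
proof -
  obtain d where d: "d > 0" "\<And>z. dist z (t0, x0) < d \<Longrightarrow> dist (f z) (f (t0, x0)) < e"
    using assms unfolding continuous_at_eps_delta by blast
  show ?thesis
  proof (intro exI[of _ "d / 2"] conjI allI impI)
    fix t x assume tx: "\<bar>t - t0\<bar> < d / 2" "\<bar>x - x0\<bar> < d / 2"
    have "dist (t, x) (t0, x0) \<le> \<bar>t - t0\<bar> + \<bar>x - x0\<bar>"
      unfolding dist_prod_def by (simp add: dist_real_def sqrt_sum_squares_le_sum_abs)
    then show "\<bar>f (t, x) - f (t0, x0)\<bar> < e" using d(2)[of "(t, x)"] tx by (simp add: dist_real_def)
  qed (use d in auto)
qed

lemma uniform_delta:
  fixes P :: "'a::finite \<Rightarrow> real \<Rightarrow> bool"
  assumes ex: "\<And>\<beta>. \<exists>d>0. P \<beta> d" and mono: "\<And>\<beta> d d'. P \<beta> d \<Longrightarrow> d' \<le> d \<Longrightarrow> P \<beta> d'"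
  shows "\<exists>d>0. \<forall>\<beta>. P \<beta> d"
proof -
  obtain d where d: "\<And>\<beta>. d \<beta> > 0" "\<And>\<beta>. P \<beta> (d \<beta>)" using ex by metis
  show ?thesis
  proof (intro exI[of _ "Min (range d)"] conjI allI)
    show "0 < Min (range d)" using d(1) by (subst Min_gr_iff) auto
    show "P \<beta> (Min (range d))" for \<beta> by (rule mono[OF d(2)[of \<beta>]]) (rule Min_le, auto)
  qed
qed

lemma vec_continuousD:
  fixes Fn :: "real^'n::finite \<Rightarrow> real"
  assumes "continuous_on UNIV Fn" "0 < e"
  shows "\<exists>d>0. \<forall>q. (\<forall>\<beta>. \<bar>q $ \<beta> - p $ \<beta>\<bar> < d) \<longrightarrow> \<bar>Fn q - Fn p\<bar> < e"
proof -
  obtain d where d: "d > 0" "\<And>q. dist q p < d \<Longrightarrow> dist (Fn q) (Fn p) < e"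
    using assms unfolding continuous_on_iff by (metis UNIV_I)
  show ?thesis
  proof (intro exI[of _ "d / (CARD('n) + 1)"] conjI allI impI)
    fix q :: "real^'n" assume q: "\<forall>\<beta>. \<bar>q $ \<beta> - p $ \<beta>\<bar> < d / (CARD('n) + 1)"
    have "dist q p \<le> (\<Sum>\<beta>\<in>UNIV. \<bar>(q - p) $ \<beta>\<bar>)" unfolding dist_norm by (rule norm_le_l1_cart)
    also have "\<dots> \<le> (\<Sum>\<beta>\<in>(UNIV::'n set). d / (CARD('n) + 1))" using q by (intro sum_mono) (simp add: less_imp_le)
    also have "\<dots> = CARD('n) * (d / (CARD('n) + 1))" by simp
    also have "\<dots> < d" using d(1) by (simp add: field_simps)
    finally show "\<bar>Fn q - Fn p\<bar> < e" using d(2) by (simp add: dist_real_def)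
  qed (use d in auto)
qed

lemma floor_grid:
  assumes "0 < h" "0 \<le> t"
  shows "real (nat \<lfloor>t / h\<rfloor>) * h \<le> t" "t < real (nat \<lfloor>t / h\<rfloor>) * h + h"
proof -
  have 0: "0 \<le> \<lfloor>t / h\<rfloor>" using assms by simp
  have "of_int \<lfloor>t / h\<rfloor> \<le> t / h" "t / h < of_int \<lfloor>t / h\<rfloor> + 1" by linarith+
  then have "of_int \<lfloor>t / h\<rfloor> * h \<le> t" "t < (of_int \<lfloor>t / h\<rfloor> + 1) * h"
    using assms(1) by (simp_all only: pos_le_divide_eq pos_divide_less_eq)
  then show "real (nat \<lfloor>t / h\<rfloor>) * h \<le> t" "t < real (nat \<lfloor>t / h\<rfloor>) * h + h" using 0 by (simp_all add: algebra_simps)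
qed

text \<open>Meshes are indexed by a filter because the limits are obtained by compactness in an
  uncountable product, where subsequences need not converge. The assumptions are symmetric under a
  change of sign, so supersolutions are covered by the negated scheme.\<close>

locale scheme_limit =
  fixes Fl :: "(real \<times> real) filter" and G :: "'n::finite \<Rightarrow> real \<Rightarrow> real \<Rightarrow> real" and Fn :: "real^'n \<Rightarrow> real"
    and W :: "real \<times> real \<Rightarrow> nat \<Rightarrow> 'n \<Rightarrow> nat \<Rightarrow> real" and u :: "real \<Rightarrow> 'n \<times> real \<Rightarrow> real"
  assumes nonbot: "Fl \<noteq> bot"
    and scheme: "\<forall>\<^sub>F e in Fl. 0 < fst e \<and> 0 < snd e \<and> mono_scheme G Fn (snd e / fst e) \<and>
      (\<forall>n. W e (Suc n) = upd G Fn (fst e) (snd e) (W e n)) \<and> (\<forall>n. junction_grid (W e n))"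
    and small: "\<And>d. 0 < d \<Longrightarrow> \<forall>\<^sub>F e in Fl. fst e < d \<and> snd e < d"
    and unif: "\<And>R \<eta>. 0 < \<eta> \<Longrightarrow> \<forall>\<^sub>F e in Fl. \<forall>n \<alpha> i. real n * fst e \<le> R \<longrightarrow> real i * snd e \<le> R \<longrightarrow>
      \<bar>W e n \<alpha> i - u (real n * fst e) (\<alpha>, real i * snd e)\<bar> \<le> \<eta>"
    and u_cont: "\<And>\<alpha> t0 x0 \<eta>. 0 \<le> t0 \<Longrightarrow> 0 \<le> x0 \<Longrightarrow> 0 < \<eta> \<Longrightarrow>
      \<exists>d>0. \<forall>t x. 0 \<le> t \<longrightarrow> 0 \<le> x \<longrightarrow> \<bar>t - t0\<bar> < d \<longrightarrow> \<bar>x - x0\<bar> < d \<longrightarrow> \<bar>u t (\<alpha>, x) - u t0 (\<alpha>, x0)\<bar> < \<eta>"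
    and G_cont: "\<And>\<alpha>. continuous_on UNIV (\<lambda>z. G \<alpha> (fst z) (snd z))" and Fn_cont: "continuous_on UNIV Fn"
begin

text \<open>The stability argument for monotone schemes of Barles and Souganidis. If the conclusion
  failed, the discrete operator would be positive for all gradients of \<open>g\<close> near the
  contact point. At a grid maximum of \<open>W - g\<close> the numerical solution may be replaced by
  \<open>g\<close> plus a constant because the update is monotone, and the mean value theorem
  contradicts this positivity.\<close>

lemma strict_touch:
  fixes g gt gx :: "'n \<Rightarrow> real \<times> real \<Rightarrow> real"
  assumes t0: "0 < t0" "t0 < T" and x0: "0 \<le> x0" and r: "0 < r"
    and A: "A = (if 0 < x0 then {\<alpha>0} else UNIV)"
    and gt: "\<And>\<beta> t x. 0 < t \<Longrightarrow> t < T \<Longrightarrow> ((\<lambda>s. g \<beta> (s, x)) has_real_derivative gt \<beta> (t, x)) (at t)"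
    and gx: "\<And>\<beta> t x. 0 < t \<Longrightarrow> t < T \<Longrightarrow> ((\<lambda>y. g \<beta> (t, y)) has_real_derivative gx \<beta> (t, x)) (at x)"
    and cont: "\<And>\<beta>. isCont (gt \<beta>) (t0, x0)" "\<And>\<beta>. isCont (gx \<beta>) (t0, x0)" "\<And>\<beta>. isCont (g \<beta>) (t0, x0)"
    and agree: "\<And>\<alpha> \<beta> t. 0 < t \<Longrightarrow> t < T \<Longrightarrow> g \<alpha> (t, 0) = g \<beta> (t, 0)"
    and touch: "\<And>\<beta> t x. \<beta> \<in> A \<Longrightarrow> \<bar>t - t0\<bar> < r \<Longrightarrow> \<bar>x - x0\<bar> < r \<Longrightarrow> 0 < t \<Longrightarrow> 0 \<le> x \<Longrightarrow>
      u t (\<beta>, x) \<le> g \<beta> (t, x) - ((t - t0)\<^sup>2 + (x - x0)\<^sup>2)"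
    and eq: "u t0 (\<alpha>0, x0) = g \<alpha>0 (t0, x0)"
  shows "(\<exists>\<beta>\<in>A. gt \<beta> (t0, x0) + G \<beta> (gx \<beta> (t0, x0)) (gx \<beta> (t0, x0)) \<le> 0) \<or>
    (x0 = 0 \<and> gt \<alpha>0 (t0, x0) + Fn (\<chi> \<beta>. gx \<beta> (t0, x0)) \<le> 0)"
proof (rule ccontr)
  assume neg: "\<not> ?thesis"
  \<comment> \<open>The time difference and the two space differences are realized at different mean
    value points, hence the three independent points.\<close>
  have D1: "\<exists>d>0. \<forall>t1 y1 t2 y2 t3 y3. \<bar>t1 - t0\<bar> < d \<longrightarrow> \<bar>y1 - x0\<bar> < d \<longrightarrow> \<bar>t2 - t0\<bar> < d \<longrightarrow> \<bar>y2 - x0\<bar> < d \<longrightarrow>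
      \<bar>t3 - t0\<bar> < d \<longrightarrow> \<bar>y3 - x0\<bar> < d \<longrightarrow> \<beta> \<in> A \<longrightarrow> 0 < gt \<beta> (t1, y1) + G \<beta> (gx \<beta> (t2, y2)) (gx \<beta> (t3, y3))" for \<beta>
  proof (cases "\<beta> \<in> A")
    case False
    then show ?thesis by (intro exI[of _ 1]) auto
  next
    case True
    define E where "E = gt \<beta> (t0, x0) + G \<beta> (gx \<beta> (t0, x0)) (gx \<beta> (t0, x0))"
    have E: "0 < E / 2" using neg True by (auto simp: E_def not_le)
    let ?q = "gx \<beta> (t0, x0)"
    have "isCont (\<lambda>z. G \<beta> (fst z) (snd z)) (?q, ?q)" using G_cont[of \<beta>] by (simp add: continuous_on_eq_continuous_at)
    from isCont_real2D[OF this E] obtain dG where dG: "dG > 0"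
      "\<And>a b. \<bar>a - ?q\<bar> < dG \<Longrightarrow> \<bar>b - ?q\<bar> < dG \<Longrightarrow> \<bar>G \<beta> a b - G \<beta> ?q ?q\<bar> < E / 2"
      unfolding fst_conv snd_conv by blast
    obtain d1 where d1: "d1 > 0" "\<And>t x. \<bar>t - t0\<bar> < d1 \<Longrightarrow> \<bar>x - x0\<bar> < d1 \<Longrightarrow> \<bar>gt \<beta> (t, x) - gt \<beta> (t0, x0)\<bar> < E / 2"
      using isCont_real2D[OF cont(1)[of \<beta>] E] by blast
    obtain d2 where d2: "d2 > 0" "\<And>t x. \<bar>t - t0\<bar> < d2 \<Longrightarrow> \<bar>x - x0\<bar> < d2 \<Longrightarrow> \<bar>gx \<beta> (t, x) - ?q\<bar> < dG"
      using isCont_real2D[OF cont(2)[of \<beta>] dG(1)] by blast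
    show ?thesis
    proof (intro exI[of _ "min d1 d2"] conjI allI impI)
      fix t1 y1 t2 y2 t3 y3
      assume "\<bar>t1 - t0\<bar> < min d1 d2" "\<bar>y1 - x0\<bar> < min d1 d2" "\<bar>t2 - t0\<bar> < min d1 d2" "\<bar>y2 - x0\<bar> < min d1 d2"
        "\<bar>t3 - t0\<bar> < min d1 d2" "\<bar>y3 - x0\<bar> < min d1 d2"
      then have "\<bar>gt \<beta> (t1, y1) - gt \<beta> (t0, x0)\<bar> < E / 2" "\<bar>G \<beta> (gx \<beta> (t2, y2)) (gx \<beta> (t3, y3)) - G \<beta> ?q ?q\<bar> < E / 2"
        by (intro d1(2) dG(2) d2(2); simp)+
      then show "0 < gt \<beta> (t1, y1) + G \<beta> (gx \<beta> (t2, y2)) (gx \<beta> (t3, y3))"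
        using E_def unfolding abs_less_iff by argo
    qed (use d1 d2 in auto)
  qed
  have "\<exists>d>0. \<forall>\<beta>. \<forall>t1 y1 t2 y2 t3 y3. \<bar>t1 - t0\<bar> < d \<longrightarrow> \<bar>y1 - x0\<bar> < d \<longrightarrow> \<bar>t2 - t0\<bar> < d \<longrightarrow> \<bar>y2 - x0\<bar> < d \<longrightarrow>
      \<bar>t3 - t0\<bar> < d \<longrightarrow> \<bar>y3 - x0\<bar> < d \<longrightarrow> \<beta> \<in> A \<longrightarrow> 0 < gt \<beta> (t1, y1) + G \<beta> (gx \<beta> (t2, y2)) (gx \<beta> (t3, y3))"
    by (rule uniform_delta[OF D1]) (meson order.strict_trans2)
  then obtain dG where dG: "dG > 0" "\<And>\<beta> t1 y1 t2 y2 t3 y3. \<bar>t1 - t0\<bar> < dG \<Longrightarrow> \<bar>y1 - x0\<bar> < dG \<Longrightarrow> \<bar>t2 - t0\<bar> < dG \<Longrightarrow> \<bar>y2 - x0\<bar> < dG \<Longrightarrow>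
      \<bar>t3 - t0\<bar> < dG \<Longrightarrow> \<bar>y3 - x0\<bar> < dG \<Longrightarrow> \<beta> \<in> A \<Longrightarrow> 0 < gt \<beta> (t1, y1) + G \<beta> (gx \<beta> (t2, y2)) (gx \<beta> (t3, y3))"
    by blast
  have "\<exists>d>0. \<forall>t1 y1 ts ys. x0 = 0 \<longrightarrow> \<bar>t1 - t0\<bar> < d \<longrightarrow> \<bar>y1 - x0\<bar> < d \<longrightarrow> (\<forall>\<beta>. \<bar>ts \<beta> - t0\<bar> < d) \<longrightarrow> (\<forall>\<beta>. \<bar>ys \<beta> - x0\<bar> < d) \<longrightarrow>
      0 < gt \<alpha>0 (t1, y1) + Fn (\<chi> \<beta>. gx \<beta> (ts \<beta>, ys \<beta>))"
  proof (cases "x0 = 0")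
    case False
    then show ?thesis by (intro exI[of _ 1]) auto
  next
    case True
    define p :: "real^'n" where "p = (\<chi> \<beta>. gx \<beta> (t0, x0))"
    define E where "E = gt \<alpha>0 (t0, x0) + Fn p"
    have E: "0 < E / 2" using neg True by (auto simp: E_def p_def not_le)
    obtain dF where dF: "dF > 0" "\<And>q. (\<And>\<beta>. \<bar>q $ \<beta> - p $ \<beta>\<bar> < dF) \<Longrightarrow> \<bar>Fn q - Fn p\<bar> < E / 2"
      using vec_continuousD[OF Fn_cont E, of p] by blast
    obtain d1 where d1: "d1 > 0" "\<And>t x. \<bar>t - t0\<bar> < d1 \<Longrightarrow> \<bar>x - x0\<bar> < d1 \<Longrightarrow> \<bar>gt \<alpha>0 (t, x) - gt \<alpha>0 (t0, x0)\<bar> < E / 2"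
      using isCont_real2D[OF cont(1)[of \<alpha>0] E] by blast
    have "\<exists>d>0. \<forall>\<beta> t x. \<bar>t - t0\<bar> < d \<longrightarrow> \<bar>x - x0\<bar> < d \<longrightarrow> \<bar>gx \<beta> (t, x) - gx \<beta> (t0, x0)\<bar> < dF"
      by (rule uniform_delta[OF isCont_real2D[OF cont(2) dF(1)]]) (meson order.strict_trans2)
    then obtain d2 where d2: "d2 > 0" "\<And>\<beta> t x. \<bar>t - t0\<bar> < d2 \<Longrightarrow> \<bar>x - x0\<bar> < d2 \<Longrightarrow> \<bar>gx \<beta> (t, x) - gx \<beta> (t0, x0)\<bar> < dF"
      by blast
    show ?thesis
    proof (intro exI[of _ "min d1 d2"] conjI allI impI)
      fix t1 y1 and ts ys :: "'n \<Rightarrow> real"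
      assume a: "\<bar>t1 - t0\<bar> < min d1 d2" "\<bar>y1 - x0\<bar> < min d1 d2" "\<forall>\<beta>. \<bar>ts \<beta> - t0\<bar> < min d1 d2" "\<forall>\<beta>. \<bar>ys \<beta> - x0\<bar> < min d1 d2"
      have "\<bar>gt \<alpha>0 (t1, y1) - gt \<alpha>0 (t0, x0)\<bar> < E / 2" using a by (intro d1(2)) auto
      moreover have "\<bar>Fn (\<chi> \<beta>. gx \<beta> (ts \<beta>, ys \<beta>)) - Fn p\<bar> < E / 2"
        using a by (intro dF(2)) (auto simp: p_def intro!: d2(2))
      ultimately show "0 < gt \<alpha>0 (t1, y1) + Fn (\<chi> \<beta>. gx \<beta> (ts \<beta>, ys \<beta>))"
        using E_def unfolding abs_less_iff by argo
    qed (use d1 d2 in auto)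
  qed
  then obtain dF where dF: "dF > 0" "\<And>t1 y1 ts ys. x0 = 0 \<Longrightarrow> \<bar>t1 - t0\<bar> < dF \<Longrightarrow> \<bar>y1 - x0\<bar> < dF \<Longrightarrow> (\<And>\<beta>. \<bar>ts \<beta> - t0\<bar> < dF) \<Longrightarrow> (\<And>\<beta>. \<bar>ys \<beta> - x0\<bar> < dF) \<Longrightarrow>
      0 < gt \<alpha>0 (t1, y1) + Fn (\<chi> \<beta>. gx \<beta> (ts \<beta>, ys \<beta>))"
    by blast
  define \<delta> where "\<delta> = min (min (min dG dF) (min r t0)) (min (T - t0) (if 0 < x0 then x0 else 1)) / 2"
  have \<delta>: "0 < \<delta>" "\<delta> < dG" "\<delta> < dF" "\<delta> < r" "\<delta> < t0" "\<delta> < T - t0" "0 < x0 \<Longrightarrow> \<delta> < x0"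
    using dG(1) dF(1) r t0 by (auto simp: \<delta>_def min_def field_simps)
  \<comment> \<open>The grid point next to the contact point gives
    \<open>- 2 * \<eta> \<le> c0\<close>, whereas strictness of the contact bounds \<open>c0\<close>
    by \<eta> minus the squared distance of the maximum point. The squared distance is therefore at
    most \<open>3 * \<eta> = (\<delta> / 4)\<^sup>2\<close>.\<close>
  define \<eta> where "\<eta> = (\<delta> / 4)\<^sup>2 / 3"
  have \<eta>: "0 < \<eta>" using \<delta> by (simp add: \<eta>_def)
  obtain du where du: "du > 0" "\<And>t x. 0 \<le> t \<Longrightarrow> 0 \<le> x \<Longrightarrow> \<bar>t - t0\<bar> < du \<Longrightarrow> \<bar>x - x0\<bar> < du \<Longrightarrow> \<bar>u t (\<alpha>0, x) - u t0 (\<alpha>0, x0)\<bar> < \<eta> / 2"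
    using u_cont[of t0 x0 "\<eta> / 2" \<alpha>0] t0(1) x0 \<eta> by (meson half_gt_zero less_imp_le)
  obtain dg where dg: "dg > 0" "\<And>t x. \<bar>t - t0\<bar> < dg \<Longrightarrow> \<bar>x - x0\<bar> < dg \<Longrightarrow> \<bar>g \<alpha>0 (t, x) - g \<alpha>0 (t0, x0)\<bar> < \<eta> / 2"
    using isCont_real2D[OF cont(3)[of \<alpha>0], of "\<eta> / 2"] \<eta> by (meson half_gt_zero)
  define h where "h = min (min (\<delta> / 4) du) dg"
  have h: "0 < h" "h \<le> \<delta> / 4" "h \<le> du" "h \<le> dg" using \<delta> du dg by (auto simp: h_def)
  have "\<forall>\<^sub>F e in Fl. (0 < fst e \<and> 0 < snd e \<and> mono_scheme G Fn (snd e / fst e) \<and>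
      (\<forall>n. W e (Suc n) = upd G Fn (fst e) (snd e) (W e n)) \<and> (\<forall>n. junction_grid (W e n))) \<and> (fst e < h \<and> snd e < h) \<and>
      (\<forall>n \<alpha> i. real n * fst e \<le> t0 + x0 + \<delta> \<longrightarrow> real i * snd e \<le> t0 + x0 + \<delta> \<longrightarrow> \<bar>W e n \<alpha> i - u (real n * fst e) (\<alpha>, real i * snd e)\<bar> \<le> \<eta>)"
    by (intro eventually_conj scheme small[OF h(1)] unif[OF \<eta>])
  from eventually_happens'[OF nonbot this] obtain e where e: "0 < fst e" "0 < snd e" "mono_scheme G Fn (snd e / fst e)"
      "\<And>n. W e (Suc n) = upd G Fn (fst e) (snd e) (W e n)" "\<And>n. junction_grid (W e n)" "fst e < h" "snd e < h"
      "\<And>n \<alpha> i. real n * fst e \<le> t0 + x0 + \<delta> \<Longrightarrow> real i * snd e \<le> t0 + x0 + \<delta> \<Longrightarrow> \<bar>W e n \<alpha> i - u (real n * fst e) (\<alpha>, real i * snd e)\<bar> \<le> \<eta>"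
    by blast
  define dt dx where "dt = fst e" and "dx = snd e"
  have dtx: "0 < dt" "0 < dx" "dt < h" "dx < h" using e by (auto simp: dt_def dx_def)
  have c: "dx / dt * dt \<le> dx" using dtx by simp
  note ms = e(3)[folded dt_def dx_def]
  have We: "W e (Suc n) = upd G Fn dt dx (W e n)" for n using e(4) by (simp add: dt_def dx_def)
  have near: "\<bar>W e n \<alpha> i - u (real n * dt) (\<alpha>, real i * dx)\<bar> \<le> \<eta>" if "\<bar>real n * dt - t0\<bar> \<le> \<delta>" "\<bar>real i * dx - x0\<bar> \<le> \<delta>" for n \<alpha> i
    using e(8)[of n i \<alpha>] that t0 x0 unfolding dt_def dx_def by linarith
  \<comment> \<open>The radius \<open>\<delta> / 2\<close> is twice the distance within which the
    maximum will be found, so that its neighbours and the previous time level also belong to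
    \<open>S\<close>.\<close>
  define S where "S = {(n, \<beta>, i). \<beta> \<in> A \<and> \<bar>real n * dt - t0\<bar> \<le> \<delta> / 2 \<and> \<bar>real i * dx - x0\<bar> \<le> \<delta> / 2}"
  have "finite S"
  proof (rule finite_subset)
    show "S \<subseteq> {..nat \<lfloor>(t0 + \<delta>) / dt\<rfloor>} \<times> UNIV \<times> {..nat \<lfloor>(x0 + \<delta>) / dx\<rfloor>}"
    proof
      fix z assume "z \<in> S"
      then obtain n \<beta> i where z: "z = (n, \<beta>, i)" "\<bar>real n * dt - t0\<bar> \<le> \<delta> / 2" "\<bar>real i * dx - x0\<bar> \<le> \<delta> / 2" by (auto simp: S_def)
      then have "real n * dt \<le> t0 + \<delta>" "real i * dx \<le> x0 + \<delta>" using \<delta> by linarith+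
      then have "real n \<le> (t0 + \<delta>) / dt" "real i \<le> (x0 + \<delta>) / dx" using dtx by (simp_all add: pos_le_divide_eq)
      then have "n \<le> nat \<lfloor>(t0 + \<delta>) / dt\<rfloor>" "i \<le> nat \<lfloor>(x0 + \<delta>) / dx\<rfloor>" by (simp_all add: le_nat_floor)
      then show "z \<in> {..nat \<lfloor>(t0 + \<delta>) / dt\<rfloor>} \<times> UNIV \<times> {..nat \<lfloor>(x0 + \<delta>) / dx\<rfloor>}" using z by auto
    qed
  qed auto
  define \<Psi> where "\<Psi> = (\<lambda>(n, \<beta>, i). W e n \<beta> i - g \<beta> (real n * dt, real i * dx))"
  define n0 i0 where "n0 = nat \<lfloor>t0 / dt\<rfloor>" and "i0 = nat \<lfloor>x0 / dx\<rfloor>"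
  have n0: "\<bar>real n0 * dt - t0\<bar> < h" and i0: "\<bar>real i0 * dx - x0\<bar> < h"
    using floor_grid[OF dtx(1), of t0] floor_grid[OF dtx(2), of x0] dtx t0 x0 unfolding n0_def i0_def by linarith+
  have "\<alpha>0 \<in> A" using A by auto
  have z0S: "(n0, \<alpha>0, i0) \<in> S" using n0 i0 h \<delta> \<open>\<alpha>0 \<in> A\<close> by (auto simp: S_def)
  have "Max (\<Psi> ` S) \<in> \<Psi> ` S" using \<open>finite S\<close> z0S by (intro Max_in) auto
  then obtain z where z: "z \<in> S" "Max (\<Psi> ` S) = \<Psi> z" by (rule imageE)
  have zmax: "\<Psi> y \<le> \<Psi> z" if "y \<in> S" for y
    unfolding z(2)[symmetric] using \<open>finite S\<close> that by (intro Max_ge) auto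
  obtain n \<beta> i where nbi: "z = (n, \<beta>, i)" by (cases z) auto
  have \<beta>A: "\<beta> \<in> A" and nS: "\<bar>real n * dt - t0\<bar> \<le> \<delta> / 2" and iS: "\<bar>real i * dx - x0\<bar> \<le> \<delta> / 2"
    using z(1) unfolding nbi S_def by auto
  define c0 where "c0 = \<Psi> z"
  have lowz: "- 2 * \<eta> \<le> c0"
  proof -
    have "\<bar>u (real n0 * dt) (\<alpha>0, real i0 * dx) - u t0 (\<alpha>0, x0)\<bar> < \<eta> / 2" using n0 i0 h dtx by (intro du(2)) auto
    moreover have "\<bar>g \<alpha>0 (real n0 * dt, real i0 * dx) - g \<alpha>0 (t0, x0)\<bar> < \<eta> / 2" using n0 i0 h by (intro dg(2)) auto
    moreover have "\<bar>W e n0 \<alpha>0 i0 - u (real n0 * dt) (\<alpha>0, real i0 * dx)\<bar> \<le> \<eta>" using n0 i0 h \<delta> by (intro near) linarith+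
    ultimately have "- 2 * \<eta> \<le> \<Psi> (n0, \<alpha>0, i0)" using eq unfolding \<Psi>_def case_prod_conv by linarith
    then show ?thesis using zmax[OF z0S] by (simp add: c0_def)
  qed
  have "c0 \<le> \<eta> - ((real n * dt - t0)\<^sup>2 + (real i * dx - x0)\<^sup>2)"
  proof -
    have "0 < real n * dt" using nS \<delta> by linarith
    then have "u (real n * dt) (\<beta>, real i * dx) \<le> g \<beta> (real n * dt, real i * dx) - ((real n * dt - t0)\<^sup>2 + (real i * dx - x0)\<^sup>2)"
      using nS iS \<delta> dtx by (intro touch \<beta>A) auto
    moreover have "\<bar>W e n \<beta> i - u (real n * dt) (\<beta>, real i * dx)\<bar> \<le> \<eta>" using nS iS \<delta> by (intro near) linarith+
    ultimately show ?thesis unfolding c0_def nbi \<Psi>_def by simp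
  qed
  then have sq: "(real n * dt - t0)\<^sup>2 + (real i * dx - x0)\<^sup>2 \<le> (\<delta> / 4)\<^sup>2" using lowz by (simp add: \<eta>_def)
  have n4: "\<bar>real n * dt - t0\<bar> \<le> \<delta> / 4"
  proof (rule power2_le_imp_le)
    show "\<bar>real n * dt - t0\<bar>\<^sup>2 \<le> (\<delta> / 4)\<^sup>2" using sq zero_le_power2[of "real i * dx - x0"] unfolding power2_abs by linarith
  qed (use \<delta> in auto)
  have i4: "\<bar>real i * dx - x0\<bar> \<le> \<delta> / 4"
  proof (rule power2_le_imp_le)
    show "\<bar>real i * dx - x0\<bar>\<^sup>2 \<le> (\<delta> / 4)\<^sup>2" using sq zero_le_power2[of "real n * dt - t0"] unfolding power2_abs by linarith
  qed (use \<delta> in auto)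
  have "0 < real n * dt" using nS \<delta> by linarith
  then have "0 < n" by (auto intro: gr0I)
  then obtain n' where n': "n = Suc n'" by (auto simp: gr0_conv_Suc)
  define t' where "t' = real n' * dt"
  have tn: "real n * dt = t' + dt" by (simp add: n' t'_def algebra_simps)
  have t'2: "\<bar>t' - t0\<bar> \<le> \<delta> / 2" using n4 tn h dtx unfolding abs_le_iff by linarith
  have t'T: "0 < t'" "t' < T" "t' + dt < T" using t'2 n4 tn \<delta> dtx h unfolding abs_le_iff by linarith+
  have below: "W e n' \<gamma> j \<le> g \<gamma> (t', real j * dx) + c0" if "\<gamma> \<in> A" "\<bar>real j * dx - x0\<bar> \<le> \<delta> / 2" for \<gamma> j
  proof -
    have "(n', \<gamma>, j) \<in> S" using that t'2 by (auto simp: S_def t'_def)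
    then have "\<Psi> (n', \<gamma>, j) \<le> c0" unfolding c0_def by (rule zmax)
    then show ?thesis by (simp add: \<Psi>_def t'_def)
  qed
  have Wn: "W e n \<beta> i = g \<beta> (t' + dt, real i * dx) + c0" by (simp add: c0_def nbi \<Psi>_def tn)
  \<comment> \<open>At the junction all branches have the same time difference; \<alpha>0 is taken
    there because the junction alternative is stated with \<open>gt \<alpha>0\<close>.\<close>
  define \<alpha>s where "\<alpha>s = (if i = 0 then \<alpha>0 else \<beta>)"
  have "\<exists>\<xi>>t'. \<xi> < t' + dt \<and> g \<alpha>s (t' + dt, real i * dx) - g \<alpha>s (t', real i * dx) = (t' + dt - t') * gt \<alpha>s (\<xi>, real i * dx)"
    using t'T dtx by (intro MVT2 gt) auto
  then obtain \<xi>1 where \<xi>1: "t' < \<xi>1" "\<xi>1 < t' + dt"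
    "g \<alpha>s (t' + dt, real i * dx) - g \<alpha>s (t', real i * dx) = dt * gt \<alpha>s (\<xi>1, real i * dx)" by auto
  have \<xi>1d: "\<bar>\<xi>1 - t0\<bar> < \<delta>"
    using \<xi>1(1,2) t'2 n4 tn \<delta>(1) unfolding abs_le_iff abs_less_iff by linarith
  have mvx: "\<exists>\<xi>. \<bar>\<xi> - x0\<bar> < \<delta> \<and> (g \<gamma> (t', real (Suc j) * dx) - g \<gamma> (t', real j * dx)) / dx = gx \<gamma> (t', \<xi>)"
    if "\<bar>real (Suc j) * dx - x0\<bar> \<le> \<delta> / 2" "\<bar>real j * dx - x0\<bar> \<le> \<delta> / 2" for \<gamma> j
  proof -
    have s: "real (Suc j) * dx = real j * dx + dx" by (simp add: algebra_simps)
    have "\<exists>\<xi>>real j * dx. \<xi> < real j * dx + dx \<and> g \<gamma> (t', real j * dx + dx) - g \<gamma> (t', real j * dx) = (real j * dx + dx - real j * dx) * gx \<gamma> (t', \<xi>)"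
      using t'T dtx by (intro MVT2 gx) auto
    then obtain \<xi> where \<xi>: "real j * dx < \<xi>" "\<xi> < real j * dx + dx" "g \<gamma> (t', real j * dx + dx) - g \<gamma> (t', real j * dx) = dx * gx \<gamma> (t', \<xi>)" by auto
    have "\<bar>\<xi> - x0\<bar> < \<delta>" using \<xi>(1,2) that \<delta> unfolding s abs_le_iff abs_less_iff by linarith
    then show ?thesis using \<xi>(3) dtx unfolding s by (intro exI[of _ \<xi>]) simp
  qed
  show False
  proof (cases "i = 0")
    case False
    then obtain j where j: "i = Suc j" using not0_implies_Suc by blast
    have nb: "\<bar>real j * dx - x0\<bar> \<le> \<delta> / 2" "\<bar>real i * dx - x0\<bar> \<le> \<delta> / 2" "\<bar>real (Suc i) * dx - x0\<bar> \<le> \<delta> / 2"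
    proof -
      have "real (Suc i) * dx = real i * dx + dx" "real i * dx = real j * dx + dx" by (simp_all add: algebra_simps j)
      then show "\<bar>real j * dx - x0\<bar> \<le> \<delta> / 2" "\<bar>real i * dx - x0\<bar> \<le> \<delta> / 2" "\<bar>real (Suc i) * dx - x0\<bar> \<le> \<delta> / 2"
        using i4 h dtx \<delta> unfolding abs_le_iff by linarith+
    qed
    let ?g = "\<lambda>j. g \<beta> (t', real j * dx)"
    obtain \<xi>2 where \<xi>2: "\<bar>\<xi>2 - x0\<bar> < \<delta>" "(?g i - ?g j) / dx = gx \<beta> (t', \<xi>2)" using mvx[of j \<beta>] nb j by auto
    obtain \<xi>3 where \<xi>3: "\<bar>\<xi>3 - x0\<bar> < \<delta>" "(?g (Suc i) - ?g i) / dx = gx \<beta> (t', \<xi>3)" using mvx[of i \<beta>] nb by auto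
    have "W e n \<beta> i = W e n' \<beta> i - dt * G \<beta> ((W e n' \<beta> i - W e n' \<beta> j) / dx) ((W e n' \<beta> (Suc i) - W e n' \<beta> i) / dx)"
      unfolding n' We using False by (simp add: upd_def j)
    also have "\<dots> \<le> (?g i + c0) - dt * G \<beta> (((?g i + c0) - (?g j + c0)) / dx) (((?g (Suc i) + c0) - (?g i + c0)) / dx)"
      by (rule interior_step_mono[OF ms dtx(1,2) c]) (rule below[OF \<beta>A nb(1)] below[OF \<beta>A nb(2)] below[OF \<beta>A nb(3)])+
    finally have "g \<beta> (t' + dt, real i * dx) - ?g i \<le> - (dt * G \<beta> (gx \<beta> (t', \<xi>2)) (gx \<beta> (t', \<xi>3)))"
      unfolding Wn using \<xi>2 \<xi>3 by simp
    then have "dt * (gt \<beta> (\<xi>1, real i * dx) + G \<beta> (gx \<beta> (t', \<xi>2)) (gx \<beta> (t', \<xi>3))) \<le> 0"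
      using \<xi>1(3) False by (simp add: \<alpha>s_def algebra_simps)
    then have "gt \<beta> (\<xi>1, real i * dx) + G \<beta> (gx \<beta> (t', \<xi>2)) (gx \<beta> (t', \<xi>3)) \<le> 0"
      using dtx by (simp add: mult_le_0_iff)
    moreover have "0 < gt \<beta> (\<xi>1, real i * dx) + G \<beta> (gx \<beta> (t', \<xi>2)) (gx \<beta> (t', \<xi>3))"
      using \<xi>1d \<xi>2(1) \<xi>3(1) t'2 i4 \<delta> by (intro dG(2)[OF _ _ _ _ _ _ \<beta>A]) linarith+
    ultimately show False by simp
  next
    case True
    have x00: "x0 = 0" using i4 True \<delta> x0 by (cases "0 < x0") auto
    then have AU: "\<gamma> \<in> A" for \<gamma> using A by simp
    have nb: "\<bar>real 0 * dx - x0\<bar> \<le> \<delta> / 2" "\<bar>real (Suc 0) * dx - x0\<bar> \<le> \<delta> / 2"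
      using x00 h dtx \<delta> by auto
    have "\<forall>\<gamma>. \<exists>\<xi>. \<bar>\<xi> - x0\<bar> < \<delta> \<and> (g \<gamma> (t', real (Suc 0) * dx) - g \<gamma> (t', real 0 * dx)) / dx = gx \<gamma> (t', \<xi>)"
      using mvx[OF nb(2) nb(1)] by blast
    from choice[OF this] obtain \<xi> where \<xi>: "\<And>\<gamma>. \<bar>\<xi> \<gamma> - x0\<bar> < \<delta>" "\<And>\<gamma>. (g \<gamma> (t', dx) - g \<gamma> (t', 0)) / dx = gx \<gamma> (t', \<xi> \<gamma>)"
      by auto
    have "(\<chi> \<gamma>. (W e n' \<gamma> 1 - W e n' \<gamma> 0) / dx) = (\<chi> \<gamma>. (W e n' \<gamma> 1 - W e n' \<beta> 0) / dx)"
      using e(5)[of n'] unfolding junction_grid_def by (metis (no_types, lifting))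
    then have "W e n \<beta> 0 = W e n' \<beta> 0 - dt * Fn (\<chi> \<gamma>. (W e n' \<gamma> 1 - W e n' \<beta> 0) / dx)"
      unfolding n' We by (simp add: upd_def)
    also have "\<dots> \<le> (g \<beta> (t', 0) + c0) - dt * Fn (\<chi> \<gamma>. ((g \<gamma> (t', dx) + c0) - (g \<beta> (t', 0) + c0)) / dx)"
      by (rule junction_step_mono[OF ms dtx(1,2) c]) (use below[OF AU nb(1)] below[OF AU nb(2)] in auto)
    also have "(\<chi> \<gamma>. ((g \<gamma> (t', dx) + c0) - (g \<beta> (t', 0) + c0)) / dx) = (\<chi> \<gamma>. gx \<gamma> (t', \<xi> \<gamma>))"
      unfolding vec_eq_iff using \<xi>(2) agree[OF t'T(1,2)] by (metis (no_types, lifting) add_diff_cancel_right vec_lambda_beta)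
    finally have "g \<alpha>0 (t' + dt, 0) - g \<alpha>0 (t', 0) \<le> - (dt * Fn (\<chi> \<gamma>. gx \<gamma> (t', \<xi> \<gamma>)))"
      using Wn True agree[of "t' + dt" \<beta> \<alpha>0] agree[of t' \<beta> \<alpha>0] t'T dtx by simp
    then have "dt * (gt \<alpha>0 (\<xi>1, 0) + Fn (\<chi> \<gamma>. gx \<gamma> (t', \<xi> \<gamma>))) \<le> 0"
      using \<xi>1(3) True by (simp add: \<alpha>s_def algebra_simps)
    then have "gt \<alpha>0 (\<xi>1, 0) + Fn (\<chi> \<gamma>. gx \<gamma> (t', \<xi> \<gamma>)) \<le> 0" using dtx by (simp add: mult_le_0_iff)
    moreover have "0 < gt \<alpha>0 (\<xi>1, 0) + Fn (\<chi> \<gamma>. gx \<gamma> (t', \<xi> \<gamma>))"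
    proof (rule dF(2)[OF x00, where ts = "\<lambda>_. t'" and ys = \<xi>])
      show "\<bar>\<xi> \<gamma> - x0\<bar> < dF" for \<gamma> using \<xi>(1)[of \<gamma>] \<delta> by linarith
    qed (use \<xi>1d t'2 x00 \<delta> in auto)
    ultimately show False by simp
  qed
qed

end

section \<open>Relaxed solutions\<close>

lemma jd_simps: "jd (\<alpha>, x) (\<alpha>, y) = \<bar>x - y\<bar>" "\<alpha> \<noteq> \<beta> \<Longrightarrow> jd (\<alpha>, x) (\<beta>, y) = x + y"
  by (simp_all add: jd_def)

lemma jd_self [simp]: "jd p p = 0" by (simp add: jd_def)

lemma jd_triangle: "p \<in> jpts \<Longrightarrow> q \<in> jpts \<Longrightarrow> m \<in> jpts \<Longrightarrow> jd p q \<le> jd p m + jd m q"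
  by (auto simp: jd_def jpts_def)

lemma jd_nonneg: "p \<in> jpts \<Longrightarrow> q \<in> jpts \<Longrightarrow> 0 \<le> jd p q"
  by (auto simp: jd_def jpts_def)

lemma nbhd_self: "0 \<le> t \<Longrightarrow> t < T \<Longrightarrow> p \<in> jpts \<Longrightarrow> 0 < r \<Longrightarrow> (t, p) \<in> nbhd T t p r"
  by (simp add: nbhd_def tjd_def)

lemma nbhd_nbhd:
  assumes "z \<in> nbhd T t p r" "p \<in> jpts"
  shows "nbhd T (fst z) (snd z) r \<subseteq> nbhd T t p (2 * r)"
proof
  fix y assume y: "y \<in> nbhd T (fst z) (snd z) r"
  have "jd (snd y) p \<le> jd (snd y) (snd z) + jd (snd z) p"
    using y assms by (intro jd_triangle) (auto simp: nbhd_def)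
  then show "y \<in> nbhd T t p (2 * r)" using y assms by (auto simp: nbhd_def tjd_def)
qed

lemma nbhd_zero: "nbhd T t (\<alpha>, 0) r = nbhd T t (\<beta>, 0) r"
proof -
  have "jd p (\<alpha>, 0) = jd p (\<beta>, 0)" if "p \<in> jpts" for p :: "'a \<times> real"
    using that by (auto simp: jd_def jpts_def)
  then show ?thesis by (auto simp: nbhd_def tjd_def)
qed

lemma ustar_ge:
  assumes "0 \<le> t" "t < T" "p \<in> jpts"
  shows "ereal (u t p) \<le> ustar T u t p"
  unfolding ustar_def
proof (rule INF_greatest)
  fix r :: real assume "r \<in> {0<..}"
  then have "(t, p) \<in> nbhd T t p r" using assms by (intro nbhd_self) auto
  then show "ereal (u t p) \<le> (SUP z\<in>nbhd T t p r. ereal (u (fst z) (snd z)))"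
    by (rule SUP_upper2) simp
qed

lemma ustar_le:
  assumes "0 < r" "\<And>z. z \<in> nbhd T t p r \<Longrightarrow> u (fst z) (snd z) \<le> c"
  shows "ustar T u t p \<le> ereal c"
  unfolding ustar_def by (rule INF_lower2[of r]) (use assms in \<open>auto intro: SUP_least\<close>)

text \<open>Local boundedness makes \<open>ustar\<close> finite, so the envelope can be handled as a
  real function on each branch.\<close>

definition Us :: "real \<Rightarrow> (real \<Rightarrow> 'n \<times> real \<Rightarrow> real) \<Rightarrow> 'n \<Rightarrow> real \<Rightarrow> real \<Rightarrow> real" where
  "Us T u \<alpha> t x = real_of_ereal (ustar T u t (\<alpha>, x))"

lemma ustar_finite:
  assumes "loc_bounded T u" "0 \<le> t" "t < T" "p \<in> jpts"
  shows "\<bar>ustar T u t p\<bar> \<noteq> \<infinity>"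
proof -
  obtain r C where "r > 0" "\<And>z. z \<in> nbhd T t p r \<Longrightarrow> \<bar>u (fst z) (snd z)\<bar> \<le> C"
    using assms unfolding loc_bounded_def by blast
  then have "ustar T u t p \<le> ereal C" by (intro ustar_le[of r]) (auto simp: abs_le_iff)
  moreover have "ereal (u t p) \<le> ustar T u t p" using assms by (intro ustar_ge)
  ultimately show ?thesis by auto
qed

lemma ustar_Us:
  assumes "loc_bounded T u" "0 \<le> t" "t < T" "0 \<le> x"
  shows "ustar T u t (\<alpha>, x) = ereal (Us T u \<alpha> t x)"
proof -
  have "\<bar>ustar T u t (\<alpha>, x)\<bar> \<noteq> \<infinity>" by (rule ustar_finite[OF assms(1-3)]) (simp add: jpts_def assms)
  then show ?thesis unfolding Us_def by (simp add: ereal_real')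
qed

lemma Us_ge:
  assumes "loc_bounded T u" "0 \<le> t" "t < T" "0 \<le> x"
  shows "u t (\<alpha>, x) \<le> Us T u \<alpha> t x"
  using ustar_ge[of t T "(\<alpha>, x)" u] assms by (simp add: ustar_Us jpts_def)

lemma Us_zero: "Us T u \<alpha> t 0 = Us T u \<beta> t 0"
  unfolding Us_def ustar_def nbhd_zero[of T t \<alpha> _ \<beta>] by simp

lemma usc_Us:
  assumes lb: "loc_bounded T u"
  shows "usc_on (strip T) (\<lambda>(t, x). Us T u \<alpha> t x)"
  unfolding usc_on_def
proof (intro ballI allI impI)
  fix z e assume z: "z \<in> strip T" and e: "0 < (e::real)"
  obtain t x where tx: "z = (t, x)" "0 \<le> t" "t < T" "0 \<le> x" using z by auto
  have "ustar T u t (\<alpha>, x) < ereal (Us T u \<alpha> t x + e)" using ustar_Us[OF lb tx(2-4), of \<alpha>] e by simp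
  then obtain r where r: "r > 0" "(SUP z\<in>nbhd T t (\<alpha>, x) r. ereal (u (fst z) (snd z))) < ereal (Us T u \<alpha> t x + e)"
    unfolding ustar_def by (auto simp: INF_less_iff)
  show "\<exists>d>0. \<forall>y\<in>strip T. dist y z < d \<longrightarrow> (case y of (t, x) \<Rightarrow> Us T u \<alpha> t x) < (case z of (t, x) \<Rightarrow> Us T u \<alpha> t x) + e"
  proof (intro exI[of _ "r / 4"] conjI ballI impI)
    fix y assume y: "y \<in> strip T" "dist y z < r / 4"
    obtain s w where sw: "y = (s, w)" "0 \<le> s" "s < T" "0 \<le> w" using y by auto
    have "\<bar>s - t\<bar> < r / 4" "\<bar>w - x\<bar> < r / 4"
      using dist_fst_le[of y z] dist_snd_le[of y z] y(2) by (auto simp: sw tx dist_real_def)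
    then have "(s, (\<alpha>, w)) \<in> nbhd T t (\<alpha>, x) (r / 2)" using sw by (auto simp: nbhd_def tjd_def jd_simps jpts_def)
    from nbhd_nbhd[OF this] have sub: "nbhd T s (\<alpha>, w) (r / 2) \<subseteq> nbhd T t (\<alpha>, x) r" using tx by (auto simp: jpts_def)
    have "ustar T u s (\<alpha>, w) \<le> (SUP z\<in>nbhd T s (\<alpha>, w) (r / 2). ereal (u (fst z) (snd z)))"
      unfolding ustar_def using r by (intro INF_lower) auto
    also have "\<dots> \<le> (SUP z\<in>nbhd T t (\<alpha>, x) r. ereal (u (fst z) (snd z)))" using sub by (rule SUP_subset_mono) simp
    finally have "ustar T u s (\<alpha>, w) < ereal (Us T u \<alpha> t x + e)" using r by simp
    then show "(case y of (t, x) \<Rightarrow> Us T u \<alpha> t x) < (case z of (t, x) \<Rightarrow> Us T u \<alpha> t x) + e"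
      using ustar_Us[OF lb sw(2-4), of \<alpha>] by (simp add: sw tx)
  qed (use r in auto)
qed

definition quad :: "real \<Rightarrow> real \<Rightarrow> real \<Rightarrow> real \<Rightarrow> real \<Rightarrow> real \<Rightarrow> real \<times> real \<Rightarrow> real" where
  "quad c a p C t0 x0 z = c + a * (fst z - t0) + p * (snd z - x0) + C * ((fst z - t0)\<^sup>2 + (snd z - x0)\<^sup>2)"

definition quad' :: "real \<Rightarrow> real \<Rightarrow> real \<Rightarrow> real \<Rightarrow> real \<Rightarrow> real \<times> real \<Rightarrow> real \<times> real \<Rightarrow> real" where
  "quad' a p C t0 x0 z h = a * fst h + p * snd h + C * (2 * (fst z - t0) * fst h + 2 * (snd z - x0) * snd h)"

lemma quad_derivative: "(quad c a p C t0 x0 has_derivative quad' a p C t0 x0 z) (at z)"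
  unfolding quad_def[abs_def] quad'_def[abs_def]
  by (auto intro!: derivative_eq_intros simp: power2_eq_square algebra_simps fun_eq_iff)

text \<open>The branch pieces must agree at the junction even if the contact point is inside a
  branch; in that case the same polynomial is used on all branches.\<close>

lemma testfun_quad:
  assumes "x0 = 0 \<or> (\<forall>\<alpha> \<beta>. p \<alpha> = p \<beta>)"
  shows "testfun T (\<lambda>\<beta>. quad c a (p \<beta>) C t0 x0)"
  unfolding testfun_def
proof (intro conjI allI impI)
  fix \<alpha>
  show "\<exists>D. (\<forall>z. 0 < fst z \<and> fst z < T \<longrightarrow> (quad c a (p \<alpha>) C t0 x0 has_derivative D z) (at z)) \<and>
    (\<forall>v. continuous_on {z. 0 < fst z \<and> fst z < T} (\<lambda>z. D z v))"
    by (rule exI[of _ "quad' a (p \<alpha>) C t0 x0"]) (auto intro: quad_derivative simp: quad'_def intro!: continuous_intros)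
next
  fix \<alpha> \<beta> t
  show "quad c a (p \<alpha>) C t0 x0 (t, 0) = quad c a (p \<beta>) C t0 x0 (t, 0)"
    using assms by (auto simp: quad_def)
qed

lemma dt_dx_quad:
  "dt_g (\<lambda>\<beta>. quad c a (p \<beta>) C t0 x0) \<beta> t0 x0 = a" "dx_g (\<lambda>\<beta>. quad c a (p \<beta>) C t0 x0) \<beta> t0 x0 = p \<beta>"
  unfolding dt_g_def dx_g_def frechet_derivative_at[OF quad_derivative, symmetric] by (simp_all add: quad'_def)

lemma isub_Us:
  assumes sub: "relaxed_sub T H F u" and lb: "loc_bounded T u"
  shows "isub T (H \<alpha>) (Us T u \<alpha>)"
  unfolding isub_def
proof (intro allI impI, elim conjE exE)
  fix t0 x0 a p C d
  assume t0: "0 < t0" "t0 < T" and x0: "0 < x0" and d: "0 < (d::real)"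
    and touch: "\<forall>t x. \<bar>t - t0\<bar> < d \<and> \<bar>x - x0\<bar> < d \<longrightarrow>
      Us T u \<alpha> t x \<le> Us T u \<alpha> t0 x0 + a * (t - t0) + p * (x - x0) + C * ((t - t0)\<^sup>2 + (x - x0)\<^sup>2)"
  define g where "g = (\<lambda>\<beta>::'a. quad (Us T u \<alpha> t0 x0) a p C t0 x0)"
  have gt: "dt_g g \<beta> t0 x0 = a" "dx_g g \<beta> t0 x0 = p" for \<beta>
    unfolding g_def by (rule dt_dx_quad[where p = "\<lambda>_. p"])+
  have "testfun T g \<and> 0 < t0 \<and> t0 < T \<and> (\<alpha>, x0) \<in> jpts \<and>
      (\<exists>r>0. \<forall>z\<in>nbhd T t0 (\<alpha>, x0) r. 0 < fst z \<longrightarrow> ustar T u (fst z) (snd z) \<le> ereal (phi_of g (fst z) (snd z))) \<and>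
      ustar T u t0 (\<alpha>, x0) = ereal (phi_of g t0 (\<alpha>, x0))"
  proof (intro conjI)
    show "testfun T g" unfolding g_def by (rule testfun_quad) simp
    show "(\<alpha>, x0) \<in> jpts" using x0 by (simp add: jpts_def)
    show "ustar T u t0 (\<alpha>, x0) = ereal (phi_of g t0 (\<alpha>, x0))"
      using t0 x0 by (simp add: ustar_Us[OF lb] phi_of_def g_def quad_def)
    show "\<exists>r>0. \<forall>z\<in>nbhd T t0 (\<alpha>, x0) r. 0 < fst z \<longrightarrow> ustar T u (fst z) (snd z) \<le> ereal (phi_of g (fst z) (snd z))"
    \<comment> \<open>The radius \<open>x0\<close> keeps the neighbourhood inside the branch of the
      contact point.\<close>
    proof (intro exI[of _ "min d x0"] conjI ballI impI)
      fix z assume z: "z \<in> nbhd T t0 (\<alpha>, x0) (min d x0)"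
      obtain t \<beta> x where tx: "z = (t, (\<beta>, x))" by (metis prod.collapse)
      have dom: "0 \<le> t" "t < T" "0 \<le> x" "\<bar>t - t0\<bar> + jd (\<beta>, x) (\<alpha>, x0) < min d x0"
        using z by (auto simp: tx nbhd_def tjd_def jpts_def)
      have \<beta>: "\<beta> = \<alpha>" using dom by (cases "\<beta> = \<alpha>") (auto simp: jd_simps)
      then have "\<bar>t - t0\<bar> < d \<and> \<bar>x - x0\<bar> < d" using dom(4) by (auto simp: jd_simps)
      then show "ustar T u (fst z) (snd z) \<le> ereal (phi_of g (fst z) (snd z))"
        using touch dom by (simp add: tx \<beta> ustar_Us[OF lb] phi_of_def g_def quad_def)
    qed (use d x0 in auto)
  qed (use t0 in auto)
  then have "if 0 < snd (\<alpha>, x0) then dt_g g (fst (\<alpha>, x0)) t0 (snd (\<alpha>, x0)) + H (fst (\<alpha>, x0)) (dx_g g (fst (\<alpha>, x0)) t0 (snd (\<alpha>, x0))) \<le> 0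
     else dt_g g (fst (\<alpha>, x0)) t0 0 + F (\<chi> \<beta>. dx_g g \<beta> t0 0) \<le> 0 \<or> (\<exists>\<alpha>. dt_g g \<alpha> t0 0 + H \<alpha> (dx_g g \<alpha> t0 0) \<le> 0)"
    using sub unfolding relaxed_sub_def by blast
  then show "a + H \<alpha> p \<le> 0" using x0 by (simp add: gt)
qed

lemma jsub_Us:
  fixes u :: "real \<Rightarrow> 'n::finite \<times> real \<Rightarrow> real"
  assumes sub: "relaxed_sub T H F u" and lb: "loc_bounded T u"
  shows "jsub T H F (Us T u)"
  unfolding jsub_def
proof (intro allI impI, elim conjE)
  fix t0 a C and p :: "real^'n"
  assume t0: "0 < t0" "t0 < T"
    and touch: "\<forall>\<alpha>. \<exists>d>0. \<forall>t x. \<bar>t - t0\<bar> < d \<and> 0 \<le> x \<and> x < d \<longrightarrow>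
      Us T u \<alpha> t x \<le> Us T u \<alpha> t0 0 + a * (t - t0) + p $ \<alpha> * x + C * ((t - t0)\<^sup>2 + x\<^sup>2)"
  have "\<exists>d>0. \<forall>\<alpha> t x. \<bar>t - t0\<bar> < d \<and> 0 \<le> x \<and> x < d \<longrightarrow>
      Us T u \<alpha> t x \<le> Us T u \<alpha> t0 0 + a * (t - t0) + p $ \<alpha> * x + C * ((t - t0)\<^sup>2 + x\<^sup>2)"
    by (rule uniform_delta[OF touch[rule_format]]) (meson order.strict_trans2)
  then obtain d where d: "d > 0" "\<And>\<alpha> t x. \<bar>t - t0\<bar> < d \<Longrightarrow> 0 \<le> x \<Longrightarrow> x < d \<Longrightarrow>
      Us T u \<alpha> t x \<le> Us T u \<alpha> t0 0 + a * (t - t0) + p $ \<alpha> * x + C * ((t - t0)\<^sup>2 + x\<^sup>2)" by blast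
  fix \<alpha>0 :: 'n
  define c where "c = Us T u \<alpha>0 t0 0"
  have c: "Us T u \<alpha> t0 0 = c" for \<alpha> unfolding c_def by (rule Us_zero)
  define g where "g = (\<lambda>\<beta>::'n. quad c a (p $ \<beta>) C t0 0)"
  have gt: "dt_g g \<beta> t0 0 = a" "dx_g g \<beta> t0 0 = p $ \<beta>" for \<beta>
    unfolding g_def by (rule dt_dx_quad[where p = "\<lambda>\<beta>. p $ \<beta>" and ?x0.0 = 0])+
  have "testfun T g \<and> 0 < t0 \<and> t0 < T \<and> (\<alpha>0, 0) \<in> jpts \<and>
      (\<exists>r>0. \<forall>z\<in>nbhd T t0 (\<alpha>0, 0) r. 0 < fst z \<longrightarrow> ustar T u (fst z) (snd z) \<le> ereal (phi_of g (fst z) (snd z))) \<and>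
      ustar T u t0 (\<alpha>0, 0) = ereal (phi_of g t0 (\<alpha>0, 0))"
  proof (intro conjI)
    show "testfun T g" unfolding g_def by (rule testfun_quad) simp
    show "(\<alpha>0, 0) \<in> jpts" by (simp add: jpts_def)
    show "ustar T u t0 (\<alpha>0, 0) = ereal (phi_of g t0 (\<alpha>0, 0))"
      using t0 by (simp add: ustar_Us[OF lb] phi_of_def g_def quad_def c)
    show "\<exists>r>0. \<forall>z\<in>nbhd T t0 (\<alpha>0, 0) r. 0 < fst z \<longrightarrow> ustar T u (fst z) (snd z) \<le> ereal (phi_of g (fst z) (snd z))"
    proof (intro exI[of _ d] conjI ballI impI)
      fix z assume z: "z \<in> nbhd T t0 (\<alpha>0, 0) d"
      obtain t \<beta> x where tx: "z = (t, (\<beta>, x))" by (metis prod.collapse)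
      have dom: "0 \<le> t" "t < T" "0 \<le> x" "\<bar>t - t0\<bar> + jd (\<beta>, x) (\<alpha>0, 0) < d"
        using z by (auto simp: tx nbhd_def tjd_def jpts_def)
      have "jd (\<beta>, x) (\<alpha>0, 0) = x" using dom by (simp add: jd_def)
      then have "\<bar>t - t0\<bar> < d" "x < d" using dom by auto
      from d(2)[OF this(1) dom(3) this(2)]
      show "ustar T u (fst z) (snd z) \<le> ereal (phi_of g (fst z) (snd z))"
        using dom by (simp add: tx ustar_Us[OF lb] phi_of_def g_def quad_def c)
    qed (use d in auto)
  qed (use t0 in auto)
  then have "if 0 < snd (\<alpha>0, 0::real) then dt_g g (fst (\<alpha>0, 0::real)) t0 (snd (\<alpha>0, 0::real)) + H (fst (\<alpha>0, 0::real)) (dx_g g (fst (\<alpha>0, 0::real)) t0 (snd (\<alpha>0, 0::real))) \<le> 0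
     else dt_g g (fst (\<alpha>0, 0::real)) t0 0 + F (\<chi> \<beta>. dx_g g \<beta> t0 0) \<le> 0 \<or> (\<exists>\<alpha>. dt_g g \<alpha> t0 0 + H \<alpha> (dx_g g \<alpha> t0 0) \<le> 0)"
    using sub unfolding relaxed_sub_def by blast
  then show "a + F p \<le> 0 \<or> (\<exists>\<alpha>. a + H \<alpha> (p $ \<alpha>) \<le> 0)" by (simp add: gt)
qed

section \<open>Change of sign between subsolutions and supersolutions\<close>

lemma ereal_uminus_real_iff:
  "ereal a \<le> - x \<longleftrightarrow> x \<le> ereal (- a)" "- x \<le> ereal a \<longleftrightarrow> ereal (- a) \<le> x" "- x = ereal a \<longleftrightarrow> x = ereal (- a)"
  by (cases x; auto)+

lemma lstar_uminus: "lstar T (\<lambda>t p. - u t p) t p = - ustar T u t p"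
  unfolding lstar_def ustar_def by (simp add: ereal_INF_uminus_eq ereal_SUP_uminus_eq flip: uminus_ereal.simps)

lemma ustar_uminus: "ustar T (\<lambda>t p. - u t p) t p = - lstar T u t p"
  unfolding lstar_def ustar_def by (simp add: ereal_INF_uminus_eq ereal_SUP_uminus_eq flip: uminus_ereal.simps)

lemma testfun_uminus: "testfun T g \<Longrightarrow> testfun T (\<lambda>\<beta> z. - g \<beta> z)"
  unfolding testfun_def
proof (elim conjE, intro conjI allI impI)
  fix \<alpha>
  assume "\<forall>\<alpha>. \<exists>D. (\<forall>z. 0 < fst z \<and> fst z < T \<longrightarrow> (g \<alpha> has_derivative D z) (at z)) \<and> (\<forall>v. continuous_on {z. 0 < fst z \<and> fst z < T} (\<lambda>z. D z v))"
  then obtain D where D: "\<And>z. 0 < fst z \<and> fst z < T \<Longrightarrow> (g \<alpha> has_derivative D z) (at z)"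
    "\<And>v. continuous_on {z. 0 < fst z \<and> fst z < T} (\<lambda>z. D z v)" by blast
  show "\<exists>D. (\<forall>z. 0 < fst z \<and> fst z < T \<longrightarrow> ((\<lambda>z. - g \<alpha> z) has_derivative D z) (at z)) \<and> (\<forall>v. continuous_on {z. 0 < fst z \<and> fst z < T} (\<lambda>z. D z v))"
    by (rule exI[of _ "\<lambda>z h. - D z h"]) (auto intro!: has_derivative_minus D continuous_on_minus)
qed auto

lemma dt_dx_uminus:
  assumes "testfun T g" "0 < t" "t < T"
  shows "dt_g (\<lambda>\<beta> z. - g \<beta> z) \<alpha> t x = - dt_g g \<alpha> t x" "dx_g (\<lambda>\<beta> z. - g \<beta> z) \<alpha> t x = - dx_g g \<alpha> t x"
proof -
  obtain D where D: "(g \<alpha> has_derivative D) (at (t, x))" using assms unfolding testfun_def by fastforce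
  have "((\<lambda>z. - g \<alpha> z) has_derivative (\<lambda>h. - D h)) (at (t, x))" by (rule has_derivative_minus[OF D])
  then show "dt_g (\<lambda>\<beta> z. - g \<beta> z) \<alpha> t x = - dt_g g \<alpha> t x" "dx_g (\<lambda>\<beta> z. - g \<beta> z) \<alpha> t x = - dx_g g \<alpha> t x"
    unfolding dt_g_def dx_g_def by (simp_all add: frechet_derivative_at[OF D, symmetric] frechet_derivative_at[OF \<open>((\<lambda>z. - g \<alpha> z) has_derivative (\<lambda>h. - D h)) (at (t, x))\<close>, symmetric])
qed

lemma relaxed_super_uminus:
  assumes sub: "relaxed_sub T H F u"
  shows "relaxed_super T (\<lambda>\<alpha>. dual (H \<alpha>)) (\<lambda>p. - F (- p)) (\<lambda>t p. - u t p)"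
  unfolding relaxed_super_def
proof (intro allI impI, elim conjE exE)
  fix g t0 x0 r
  assume g: "testfun T g" and t0: "0 < t0" "t0 < T" and x0: "x0 \<in> jpts" and r: "0 < r"
    and le: "\<forall>z\<in>nbhd T t0 x0 r. 0 < fst z \<longrightarrow> ereal (phi_of g (fst z) (snd z)) \<le> lstar T (\<lambda>t p. - u t p) (fst z) (snd z)"
    and eq: "lstar T (\<lambda>t p. - u t p) t0 x0 = ereal (phi_of g t0 x0)"
  let ?g = "\<lambda>\<beta> z. - g \<beta> z"
  have phi: "phi_of ?g t p = - phi_of g t p" for t p by (simp add: phi_of_def)
  have "\<forall>z\<in>nbhd T t0 x0 r. 0 < fst z \<longrightarrow> ustar T u (fst z) (snd z) \<le> ereal (phi_of ?g (fst z) (snd z))"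
    using le by (auto simp: lstar_uminus phi ereal_uminus_real_iff simp del: uminus_ereal.simps)
  moreover have "ustar T u t0 x0 = ereal (phi_of ?g t0 x0)"
    using eq by (auto simp: lstar_uminus phi ereal_uminus_real_iff simp del: uminus_ereal.simps)
  ultimately have *: "if 0 < snd x0 then dt_g ?g (fst x0) t0 (snd x0) + H (fst x0) (dx_g ?g (fst x0) t0 (snd x0)) \<le> 0
     else dt_g ?g (fst x0) t0 0 + F (\<chi> \<beta>. dx_g ?g \<beta> t0 0) \<le> 0 \<or> (\<exists>\<alpha>. dt_g ?g \<alpha> t0 0 + H \<alpha> (dx_g ?g \<alpha> t0 0) \<le> 0)"
    using sub testfun_uminus[OF g] t0 x0 r unfolding relaxed_sub_def by blast
  have v: "(\<chi> \<beta>. - dx_g g \<beta> t0 0) = - (\<chi> \<beta>. dx_g g \<beta> t0 0)" by (simp add: vec_eq_iff)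
  show "if 0 < snd x0 then dt_g g (fst x0) t0 (snd x0) + dual (H (fst x0)) (dx_g g (fst x0) t0 (snd x0)) \<ge> 0
     else dt_g g (fst x0) t0 0 + - F (- (\<chi> \<beta>. dx_g g \<beta> t0 0)) \<ge> 0 \<or> (\<exists>\<alpha>. dt_g g \<alpha> t0 0 + dual (H \<alpha>) (dx_g g \<alpha> t0 0) \<ge> 0)"
    using * by (auto simp: dt_dx_uminus[OF g t0] dual_def v split: if_splits)
qed

lemma relaxed_sub_uminus:
  assumes super: "relaxed_super T H F u"
  shows "relaxed_sub T (\<lambda>\<alpha>. dual (H \<alpha>)) (\<lambda>p. - F (- p)) (\<lambda>t p. - u t p)"
  unfolding relaxed_sub_def
proof (intro allI impI, elim conjE exE)
  fix g t0 x0 r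
  assume g: "testfun T g" and t0: "0 < t0" "t0 < T" and x0: "x0 \<in> jpts" and r: "0 < r"
    and le: "\<forall>z\<in>nbhd T t0 x0 r. 0 < fst z \<longrightarrow> ustar T (\<lambda>t p. - u t p) (fst z) (snd z) \<le> ereal (phi_of g (fst z) (snd z))"
    and eq: "ustar T (\<lambda>t p. - u t p) t0 x0 = ereal (phi_of g t0 x0)"
  let ?g = "\<lambda>\<beta> z. - g \<beta> z"
  have phi: "phi_of ?g t p = - phi_of g t p" for t p by (simp add: phi_of_def)
  have "\<forall>z\<in>nbhd T t0 x0 r. 0 < fst z \<longrightarrow> lstar T u (fst z) (snd z) \<ge> ereal (phi_of ?g (fst z) (snd z))"
    using le by (auto simp: ustar_uminus phi ereal_uminus_real_iff simp del: uminus_ereal.simps)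
  moreover have "lstar T u t0 x0 = ereal (phi_of ?g t0 x0)"
    using eq by (auto simp: ustar_uminus phi ereal_uminus_real_iff simp del: uminus_ereal.simps)
  ultimately have *: "if 0 < snd x0 then dt_g ?g (fst x0) t0 (snd x0) + H (fst x0) (dx_g ?g (fst x0) t0 (snd x0)) \<ge> 0
     else dt_g ?g (fst x0) t0 0 + F (\<chi> \<beta>. dx_g ?g \<beta> t0 0) \<ge> 0 \<or> (\<exists>\<alpha>. dt_g ?g \<alpha> t0 0 + H \<alpha> (dx_g ?g \<alpha> t0 0) \<ge> 0)"
    using super testfun_uminus[OF g] t0 x0 r unfolding relaxed_super_def by blast
  have v: "(\<chi> \<beta>. - dx_g g \<beta> t0 0) = - (\<chi> \<beta>. dx_g g \<beta> t0 0)" by (simp add: vec_eq_iff)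
  show "if 0 < snd x0 then dt_g g (fst x0) t0 (snd x0) + dual (H (fst x0)) (dx_g g (fst x0) t0 (snd x0)) \<le> 0
     else dt_g g (fst x0) t0 0 + - F (- (\<chi> \<beta>. dx_g g \<beta> t0 0)) \<le> 0 \<or> (\<exists>\<alpha>. dt_g g \<alpha> t0 0 + dual (H \<alpha>) (dx_g g \<alpha> t0 0) \<le> 0)"
    using * by (auto simp: dt_dx_uminus[OF g t0] dual_def v split: if_splits)
qed

text \<open>There is no upper limit on the times, so that one limit function serves every
  \<open>T\<close>. As different labels of the origin are at distance 0, agreement of the branches
  at the junction is included.\<close>

definition lipschitz_tj :: "real \<Rightarrow> real \<Rightarrow> (real \<Rightarrow> 'n \<times> real \<Rightarrow> real) \<Rightarrow> bool" where
  "lipschitz_tj K P u \<longleftrightarrow> 0 \<le> K \<and> 0 \<le> P \<and>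
    (\<forall>t s p q. 0 \<le> t \<longrightarrow> 0 \<le> s \<longrightarrow> p \<in> jpts \<longrightarrow> q \<in> jpts \<longrightarrow> \<bar>u t p - u s q\<bar> \<le> K * \<bar>t - s\<bar> + P * jd p q)"

lemma lipschitz_tjD:
  "lipschitz_tj K P u \<Longrightarrow> 0 \<le> t \<Longrightarrow> 0 \<le> s \<Longrightarrow> p \<in> jpts \<Longrightarrow> q \<in> jpts \<Longrightarrow>
    \<bar>u t p - u s q\<bar> \<le> K * \<bar>t - s\<bar> + P * jd p q"
  unfolding lipschitz_tj_def by blast

lemma lipschitz_tj_uminus: "lipschitz_tj K P u \<Longrightarrow> lipschitz_tj K P (\<lambda>t p. - u t p)"
  unfolding lipschitz_tj_def by (simp add: abs_minus_commute)

lemma lipschitz_tj_nbhd: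
  assumes u: "lipschitz_tj K P u" and tp: "0 \<le> t" "p \<in> jpts" and z: "z \<in> nbhd T t p r"
  shows "\<bar>u (fst z) (snd z) - u t p\<bar> \<le> (K + P) * r"
proof -
  have "\<bar>u (fst z) (snd z) - u t p\<bar> \<le> K * \<bar>fst z - t\<bar> + P * jd (snd z) p"
    using u tp z unfolding lipschitz_tj_def nbhd_def by blast
  also have "\<dots> \<le> K * r + P * r"
  proof -
    have "0 \<le> jd (snd z) p" using tp z by (intro jd_nonneg) (auto simp: nbhd_def)
    moreover have "\<bar>fst z - t\<bar> + jd (snd z) p < r" using z by (simp add: nbhd_def tjd_def)
    ultimately show ?thesis using u unfolding lipschitz_tj_def by (intro add_mono mult_left_mono) auto
  qed
  finally show ?thesis by (simp add: algebra_simps)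
qed

lemma lipschitz_tj_loc_bounded: "lipschitz_tj K P u \<Longrightarrow> loc_bounded T u"
  unfolding loc_bounded_def
proof (intro allI impI)
  fix t and p :: "'a \<times> real" assume u: "lipschitz_tj K P u" and "0 \<le> t \<and> t < T \<and> p \<in> jpts"
  then have "\<bar>u (fst z) (snd z)\<bar> \<le> \<bar>u t p\<bar> + (K + P) * 1" if "z \<in> nbhd T t p 1" for z
    using lipschitz_tj_nbhd[OF u _ _ that] by force
  then show "\<exists>r>0. \<exists>C. \<forall>z\<in>nbhd T t p r. \<bar>u (fst z) (snd z)\<bar> \<le> C" by (meson zero_less_one)
qed

lemma lipschitz_tj_ustar:
  assumes u: "lipschitz_tj K P u" and tp: "0 \<le> t" "t < T" "p \<in> jpts"
  shows "ustar T u t p = ereal (u t p)"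
proof (rule antisym)
  show "ustar T u t p \<le> ereal (u t p)"
  proof (rule ereal_le_epsilon2)
    fix e :: real assume e: "0 < e"
    have KP: "0 \<le> K + P" using u by (simp add: lipschitz_tj_def)
    have "ustar T u t p \<le> ereal (u t p + e)"
    proof (rule ustar_le[of "e / (K + P + 1)"])
      show "0 < e / (K + P + 1)" using e KP by simp
      fix z assume "z \<in> nbhd T t p (e / (K + P + 1))"
      from lipschitz_tj_nbhd[OF u tp(1,3) this]
      have "u (fst z) (snd z) - u t p \<le> (K + P) * (e / (K + P + 1))" by linarith
      also have "\<dots> \<le> e" using e KP by (simp add: field_simps)
      finally show "u (fst z) (snd z) \<le> u t p + e" by simp
    qed
    then show "ustar T u t p \<le> ereal (u t p) + ereal e" by simp
  qed
qed (rule ustar_ge[OF tp])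

lemma lipschitz_tj_Us:
  assumes "lipschitz_tj K P u" "0 \<le> t" "t < T" "0 \<le> x"
  shows "Us T u \<alpha> t x = u t (\<alpha>, x)"
  unfolding Us_def using lipschitz_tj_ustar[OF assms(1-3), of "(\<alpha>, x)"] assms by (simp add: jpts_def)

lemma lipschitz_tj_junction: "lipschitz_tj K P u \<Longrightarrow> 0 \<le> t \<Longrightarrow> u t (\<alpha>, 0) = u t (\<beta>, 0)"
proof -
  assume u: "lipschitz_tj K P u" "0 \<le> t"
  then have "\<bar>u t (\<alpha>, 0) - u t (\<beta>, 0)\<bar> \<le> K * \<bar>t - t\<bar> + P * jd (\<alpha>, 0) (\<beta>, 0)"
    by (intro lipschitz_tjD) (simp_all add: jpts_def)
  also have "\<dots> = 0" by (simp add: jd_def)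
  finally show ?thesis by simp
qed

text \<open>\<open>b\<close> stands for minus a supersolution. Either function may be the Lipschitz
  one, so the lemma serves both inequalities between a Lipschitz solution and an arbitrary
  one.\<close>

lemma comparison_functions:
  fixes H :: "'n::finite \<Rightarrow> real \<Rightarrow> real" and F :: "real^'n \<Rightarrow> real"
  assumes H_lip: "\<And>\<alpha> p q. \<bar>H \<alpha> p - H \<alpha> q\<bar> \<le> L * \<bar>p - q\<bar>" and L: "0 < L"
    and H_coercive: "\<And>\<alpha>. coercive (H \<alpha>)"
    and F_coercive: "\<And>M. \<exists>R. \<forall>p. (\<Sum>\<beta>\<in>UNIV. max (- p $ \<beta>) 0) \<ge> R \<longrightarrow> F p \<ge> M"
    and a: "relaxed_sub T H F a" "loc_bounded T a"
    and b: "relaxed_sub T (\<lambda>\<alpha>. dual (H \<alpha>)) (\<lambda>p. - F (- p)) b" "loc_bounded T b"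
    and init: "\<And>p. p \<in> jpts \<Longrightarrow> ustar T a 0 p \<le> ereal (u0 p)" "\<And>p. p \<in> jpts \<Longrightarrow> ustar T b 0 p \<le> ereal (- u0 p)"
    and lip: "lipschitz_tj K P a \<or> lipschitz_tj K P b"
    and tp: "0 \<le> t" "t < T" "p \<in> jpts"
  shows "a t p + b t p \<le> 0"
proof -
  obtain \<alpha> x where p: "p = (\<alpha>, x)" "0 \<le> x" using tp by (cases p) (auto simp: jpts_def)
  interpret junction_pair T L H F "Us T a" "Us T b"
  proof
    show "isub T (dual (H \<alpha>)) (Us T b \<alpha>)" for \<alpha> by (rule isub_Us[OF b])
    show "jsub T (\<lambda>\<alpha>. dual (H \<alpha>)) (\<lambda>p. - F (- p)) (Us T b)" by (rule jsub_Us[OF b])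
  qed (use assms usc_Us Us_zero in auto)
  have "Us T a \<alpha> t x + Us T b \<alpha> t x \<le> 0"
  proof (rule comparison)
    show "isub T (H \<alpha>) (Us T a \<alpha>)" for \<alpha> by (rule isub_Us[OF a])
    show "jsub T H F (Us T a)" by (rule jsub_Us[OF a])
    fix \<alpha> x assume x: "(0::real) \<le> x"
    have "ereal (Us T a \<alpha> 0 x) \<le> ereal (u0 (\<alpha>, x))" "ereal (Us T b \<alpha> 0 x) \<le> ereal (- u0 (\<alpha>, x))"
      using init[of "(\<alpha>, x)"] x tp by (auto simp: ustar_Us[OF a(2), symmetric] ustar_Us[OF b(2), symmetric] jpts_def simp del: ereal_less_eq)
    then show "Us T a \<alpha> 0 x + Us T b \<alpha> 0 x \<le> 0" by simp
  next
    have *: "\<bar>Us T c \<alpha> t x - Us T c \<alpha> t 0\<bar> \<le> P * x" if c: "lipschitz_tj K P c" and "0 \<le> t" "t < T" "0 \<le> x" for c \<alpha> t x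
    proof -
      have "\<bar>c t (\<alpha>, x) - c t (\<alpha>, 0)\<bar> \<le> K * \<bar>t - t\<bar> + P * jd (\<alpha>, x) (\<alpha>, 0)"
        using that(2-4) by (intro lipschitz_tjD[OF c]) (simp_all add: jpts_def)
      then show ?thesis using that by (simp add: lipschitz_tj_Us[OF c] jd_simps)
    qed
    show "(\<forall>\<alpha> t x. 0 \<le> t \<longrightarrow> t < T \<longrightarrow> 0 \<le> x \<longrightarrow> \<bar>Us T a \<alpha> t x - Us T a \<alpha> t 0\<bar> \<le> P * x) \<or>
          (\<forall>\<alpha> t x. 0 \<le> t \<longrightarrow> t < T \<longrightarrow> 0 \<le> x \<longrightarrow> \<bar>Us T b \<alpha> t x - Us T b \<alpha> t 0\<bar> \<le> P * x)"
      using lip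
    proof
      assume "lipschitz_tj K P a"
      then show ?thesis by (intro disjI1 allI impI *)
    next
      assume "lipschitz_tj K P b"
      then show ?thesis by (intro disjI2 allI impI *)
    qed
  qed (use tp p in auto)
  then show ?thesis using Us_ge[OF a(2) tp(1,2) p(2), of \<alpha>] Us_ge[OF b(2) tp(1,2) p(2), of \<alpha>] by (simp add: p)
qed

context scheme_limit begin

lemma relaxed_sub_limit:
  assumes lip: "lipschitz_tj K P u"
  shows "relaxed_sub T (\<lambda>\<alpha> p. G \<alpha> p p) Fn u"
  unfolding relaxed_sub_def
proof (intro allI impI, elim conjE exE)
  fix g t0 p0 r
  assume g: "testfun T g" and t0: "0 < t0" "t0 < T" and p0: "p0 \<in> jpts" and r: "0 < r"
    and le: "\<forall>z\<in>nbhd T t0 p0 r. 0 < fst z \<longrightarrow> ustar T u (fst z) (snd z) \<le> ereal (phi_of g (fst z) (snd z))"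
    and eq: "ustar T u t0 p0 = ereal (phi_of g t0 p0)"
  obtain \<alpha>0 x0 where p0': "p0 = (\<alpha>0, x0)" "0 \<le> x0" using p0 by (cases p0) (auto simp: jpts_def)
  have "\<forall>\<alpha>. \<exists>D. (\<forall>z. 0 < fst z \<and> fst z < T \<longrightarrow> (g \<alpha> has_derivative D z) (at z)) \<and>
              (\<forall>v. continuous_on {z. 0 < fst z \<and> fst z < T} (\<lambda>z. D z v))"
    using g unfolding testfun_def by blast
  from choice[OF this] obtain D where "\<forall>\<alpha>. (\<forall>z. 0 < fst z \<and> fst z < T \<longrightarrow> (g \<alpha> has_derivative D \<alpha> z) (at z)) \<and>
              (\<forall>v. continuous_on {z. 0 < fst z \<and> fst z < T} (\<lambda>z. D \<alpha> z v))" by (elim exE)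
  then have D: "\<And>\<alpha> z. 0 < fst z \<and> fst z < T \<Longrightarrow> (g \<alpha> has_derivative D \<alpha> z) (at z)"
    "\<And>\<alpha> v. continuous_on {z. 0 < fst z \<and> fst z < T} (\<lambda>z. D \<alpha> z v)" by blast+
  have op: "open {z::real \<times> real. 0 < fst z \<and> fst z < T}"
    by (intro open_Collect_conj open_Collect_less continuous_intros)
  have Dc: "isCont (\<lambda>z. D \<alpha> z v) (t0, x0)" for \<alpha> v
    using D(2)[of \<alpha> v] t0 by (simp add: continuous_on_eq_continuous_at[OF op])
  have gtx: "dt_g g \<alpha> t0 x0 = D \<alpha> (t0, x0) (1, 0)" "dx_g g \<alpha> t0 x0 = D \<alpha> (t0, x0) (0, 1)" for \<alpha>
    using D(1)[of "(t0, x0)" \<alpha>] t0 unfolding dt_g_def dx_g_def by (simp_all add: frechet_derivative_at[symmetric])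
  \<comment> \<open>Added to the test function to make the contact strict; its gradient vanishes at
    the contact point and so does not alter the inequality to be proved.\<close>
  define q where "q = (\<lambda>z::real \<times> real. (fst z - t0)\<^sup>2 + (snd z - x0)\<^sup>2)"
  define A where "A = (if 0 < x0 then {\<alpha>0} else (UNIV :: 'n set))"
  have "(\<exists>\<beta>\<in>A. (D \<beta> (t0, x0) (1, 0) + 2 * (fst (t0, x0) - t0)) + G \<beta> (D \<beta> (t0, x0) (0, 1) + 2 * (snd (t0, x0) - x0)) (D \<beta> (t0, x0) (0, 1) + 2 * (snd (t0, x0) - x0)) \<le> 0) \<or>
    (x0 = 0 \<and> (D \<alpha>0 (t0, x0) (1, 0) + 2 * (fst (t0, x0) - t0)) + Fn (\<chi> \<beta>. D \<beta> (t0, x0) (0, 1) + 2 * (snd (t0, x0) - x0)) \<le> 0)"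
  proof (rule strict_touch[OF t0 p0'(2) _ A_def, where g = "\<lambda>\<beta> z. g \<beta> z + q z" and gt = "\<lambda>\<beta> z. D \<beta> z (1, 0) + 2 * (fst z - t0)" and gx = "\<lambda>\<beta> z. D \<beta> z (0, 1) + 2 * (snd z - x0)"])
    \<comment> \<open>Half of \<open>r\<close> is taken because \<open>nbhd\<close> measures the sum
      of the time and the space distance.\<close>
    show "0 < min (r / 2) (T - t0)" using r t0 by simp
    fix \<beta> t x assume t: "0 < t" "t < T"
    have lin: "linear (D \<beta> (t, x))" using D(1)[of "(t, x)" \<beta>] t has_derivative_linear by auto
    have "((\<lambda>s. g \<beta> (s, x)) has_derivative (\<lambda>h. D \<beta> (t, x) (h, 0))) (at t)"
      using t by (intro has_derivative_compose[where g = "g \<beta>" and f = "\<lambda>s. (s, x)"] D has_derivative_Pair derivative_intros) auto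
    moreover have "(\<lambda>h. D \<beta> (t, x) (h, 0)) = (*) (D \<beta> (t, x) (1, 0))"
    proof
      show "D \<beta> (t, x) (h, 0) = D \<beta> (t, x) (1, 0) * h" for h
        using linear_cmul[OF lin, of h "(1, 0)"] by simp
    qed
    ultimately have "((\<lambda>s. g \<beta> (s, x)) has_real_derivative D \<beta> (t, x) (1, 0)) (at t)"
      by (simp only: has_field_derivative_def)
    then show "((\<lambda>s. g \<beta> (s, x) + q (s, x)) has_real_derivative D \<beta> (t, x) (1, 0) + 2 * (fst (t, x) - t0)) (at t)"
      unfolding q_def by (auto intro!: derivative_eq_intros)
    have "((\<lambda>y. g \<beta> (t, y)) has_derivative (\<lambda>h. D \<beta> (t, x) (0, h))) (at x)"
      using t by (intro has_derivative_compose[where g = "g \<beta>" and f = "\<lambda>y. (t, y)"] D has_derivative_Pair derivative_intros) auto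
    moreover have "(\<lambda>h. D \<beta> (t, x) (0, h)) = (*) (D \<beta> (t, x) (0, 1))"
    proof
      show "D \<beta> (t, x) (0, h) = D \<beta> (t, x) (0, 1) * h" for h
        using linear_cmul[OF lin, of h "(0, 1)"] by simp
    qed
    ultimately have "((\<lambda>y. g \<beta> (t, y)) has_real_derivative D \<beta> (t, x) (0, 1)) (at x)"
      by (simp only: has_field_derivative_def)
    then show "((\<lambda>y. g \<beta> (t, y) + q (t, y)) has_real_derivative D \<beta> (t, x) (0, 1) + 2 * (snd (t, x) - x0)) (at x)"
      unfolding q_def by (auto intro!: derivative_eq_intros)
  next
    fix \<beta>
    show "isCont (\<lambda>z. D \<beta> z (1, 0) + 2 * (fst z - t0)) (t0, x0)" "isCont (\<lambda>z. D \<beta> z (0, 1) + 2 * (snd z - x0)) (t0, x0)"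
      by (intro continuous_intros Dc)+
    have "isCont (g \<beta>) (t0, x0)" using D(1)[of "(t0, x0)" \<beta>] t0 has_derivative_continuous by auto
    then show "isCont (\<lambda>z. g \<beta> z + q z) (t0, x0)" unfolding q_def by (intro continuous_intros)
  next
    fix \<alpha> \<beta> t assume "0 < t" "t < T"
    then show "g \<alpha> (t, 0) + q (t, 0) = g \<beta> (t, 0) + q (t, 0)" using g unfolding testfun_def by simp
  next
    fix \<beta> t x assume a: "\<beta> \<in> A" "\<bar>t - t0\<bar> < min (r / 2) (T - t0)" "\<bar>x - x0\<bar> < min (r / 2) (T - t0)" "0 < t" "0 \<le> x"
    have "jd (\<beta>, x) (\<alpha>0, x0) = \<bar>x - x0\<bar>" using a p0'(2) by (auto simp: A_def jd_def split: if_splits)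
    then have "(t, (\<beta>, x)) \<in> nbhd T t0 p0 r" using a by (auto simp: nbhd_def tjd_def p0' jpts_def)
    then have "ustar T u t (\<beta>, x) \<le> ereal (g \<beta> (t, x))" using le a by (fastforce simp: phi_of_def)
    moreover have "t < T" using a by auto
    ultimately have "u t (\<beta>, x) \<le> g \<beta> (t, x)" using lipschitz_tj_ustar[OF lip, of t T "(\<beta>, x)"] a by (simp add: jpts_def)
    then show "u t (\<beta>, x) \<le> g \<beta> (t, x) + q (t, x) - ((t - t0)\<^sup>2 + (x - x0)\<^sup>2)" by (simp add: q_def)
  next
    show "u t0 (\<alpha>0, x0) = g \<alpha>0 (t0, x0) + q (t0, x0)"
      using eq lipschitz_tj_ustar[OF lip, of t0 T p0] t0 p0 by (simp add: p0' phi_of_def q_def)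
  qed
  then show "if 0 < snd p0 then dt_g g (fst p0) t0 (snd p0) + G (fst p0) (dx_g g (fst p0) t0 (snd p0)) (dx_g g (fst p0) t0 (snd p0)) \<le> 0
     else dt_g g (fst p0) t0 0 + Fn (\<chi> \<beta>. dx_g g \<beta> t0 0) \<le> 0 \<or> (\<exists>\<alpha>. dt_g g \<alpha> t0 0 + G \<alpha> (dx_g g \<alpha> t0 0) (dx_g g \<alpha> t0 0) \<le> 0)"
    using gtx p0' by (cases "0 < x0") (auto simp: A_def)
qed

end

section \<open>Convergence of subsequences\<close>

text \<open>By Tychonoff the pointwise bounds define a compact product of intervals, so the values
  have a cluster point \<open>f\<close>. Refining \<open>Fl\<close> by the preimages of the
  neighbourhoods of \<open>f\<close> gives a proper filter along which convergence holds.\<close>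

lemma pointwise_cluster:
  fixes I :: "'e \<Rightarrow> 'z \<Rightarrow> real"
  assumes nb: "Fl \<noteq> bot" and bd: "\<forall>\<^sub>F e in Fl. \<forall>z. \<bar>I e z\<bar> \<le> B z"
  shows "\<exists>Fl' f. Fl' \<noteq> bot \<and> Fl' \<le> Fl \<and> (\<forall>z. ((\<lambda>e. I e z) \<longlongrightarrow> f z) Fl')"
proof -
  define S where "S = PiE UNIV (\<lambda>z. {- B z..B z})"
  have "compactin (product_topology (\<lambda>_. euclidean) UNIV) S"
    unfolding S_def by (subst compactin_PiE) (simp add: compactin_euclidean_iff)
  then have S: "compact S" by (simp add: euclidean_product_topology compactin_euclidean_iff)
  have "\<forall>\<^sub>F f in filtermap I Fl. f \<in> S"
    unfolding eventually_filtermap using bd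
    by (rule eventually_mono) (auto simp: S_def PiE_def abs_le_iff minus_le_iff)
  then obtain f where f: "inf (nhds f) (filtermap I Fl) \<noteq> bot"
    using S nb unfolding compact_filter by (metis filtermap_bot_iff)
  define Fl' where "Fl' = inf (filtercomap I (nhds f)) Fl"
  have "Fl' \<noteq> bot"
  proof
    assume "Fl' = bot"
    then have "eventually (\<lambda>_. False) (inf (filtercomap I (nhds f)) Fl)" by (simp add: Fl'_def)
    then obtain Q R where QR: "eventually Q (filtercomap I (nhds f))" "eventually R Fl" "\<And>e. Q e \<Longrightarrow> R e \<Longrightarrow> False"
      unfolding eventually_inf by blast
    obtain Q' where Q': "eventually Q' (nhds f)" "\<And>e. Q' (I e) \<Longrightarrow> Q e"
      using QR(1) unfolding eventually_filtercomap by blast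
    have "eventually (\<lambda>g. \<not> Q' g) (filtermap I Fl)"
      unfolding eventually_filtermap using QR(2) by (rule eventually_mono) (use QR(3) Q'(2) in blast)
    with Q'(1) have "eventually (\<lambda>_. False) (inf (nhds f) (filtermap I Fl))"
      unfolding eventually_inf by blast
    then show False using f by (simp add: trivial_limit_def)
  qed
  moreover have "Fl' \<le> Fl" by (simp add: Fl'_def)
  moreover have "((\<lambda>e. I e z) \<longlongrightarrow> f z) Fl'" for z
  proof -
    have "filterlim I (nhds f) Fl'"
      by (rule filterlim_mono[OF filterlim_filtercomap order_refl]) (simp add: Fl'_def)
    then show ?thesis
      using continuous_on_tendsto_compose[OF continuous_on_product_coordinates[of z], of I f Fl'] by simp
  qed
  ultimately show ?thesis by blast
qed

lemma upd_uminus: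
  "upd (\<lambda>\<alpha> a b. - G \<alpha> (- a) (- b)) (\<lambda>p. - Fn (- p)) dt dx (\<lambda>\<alpha> i. - V \<alpha> i) = (\<lambda>\<alpha> i. - upd G Fn dt dx V \<alpha> i)"
proof (intro ext)
  fix \<alpha> :: 'a and i
  have v: "- (\<chi> \<beta>. (- V \<beta> 1 - - V \<beta> 0) / dx) = (\<chi> \<beta>. (V \<beta> 1 - V \<beta> 0) / dx)"
    by (simp add: vec_eq_iff minus_divide_left)
  have q: "- ((- a - - b) / dx) = (a - b) / dx" for a b :: real by (simp add: minus_divide_left)
  show "upd (\<lambda>\<alpha> a b. - G \<alpha> (- a) (- b)) (\<lambda>p. - Fn (- p)) dt dx (\<lambda>\<alpha> i. - V \<alpha> i) \<alpha> i = - upd G Fn dt dx V \<alpha> i"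
    unfolding upd_def v q by simp
qed

text \<open>Bounds the time derivative of a test function from below by minus the time Lipschitz
  constant of the solution: contact from above is exploited at later times, contact from below at
  earlier times by \<open>derivative_ge_left\<close>.\<close>

lemma derivative_ge_right:
  assumes "(f has_real_derivative D) (at t0)" "0 < r" "\<And>t. t0 < t \<Longrightarrow> t < t0 + r \<Longrightarrow> - k * (t - t0) \<le> f t - f t0"
  shows "- k \<le> D"
proof -
  have "((\<lambda>t. (f t - f t0) / (t - t0)) \<longlongrightarrow> D) (at_right t0)"
    using has_field_derivative_at_within[OF assms(1)] by (simp add: has_field_derivative_iff)
  moreover have "\<forall>\<^sub>F t in at_right t0. - k \<le> (f t - f t0) / (t - t0)"
  proof -
    have "\<forall>\<^sub>F t in at_right t0. t \<in> {t0<..<t0 + r}" by (rule eventually_at_right_real) (use assms(2) in simp)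
    then show ?thesis by (rule eventually_mono) (use assms(3) in \<open>auto simp: pos_le_divide_eq\<close>)
  qed
  ultimately show ?thesis by (rule tendsto_lowerbound) simp
qed

lemma derivative_ge_left:
  assumes "(f has_real_derivative D) (at t0)" "0 < r" "\<And>t. t0 - r < t \<Longrightarrow> t < t0 \<Longrightarrow> f t - f t0 \<le> k * (t0 - t)"
  shows "- k \<le> D"
proof -
  have "((\<lambda>t. (f t - f t0) / (t - t0)) \<longlongrightarrow> D) (at_left t0)"
    using has_field_derivative_at_within[OF assms(1)] by (simp add: has_field_derivative_iff)
  moreover have "\<forall>\<^sub>F t in at_left t0. - k \<le> (f t - f t0) / (t - t0)"
  proof -
    have "\<forall>\<^sub>F t in at_left t0. t \<in> {t0 - r<..<t0}" by (rule eventually_at_left_real) (use assms(2) in simp)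
    then show ?thesis
    proof (rule eventually_mono)
      fix t assume t: "t \<in> {t0 - r<..<t0}"
      then have "f t - f t0 \<le> k * (t0 - t)" using assms(3) by auto
      then have "f t - f t0 \<le> - k * (t - t0)" by (simp add: algebra_simps)
      then show "- k \<le> (f t - f t0) / (t - t0)" using t by (simp add: neg_le_divide_eq)
    qed
  qed
  ultimately show ?thesis by (rule tendsto_lowerbound) simp
qed

lemma testfun_time_derivative:
  assumes "testfun T g" "0 < t0" "t0 < T"
  shows "((\<lambda>t. g \<alpha> (t, x)) has_real_derivative dt_g g \<alpha> t0 x) (at t0)"
proof -
  obtain D where D: "(g \<alpha> has_derivative D) (at (t0, x))" using assms unfolding testfun_def by fastforce
  have lin: "linear D" using D has_derivative_linear by auto
  have "((\<lambda>s. g \<alpha> (s, x)) has_derivative (\<lambda>h. D (h, 0))) (at t0)"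
    by (intro has_derivative_compose[where g = "g \<alpha>" and f = "\<lambda>s. (s, x)", OF _ D] has_derivative_Pair derivative_intros)
  moreover have "(\<lambda>h. D (h, 0)) = (*) (D (1, 0))"
  proof
    show "D (h, 0) = D (1, 0) * h" for h using linear_cmul[OF lin, of h "(1, 0)"] by simp
  qed
  ultimately show ?thesis
    unfolding dt_g_def frechet_derivative_at[OF D, symmetric] by (simp only: has_field_derivative_def)
qed

lemma phi_of_time_derivative:
  assumes "testfun T g" "0 < t0" "t0 < T"
  shows "((\<lambda>t. phi_of g t p) has_real_derivative dt_g g (fst p) t0 (snd p)) (at t0)"
  unfolding phi_of_def by (rule testfun_time_derivative[OF assms])

lemma time_slice_in_nbhd: "p \<in> jpts \<Longrightarrow> 0 \<le> t \<Longrightarrow> t < T \<Longrightarrow> \<bar>t - t0\<bar> < r \<Longrightarrow> (t, p) \<in> nbhd T t0 p r"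
  by (simp add: nbhd_def tjd_def)

lemma dt_g_junction:
  assumes "testfun T g" "0 < t0" "t0 < T"
  shows "dt_g g \<alpha> t0 0 = dt_g g \<beta> t0 0"
proof -
  have "((\<lambda>t. g \<beta> (t, 0)) has_real_derivative dt_g g \<alpha> t0 0) (at t0)"
  proof (rule has_field_derivative_transform_within_open[OF testfun_time_derivative[OF assms]])
    show "open {0<..<T}" "t0 \<in> {0<..<T}" using assms by auto
    show "g \<alpha> (t, 0) = g \<beta> (t, 0)" if "t \<in> {0<..<T}" for t using assms that unfolding testfun_def by auto
  qed
  then show ?thesis by (rule DERIV_unique[OF _ testfun_time_derivative[OF assms]])
qed

section \<open>Passing from the truncated to the original equation\<close>

context truncation begin

lemma Gt_diag_le: "Gt \<alpha> p p \<le> H \<alpha> p"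
proof -
  have "Gt \<alpha> p p \<le> max (Hplus (H \<alpha>) p) (Hminus (H \<alpha>) p)"
    unfolding Gt_def by (intro max.mono Hplus_mono Hminus_antimono qm) auto
  then show ?thesis by (simp add: max_Hplus_Hminus qm)
qed

lemma H_gt_K: "phi \<alpha> \<le> p \<Longrightarrow> K < H \<alpha> p"
proof -
  assume p: "phi \<alpha> \<le> p"
  have "Hplus (H \<alpha>) (phi \<alpha>) \<le> Hplus (H \<alpha>) p" using p by (intro Hplus_mono qm)
  moreover have "max (phi \<alpha>) (hp0 (H \<alpha>)) = phi \<alpha>" "max p (hp0 (H \<alpha>)) = p" using phi(2)[of \<alpha>] p by auto
  ultimately show ?thesis using phi(3)[of \<alpha>] by (simp add: Hplus_def)
qed

text \<open>The time slope of a test function is at least \<open>- K\<close>, so the truncated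
  inequality forces \<open>Gt\<close> or \<open>Ft\<close> to be at most \<open>K\<close>. Then
  \<open>Gt\<close> is not truncated, and in \<open>Ft\<close> only the clamp from above can be
  active; it lowers the arguments and hence gives \<open>F \<le> Ft\<close>, the favourable
  direction.\<close>

lemma relaxed_sub_of_trunc:
  assumes sub: "relaxed_sub T (\<lambda>\<alpha> p. Gt \<alpha> p p) Ft u" and lip: "lipschitz_tj K P' u"
  shows "relaxed_sub T H F u"
  unfolding relaxed_sub_def
proof (intro allI impI, elim conjE exE)
  fix g t0 p0 r
  assume g: "testfun T g" and t0: "0 < t0" "t0 < T" and p0: "p0 \<in> jpts" and r: "0 < r"
    and le: "\<forall>z\<in>nbhd T t0 p0 r. 0 < fst z \<longrightarrow> ustar T u (fst z) (snd z) \<le> ereal (phi_of g (fst z) (snd z))"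
    and eq: "ustar T u t0 p0 = ereal (phi_of g t0 p0)"
  have eq': "u t0 p0 = phi_of g t0 p0" using eq lipschitz_tj_ustar[OF lip, of t0 T p0] t0 p0 by simp
  have "- K \<le> dt_g g (fst p0) t0 (snd p0)"
  proof (rule derivative_ge_right[OF phi_of_time_derivative[OF g t0]])
    show "0 < min r (T - t0)" using r t0 by simp
    fix t assume t: "t0 < t" "t < t0 + min r (T - t0)"
    then have "(t, p0) \<in> nbhd T t0 p0 r" using t0 p0 by (intro time_slice_in_nbhd) auto
    then have "ustar T u t p0 \<le> ereal (phi_of g t p0)" using le t t0 by auto
    then have "u t p0 \<le> phi_of g t p0" using lipschitz_tj_ustar[OF lip, of t T p0] t t0 p0 by simp
    moreover have "\<bar>u t p0 - u t0 p0\<bar> \<le> K * \<bar>t - t0\<bar> + P' * jd p0 p0" using t t0 p0 by (intro lipschitz_tjD[OF lip]) auto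
    ultimately show "- K * (t - t0) \<le> phi_of g t p0 - phi_of g t0 p0" using eq' t by (simp add: abs_le_iff)
  qed
  then have dt: "- K \<le> dt_g g \<alpha> t0 (snd p0)" if "snd p0 = 0 \<or> \<alpha> = fst p0" for \<alpha>
    using that dt_g_junction[OF g t0, of \<alpha> "fst p0"] by auto
  have *: "if 0 < snd p0 then dt_g g (fst p0) t0 (snd p0) + Gt (fst p0) (dx_g g (fst p0) t0 (snd p0)) (dx_g g (fst p0) t0 (snd p0)) \<le> 0
     else dt_g g (fst p0) t0 0 + Ft (\<chi> \<beta>. dx_g g \<beta> t0 0) \<le> 0 \<or> (\<exists>\<alpha>. dt_g g \<alpha> t0 0 + Gt \<alpha> (dx_g g \<alpha> t0 0) (dx_g g \<alpha> t0 0) \<le> 0)"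
    using sub g t0 p0 r le eq unfolding relaxed_sub_def by blast
  have G: "Gt \<alpha> p p = H \<alpha> p" if "Gt \<alpha> p p \<le> K" for \<alpha> p
    using Gt_le_KD(3)[OF that] by (simp add: godunov_def max_Hplus_Hminus qm)
  show "if 0 < snd p0 then dt_g g (fst p0) t0 (snd p0) + H (fst p0) (dx_g g (fst p0) t0 (snd p0)) \<le> 0
     else dt_g g (fst p0) t0 0 + F (\<chi> \<beta>. dx_g g \<beta> t0 0) \<le> 0 \<or> (\<exists>\<alpha>. dt_g g \<alpha> t0 0 + H \<alpha> (dx_g g \<alpha> t0 0) \<le> 0)"
  proof (cases "0 < snd p0")
    case True
    then have 1: "dt_g g (fst p0) t0 (snd p0) + Gt (fst p0) (dx_g g (fst p0) t0 (snd p0)) (dx_g g (fst p0) t0 (snd p0)) \<le> 0" using * by simp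
    then have "Gt (fst p0) (dx_g g (fst p0) t0 (snd p0)) (dx_g g (fst p0) t0 (snd p0)) \<le> K" using dt[of "fst p0"] by simp
    then show ?thesis using 1 G True by simp
  next
    case False
    then have s0: "snd p0 = 0" using p0 by (simp add: jpts_def)
    have d: "- K \<le> dt_g g \<alpha> t0 0" for \<alpha> using dt[of \<alpha>] s0 by simp
    from * False consider "dt_g g (fst p0) t0 0 + Ft (\<chi> \<beta>. dx_g g \<beta> t0 0) \<le> 0"
      | \<alpha> where "dt_g g \<alpha> t0 0 + Gt \<alpha> (dx_g g \<alpha> t0 0) (dx_g g \<alpha> t0 0) \<le> 0" by auto
    then show ?thesis
    proof cases
      case 1
      let ?p = "\<chi> \<beta>. dx_g g \<beta> t0 0"
      have "Ft ?p \<le> K" using 1 d[of "fst p0"] by simp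
      then have "p0lo \<beta> < ?p $ \<beta>" for \<beta> by (rule Ft_le_KD)
      then have "F ?p \<le> Ft ?p" unfolding Ft_def
        by (intro F_antimono) (simp add: clamp0_def max_def min_def less_imp_le not_le)
      then show ?thesis using 1 False by auto
    next
      case 2
      then have "Gt \<alpha> (dx_g g \<alpha> t0 0) (dx_g g \<alpha> t0 0) \<le> K" using d[of \<alpha>] by simp
      then have "dt_g g \<alpha> t0 0 + H \<alpha> (dx_g g \<alpha> t0 0) \<le> 0" using 2 G by metis
      then show ?thesis using False by auto
    qed
  qed
qed

text \<open>\<open>Gt\<close> never exceeds \<open>H\<close> on the diagonal, and the clamp from
  below lowers \<open>F\<close>, so both are harmless. If a junction slope reaches
  \<open>phi\<close>, the Hamiltonian of that branch exceeds \<open>K\<close>, while the time slope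
  is at least \<open>- K\<close>: the Hamiltonian alternative of the relaxed condition
  holds.\<close>

lemma relaxed_super_of_trunc:
  assumes sup: "relaxed_super T (\<lambda>\<alpha> p. Gt \<alpha> p p) Ft u" and lip: "lipschitz_tj K P' u"
  shows "relaxed_super T H F u"
  unfolding relaxed_super_def
proof (intro allI impI, elim conjE exE)
  fix g t0 p0 r
  assume g: "testfun T g" and t0: "0 < t0" "t0 < T" and p0: "p0 \<in> jpts" and r: "0 < r"
    and ge: "\<forall>z\<in>nbhd T t0 p0 r. 0 < fst z \<longrightarrow> ereal (phi_of g (fst z) (snd z)) \<le> lstar T u (fst z) (snd z)"
    and eq: "lstar T u t0 p0 = ereal (phi_of g t0 p0)"
  have ls: "lstar T u t p0 = ereal (u t p0)" if "0 \<le> t" "t < T" for t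
    using lipschitz_tj_ustar[OF lipschitz_tj_uminus[OF lip] that p0] unfolding ustar_uminus
    by (simp add: ereal_uminus_eq_reorder)
  have eq': "u t0 p0 = phi_of g t0 p0" using eq ls[of t0] t0 by simp
  have "- K \<le> dt_g g (fst p0) t0 (snd p0)"
  proof (rule derivative_ge_left[OF phi_of_time_derivative[OF g t0]])
    show "0 < min r t0" using r t0 by simp
    fix t assume t: "t0 - min r t0 < t" "t < t0"
    then have "(t, p0) \<in> nbhd T t0 p0 r" using t0 p0 by (intro time_slice_in_nbhd) auto
    then have "ereal (phi_of g t p0) \<le> lstar T u t p0" using ge t t0 by auto
    then have "phi_of g t p0 \<le> u t p0" using ls[of t] t t0 by simp
    moreover have "\<bar>u t p0 - u t0 p0\<bar> \<le> K * \<bar>t - t0\<bar> + P' * jd p0 p0" using t t0 p0 by (intro lipschitz_tjD[OF lip]) auto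
    ultimately show "phi_of g t p0 - phi_of g t0 p0 \<le> K * (t0 - t)" using eq' t by (simp add: abs_le_iff)
  qed
  then have dt: "- K \<le> dt_g g \<alpha> t0 (snd p0)" if "snd p0 = 0 \<or> \<alpha> = fst p0" for \<alpha>
    using that dt_g_junction[OF g t0, of \<alpha> "fst p0"] by auto
  have *: "if 0 < snd p0 then dt_g g (fst p0) t0 (snd p0) + Gt (fst p0) (dx_g g (fst p0) t0 (snd p0)) (dx_g g (fst p0) t0 (snd p0)) \<ge> 0
     else dt_g g (fst p0) t0 0 + Ft (\<chi> \<beta>. dx_g g \<beta> t0 0) \<ge> 0 \<or> (\<exists>\<alpha>. dt_g g \<alpha> t0 0 + Gt \<alpha> (dx_g g \<alpha> t0 0) (dx_g g \<alpha> t0 0) \<ge> 0)"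
    using sup g t0 p0 r ge eq unfolding relaxed_super_def by blast
  show "if 0 < snd p0 then dt_g g (fst p0) t0 (snd p0) + H (fst p0) (dx_g g (fst p0) t0 (snd p0)) \<ge> 0
     else dt_g g (fst p0) t0 0 + F (\<chi> \<beta>. dx_g g \<beta> t0 0) \<ge> 0 \<or> (\<exists>\<alpha>. dt_g g \<alpha> t0 0 + H \<alpha> (dx_g g \<alpha> t0 0) \<ge> 0)"
  proof (cases "0 < snd p0")
    case True
    then show ?thesis using * Gt_diag_le[of "fst p0" "dx_g g (fst p0) t0 (snd p0)"] by auto
  next
    case False
    then have s0: "snd p0 = 0" using p0 by (simp add: jpts_def)
    have d: "- K \<le> dt_g g \<alpha> t0 0" for \<alpha> using dt[of \<alpha>] s0 by simp
    from * False consider "dt_g g (fst p0) t0 0 + Ft (\<chi> \<beta>. dx_g g \<beta> t0 0) \<ge> 0"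
      | \<alpha> where "dt_g g \<alpha> t0 0 + Gt \<alpha> (dx_g g \<alpha> t0 0) (dx_g g \<alpha> t0 0) \<ge> 0" by auto
    then show ?thesis
    proof cases
      case 1
      let ?p = "\<chi> \<beta>. dx_g g \<beta> t0 0"
      show ?thesis
      proof (cases "\<exists>\<beta>. phi \<beta> \<le> ?p $ \<beta>")
        case True
        then obtain \<beta> where "phi \<beta> \<le> dx_g g \<beta> t0 0" by auto
        then have "K < H \<beta> (dx_g g \<beta> t0 0)" by (rule H_gt_K)
        then have "0 \<le> dt_g g \<beta> t0 0 + H \<beta> (dx_g g \<beta> t0 0)" using d[of \<beta>] by linarith
        then show ?thesis using False by auto
      next
        case not: False
        then have "Ft ?p \<le> F ?p" unfolding Ft_def
          by (intro F_antimono) (auto simp: clamp0_def not_le)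
        then show ?thesis using 1 False by auto
      qed
    next
      case 2
      then have "0 \<le> dt_g g \<alpha> t0 0 + H \<alpha> (dx_g g \<alpha> t0 0)" using Gt_diag_le[of \<alpha> "dx_g g \<alpha> t0 0"] by linarith
      then show ?thesis using False by auto
    qed
  qed
qed

end

text \<open>Piecewise constant, so grid values are reproduced exactly; the jumps add terms of the
  order of the mesh to the Lipschitz estimate, and these vanish in the limit.\<close>

definition interp :: "(nat \<Rightarrow> 'n \<Rightarrow> nat \<Rightarrow> real) \<Rightarrow> real \<times> real \<Rightarrow> real \<Rightarrow> 'n \<times> real \<Rightarrow> real" where
  "interp V e t p = V (nat \<lfloor>t / fst e\<rfloor>) (fst p) (nat \<lfloor>snd p / snd e\<rfloor>)"

lemma interp_grid: "0 < fst e \<Longrightarrow> 0 < snd e \<Longrightarrow> interp V e (real n * fst e) (\<alpha>, real i * snd e) = V n \<alpha> i"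
  by (simp add: interp_def)

lemma grid_distance:
  assumes "0 < h" "0 \<le> t" "0 \<le> s"
  shows "\<bar>real (nat \<lfloor>t / h\<rfloor>) - real (nat \<lfloor>s / h\<rfloor>)\<bar> * h \<le> \<bar>t - s\<bar> + h"
proof -
  have "\<bar>real (nat \<lfloor>t / h\<rfloor>) - real (nat \<lfloor>s / h\<rfloor>)\<bar> * h = \<bar>real (nat \<lfloor>t / h\<rfloor>) * h - real (nat \<lfloor>s / h\<rfloor>) * h\<bar>"
    using assms(1) by (simp add: abs_mult flip: left_diff_distrib)
  then show ?thesis using floor_grid[OF assms(1,2)] floor_grid[OF assms(1,3)] by linarith
qed

section \<open>Cluster points of the numerical solutions\<close>

context truncation begin

lemma interp_lipschitz:
  assumes u0: "\<And>p q. p \<in> jpts \<Longrightarrow> q \<in> jpts \<Longrightarrow> \<bar>u0 p - u0 q\<bar> \<le> L0 * jd p q"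
    and e: "0 < fst e" "0 < snd e" "cfl (snd e / fst e)"
    and ts: "0 \<le> t" "0 \<le> s" and pq: "p \<in> jpts" "q \<in> jpts"
  shows "\<bar>interp (scheme H F u0 (fst e) (snd e)) e t p - interp (scheme H F u0 (fst e) (snd e)) e s q\<bar>
     \<le> K * (\<bar>t - s\<bar> + fst e) + P * (jd p q + 2 * snd e)"
proof -
  let ?V = "scheme H F u0 (fst e) (snd e)"
  obtain \<alpha> x where p: "p = (\<alpha>, x)" "0 \<le> x" using pq by (cases p) (auto simp: jpts_def)
  obtain \<beta> y where q: "q = (\<beta>, y)" "0 \<le> y" using pq by (cases q) (auto simp: jpts_def)
  define n m i j where "n = nat \<lfloor>t / fst e\<rfloor>" and "m = nat \<lfloor>s / fst e\<rfloor>" and "i = nat \<lfloor>x / snd e\<rfloor>" and "j = nat \<lfloor>y / snd e\<rfloor>"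
  have "\<bar>?V n \<alpha> i - ?V m \<alpha> i\<bar> \<le> K * (\<bar>real n - real m\<bar> * fst e)"
    by (rule scheme_time_lipschitz[OF u0 e])
  also have "\<dots> \<le> K * (\<bar>t - s\<bar> + fst e)"
    unfolding n_def m_def by (intro mult_left_mono grid_distance K_nonneg e ts)
  finally have 1: "\<bar>?V n \<alpha> i - ?V m \<alpha> i\<bar> \<le> K * (\<bar>t - s\<bar> + fst e)" .
  have sp: "\<bar>?V m \<gamma> i' - ?V m \<gamma> j'\<bar> \<le> P * (\<bar>real i' - real j'\<bar> * snd e)" for \<gamma> i' j'
    by (rule scheme_space_lipschitz[OF u0 e])
  have 2: "\<bar>?V m \<alpha> i - ?V m \<beta> j\<bar> \<le> P * (jd p q + 2 * snd e)"
  proof (cases "\<alpha> = \<beta>")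
    case True
    have "\<bar>real i - real j\<bar> * snd e \<le> \<bar>x - y\<bar> + snd e" unfolding i_def j_def by (intro grid_distance e p q)
    also have "\<dots> \<le> jd p q + 2 * snd e" using e by (simp add: p q True jd_simps)
    finally have "P * (\<bar>real i - real j\<bar> * snd e) \<le> P * (jd p q + 2 * snd e)" by (intro mult_left_mono P_nonneg)
    then show ?thesis using sp[of \<alpha> i j] True by simp
  next
    case False
    have "?V m \<alpha> 0 = ?V m \<beta> 0" by (rule junction_scheme[OF u0 e])
    then have "\<bar>?V m \<alpha> i - ?V m \<beta> j\<bar> \<le> P * (real i * snd e) + P * (real j * snd e)"
      using sp[of \<alpha> i 0] sp[of \<beta> j 0] by simp
    also have "\<dots> = P * (real i * snd e + real j * snd e)" by (simp add: distrib_left)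
    also have "\<dots> \<le> P * (jd p q + 2 * snd e)"
    proof (intro mult_left_mono P_nonneg)
      have "real i * snd e \<le> x" "real j * snd e \<le> y"
        unfolding i_def j_def using floor_grid(1)[OF e(2)] p(2) q(2) by auto
      then show "real i * snd e + real j * snd e \<le> jd p q + 2 * snd e" using e by (simp add: p q False jd_simps)
    qed
    finally show ?thesis .
  qed
  have "interp ?V e t p = ?V n \<alpha> i" "interp ?V e s q = ?V m \<beta> j"
    by (simp_all add: interp_def p q n_def m_def i_def j_def)
  then show ?thesis using 1 2 by linarith
qed

lemma interp_initial:
  assumes u0: "\<And>p q. p \<in> jpts \<Longrightarrow> q \<in> jpts \<Longrightarrow> \<bar>u0 p - u0 q\<bar> \<le> L0 * jd p q"
    and e: "0 < fst e" "0 < snd e" and p: "p \<in> jpts"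
  shows "\<bar>interp (scheme H F u0 (fst e) (snd e)) e 0 p - u0 p\<bar> \<le> L0 * snd e"
proof -
  obtain \<alpha> x where px: "p = (\<alpha>, x)" "0 \<le> x" using p by (cases p) (auto simp: jpts_def)
  let ?y = "real (nat \<lfloor>x / snd e\<rfloor>) * snd e"
  have y: "?y \<le> x" "x < ?y + snd e" using floor_grid[OF e(2) px(2)] by auto
  have "\<bar>u0 (\<alpha>, ?y) - u0 (\<alpha>, x)\<bar> \<le> L0 * jd (\<alpha>, ?y) (\<alpha>, x)" using e px by (intro u0) (auto simp: jpts_def)
  also have "\<dots> \<le> L0 * snd e" using y by (intro mult_left_mono L0) (simp add: jd_simps)
  finally show ?thesis by (simp add: interp_def px)
qed

lemma cluster_solution:
  assumes u0: "\<And>p q. p \<in> jpts \<Longrightarrow> q \<in> jpts \<Longrightarrow> \<bar>u0 p - u0 q\<bar> \<le> L0 * jd p q"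
    and Hc: "\<And>\<alpha>. continuous_on UNIV (H \<alpha>)" and Fc: "continuous_on UNIV F"
    and nb: "Fl \<noteq> bot" and adm: "\<forall>\<^sub>F e in Fl. 0 < fst e \<and> 0 < snd e \<and> cfl (snd e / fst e)"
    and small: "\<And>d. 0 < d \<Longrightarrow> \<forall>\<^sub>F e in Fl. fst e < d \<and> snd e < d"
  shows "\<exists>Fl' u. Fl' \<noteq> bot \<and> Fl' \<le> Fl \<and> lipschitz_tj K P u \<and> (\<forall>T>0. relaxed_solution T H F u0 u) \<and>
    (\<forall>R \<eta>. 0 < \<eta> \<longrightarrow> (\<forall>\<^sub>F e in Fl'. \<forall>n \<alpha> i. real n * fst e \<le> R \<longrightarrow> real i * snd e \<le> R \<longrightarrow>
      \<bar>scheme H F u0 (fst e) (snd e) n \<alpha> i - u (real n * fst e) (\<alpha>, real i * snd e)\<bar> \<le> \<eta>))"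
proof -
  define V where "V = (\<lambda>e::real\<times>real. scheme H F u0 (fst e) (snd e))"
  define dom where "dom z \<longleftrightarrow> 0 \<le> fst z \<and> snd z \<in> (jpts :: ('n \<times> real) set)" for z :: "real \<times> ('n \<times> real)"
  \<comment> \<open>Extended by 0 outside the domain, so that the compactness argument applies to
    functions on the full product type.\<close>
  define I where "I = (\<lambda>e z. if dom z then interp (V e) e (fst z) (snd z) else 0)"
  define B where "B = (\<lambda>z. \<bar>u0 (snd z)\<bar> + L0 + K * (\<bar>fst z\<bar> + 1) + P * 2)"
  have lipV: "\<bar>interp (V e) e t p - interp (V e) e s q\<bar> \<le> K * (\<bar>t - s\<bar> + fst e) + P * (jd p q + 2 * snd e)"
    if "0 < fst e \<and> 0 < snd e \<and> cfl (snd e / fst e)" "0 \<le> t" "0 \<le> s" "p \<in> jpts" "q \<in> jpts" for e t s p q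
    unfolding V_def using that by (intro interp_lipschitz[OF u0]) auto
  have iniV: "\<bar>interp (V e) e 0 p - u0 p\<bar> \<le> L0 * snd e" if "0 < fst e \<and> 0 < snd e \<and> cfl (snd e / fst e)" "p \<in> jpts" for e p
    unfolding V_def using that by (intro interp_initial[OF u0]) auto
  have "\<forall>\<^sub>F e in Fl. \<forall>z. \<bar>I e z\<bar> \<le> B z"
    using adm small[of 1, simplified]
  proof eventually_elim
    case (elim e)
    show ?case
    proof
      fix z show "\<bar>I e z\<bar> \<le> B z"
      proof (cases "dom z")
        case False
        then show ?thesis using K_nonneg P_nonneg L0 by (simp add: I_def B_def)
      next
        case True
        then have z: "0 \<le> fst z" "snd z \<in> jpts" by (auto simp: dom_def)
        have "\<bar>interp (V e) e (fst z) (snd z) - interp (V e) e 0 (snd z)\<bar> \<le> K * (\<bar>fst z - 0\<bar> + fst e) + P * (jd (snd z) (snd z) + 2 * snd e)"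
          using z elim by (intro lipV) auto
        also have "\<dots> \<le> K * (\<bar>fst z\<bar> + 1) + P * 2"
          using elim K_nonneg P_nonneg by (intro add_mono mult_left_mono) auto
        finally have 1: "\<bar>interp (V e) e (fst z) (snd z) - interp (V e) e 0 (snd z)\<bar> \<le> K * (\<bar>fst z\<bar> + 1) + P * 2" .
        have "\<bar>interp (V e) e 0 (snd z) - u0 (snd z)\<bar> \<le> L0 * snd e" using z elim by (intro iniV) auto
        also have "\<dots> \<le> L0 * 1" using elim L0 by (intro mult_left_mono) auto
        finally show ?thesis using 1 True unfolding I_def B_def by simp
      qed
    qed
  qed
  from pointwise_cluster[OF nb this] obtain Fl' f where Fl': "Fl' \<noteq> bot" "Fl' \<le> Fl"
    and lim: "\<And>z. ((\<lambda>e. I e z) \<longlongrightarrow> f z) Fl'" by blast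
  define u where "u = (\<lambda>t p. f (t, p))"
  have adm': "\<forall>\<^sub>F e in Fl'. 0 < fst e \<and> 0 < snd e \<and> cfl (snd e / fst e)" by (rule filter_leD[OF Fl'(2) adm])
  have small': "\<forall>\<^sub>F e in Fl'. fst e < d \<and> snd e < d" if "0 < d" for d by (rule filter_leD[OF Fl'(2) small[OF that]])
  have limu: "((\<lambda>e. interp (V e) e t p) \<longlongrightarrow> u t p) Fl'" if "0 \<le> t" "p \<in> jpts" for t p
    using lim[of "(t, p)"] that by (simp add: I_def dom_def u_def)
  have lim0: "(fst \<longlongrightarrow> 0) Fl'" "(snd \<longlongrightarrow> 0) Fl'"
  proof -
    have "\<forall>\<^sub>F e in Fl'. dist (fst e) 0 < d" "\<forall>\<^sub>F e in Fl'. dist (snd e) 0 < d" if "0 < d" for d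
      using small'[OF that] adm' by (eventually_elim, auto simp: dist_real_def)+
    then show "(fst \<longlongrightarrow> 0) Fl'" "(snd \<longlongrightarrow> 0) Fl'" by (auto intro!: tendstoI)
  qed
  have lip: "lipschitz_tj K P u"
    unfolding lipschitz_tj_def
  proof (intro conjI allI impI K_nonneg P_nonneg)
    fix t s :: real and p q :: "'n \<times> real" assume a: "0 \<le> t" "0 \<le> s" "p \<in> jpts" "q \<in> jpts"
    have "((\<lambda>e. K * (\<bar>t - s\<bar> + fst e) + P * (jd p q + 2 * snd e)) \<longlongrightarrow> K * (\<bar>t - s\<bar> + 0) + P * (jd p q + 2 * 0)) Fl'"
      by (intro tendsto_intros lim0)
    moreover have "((\<lambda>e. \<bar>interp (V e) e t p - interp (V e) e s q\<bar>) \<longlongrightarrow> \<bar>u t p - u s q\<bar>) Fl'"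
      by (intro tendsto_intros limu a)
    moreover have "\<forall>\<^sub>F e in Fl'. \<bar>interp (V e) e t p - interp (V e) e s q\<bar> \<le> K * (\<bar>t - s\<bar> + fst e) + P * (jd p q + 2 * snd e)"
      using adm' by (rule eventually_mono) (intro lipV a)
    ultimately have "\<bar>u t p - u s q\<bar> \<le> K * (\<bar>t - s\<bar> + 0) + P * (jd p q + 2 * 0)"
      by (rule tendsto_le[OF Fl'(1)])
    then show "\<bar>u t p - u s q\<bar> \<le> K * \<bar>t - s\<bar> + P * jd p q" by simp
  qed
  have ini: "u 0 p = u0 p" if p: "p \<in> jpts" for p
  proof -
    have "((\<lambda>e. L0 * snd e) \<longlongrightarrow> L0 * 0) Fl'" by (intro tendsto_intros lim0)
    moreover have "((\<lambda>e. \<bar>interp (V e) e 0 p - u0 p\<bar>) \<longlongrightarrow> \<bar>u 0 p - u0 p\<bar>) Fl'" by (intro tendsto_intros limu p) simp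
    moreover have "\<forall>\<^sub>F e in Fl'. \<bar>interp (V e) e 0 p - u0 p\<bar> \<le> L0 * snd e"
      using adm' by (rule eventually_mono) (intro iniV p)
    ultimately have "\<bar>u 0 p - u0 p\<bar> \<le> L0 * 0" by (rule tendsto_le[OF Fl'(1)])
    then show ?thesis by simp
  qed
  have unif: "\<forall>\<^sub>F e in Fl'. \<forall>n \<alpha> i. real n * fst e \<le> R \<longrightarrow> real i * snd e \<le> R \<longrightarrow>
      \<bar>V e n \<alpha> i - u (real n * fst e) (\<alpha>, real i * snd e)\<bar> \<le> \<eta>" if \<eta>: "0 < \<eta>" for R \<eta>
  proof -
    \<comment> \<open>Spacing of a finite reference grid. Moving to its nodes costs at most
      \<open>(3 * K + 4 * P) * h \<le> \<eta> / 2\<close> by the two Lipschitz estimates, and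
      pointwise convergence at finitely many nodes provides the other half.\<close>
    define h where "h = \<eta> / (2 * (3 * K + 4 * P + 1))"
    have KP: "0 < 3 * K + 4 * P + 1" using K_nonneg P_nonneg by simp
    have h: "0 < h" using \<eta> KP by (simp add: h_def)
    have hK: "(3 * K + 4 * P) * h \<le> \<eta> / 2"
    proof -
      have "(3 * K + 4 * P) * h \<le> (3 * K + 4 * P + 1) * h" using h by (intro mult_right_mono) auto
      also have "\<dots> = \<eta> / 2"
      proof -
        have "c * (\<eta> / (2 * c)) = \<eta> / 2" if "0 < c" for c using that by simp
        from this[OF KP] show ?thesis by (simp only: h_def)
      qed
      finally show ?thesis .
    qed
    define M where "M = nat \<lfloor>R / h\<rfloor>"
    have "\<forall>\<^sub>F e in Fl'. \<forall>(j, \<alpha>, k)\<in>{..M} \<times> (UNIV :: 'n set) \<times> {..M}. \<bar>interp (V e) e (real j * h) (\<alpha>, real k * h) - u (real j * h) (\<alpha>, real k * h)\<bar> < \<eta> / 2"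
    proof (rule eventually_ball_finite, simp, clarify)
      fix j \<alpha> k
      have "((\<lambda>e. interp (V e) e (real j * h) (\<alpha>, real k * h)) \<longlongrightarrow> u (real j * h) (\<alpha>, real k * h)) Fl'"
        using h by (intro limu) (auto simp: jpts_def)
      from tendstoD[OF this, of "\<eta> / 2"] \<eta>
      show "\<forall>\<^sub>F e in Fl'. \<bar>interp (V e) e (real j * h) (\<alpha>, real k * h) - u (real j * h) (\<alpha>, real k * h)\<bar> < \<eta> / 2"
        by (simp add: dist_real_def)
    qed
    then show ?thesis using adm' small'[OF h]
    proof eventually_elim
      case (elim e)
      show ?case
      proof (intro allI impI)
        fix n \<alpha> i assume R: "real n * fst e \<le> R" "real i * snd e \<le> R"
        define t x where "t = real n * fst e" and "x = real i * snd e"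
        have tx: "0 \<le> t" "0 \<le> x" using elim by (auto simp: t_def x_def)
        define j k where "j = nat \<lfloor>t / h\<rfloor>" and "k = nat \<lfloor>x / h\<rfloor>"
        have jk: "real j * h \<le> t" "t < real j * h + h" "real k * h \<le> x" "x < real k * h + h"
          unfolding j_def k_def using floor_grid[OF h tx(1)] floor_grid[OF h tx(2)] by auto
        have "j \<le> M" "k \<le> M" unfolding j_def k_def M_def using R h
          by (auto intro!: nat_mono floor_mono divide_right_mono simp: t_def x_def)
        then have 1: "\<bar>interp (V e) e (real j * h) (\<alpha>, real k * h) - u (real j * h) (\<alpha>, real k * h)\<bar> < \<eta> / 2"
          using elim(1) by auto
        have "\<bar>interp (V e) e t (\<alpha>, x) - interp (V e) e (real j * h) (\<alpha>, real k * h)\<bar>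
          \<le> K * (\<bar>t - real j * h\<bar> + fst e) + P * (jd (\<alpha>, x) (\<alpha>, real k * h) + 2 * snd e)"
          using elim tx h by (intro lipV) (auto simp: jpts_def)
        also have "\<dots> \<le> K * (2 * h) + P * (3 * h)"
          using jk elim by (intro add_mono mult_left_mono K_nonneg P_nonneg) (auto simp: jd_simps)
        finally have 2: "\<bar>interp (V e) e t (\<alpha>, x) - interp (V e) e (real j * h) (\<alpha>, real k * h)\<bar> \<le> K * (2 * h) + P * (3 * h)" .
        have "\<bar>u t (\<alpha>, x) - u (real j * h) (\<alpha>, real k * h)\<bar> \<le> K * \<bar>t - real j * h\<bar> + P * jd (\<alpha>, x) (\<alpha>, real k * h)"
          using tx h by (intro lipschitz_tjD[OF lip]) (auto simp: jpts_def)
        also have "\<dots> \<le> K * h + P * h"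
          using jk by (intro add_mono mult_left_mono K_nonneg P_nonneg) (auto simp: jd_simps)
        finally have 3: "\<bar>u t (\<alpha>, x) - u (real j * h) (\<alpha>, real k * h)\<bar> \<le> K * h + P * h" .
        have "K * (2 * h) + P * (3 * h) + (K * h + P * h) \<le> \<eta> / 2" using hK by (simp add: algebra_simps)
        then have "\<bar>interp (V e) e t (\<alpha>, x) - u t (\<alpha>, x)\<bar> \<le> \<eta>" using 1 2 3 by linarith
        then show "\<bar>V e n \<alpha> i - u (real n * fst e) (\<alpha>, real i * snd e)\<bar> \<le> \<eta>"
          using interp_grid[of e "V e" n \<alpha> i] elim by (simp add: t_def x_def)
      qed
    qed
  qed
  have ucont: "\<exists>d>0. \<forall>t x. 0 \<le> t \<longrightarrow> 0 \<le> x \<longrightarrow> \<bar>t - t0\<bar> < d \<longrightarrow> \<bar>x - x0\<bar> < d \<longrightarrow> \<bar>v t (\<alpha>, x) - v t0 (\<alpha>, x0)\<bar> < \<eta>"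
    if v: "lipschitz_tj K P v" and "0 \<le> t0" "0 \<le> x0" "0 < \<eta>" for v :: "real \<Rightarrow> 'n \<times> real \<Rightarrow> real" and \<alpha> t0 x0 \<eta>
  proof (intro exI[of _ "\<eta> / (K + P + 1)"] conjI allI impI)
    have KP: "0 < K + P + 1" using K_nonneg P_nonneg by simp
    then show "0 < \<eta> / (K + P + 1)" using that by simp
    fix t x assume a: "0 \<le> t" "0 \<le> x" "\<bar>t - t0\<bar> < \<eta> / (K + P + 1)" "\<bar>x - x0\<bar> < \<eta> / (K + P + 1)"
    have "\<bar>v t (\<alpha>, x) - v t0 (\<alpha>, x0)\<bar> \<le> K * \<bar>t - t0\<bar> + P * jd (\<alpha>, x) (\<alpha>, x0)"
      using a that by (intro lipschitz_tjD[OF v]) (auto simp: jpts_def)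
    also have "\<dots> \<le> K * (\<eta> / (K + P + 1)) + P * (\<eta> / (K + P + 1))"
      using a by (intro add_mono mult_left_mono K_nonneg P_nonneg) (auto simp: jd_simps)
    also have "\<dots> = (K + P) * \<eta> / (K + P + 1)" by (simp add: add_divide_distrib distrib_right)
    also have "\<dots> < \<eta>" using KP that by (simp add: pos_divide_less_eq algebra_simps)
    finally show "\<bar>v t (\<alpha>, x) - v t0 (\<alpha>, x0)\<bar> < \<eta>" .
  qed
  have Gtc: "continuous_on UNIV (\<lambda>z. Gt \<alpha> (fst z) (snd z))" for \<alpha>
    unfolding Gt_def Hplus_def Hminus_def
    by (intro continuous_intros continuous_on_compose2[OF Hc]) auto
  have Ftc: "continuous_on UNIV Ft"
    unfolding Ft_def[abs_def] clamp0_def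
    by (intro continuous_on_compose2[OF Fc] continuous_on_vec_lambda continuous_intros) auto
  have sch: "\<forall>\<^sub>F e in Fl'. 0 < fst e \<and> 0 < snd e \<and> mono_scheme Gt Ft (snd e / fst e) \<and>
      (\<forall>n. V e (Suc n) = upd Gt Ft (fst e) (snd e) (V e n)) \<and> (\<forall>n. junction_grid (V e n))"
    using adm'
  proof eventually_elim
    case (elim e)
    show ?case
    proof (intro conjI allI)
      show "mono_scheme Gt Ft (snd e / fst e)" using elim by (intro mono_scheme_trunc) auto
      show "V e (Suc n) = upd Gt Ft (fst e) (snd e) (V e n)" for n
        unfolding V_def using elim by (intro scheme_Suc_trunc[OF u0]) auto
      show "junction_grid (V e n)" for n
        unfolding V_def junction_grid_def using elim junction_scheme[OF u0, where dt = "fst e" and dx = "snd e"] by blast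
    qed (use elim in auto)
  qed
  interpret S: scheme_limit Fl' Gt Ft V u
    by unfold_locales (use Fl' sch small' unif ucont[OF lip] Gtc Ftc in auto)
  \<comment> \<open>The negated scheme makes \<open>- u\<close> a subsolution of the dual problem; a
    second change of sign yields the supersolution property of \<open>u\<close>.\<close>
  interpret D: scheme_limit Fl' "\<lambda>\<alpha> a b. - Gt \<alpha> (- a) (- b)" "\<lambda>p. - Ft (- p)" "\<lambda>e n \<alpha> i. - V e n \<alpha> i" "\<lambda>t p. - u t p"
  proof
    show "\<forall>\<^sub>F e in Fl'. 0 < fst e \<and> 0 < snd e \<and> mono_scheme (\<lambda>\<alpha> a b. - Gt \<alpha> (- a) (- b)) (\<lambda>p. - Ft (- p)) (snd e / fst e) \<and>
      (\<forall>n. (\<lambda>\<alpha> i. - V e (Suc n) \<alpha> i) = upd (\<lambda>\<alpha> a b. - Gt \<alpha> (- a) (- b)) (\<lambda>p. - Ft (- p)) (fst e) (snd e) (\<lambda>\<alpha> i. - V e n \<alpha> i)) \<and>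
      (\<forall>n. junction_grid (\<lambda>\<alpha> i. - V e n \<alpha> i))"
      using sch by (rule eventually_mono) (auto simp: upd_uminus mono_scheme_dual junction_grid_def)
    show "\<forall>\<^sub>F e in Fl'. \<forall>n \<alpha> i. real n * fst e \<le> R \<longrightarrow> real i * snd e \<le> R \<longrightarrow>
      \<bar>- V e n \<alpha> i - - u (real n * fst e) (\<alpha>, real i * snd e)\<bar> \<le> \<eta>" if "0 < \<eta>" for R \<eta>
      using unif[OF that, of R] by (rule eventually_mono) (simp add: abs_minus_commute)
    show "continuous_on UNIV (\<lambda>z. - Gt \<alpha> (- fst z) (- snd z))" for \<alpha>
    proof -
      have "continuous_on UNIV (\<lambda>z::real \<times> real. (- fst z, - snd z))" by (intro continuous_intros)
      from continuous_on_compose2[OF Gtc[of \<alpha>] this] show ?thesis by (intro continuous_on_minus) simp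
    qed
    show "continuous_on UNIV (\<lambda>p. - Ft (- p))"
      by (intro continuous_on_minus continuous_on_compose2[OF Ftc] continuous_intros) auto
  qed (use Fl' small' ucont[OF lipschitz_tj_uminus[OF lip]] in auto)
  have "relaxed_solution T H F u0 u" if T: "0 < T" for T
    unfolding relaxed_solution_def
  proof (intro conjI ballI)
    show "junction_fun T u" unfolding junction_fun_def using lipschitz_tj_junction[OF lip] by blast
    show "loc_bounded T u" by (rule lipschitz_tj_loc_bounded[OF lip])
    show "relaxed_sub T H F u" by (rule relaxed_sub_of_trunc[OF S.relaxed_sub_limit[OF lip] lip])
    have "relaxed_super T (\<lambda>\<alpha> p. Gt \<alpha> p p) Ft u"
      using relaxed_super_uminus[OF D.relaxed_sub_limit[OF lipschitz_tj_uminus[OF lip], of T]]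
      unfolding dual_def by simp
    then show "relaxed_super T H F u" by (rule relaxed_super_of_trunc[OF _ lip])
    fix p :: "'n \<times> real" assume p: "p \<in> jpts"
    show "ustar T u 0 p \<le> ereal (u0 p)" using lipschitz_tj_ustar[OF lip, of 0 T p] T p ini[OF p] by simp
    have "ustar T (\<lambda>t p. - u t p) 0 p = ereal (- u0 p)"
      using lipschitz_tj_ustar[OF lipschitz_tj_uminus[OF lip], of 0 T p] T p ini[OF p] by simp
    then have "lstar T u 0 p = ereal (u0 p)" unfolding ustar_uminus by (simp add: ereal_uminus_eq_reorder)
    then show "ereal (u0 p) \<le> lstar T u 0 p" by simp
  qed
  then show ?thesis using Fl' lip unif unfolding V_def by blast
qed

end

text \<open>A global minimizer exists by coercivity and belongs to the convex sublevel set through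
  any point \<open>a\<close>, so \<open>h\<close> does not exceed \<open>h a\<close> between
  \<open>a\<close> and the minimizer. This justifies the choice made in \<open>hp0\<close>.\<close>

lemma quasi_min_of_quasi_convex:
  assumes cont: "continuous_on UNIV h" and coer: "coercive h" and qc: "quasi_convex h"
  shows "quasi_min h"
proof -
  obtain R where R: "R > 0" "\<And>p. R \<le> \<bar>p\<bar> \<Longrightarrow> h 0 \<le> h p" using coerciveD[OF coer] by blast
  obtain m where m: "m \<in> {-R..R}" "\<And>p. p \<in> {-R..R} \<Longrightarrow> h m \<le> h p"
    using continuous_attains_inf[of "{-R..R}" h] continuous_on_subset[OF cont] R(1) by auto
  have min: "h m \<le> h p" for p
  proof (cases "p \<in> {-R..R}")
    case False
    then have "h 0 \<le> h p" by (intro R(2)) auto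
    moreover have "h m \<le> h 0" using R(1) by (intro m(2)) auto
    ultimately show ?thesis by simp
  qed (rule m(2))
  have conv: "h b \<le> h a" if "b \<in> closed_segment a m" for a b
  proof -
    have "convex {p. h p \<le> h a}" using qc by (simp add: quasi_convex_def)
    then have "closed_segment a m \<subseteq> {p. h p \<le> h a}" using min by (intro closed_segment_subset) auto
    then show ?thesis using that by auto
  qed
  have "antimono_on {..m} h \<and> mono_on {m..} h"
  proof
    show "antimono_on {..m} h"
      by (rule monotone_onI) (rule conv, simp add: closed_segment_eq_real_ivl)
    show "mono_on {m..} h"
      by (rule mono_onI) (rule conv, simp add: closed_segment_eq_real_ivl)
  qed
  then show ?thesis unfolding quasi_min_def hp0_def by (rule someI)
qed

text \<open>The coordinates are raised one at a time, by induction on the set of those already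
  changed.\<close>

lemma vector_antimono:
  fixes F :: "real^'n::finite \<Rightarrow> real"
  assumes F: "\<And>p \<beta> s t. s < t \<Longrightarrow> F (vupd p \<beta> t) < F (vupd p \<beta> s)" and le: "\<And>\<beta>. p $ \<beta> \<le> q $ \<beta>"
  shows "F q \<le> F p"
proof -
  have vs: "vupd v \<beta> (v $ \<beta>) = v" for v \<beta> by (simp add: vupd_def vec_eq_iff)
  have "F (\<chi> i. if i \<in> S then q $ i else p $ i) \<le> F p" if "finite S" for S
    using that
  proof induction
    case (insert \<beta> S)
    let ?v = "\<chi> i. if i \<in> S then q $ i else p $ i"
    have "(\<chi> i. if i \<in> insert \<beta> S then q $ i else p $ i) = vupd ?v \<beta> (q $ \<beta>)"
      by (simp add: vupd_def vec_eq_iff)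
    moreover have "vupd ?v \<beta> (p $ \<beta>) = ?v" using vs[of ?v \<beta>] insert by simp
    ultimately have "F (\<chi> i. if i \<in> insert \<beta> S then q $ i else p $ i) \<le> F ?v"
      using F[of "p $ \<beta>" "q $ \<beta>" ?v \<beta>] le[of \<beta>] by (cases "p $ \<beta> = q $ \<beta>") auto
    then show ?case using insert by simp
  qed (simp add: vec_nth_inverse)
  from this[of UNIV] show ?thesis by (simp add: vec_nth_inverse)
qed

section \<open>Truncation levels and admissible mesh ratios\<close>

lemma hyp_H_lipschitz:
  fixes H :: "'n::finite \<Rightarrow> real \<Rightarrow> real"
  assumes "hyp_H H"
  shows "\<exists>L>0. (\<forall>\<alpha> p q. \<bar>H \<alpha> p - H \<alpha> q\<bar> \<le> L * \<bar>p - q\<bar>) \<and> (\<forall>\<alpha>. L-lipschitz_on UNIV (H \<alpha>))"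
proof -
  have "\<forall>\<alpha>. \<exists>L. L-lipschitz_on UNIV (H \<alpha>)" using assms unfolding hyp_H_def by blast
  from choice[OF this] obtain l where l: "\<And>\<alpha>. (l \<alpha>)-lipschitz_on UNIV (H \<alpha>)" by blast
  define L where "L = (\<Sum>\<alpha>\<in>UNIV. l \<alpha>) + 1"
  have nn: "0 \<le> l \<alpha>" for \<alpha> using l by (rule lipschitz_on_nonneg)
  have "l \<alpha> \<le> L" for \<alpha> using member_le_sum[of \<alpha> UNIV l] nn by (simp add: L_def)
  then have lip: "L-lipschitz_on UNIV (H \<alpha>)" for \<alpha> by (rule lipschitz_on_le[OF l])
  moreover have "0 < L" unfolding L_def using sum_nonneg[of UNIV l] nn by (simp add: add_nonneg_pos)
  moreover have "\<bar>H \<alpha> p - H \<alpha> q\<bar> \<le> L * \<bar>p - q\<bar>" for \<alpha> p q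
    using lipschitz_onD[OF lip, of p q] by (simp add: dist_real_def)
  ultimately show ?thesis by blast
qed

lemma truncation_exists:
  fixes H :: "'n::finite \<Rightarrow> real \<Rightarrow> real" and F :: "real^'n \<Rightarrow> real"
  assumes H: "hyp_H H" and F: "hyp_F F" and L0: "0 \<le> L0"
  shows "\<exists>K plo phi p0lo. truncation H F L0 K plo phi p0lo"
proof -
  from hyp_H_lipschitz[OF H] obtain L where L': "0 < L" "\<forall>\<alpha> p q. \<bar>H \<alpha> p - H \<alpha> q\<bar> \<le> L * \<bar>p - q\<bar>"
    "\<forall>\<alpha>. L-lipschitz_on UNIV (H \<alpha>)" by (elim exE conjE)
  note L = L'(1) L'(2,3)[rule_format]
  have qm: "quasi_min (H \<alpha>)" for \<alpha>
    using H lipschitz_on_continuous_on[OF L(3)] unfolding hyp_H_def by (intro quasi_min_of_quasi_convex) auto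
  have Fc: "continuous_on UNIV F" using F unfolding hyp_F_def by (intro piecewise_C1_continuous) auto
  have coer: "coercive (H \<alpha>)" for \<alpha> using H by (simp add: hyp_H_def)
  have "compact (F ` vbox (\<lambda>_. - L0) (\<lambda>_. L0))"
    unfolding vbox_eq_cbox using continuous_on_subset[OF Fc] by (intro compact_continuous_image compact_cbox) auto
  from compact_imp_bounded[OF this] obtain KF where "\<forall>y\<in>F ` vbox (\<lambda>_. - L0) (\<lambda>_. L0). norm y \<le> KF"
    unfolding bounded_iff ..
  then have KF: "\<bar>F p\<bar> \<le> KF" if "p \<in> vbox (\<lambda>_. - L0) (\<lambda>_. L0)" for p using imageI[OF that, of F] by auto
  \<comment> \<open>\<open>Hplus\<close> and \<open>Hminus\<close> evaluate
    \<open>H \<alpha>\<close> at \<open>max a (hp0 (H \<alpha>))\<close> and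
    \<open>min b (hp0 (H \<alpha>))\<close>, so the bound must cover slopes up to
    \<open>L0 + \<bar>hp0 (H \<alpha>)\<bar>\<close>.\<close>
  define kH where "kH = (\<lambda>\<alpha>. \<bar>H \<alpha> 0\<bar> + L * (L0 + \<bar>hp0 (H \<alpha>)\<bar>))"
  have kH0: "0 \<le> kH \<alpha>" for \<alpha> using L L0 by (simp add: kH_def)
  define K where "K = \<bar>KF\<bar> + (\<Sum>\<alpha>\<in>UNIV. kH \<alpha>)"
  have kHK: "kH \<alpha> \<le> K" for \<alpha> using member_le_sum[of \<alpha> UNIV kH] kH0 by (simp add: K_def)
  have KFK: "KF \<le> K" using sum_nonneg[of UNIV kH] kH0 by (simp add: K_def)
  have Hb: "\<bar>H \<alpha> p\<bar> \<le> K" if "\<bar>p\<bar> \<le> L0 + \<bar>hp0 (H \<alpha>)\<bar>" for \<alpha> p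
  proof -
    have "\<bar>H \<alpha> p\<bar> \<le> \<bar>H \<alpha> 0\<bar> + L * \<bar>p\<bar>" using L(2)[of \<alpha> p 0] by simp
    also have "\<dots> \<le> kH \<alpha>" unfolding kH_def using that L by (intro add_mono mult_left_mono) auto
    finally show ?thesis using kHK[of \<alpha>] by simp
  qed
  have "\<forall>\<alpha>. \<exists>R>0. \<forall>p. R \<le> \<bar>p\<bar> \<longrightarrow> K + 1 \<le> H \<alpha> p" using coerciveD[OF coer] by blast
  then obtain R where R: "\<And>\<alpha>. R \<alpha> > 0" "\<And>\<alpha> p. R \<alpha> \<le> \<bar>p\<bar> \<Longrightarrow> K + 1 \<le> H \<alpha> p" by metis
  obtain RF where RF: "\<And>p. (\<Sum>\<beta>\<in>UNIV. max (- p $ \<beta>) 0) \<ge> RF \<Longrightarrow> F p \<ge> K + 1"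
    using F unfolding hyp_F_def by blast
  define M where "M = (\<lambda>\<alpha>. R \<alpha> + L0 + 1 + \<bar>hp0 (H \<alpha>)\<bar>)"
  have "truncation H F L0 K (\<lambda>\<alpha>. - M \<alpha>) M (\<lambda>_. - (\<bar>RF\<bar> + L0 + 1))"
  proof
    have "\<forall>p \<beta> s t. s < t \<longrightarrow> F (vupd p \<beta> t) < F (vupd p \<beta> s)" using F unfolding hyp_F_def by (elim conjE)
    note strict = this[rule_format]
    show "F q \<le> F p" if "\<And>\<beta>. p $ \<beta> \<le> q $ \<beta>" for p q
      by (rule vector_antimono[of F, OF strict that])
    show "\<bar>godunov H \<alpha> a b\<bar> \<le> K" if ab: "\<bar>a\<bar> \<le> L0" "\<bar>b\<bar> \<le> L0" for \<alpha> a b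
    proof -
      have "\<bar>Hplus (H \<alpha>) a\<bar> \<le> K" "\<bar>Hminus (H \<alpha>) b\<bar> \<le> K"
        unfolding Hplus_def Hminus_def using ab by (intro Hb; simp add: max_def min_def abs_if split: if_splits)+
      then show ?thesis by (simp add: godunov_def max_def)
    qed
    show "\<bar>F p\<bar> \<le> K" if "\<And>\<beta>. \<bar>p $ \<beta>\<bar> \<le> L0" for p
    proof -
      have "- L0 \<le> p $ \<beta> \<and> p $ \<beta> \<le> L0" for \<beta> using that[of \<beta>] by (simp add: abs_le_iff)
      then have "\<bar>F p\<bar> \<le> KF" by (intro KF) simp
      then show ?thesis using KFK by simp
    qed
    show "K < H \<alpha> (- M \<alpha>)" "K < H \<alpha> (M \<alpha>)" for \<alpha>
      using R(2)[of \<alpha> "- M \<alpha>"] R(2)[of \<alpha> "M \<alpha>"] L0 R(1)[of \<alpha>] by (auto simp: M_def)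
    show "K < F p" if "p $ \<beta> \<le> - (\<bar>RF\<bar> + L0 + 1)" for p \<beta>
    proof -
      have "RF \<le> max (- p $ \<beta>) 0" using that L0 by auto
      also have "\<dots> \<le> (\<Sum>\<beta>\<in>UNIV. max (- p $ \<beta>) 0)" by (rule member_le_sum) auto
      finally show ?thesis using RF[of p] by simp
    qed
    show "- M \<alpha> < - L0" "- M \<alpha> \<le> hp0 (H \<alpha>)" "L0 < M \<alpha>" "hp0 (H \<alpha>) \<le> M \<alpha>" for \<alpha>
      using R(1)[of \<alpha>] L0 by (auto simp: M_def)
  qed (use qm L0 in auto)
  then show ?thesis by blast
qed

context truncation begin

lemma cfl_of_CFLr:
  assumes L: "\<And>\<alpha>. L-lipschitz_on UNIV (H \<alpha>)" and F: "piecewise_C1 F" and dt: "0 < dt" "0 < dx"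
    and c: "CFLr H F plo phi (\<lambda>\<beta>. p0lo \<beta> - 1) dt dx"
  shows "cfl (dx / dt)"
  unfolding cfl_def
proof (intro conjI allI impI)
  show "0 < dx / dt" using dt by simp
  fix \<alpha> p q assume "plo \<alpha> \<le> p \<and> p \<le> q \<and> q \<le> phi \<alpha>"
  then show "\<bar>H \<alpha> q - H \<alpha> p\<bar> \<le> dx / dt * (q - p)"
    using c dt unfolding CFLr_def by (intro increment_le_of_esssup_deriv[OF L, of "plo \<alpha>" _ _ "phi \<alpha>"]) auto
next
  fix p h assume "0 \<le> h" "p \<in> vbox (\<lambda>\<beta>. p0lo \<beta> - 1) phi" "p - cvec h \<in> vbox (\<lambda>\<beta>. p0lo \<beta> - 1) phi"
  moreover have "p0lo \<beta> - 1 < phi \<beta>" for \<beta> using p0lo_less_phi[of \<beta>] by simp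
  ultimately show "F (p - cvec h) - F p \<le> dx / dt * h"
    using c unfolding CFLr_def by (intro diagonal_increment_le_of_esssup[OF F]) auto
qed

text \<open>Makes it possible to choose meshes tending to 0 with a fixed admissible ratio, from
  which the solution itself is constructed.\<close>

lemma cfl_exists:
  assumes L: "0 < L" "\<And>\<alpha> p q. \<bar>H \<alpha> p - H \<alpha> q\<bar> \<le> L * \<bar>p - q\<bar>" and F: "piecewise_C1 F"
  shows "\<exists>c. cfl c"
proof -
  from diagonal_lipschitz_on_vbox[OF F, of "\<lambda>\<beta>. p0lo \<beta> - 1" phi] obtain c0 where
    c0: "\<forall>c\<ge>c0. \<forall>p h. 0 \<le> h \<longrightarrow> p \<in> vbox (\<lambda>\<beta>. p0lo \<beta> - 1) phi \<longrightarrow> p - cvec h \<in> vbox (\<lambda>\<beta>. p0lo \<beta> - 1) phi \<longrightarrow>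
      F (p - cvec h) - F p \<le> c * h" ..
  have "cfl (max L c0)"
    unfolding cfl_def
  proof (intro conjI allI impI)
    fix \<alpha> p q assume pq: "plo \<alpha> \<le> p \<and> p \<le> q \<and> q \<le> phi \<alpha>"
    have "\<bar>H \<alpha> q - H \<alpha> p\<bar> \<le> L * (q - p)" using L(2)[of \<alpha> q p] pq by simp
    also have "\<dots> \<le> max L c0 * (q - p)" using pq by (intro mult_right_mono) auto
    finally show "\<bar>H \<alpha> q - H \<alpha> p\<bar> \<le> max L c0 * (q - p)" .
  next
    show "F (p - cvec h) - F p \<le> max L c0 * h"
      if "0 \<le> h" "p \<in> vbox (\<lambda>\<beta>. p0lo \<beta> - 1) phi" "p - cvec h \<in> vbox (\<lambda>\<beta>. p0lo \<beta> - 1) phi" for p h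
      by (rule c0[rule_format, OF _ that]) simp
  qed (use L in simp)
  then show ?thesis by blast
qed

end

text \<open>\<open>v\<close> may be discontinuous. The Lipschitz solution \<open>u\<close> meets the
  Lipschitz requirement of the comparison principle in both inequalities, once as the subsolution
  and once as the supersolution.\<close>

lemma relaxed_solution_unique:
  fixes H :: "'n::finite \<Rightarrow> real \<Rightarrow> real"
  assumes H: "hyp_H H" and F: "hyp_F F"
    and u: "relaxed_solution T H F u0 u" "lipschitz_tj K P u" and v: "relaxed_solution T H F u0 v"
    and tp: "0 \<le> t" "t < T" "p \<in> jpts"
  shows "v t p = u t p"
proof -
  from hyp_H_lipschitz[OF H] obtain L where L': "0 < L" "\<forall>\<alpha> p q. \<bar>H \<alpha> p - H \<alpha> q\<bar> \<le> L * \<bar>p - q\<bar>"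
    "\<forall>\<alpha>. L-lipschitz_on UNIV (H \<alpha>)" by (elim exE conjE)
  note L = L'(1) L'(2,3)[rule_format]
  have coer: "coercive (H \<alpha>)" for \<alpha> using H by (simp add: hyp_H_def)
  have Fcoer: "\<exists>R. \<forall>p. (\<Sum>\<beta>\<in>UNIV. max (- p $ \<beta>) 0) \<ge> R \<longrightarrow> F p \<ge> M" for M using F by (simp add: hyp_F_def)
  have pos: "relaxed_sub T H F w" "loc_bounded T w" "\<And>p. p \<in> jpts \<Longrightarrow> ustar T w 0 p \<le> ereal (u0 p)"
    if "relaxed_solution T H F u0 w" for w using that unfolding relaxed_solution_def by auto
  have neg: "relaxed_sub T (\<lambda>\<alpha>. dual (H \<alpha>)) (\<lambda>p. - F (- p)) (\<lambda>t p. - w t p)" "loc_bounded T (\<lambda>t p. - w t p)"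
    "\<And>p. p \<in> jpts \<Longrightarrow> ustar T (\<lambda>t p. - w t p) 0 p \<le> ereal (- u0 p)"
    if w: "relaxed_solution T H F u0 w" for w
  proof -
    show "relaxed_sub T (\<lambda>\<alpha>. dual (H \<alpha>)) (\<lambda>p. - F (- p)) (\<lambda>t p. - w t p)"
      using w unfolding relaxed_solution_def by (intro relaxed_sub_uminus) auto
    show "loc_bounded T (\<lambda>t p. - w t p)" using w unfolding relaxed_solution_def loc_bounded_def by simp
    fix p :: "'n \<times> real" assume "p \<in> jpts"
    then have "ereal (u0 p) \<le> lstar T w 0 p" using w unfolding relaxed_solution_def by auto
    then show "ustar T (\<lambda>t p. - w t p) 0 p \<le> ereal (- u0 p)"
      unfolding ustar_uminus ereal_uminus_real_iff by simp
  qed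
  have "v t p + - u t p \<le> 0"
    using comparison_functions[OF L(2,1) coer Fcoer pos(1,2)[OF v] neg(1,2)[OF u(1)] pos(3)[OF v] neg(3)[OF u(1)] _ tp, of K P]
      lipschitz_tj_uminus[OF u(2)] by blast
  moreover have "u t p + - v t p \<le> 0"
    using comparison_functions[OF L(2,1) coer Fcoer pos(1,2)[OF u(1)] neg(1,2)[OF v] pos(3)[OF u(1)] neg(3)[OF v] _ tp, of K P]
      u(2) by blast
  ultimately show ?thesis by simp
qed

section \<open>Convergence of the whole family of numerical solutions\<close>

lemma jcompact_bounded:
  assumes K: "jcompact T K"
  shows "\<exists>R. \<forall>z\<in>K. fst z \<le> R \<and> snd (snd z) \<le> R"
proof -
  have dom: "0 \<le> fst z" "fst z < T" "snd z \<in> jpts" if "z \<in> K" for z using K that unfolding jcompact_def by auto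
  have "\<exists>R. \<forall>z\<in>K. snd (snd z) \<le> R"
  proof (rule ccontr)
    assume "\<not> ?thesis"
    then have "\<forall>n::nat. \<exists>z\<in>K. real n < snd (snd z)" by (meson not_le)
    then obtain f where f: "\<And>n. f n \<in> K" "\<And>n::nat. real n < snd (snd (f n))" by metis
    then obtain l r where l: "l \<in> K" "strict_mono r" "(\<lambda>n. tjd (f (r n)) l) \<longlonglongrightarrow> 0"
      using K unfolding jcompact_def by blast
    obtain N where N: "\<And>n. N \<le> n \<Longrightarrow> tjd (f (r n)) l < 1"
      using order_tendstoD(2)[OF l(3), of 1] by (auto simp: eventually_sequentially)
    obtain n0 where n0: "snd (snd l) + 1 \<le> real n0" using real_arch_simple by blast
    define n where "n = max N n0"
    have "snd (snd (f (r n))) \<le> snd (snd l) + tjd (f (r n)) l"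
      using dom(3)[OF l(1)] dom(3)[OF f(1)[of "r n"]] by (auto simp: tjd_def jd_def jpts_def)
    also have "\<dots> < snd (snd l) + 1" using N[of n] by (simp add: n_def)
    also have "\<dots> \<le> real (r n)" using n0 seq_suble[OF l(2), of n] by (simp add: n_def)
    finally show False using f(2)[of "r n"] by simp
  qed
  then obtain R where "\<forall>z\<in>K. snd (snd z) \<le> R" by blast
  then show ?thesis using dom by (intro exI[of _ "max R T"]) (auto simp: le_max_iff_disj less_imp_le)
qed

theorem theorem1p1:
  fixes H :: "'n::finite \<Rightarrow> real \<Rightarrow> real"
    and F :: "real^'n \<Rightarrow> real"
    and u0 :: "'n \<times> real \<Rightarrow> real"
  assumes "hyp_H H" and "hyp_F F" and "jlipschitz u0"
  shows "\<exists>plo phi p0lo :: 'n \<Rightarrow> real. \<forall>T>0.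
     \<exists>u. relaxed_solution T H F u0 u \<and>
       (\<forall>v. relaxed_solution T H F u0 v \<longrightarrow>
            (\<forall>t p. 0 \<le> t \<and> t < T \<and> p \<in> jpts \<longrightarrow> v t p = u t p)) \<and>
       (\<forall>K. jcompact T K \<longrightarrow>
          (\<forall>e>0. \<exists>\<delta>>0. \<forall>dt dx. 0 < dt \<and> 0 < dx \<and> norm (dt, dx) < \<delta> \<and>
                 CFLr H F plo phi p0lo dt dx \<longrightarrow>
             (\<forall>n \<alpha> i. (real n * dt, (\<alpha>, real i * dx)) \<in> K \<longrightarrow>
                \<bar>scheme H F u0 dt dx n \<alpha> i - u (real n * dt) (\<alpha>, real i * dx)\<bar> \<le> e)))"
proof -
  obtain L1 where L1: "\<forall>p\<in>jpts. \<forall>q\<in>jpts. \<bar>u0 p - u0 q\<bar> \<le> L1 * jd p q"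
    using assms(3) unfolding jlipschitz_def by blast
  define L0 where "L0 = max 0 L1"
  have L0: "0 \<le> L0" by (simp add: L0_def)
  have u0: "\<bar>u0 p - u0 q\<bar> \<le> L0 * jd p q" if pq: "p \<in> jpts" "q \<in> jpts" for p q
  proof -
    have "L1 * jd p q \<le> L0 * jd p q" using jd_nonneg[OF pq] by (intro mult_right_mono) (auto simp: L0_def)
    then show ?thesis using L1 pq by (meson order_trans)
  qed
  from hyp_H_lipschitz[OF assms(1)] obtain L where L': "0 < L" "\<forall>\<alpha> p q. \<bar>H \<alpha> p - H \<alpha> q\<bar> \<le> L * \<bar>p - q\<bar>"
    "\<forall>\<alpha>. L-lipschitz_on UNIV (H \<alpha>)" by (elim exE conjE)
  note L = L'(1) L'(2,3)[rule_format]
  have Hc: "continuous_on UNIV (H \<alpha>)" for \<alpha> by (rule lipschitz_on_continuous_on[OF L(3)])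
  have Fp: "piecewise_C1 F" using assms(2) by (simp add: hyp_F_def)
  note Fc = piecewise_C1_continuous[OF Fp]
  obtain K plo phi p0lo where "truncation H F L0 K plo phi p0lo"
    using truncation_exists[OF assms(1,2) L0] by blast
  then interpret truncation H F L0 K plo phi p0lo .
  note cluster = cluster_solution[OF u0 Hc Fc]
  obtain c where c: "cfl c" using cfl_exists[OF L(1,2) Fp] by blast
  have c0: "0 < c" using c by (simp add: cfl_def)
  \<comment> \<open>Meshes with constant ratio \<open>dx / dt = c\<close>; their cluster point
    serves as the solution \<open>u\<close> for every \<open>T\<close>.\<close>
  define Fl where "Fl = filtermap (\<lambda>n. (1 / (c * real (Suc n)), 1 / real (Suc n))) sequentially"
  have "\<exists>Fl' u. Fl' \<noteq> bot \<and> Fl' \<le> Fl \<and> lipschitz_tj K P u \<and> (\<forall>T>0. relaxed_solution T H F u0 u) \<and>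
    (\<forall>R \<eta>. 0 < \<eta> \<longrightarrow> (\<forall>\<^sub>F e in Fl'. \<forall>n \<alpha> i. real n * fst e \<le> R \<longrightarrow> real i * snd e \<le> R \<longrightarrow>
      \<bar>scheme H F u0 (fst e) (snd e) n \<alpha> i - u (real n * fst e) (\<alpha>, real i * snd e)\<bar> \<le> \<eta>))"
  proof (rule cluster)
    show "Fl \<noteq> bot" by (simp add: Fl_def filtermap_bot_iff)
    show "\<forall>\<^sub>F e in Fl. 0 < fst e \<and> 0 < snd e \<and> cfl (snd e / fst e)"
      unfolding Fl_def eventually_filtermap using c c0 by (intro always_eventually) simp
    fix d :: real assume d: "0 < d"
    have 1: "(\<lambda>n. 1 / real (Suc n)) \<longlonglongrightarrow> 0"
      using LIMSEQ_Suc[OF lim_const_over_n[of 1]] by simp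
    have "(\<lambda>n. 1 / c * (1 / real (Suc n))) \<longlonglongrightarrow> 0"
      using tendsto_mult_left[OF 1, of "1 / c"] unfolding mult_zero_right .
    then have 2: "(\<lambda>n. 1 / (c * real (Suc n))) \<longlonglongrightarrow> 0"
      unfolding times_divide_times_eq mult_1 .
    show "\<forall>\<^sub>F e in Fl. fst e < d \<and> snd e < d"
      unfolding Fl_def eventually_filtermap fst_conv snd_conv
      using order_tendstoD(2)[OF 2 d] order_tendstoD(2)[OF 1 d] by (rule eventually_conj)
  qed
  then obtain u where u: "lipschitz_tj K P u" "\<And>T. 0 < T \<Longrightarrow> relaxed_solution T H F u0 u" by blast
  have conv: "\<exists>\<delta>>0. \<forall>dt dx. 0 < dt \<and> 0 < dx \<and> norm (dt, dx) < \<delta> \<and> CFLr H F plo phi (\<lambda>\<beta>. p0lo \<beta> - 1) dt dx \<longrightarrow>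
      (\<forall>n \<alpha> i. (real n * dt, (\<alpha>, real i * dx)) \<in> Q \<longrightarrow> \<bar>scheme H F u0 dt dx n \<alpha> i - u (real n * dt) (\<alpha>, real i * dx)\<bar> \<le> e)"
    if T: "0 < T" and Q: "jcompact T Q" and e: "0 < e" for T Q e
  proof (rule ccontr)
    assume neg: "\<not> ?thesis"
    \<comment> \<open>If convergence fails, there are bad meshes of arbitrarily small size. Along a
      finer filter their numerical solutions come within \<open>e\<close> of a solution
      \<open>v\<close> on the compact set, and uniqueness identifies \<open>v\<close> with
      \<open>u\<close> there.\<close>
    define bad where "bad z \<longleftrightarrow> (\<exists>n \<alpha> i. (real n * fst z, (\<alpha>, real i * snd z)) \<in> Q \<and>
      e < \<bar>scheme H F u0 (fst z) (snd z) n \<alpha> i - u (real n * fst z) (\<alpha>, real i * snd z)\<bar>)" for z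
    have "\<exists>z. 0 < fst z \<and> 0 < snd z \<and> norm z < 1 / real (Suc k) \<and> CFLr H F plo phi (\<lambda>\<beta>. p0lo \<beta> - 1) (fst z) (snd z) \<and> bad z" for k
    proof -
      have "0 < 1 / real (Suc k)" by simp
      with neg[unfolded not_ex, THEN spec, of "1 / real (Suc k)"]
      obtain dt dx n \<alpha> i where "0 < dt" "0 < dx" "norm (dt, dx) < 1 / real (Suc k)" "CFLr H F plo phi (\<lambda>\<beta>. p0lo \<beta> - 1) dt dx"
        "(real n * dt, (\<alpha>, real i * dx)) \<in> Q" "\<not> \<bar>scheme H F u0 dt dx n \<alpha> i - u (real n * dt) (\<alpha>, real i * dx)\<bar> \<le> e"
        unfolding de_Morgan_conj not_all not_imp by (elim disjE exE conjE) blast+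
      then show ?thesis by (intro exI[of _ "(dt, dx)"]) (auto simp: bad_def not_le)
    qed
    then obtain z where z: "\<And>k. 0 < fst (z k)" "\<And>k. 0 < snd (z k)" "\<And>k. norm (z k) < 1 / real (Suc k)"
      "\<And>k. CFLr H F plo phi (\<lambda>\<beta>. p0lo \<beta> - 1) (fst (z k)) (snd (z k))" "\<And>k. bad (z k)" by metis
    define Fb where "Fb = filtermap z sequentially"
    have "\<exists>Fl' v. Fl' \<noteq> bot \<and> Fl' \<le> Fb \<and> lipschitz_tj K P v \<and> (\<forall>T>0. relaxed_solution T H F u0 v) \<and>
      (\<forall>R \<eta>. 0 < \<eta> \<longrightarrow> (\<forall>\<^sub>F e in Fl'. \<forall>n \<alpha> i. real n * fst e \<le> R \<longrightarrow> real i * snd e \<le> R \<longrightarrow>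
        \<bar>scheme H F u0 (fst e) (snd e) n \<alpha> i - v (real n * fst e) (\<alpha>, real i * snd e)\<bar> \<le> \<eta>))"
    proof (rule cluster)
      show "Fb \<noteq> bot" by (simp add: Fb_def filtermap_bot_iff)
      show "\<forall>\<^sub>F e in Fb. 0 < fst e \<and> 0 < snd e \<and> cfl (snd e / fst e)"
        unfolding Fb_def eventually_filtermap using z cfl_of_CFLr[OF L(3) Fp z(1,2,4)] by (intro always_eventually) simp
      fix d :: real assume d: "0 < d"
      have "(\<lambda>n. 1 / real (Suc n)) \<longlonglongrightarrow> 0" using LIMSEQ_Suc[OF lim_const_over_n[of 1]] by simp
      from order_tendstoD(2)[OF this d]
      show "\<forall>\<^sub>F e in Fb. fst e < d \<and> snd e < d"
        unfolding Fb_def eventually_filtermap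
      proof (rule eventually_mono)
        fix k assume "1 / real (Suc k) < d"
        then have "norm (z k) < d" using z(3)[of k] by simp
        then show "fst (z k) < d \<and> snd (z k) < d"
          using norm_fst_le[of "fst (z k)" "snd (z k)"] norm_snd_le[of "snd (z k)" "fst (z k)"] by auto
      qed
    qed
    then obtain Fl' v where Fl': "Fl' \<noteq> bot" "Fl' \<le> Fb" and v: "lipschitz_tj K P v" "\<And>T. 0 < T \<Longrightarrow> relaxed_solution T H F u0 v"
      and unif: "\<And>R \<eta>. 0 < \<eta> \<Longrightarrow> \<forall>\<^sub>F e in Fl'. \<forall>n \<alpha> i. real n * fst e \<le> R \<longrightarrow> real i * snd e \<le> R \<longrightarrow>
        \<bar>scheme H F u0 (fst e) (snd e) n \<alpha> i - v (real n * fst e) (\<alpha>, real i * snd e)\<bar> \<le> \<eta>" by blast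
    obtain R where R: "\<And>z. z \<in> Q \<Longrightarrow> fst z \<le> R \<and> snd (snd z) \<le> R" using jcompact_bounded[OF Q] by blast
    have "\<forall>\<^sub>F e in Fl'. bad e"
      by (rule filter_leD[OF Fl'(2)]) (simp add: Fb_def eventually_filtermap z(5))
    then have "\<forall>\<^sub>F e in Fl'. False" using unif[OF e, of R]
    proof eventually_elim
      case (elim y)
      then obtain n \<alpha> i where n: "(real n * fst y, (\<alpha>, real i * snd y)) \<in> Q"
        "e < \<bar>scheme H F u0 (fst y) (snd y) n \<alpha> i - u (real n * fst y) (\<alpha>, real i * snd y)\<bar>" unfolding bad_def by blast
      have dom: "0 \<le> real n * fst y" "real n * fst y < T" "(\<alpha>, real i * snd y) \<in> jpts"
        using Q n(1) unfolding jcompact_def by auto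
      have "v (real n * fst y) (\<alpha>, real i * snd y) = u (real n * fst y) (\<alpha>, real i * snd y)"
        by (rule relaxed_solution_unique[OF assms(1,2) u(2)[OF T] u(1) v(2)[OF T] dom])
      then show ?case using elim(2) R[OF n(1)] n(2) by (metis fst_conv snd_conv not_le)
    qed
    then show False using Fl'(1) by (simp add: trivial_limit_def)
  qed
  show ?thesis
  proof (rule exI[of _ plo], rule exI[of _ phi], rule exI[of _ "\<lambda>\<beta>. p0lo \<beta> - 1"], intro allI impI)
    fix T :: real assume T: "0 < T"
    show "\<exists>u. relaxed_solution T H F u0 u \<and>
       (\<forall>v. relaxed_solution T H F u0 v \<longrightarrow>
            (\<forall>t p. 0 \<le> t \<and> t < T \<and> p \<in> jpts \<longrightarrow> v t p = u t p)) \<and>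
       (\<forall>K. jcompact T K \<longrightarrow>
          (\<forall>e>0. \<exists>\<delta>>0. \<forall>dt dx. 0 < dt \<and> 0 < dx \<and> norm (dt, dx) < \<delta> \<and>
                 CFLr H F plo phi (\<lambda>\<beta>. p0lo \<beta> - 1) dt dx \<longrightarrow>
             (\<forall>n \<alpha> i. (real n * dt, (\<alpha>, real i * dx)) \<in> K \<longrightarrow>
                \<bar>scheme H F u0 dt dx n \<alpha> i - u (real n * dt) (\<alpha>, real i * dx)\<bar> \<le> e)))"
    proof (rule exI[of _ u], intro conjI allI impI)
      show "relaxed_solution T H F u0 u" by (rule u(2)[OF T])
      show "v t p = u t p" if "relaxed_solution T H F u0 v" "0 \<le> t \<and> t < T \<and> p \<in> jpts" for v t p
        using that by (intro relaxed_solution_unique[OF assms(1,2) u(2)[OF T] u(1)]) auto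
    qed (rule conv[OF T])
  qed
qed

end
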